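(* Let $(S,\mathfrak{n},\Bbbk)$ be an $F$-finite regular local ring of prime characteristic $p>0$ and dimension $n$. Let $I\subsetneq S$ be an ideal such that $R=S/I$ is $F$-pure, and let $i$ be an integer. If $\mathfrak{p}\in \operatorname{Ass}_S \mathrm{H}^{n-i}_I(S)$, then $\phi(\mathfrak{p}R)\subseteq \mathfrak{p}R$ for every $e\in\mathbb{N}$ and every $\phi\in\mathscr{C}_e(R)$.
   Context: A ring $R$ of characteristic $p>0$ is $F$-finite if it is a finitely generated module over itself via the Frobenius map $F:R\to R$, $r\mapsto r^p$. It is $F$-pure if $F$ is a pure homomorphism (for $F$-finite $R$, equivalently, $R\to F_*R$ splits as a map of $R$-modules). $\mathrm{H}^j_I(S)$ denotes the $j$-th local cohomology module of $S$ with support in $I$. For an integer $e$, $\mathscr{C}_e(R)=\{\phi\in\operatorname{Hom}_{\mathbb{Z}}(R,R)\mid r\phi(s)=\phi(r^{p^e}s)\text{ for all } r,s\in R\}$; this is the degree $e$ part of the Cartier algebra $\mathscr{C}(R)=\bigoplus_e\mathscr{C}_e(R)$. *)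

theory Defs
  imports "HOL-Algebra.Algebra" "HOL-Library.Extended_Nat"
begin

definition ring_char :: "('a, 'm) ring_scheme \<Rightarrow> nat" where
  "ring_char R =
     (if \<exists>m>0. add_pow R (m::nat) \<one>\<^bsub>R\<^esub> = \<zero>\<^bsub>R\<^esub>
      then LEAST m. m > 0 \<and> add_pow R m \<one>\<^bsub>R\<^esub> = \<zero>\<^bsub>R\<^esub> else 0)"

definition krull_dim :: "('a, 'm) ring_scheme \<Rightarrow> enat" where
  "krull_dim R =
     Sup {enat k | k. \<exists>P :: nat \<Rightarrow> 'a set.
        (\<forall>i\<le>k. primeideal (P i) R) \<and> (\<forall>i<k. P i \<subset> P (Suc i))}"

definition local_ring :: "('a, 'm) ring_scheme \<Rightarrow> 'a set \<Rightarrow> bool" where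
  "local_ring R \<nn> \<longleftrightarrow>
     cring R \<and> maximalideal \<nn> R \<and> (\<forall>J. maximalideal J R \<longrightarrow> J = \<nn>)"

definition regular_local_ring :: "('a, 'm) ring_scheme \<Rightarrow> 'a set \<Rightarrow> bool" where
  "regular_local_ring R \<nn> \<longleftrightarrow>
     noetherian_ring R \<and> local_ring R \<nn> \<and>
     (\<exists>B \<subseteq> carrier R. finite B \<and> enat (card B) = krull_dim R \<and> \<nn> = Idl\<^bsub>R\<^esub> B)"

text \<open>The fields \<open>mult\<close> and \<open>one\<close> of a module record carry no meaning; the locale
  \<^locale>\<open>Module.module\<close> does not constrain them.\<close>

definition regular_module :: "('a, 'm) ring_scheme \<Rightarrow> ('a, 'a) module" where
  "regular_module R =
     \<lparr>carrier = carrier R, monoid.mult = monoid.mult R,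
      one = \<one>\<^bsub>R\<^esub>, ring.zero = \<zero>\<^bsub>R\<^esub>, add = add R,
      smult = monoid.mult R\<rparr>"

definition mod_hom ::
  "('a, 'm) ring_scheme \<Rightarrow> ('a, 'b, 'k) module_scheme \<Rightarrow> ('a, 'c, 'l) module_scheme \<Rightarrow> ('b \<Rightarrow> 'c) set"
  where
  "mod_hom R M N =
     {h \<in> hom (add_monoid M) (add_monoid N).
        \<forall>r\<in>carrier R. \<forall>x\<in>carrier M. h (r \<odot>\<^bsub>M\<^esub> x) = r \<odot>\<^bsub>N\<^esub> h x}"

definition fin_gen_module :: "('a, 'm) ring_scheme \<Rightarrow> ('a, 'b, 'k) module_scheme \<Rightarrow> bool" where
  "fin_gen_module R M \<longleftrightarrow>
     module R M \<and>
     (\<exists>B \<subseteq> carrier M. finite B \<and>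
        (\<forall>x\<in>carrier M. \<exists>c\<in>B \<rightarrow> carrier R. x = (\<Oplus>\<^bsub>M\<^esub>b\<in>B. c b \<odot>\<^bsub>M\<^esub> b)))"

definition quotient_module :: "('a, 'b, 'k) module_scheme \<Rightarrow> 'b set \<Rightarrow> ('a, 'b set) module" where
  "quotient_module M N =
     \<lparr>carrier = a_rcosets\<^bsub>M\<^esub> N, monoid.mult = rcoset_mult M N, one = N +>\<^bsub>M\<^esub> \<one>\<^bsub>M\<^esub>,
      ring.zero = N, add = set_add M,
      smult = (\<lambda>r Q. \<Union>x\<in>Q. N +>\<^bsub>M\<^esub> (r \<odot>\<^bsub>M\<^esub> x))\<rparr>"

definition associated_primes ::
  "('a, 'm) ring_scheme \<Rightarrow> ('a, 'b, 'k) module_scheme \<Rightarrow> 'a set set" where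
  "associated_primes R M =
     {P. primeideal P R \<and> (\<exists>x\<in>carrier M. P = {r \<in> carrier R. r \<odot>\<^bsub>M\<^esub> x = \<zero>\<^bsub>M\<^esub>})}"

definition tensor_relations ::
  "('a, 'm) ring_scheme \<Rightarrow> ('a, 'b, 'k) module_scheme \<Rightarrow> ('a, 'c, 'l) module_scheme
    \<Rightarrow> ('b \<times> 'c \<Rightarrow>\<^sub>0 int) set" where
  "tensor_relations R M N =
     {frag_of (x \<oplus>\<^bsub>M\<^esub> y, u) - frag_of (x, u) - frag_of (y, u) | x y u.
        x \<in> carrier M \<and> y \<in> carrier M \<and> u \<in> carrier N} \<union>
     {frag_of (x, u \<oplus>\<^bsub>N\<^esub> v) - frag_of (x, u) - frag_of (x, v) | x u v.
        x \<in> carrier M \<and> u \<in> carrier N \<and> v \<in> carrier N} \<union>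
     {frag_of (r \<odot>\<^bsub>M\<^esub> x, u) - frag_of (x, r \<odot>\<^bsub>N\<^esub> u) | r x u.
        r \<in> carrier R \<and> x \<in> carrier M \<and> u \<in> carrier N}"

definition tensor_null ::
  "('a, 'm) ring_scheme \<Rightarrow> ('a, 'b, 'k) module_scheme \<Rightarrow> ('a, 'c, 'l) module_scheme
    \<Rightarrow> ('b \<times> 'c \<Rightarrow>\<^sub>0 int) set" where
  "tensor_null R M N =
     generate (free_Abelian_group (carrier M \<times> carrier N)) (tensor_relations R M N)"

definition tensor_product ::
  "('a, 'm) ring_scheme \<Rightarrow> ('a, 'b, 'k) module_scheme \<Rightarrow> ('a, 'c, 'l) module_scheme
    \<Rightarrow> ('b \<times> 'c \<Rightarrow>\<^sub>0 int) set monoid" where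
  "tensor_product R M N =
     free_Abelian_group (carrier M \<times> carrier N) Mod tensor_null R M N"

text \<open>The map \<open>id \<otimes> g : M \<otimes> N \<rightarrow> M \<otimes> N'\<close> induced by \<open>g : N \<rightarrow> N'\<close>, on cosets.\<close>

definition tensor_map ::
  "('a, 'm) ring_scheme \<Rightarrow> ('a, 'b, 'k) module_scheme \<Rightarrow> ('a, 'd, 'l) module_scheme
    \<Rightarrow> ('c \<Rightarrow> 'd) \<Rightarrow> ('b \<times> 'c \<Rightarrow>\<^sub>0 int) set \<Rightarrow> ('b \<times> 'd \<Rightarrow>\<^sub>0 int) set" where
  "tensor_map R M N' g Q =
     (\<Union>z\<in>Q. tensor_null R M N' #>\<^bsub>free_Abelian_group (carrier M \<times> carrier N')\<^esub>
        frag_extend (\<lambda>(x, u). frag_of (x, g u)) z)"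

text \<open>Purity: \<open>id \<otimes> g\<close> is injective for every module \<open>M\<close>. HOL cannot quantify over types inside
  a definition, so \<open>M\<close> ranges over the modules carried by \<^typ>\<open>'a list set\<close>. This is no
  restriction: every finitely generated module is isomorphic to a quotient of some \<open>R\<^sup>m\<close>, hence to
  one on this type, and since tensor products commute with direct limits it suffices to test
  finitely generated \<open>M\<close>.\<close>

definition pure_hom ::
  "('a, 'm) ring_scheme \<Rightarrow> ('a, 'b, 'k) module_scheme \<Rightarrow> ('a, 'c, 'l) module_scheme
    \<Rightarrow> ('b \<Rightarrow> 'c) \<Rightarrow> bool" where
  "pure_hom R N N' g \<longleftrightarrow>
     module R N \<and> module R N' \<and> g \<in> mod_hom R N N' \<and>
     (\<forall>M :: ('a, 'a list set) module.
        module R M \<longrightarrow> inj_on (tensor_map R M N' g) (carrier (tensor_product R M N)))"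

text \<open>For \<open>q = p ^ e\<close> in characteristic \<open>p\<close> this is the module \<open>F\<^sup>e\<^sub>* R\<close>.\<close>

definition frobenius_module :: "('a, 'm) ring_scheme \<Rightarrow> nat \<Rightarrow> ('a, 'a) module" where
  "frobenius_module R q =
     (regular_module R)\<lparr>smult := (\<lambda>r x. (r [^]\<^bsub>R\<^esub> q) \<otimes>\<^bsub>R\<^esub> x)\<rparr>"

definition F_finite :: "('a, 'm) ring_scheme \<Rightarrow> nat \<Rightarrow> bool" where
  "F_finite R p \<longleftrightarrow> fin_gen_module R (frobenius_module R p)"

definition F_pure :: "('a, 'm) ring_scheme \<Rightarrow> nat \<Rightarrow> bool" where
  "F_pure R p \<longleftrightarrow>
     pure_hom R (regular_module R) (frobenius_module R p) (\<lambda>r. r [^]\<^bsub>R\<^esub> p)"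

definition cartier_maps :: "('a, 'm) ring_scheme \<Rightarrow> nat \<Rightarrow> nat \<Rightarrow> ('a \<Rightarrow> 'a) set" where
  "cartier_maps R p e =
     {\<phi> \<in> hom (add_monoid R) (add_monoid R).
        \<forall>r\<in>carrier R. \<forall>s\<in>carrier R.
          r \<otimes>\<^bsub>R\<^esub> \<phi> s = \<phi> ((r [^]\<^bsub>R\<^esub> (p ^ e)) \<otimes>\<^bsub>R\<^esub> s)}"

text \<open>Injectivity is the extension property along monomorphisms \<open>M \<rightarrow> N\<close>, with \<open>M\<close> and \<open>N\<close>
  carried by the type of the ring. This is no restriction: that type carries the inclusions of
  ideals into \<open>R\<close>, and by Baer's criterion these suffice.\<close>

definition injective_module :: "('a, 'm) ring_scheme \<Rightarrow> ('a, 'b, 'k) module_scheme \<Rightarrow> bool" where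
  "injective_module R E \<longleftrightarrow>
     module R E \<and>
     (\<forall>(M :: ('a, 'a) module) (N :: ('a, 'a) module) j g.
        module R M \<and> module R N \<and> j \<in> mod_hom R M N \<and> inj_on j (carrier M) \<and>
        g \<in> mod_hom R M E \<longrightarrow>
        (\<exists>h\<in>mod_hom R N E. \<forall>x\<in>carrier M. h (j x) = g x))"

text \<open>Cochain complexes are indexed by the integers; a resolution vanishes in negative degrees.\<close>

definition injective_resolution ::
  "('a, 'm) ring_scheme \<Rightarrow> ('a, 'c, 'k) module_scheme \<Rightarrow> (int \<Rightarrow> ('a, 'b) module)
    \<Rightarrow> (int \<Rightarrow> 'b \<Rightarrow> 'b) \<Rightarrow> ('c \<Rightarrow> 'b) \<Rightarrow> bool" where
  "injective_resolution R M E d \<epsilon> \<longleftrightarrow>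
     module R M \<and>
     (\<forall>k. injective_module R (E k)) \<and>
     (\<forall>k<0. carrier (E k) = {\<zero>\<^bsub>E k\<^esub>}) \<and>
     (\<forall>k. d k \<in> mod_hom R (E k) (E (k + 1))) \<and>
     \<epsilon> \<in> mod_hom R M (E 0) \<and> inj_on \<epsilon> (carrier M) \<and>
     a_kernel (E 0) (E 1) (d 0) = \<epsilon> ` carrier M \<and>
     (\<forall>k\<ge>0. a_kernel (E (k + 1)) (E (k + 2)) (d (k + 1)) = d k ` carrier (E k))"

definition cohomology ::
  "(int \<Rightarrow> ('a, 'b) module) \<Rightarrow> (int \<Rightarrow> 'b \<Rightarrow> 'b) \<Rightarrow> int \<Rightarrow> ('a, 'b set) module" where
  "cohomology C d k =
     quotient_module ((C k)\<lparr>carrier := a_kernel (C k) (C (k + 1)) (d k)\<rparr>)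
       (d (k - 1) ` carrier (C (k - 1)))"

definition torsion_functor ::
  "('a, 'm) ring_scheme \<Rightarrow> 'a set \<Rightarrow> ('a, 'b) module \<Rightarrow> ('a, 'b) module" where
  "torsion_functor R I M =
     M\<lparr>carrier := {x \<in> carrier M.
        \<exists>t::nat. \<forall>a \<in> I [^]\<^bsub>ideals_set R\<^esub> t. a \<odot>\<^bsub>M\<^esub> x = \<zero>\<^bsub>M\<^esub>}\<rparr>"

text \<open>If \<open>(E, d)\<close> is an injective resolution of \<open>M\<close>, this is the right derived functor
  \<open>H\<^sup>k\<^sub>I(M) = R\<^sup>k \<Gamma>\<^sub>I(M)\<close>; up to isomorphism it does not depend on the resolution.\<close>

definition local_cohomology ::
  "('a, 'm) ring_scheme \<Rightarrow> 'a set \<Rightarrow> (int \<Rightarrow> ('a, 'b) module) \<Rightarrow> (int \<Rightarrow> 'b \<Rightarrow> 'b)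
    \<Rightarrow> int \<Rightarrow> ('a, 'b set) module" where
  "local_cohomology R I E d k = cohomology (\<lambda>l. torsion_functor R I (E l)) d k"

definition ideal_extension :: "('a, 'm) ring_scheme \<Rightarrow> 'a set \<Rightarrow> 'a set \<Rightarrow> 'a set set" where
  "ideal_extension S I P = Idl\<^bsub>S Quot I\<^esub> ((\<lambda>s. I +>\<^bsub>S\<^esub> s) ` P)"

end

theory Submission
  imports Defs
begin

text \<open>By Kunz's theorem \<open>F\<^sub>* S\<close> is free, and \<open>Hom(F\<^sup>e\<^sub>* S, S)\<close> is generated over \<open>F\<^sup>e\<^sub>* S\<close> by one map
  \<open>\<tau>\<close>. Hence \<open>\<phi>\<close> lifts to \<open>\<psi> = \<tau>(u \<cdot>)\<close> on \<open>S\<close> with \<open>\<psi> I \<subseteq> I\<close>, and \<open>u F\<^sup>e\<close> acts on \<open>Ext(S / I, S)\<close>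
  compatibly with its action on local cohomology. The prime \<open>\<pp>\<close> is the annihilator of the image \<open>z\<close> of a
  class in \<open>Ext(S / I, S)\<close>. For \<open>a \<in> \<pp>\<close> all \<open>(u F\<^sup>e)\<^sup>k z\<close> are killed by a power of \<open>a\<close>, and
  Noetherianity of \<open>Ext(S / I, S)\<close> bounds this power independently of \<open>k\<close>. Since \<open>\<tau> \<circ> (c \<cdot>) \<circ> F\<^sup>e\<close> induces
  multiplication by \<open>\<tau> c\<close>, descending back to \<open>z\<close> puts the images of high iterates of \<open>\<psi>(a \<cdot>)\<close> into
  \<open>\<pp>\<close>, which forces \<open>\<psi> a \<in> \<pp>\<close>.\<close>

section \<open>Ideals and saturation\<close>

text \<open>Derived functors are replaced by cochains of one injective resolution: a map between
  cohomology modules is a lift to the resolution, and an identity between two such maps is a null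
  homotopy. Lifting a semilinear map means comparing the complex with its restriction of scalars
  along Frobenius, whose terms must still be injective. This, the lifting of \<open>\<phi>\<close>
  and the splitting of classes all use a dual basis of \<open>F\<^sub>* S\<close>, which is why
  Kunz's theorem precedes all cohomology. Regularity enters through the parameters: every subset of
  them generates a prime ideal, so they and their powers form regular sequences in any order. The
  reduction to Ext uses a second Frobenius exponent, unrelated to \<open>e\<close>: a class of local
  cohomology is killed by some \<open>I^t\<close>, hence by all \<open>a^(p^t)\<close> with
  \<open>a \<in> I\<close>, and the dual basis for \<open>p^t\<close> turns it into classes killed
  by \<open>I\<close> itself. Local cohomology is not finitely generated in general, so a uniform
  bound on exponents has to come from Ext; for this \<open>u F\<^sup>e\<close> must preserve
  annihilation by \<open>I\<close>.\<close>

context cring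
begin

lemma ideal_intro:
  assumes "J \<subseteq> carrier R" "\<zero> \<in> J" "\<And>x y. x \<in> J \<Longrightarrow> y \<in> J \<Longrightarrow> x \<oplus> y \<in> J"
    "\<And>r x. r \<in> carrier R \<Longrightarrow> x \<in> J \<Longrightarrow> r \<otimes> x \<in> J"
  shows "ideal J R"
proof (rule idealI[OF ring_axioms])
  have "\<ominus> x \<in> J" if "x \<in> J" for x
    using assms(4)[of "\<ominus> \<one>" x] that assms(1) by (auto simp: l_minus subset_iff)
  then show "subgroup J (add_monoid R)"
    using assms by (intro add.subgroupI) (auto simp: a_inv_def)
next
  show "\<And>a x. a \<in> J \<Longrightarrow> x \<in> carrier R \<Longrightarrow> x \<otimes> a \<in> J" using assms(4) by blast
  show "\<And>a x. a \<in> J \<Longrightarrow> x \<in> carrier R \<Longrightarrow> a \<otimes> x \<in> J" using assms(1,4) m_comm by (metis subsetD)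
qed

lemma ideal_carrier: "ideal J R \<Longrightarrow> x \<in> J \<Longrightarrow> x \<in> carrier R"
  and ideal_zero: "ideal J R \<Longrightarrow> \<zero> \<in> J"
  and ideal_add: "ideal J R \<Longrightarrow> x \<in> J \<Longrightarrow> y \<in> J \<Longrightarrow> x \<oplus> y \<in> J"
  and ideal_mult: "ideal J R \<Longrightarrow> r \<in> carrier R \<Longrightarrow> x \<in> J \<Longrightarrow> r \<otimes> x \<in> J"
  and ideal_mult_right: "ideal J R \<Longrightarrow> r \<in> carrier R \<Longrightarrow> x \<in> J \<Longrightarrow> x \<otimes> r \<in> J"
  and ideal_neg: "ideal J R \<Longrightarrow> x \<in> J \<Longrightarrow> \<ominus> x \<in> J"
  and ideal_diff: "ideal J R \<Longrightarrow> x \<in> J \<Longrightarrow> y \<in> J \<Longrightarrow> x \<ominus> y \<in> J"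
  by (auto simp: ideal.Icarr additive_subgroup.zero_closed ideal.axioms additive_subgroup.a_closed
      ideal.I_l_closed ideal.I_r_closed additive_subgroup.a_inv_closed minus_eq)

lemma ideal_add_cancel:
  assumes "ideal J R" "x \<in> carrier R" "y \<in> J" "x \<oplus> y \<in> J"
  shows "x \<in> J"
proof -
  have y: "y \<in> carrier R" using assms(1,3) ideal_carrier by blast
  have "x = (x \<oplus> y) \<ominus> y" using assms(2) y by (simp add: minus_eq a_assoc r_neg)
  then show ?thesis using ideal_diff[OF assms(1,4,3)] by simp
qed

lemma ideal_diff_cancel:
  assumes "ideal J R" "x \<in> carrier R" "y \<in> J" "x \<ominus> y \<in> J"
  shows "x \<in> J"
  using ideal_add_cancel[OF assms(1,2) ideal_neg[OF assms(1,3)]] assms(4) by (simp add: minus_eq)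

lemma prime_mult:
  "primeideal P R \<Longrightarrow> a \<in> carrier R \<Longrightarrow> b \<in> carrier R \<Longrightarrow> a \<otimes> b \<in> P \<Longrightarrow> a \<in> P \<or> b \<in> P"
  by (rule primeideal.I_prime)

lemma prime_ideal: "primeideal P R \<Longrightarrow> ideal P R"
  by (simp add: primeideal.axioms(1))

lemma prime_one: "primeideal P R \<Longrightarrow> \<one> \<notin> P"
  by (metis ideal.one_imp_carrier prime_ideal primeideal.I_notcarr)

lemma prime_pow: "primeideal P R \<Longrightarrow> a \<in> carrier R \<Longrightarrow> a [^] (k::nat) \<in> P \<Longrightarrow> a \<in> P"
proof (induction k)
  case 0
  then show ?case using prime_one by simp
next
  case (Suc k)
  then show ?case using prime_mult[of P "a [^] k" a] by auto
qed

lemma prime_intro: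
  assumes "ideal P R" "\<one> \<notin> P"
    "\<And>a b. a \<in> carrier R \<Longrightarrow> b \<in> carrier R \<Longrightarrow> a \<otimes> b \<in> P \<Longrightarrow> a \<in> P \<or> b \<in> P"
  shows "primeideal P R"
  using assms by (intro primeidealI) (auto simp: cring_axioms)

lemma ideal_adjoin:
  assumes "ideal J R" "x \<in> carrier R"
  shows "ideal {w \<oplus> r \<otimes> x | w r. w \<in> J \<and> r \<in> carrier R} R" (is "ideal ?K R")
proof (rule ideal_intro)
  note [simp] = ideal_carrier[OF assms(1)] assms(2)
  show "?K \<subseteq> carrier R" by auto
  have "\<zero> = \<zero> \<oplus> \<zero> \<otimes> x" by simp
  then show "\<zero> \<in> ?K" using ideal_zero[OF assms(1)] by blast
  show "y \<oplus> z \<in> ?K" if yz: "y \<in> ?K" "z \<in> ?K" for y z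
  proof -
    obtain w r v s where w: "w \<in> J" "r \<in> carrier R" "y = w \<oplus> r \<otimes> x"
      "v \<in> J" "s \<in> carrier R" "z = v \<oplus> s \<otimes> x" using yz by blast
    have "y \<oplus> z = (w \<oplus> v) \<oplus> (r \<oplus> s) \<otimes> x" using w by (simp add: l_distr a_ac)
    then show ?thesis using w ideal_add[OF assms(1)] by blast
  qed
  show "t \<otimes> y \<in> ?K" if t: "t \<in> carrier R" "y \<in> ?K" for t y
  proof -
    obtain w r where w: "w \<in> J" "r \<in> carrier R" "y = w \<oplus> r \<otimes> x" using t by blast
    have "t \<otimes> y = t \<otimes> w \<oplus> (t \<otimes> r) \<otimes> x" using w t by (simp add: r_distr m_assoc)
    then show ?thesis using w t ideal_mult[OF assms(1)] by blast
  qed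
qed

lemma Idl_insert:
  fixes G :: "'a set"
  assumes "x \<in> carrier R" "G \<subseteq> carrier R"
  shows "Idl (insert x G) = {w \<oplus> r \<otimes> x | w r. w \<in> Idl G \<and> r \<in> carrier R}" (is "_ = ?K")
proof
  have I: "ideal (Idl G) R" using assms genideal_ideal by blast
  have "y \<in> ?K" if "y \<in> Idl G" for y
  proof -
    have "y = y \<oplus> \<zero> \<otimes> x" using that assms ideal_carrier[OF I] by simp
    then show ?thesis using that by blast
  qed
  moreover have "x \<in> ?K"
  proof -
    have "x = \<zero> \<oplus> \<one> \<otimes> x" using assms by simp
    then show ?thesis using ideal_zero[OF I] by blast
  qed
  ultimately have "insert x G \<subseteq> ?K" using genideal_self[OF assms(2)] by blast
  then show "Idl (insert x G) \<subseteq> ?K" by (rule genideal_minimal[OF ideal_adjoin[OF I assms(1)]])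
  have xG: "insert x G \<subseteq> carrier R" using assms by simp
  note I2 = genideal_ideal[OF xG]
  have x: "x \<in> Idl (insert x G)" using genideal_self[OF xG] by blast
  have "G \<subseteq> Idl (insert x G)" using genideal_self[OF xG] by blast
  then have G: "Idl G \<subseteq> Idl (insert x G)" by (rule genideal_minimal[OF I2])
  have *: "w \<oplus> r \<otimes> x \<in> Idl (insert x G)" if "w \<in> Idl G" "r \<in> carrier R" for w r
    by (rule ideal_add[OF I2 subsetD[OF G that(1)] ideal_mult[OF I2 that(2) x]])
  then show "?K \<subseteq> Idl (insert x G)" by blast
qed

lemma Idl_empty: "Idl {} = {\<zero>}"
  using genideal_minimal[OF zeroideal, of "{}"] ideal_zero[OF genideal_ideal, of "{}"] by auto

lemma Idl_mono: "G \<subseteq> H \<Longrightarrow> H \<subseteq> carrier R \<Longrightarrow> Idl G \<subseteq> Idl H"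
  using genideal_self[of H] genideal_minimal[OF genideal_ideal, of H G] by blast

lemma ideal_colon:
  assumes "ideal J R" "y \<in> carrier R"
  shows "ideal {r \<in> carrier R. r \<otimes> y \<in> J} R"
  using assms by (intro ideal_intro) (auto simp: l_distr m_assoc ideal_zero ideal_add ideal_mult)

text \<open>The contraction to \<open>R\<close> of the extension of \<open>J\<close> to the localization at \<open>Q\<close>.\<close>

definition saturation :: "'a set \<Rightarrow> 'a set \<Rightarrow> 'a set" where
  "saturation Q J = {y \<in> carrier R. \<exists>s\<in>carrier R - Q. s \<otimes> y \<in> J}"

text \<open>For prime \<open>Q\<close> these are the contractions of ideals of the localization at
  \<open>Q\<close>, so arguments over the localization can stay inside \<open>R\<close>.\<close>

definition saturated :: "'a set \<Rightarrow> 'a set \<Rightarrow> bool" where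
  "saturated Q J \<longleftrightarrow> ideal J R \<and> (\<forall>s\<in>carrier R - Q. \<forall>y\<in>carrier R. s \<otimes> y \<in> J \<longrightarrow> y \<in> J)"

lemma saturatedD:
  "saturated Q J \<Longrightarrow> ideal J R"
  "saturated Q J \<Longrightarrow> s \<in> carrier R \<Longrightarrow> s \<notin> Q \<Longrightarrow> y \<in> carrier R \<Longrightarrow> s \<otimes> y \<in> J \<Longrightarrow> y \<in> J"
  by (auto simp: saturated_def)

lemma prime_complement_mult:
  "primeideal Q R \<Longrightarrow> s \<in> carrier R - Q \<Longrightarrow> t \<in> carrier R - Q \<Longrightarrow> s \<otimes> t \<in> carrier R - Q"
  using prime_mult by blast

lemma saturation_saturated:
  assumes "primeideal Q R" "ideal J R"
  shows "saturated Q (saturation Q J)"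
  unfolding saturated_def
proof (intro conjI ballI impI)
  have one: "\<one> \<in> carrier R - Q" using prime_one assms by simp
  show "ideal (saturation Q J) R"
  proof (rule ideal_intro)
    show "saturation Q J \<subseteq> carrier R" by (auto simp: saturation_def)
    show "\<zero> \<in> saturation Q J" using one ideal_zero[OF assms(2)] by (auto simp: saturation_def)
  next
    fix x y assume xy: "x \<in> saturation Q J" "y \<in> saturation Q J"
    then obtain s t where st: "s \<in> carrier R - Q" "s \<otimes> x \<in> J" "t \<in> carrier R - Q" "t \<otimes> y \<in> J"
      by (auto simp: saturation_def)
    have xyc: "x \<in> carrier R" "y \<in> carrier R" using xy by (auto simp: saturation_def)
    have "(s \<otimes> t) \<otimes> (x \<oplus> y) = t \<otimes> (s \<otimes> x) \<oplus> s \<otimes> (t \<otimes> y)"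
      using st xyc by (simp add: r_distr m_ac)
    also have "\<dots> \<in> J" using st ideal_add[OF assms(2)] ideal_mult[OF assms(2)] by simp
    finally show "x \<oplus> y \<in> saturation Q J"
      using prime_complement_mult[OF assms(1) st(1,3)] xyc by (auto simp: saturation_def)
  next
    fix r x assume r: "r \<in> carrier R" "x \<in> saturation Q J"
    then obtain s where s: "s \<in> carrier R - Q" "s \<otimes> x \<in> J" "x \<in> carrier R"
      by (auto simp: saturation_def)
    have "s \<otimes> (r \<otimes> x) = r \<otimes> (s \<otimes> x)" using r s by (simp add: m_ac)
    then have "s \<otimes> (r \<otimes> x) \<in> J" using r s ideal_mult[OF assms(2)] by simp
    then show "r \<otimes> x \<in> saturation Q J"
      using r s unfolding saturation_def by blast
  qed
next
  fix s y assume s: "s \<in> carrier R - Q" "y \<in> carrier R" "s \<otimes> y \<in> saturation Q J"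
  then obtain t where t: "t \<in> carrier R - Q" "t \<otimes> (s \<otimes> y) \<in> J" by (auto simp: saturation_def)
  then have "(t \<otimes> s) \<otimes> y \<in> J" using s by (simp add: m_assoc)
  then show "y \<in> saturation Q J"
    using prime_complement_mult[OF assms(1) t(1) s(1)] s by (auto simp: saturation_def)
qed

lemma saturation_superset:
  assumes "primeideal Q R" "ideal J R"
  shows "J \<subseteq> saturation Q J"
  using prime_one[OF assms(1)] ideal_carrier[OF assms(2)]
  by (auto simp: saturation_def intro!: bexI[of _ \<one>])

lemma saturation_minimal:
  assumes "saturated Q K" "J \<subseteq> K"
  shows "saturation Q J \<subseteq> K"
  using assms unfolding saturated_def saturation_def by blast

end

section \<open>Noetherian rings and the principal ideal theorem\<close>

locale noetherian_cring = cring R + noetherian_ring R for R (structure)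
begin

text \<open>Otherwise dependent choice yields a strictly increasing sequence of ideals; its range is
  a chain, so its union is one of its members, which is absurd.\<close>

lemma ideal_psupset_wf: "wf {(J', J). ideal J' R \<and> ideal J R \<and> J \<subset> J'}"
proof (rule wfUNIVI, rule ccontr)
  fix P :: "'a set \<Rightarrow> bool" and x
  assume H: "\<forall>x. (\<forall>y. (y, x) \<in> {(J', J). ideal J' R \<and> ideal J R \<and> J \<subset> J'} \<longrightarrow> P y) \<longrightarrow> P x"
    and "\<not> P x"
  have step: "\<And>x. \<not> P x \<Longrightarrow> \<exists>y. \<not> P y \<and> ideal y R \<and> ideal x R \<and> x \<subset> y" using H by blast
  have "\<exists>f. \<forall>n. \<not> P (f n) \<and> (ideal (f n) R \<and> ideal (f (Suc n)) R \<and> f n \<subset> f (Suc n))"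
    using dependent_nat_choice[of "\<lambda>n x. \<not> P x" "\<lambda>n x y. ideal x R \<and> ideal y R \<and> x \<subset> y"]
      step \<open>\<not> P x\<close> by blast
  then obtain f where f: "\<And>n. ideal (f n) R" "\<And>n. f n \<subset> f (Suc n)" by blast
  have mono: "m \<le> n \<Longrightarrow> f m \<subseteq> f n" for m n
    using lift_Suc_mono_le[of f m n] f(2) by (simp add: less_imp_le)
  have tot: "f m \<subseteq> f n \<or> f n \<subseteq> f m" for m n using mono[of m n] mono[of n m] by linarith
  have "subset.chain {I. ideal I R} (range f)"
    unfolding subset_chain_def using f(1) tot by blast
  then have "\<Union> (range f) \<in> range f" using ideal_chain_is_trivial[of "range f"] by blast
  then obtain n where "\<Union> (range f) = f n" by blast
  then show False using f(2)[of n] by blast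
qed

lemma noetherian_induct [consumes 1]:
  assumes "ideal J R"
    and "\<And>J. ideal J R \<Longrightarrow> (\<And>J'. ideal J' R \<Longrightarrow> J \<subset> J' \<Longrightarrow> P J') \<Longrightarrow> P J"
  shows "P J"
  using assms(1)
proof (induction J rule: wf_induct_rule[OF ideal_psupset_wf])
  case (1 J) then show ?case using assms(2)[of J] by blast
qed

lemma ascending_ideals_stabilize:
  assumes "\<And>k. ideal (J k) R" "\<And>k. J k \<subseteq> J (Suc k)"
  obtains k0 where "\<And>k. k \<ge> k0 \<Longrightarrow> J k = J k0"
proof -
  have "\<forall>k0. J k0 = L \<longrightarrow> (\<exists>k1. \<forall>k\<ge>k1. J k = J k1)" if "ideal L R" for L
    using that
  proof (induction rule: noetherian_induct)
    case (1 L)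
    show ?case
    proof (intro allI impI)
      fix k0 assume k0: "J k0 = L"
      have mono: "m \<le> n \<Longrightarrow> J m \<subseteq> J n" for m n using lift_Suc_mono_le[of J] assms(2) by blast
      show "\<exists>k1. \<forall>k\<ge>k1. J k = J k1"
        using 1(2)[OF assms(1)] mono[of k0] k0 by (metis psubsetI)
    qed
  qed
  then obtain k1 where "\<forall>k\<ge>k1. J k = J k1" using assms(1)[of 0] by blast
  then show ?thesis using that by blast
qed

text \<open>Nakayama's lemma after localizing at \<open>Q\<close>, without generators of
  \<open>N\<close>. Noetherian induction runs over the saturated ideals \<open>K\<close> containing
  \<open>L\<close>: for \<open>y \<in> N\<close> outside \<open>K\<close>, the induction hypothesis
  puts \<open>N\<close> into the saturation of \<open>K + (y)\<close>. Feeding this back into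
  \<open>hyp\<close> gives \<open>(t s - x r) y \<in> K\<close>, and the factor is outside
  \<open>Q\<close> because \<open>x \<in> Q\<close>.\<close>

lemma nakayama:
  assumes Q: "primeideal Q R" and L: "ideal L R" and N: "ideal N R" and x: "x \<in> Q"
    and hyp: "\<And>y. y \<in> N \<Longrightarrow> \<exists>s\<in>carrier R - Q. \<exists>l\<in>L. \<exists>m\<in>N. s \<otimes> y = l \<oplus> x \<otimes> m"
  shows "N \<subseteq> saturation Q L"
proof -
  have IQ: "ideal Q R" using Q prime_ideal by blast
  have xc: "x \<in> carrier R" using x IQ ideal_carrier by blast
  have "saturated Q K \<longrightarrow> L \<subseteq> K \<longrightarrow> N \<subseteq> K" if "ideal K R" for K
    using that
  proof (induction rule: noetherian_induct)
    case (1 K)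
    show ?case
    proof (intro impI subsetI, rule ccontr)
      fix y assume K: "saturated Q K" "L \<subseteq> K" and y: "y \<in> N" "y \<notin> K"
      have yc: "y \<in> carrier R" using y N ideal_carrier by blast
      define K1 where "K1 = {w \<oplus> r \<otimes> y | w r. w \<in> K \<and> r \<in> carrier R}"
      have K1: "ideal K1 R" unfolding K1_def using ideal_adjoin 1(1) yc by blast
      have sub: "K \<subseteq> K1"
      proof
        fix w assume w: "w \<in> K"
        then have "w = w \<oplus> \<zero> \<otimes> y" using yc ideal_carrier[OF 1(1)] by simp
        then show "w \<in> K1" unfolding K1_def using w by blast
      qed
      have yK1: "y \<in> K1"
      proof -
        have "y = \<zero> \<oplus> \<one> \<otimes> y" using yc by simp
        then show "y \<in> K1" unfolding K1_def using ideal_zero[OF 1(1)] by blast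
      qed
      note sat = saturation_saturated[OF Q K1] and sup = saturation_superset[OF Q K1]
      have "N \<subseteq> saturation Q K1"
        using 1(2)[OF saturatedD(1)[OF sat]] sub yK1 y sup sat K(2) by blast
      moreover obtain s l m where s: "s \<in> carrier R - Q" "l \<in> L" "m \<in> N" "s \<otimes> y = l \<oplus> x \<otimes> m"
        using hyp[OF y(1)] by blast
      ultimately obtain t where t: "t \<in> carrier R - Q" "t \<otimes> m \<in> K1"
        unfolding saturation_def by blast
      then obtain w r where w: "w \<in> K" "r \<in> carrier R" "t \<otimes> m = w \<oplus> r \<otimes> y"
        unfolding K1_def by blast
      have c: "s \<in> carrier R" "t \<in> carrier R" "l \<in> carrier R" "m \<in> carrier R" "w \<in> carrier R"
        using s t w ideal_carrier[OF L] ideal_carrier[OF N] ideal_carrier[OF 1(1)] by auto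
      have "(t \<otimes> s \<ominus> x \<otimes> r) \<otimes> y = t \<otimes> (s \<otimes> y) \<ominus> x \<otimes> (r \<otimes> y)"
        using c w(2) xc yc by algebra
      also have "\<dots> = t \<otimes> l \<oplus> x \<otimes> (t \<otimes> m) \<ominus> x \<otimes> (r \<otimes> y)"
        unfolding s(4) using c w(2) xc yc by algebra
      also have "\<dots> = t \<otimes> l \<oplus> x \<otimes> w"
        unfolding w(3) using c w(2) xc yc by algebra
      also have "\<dots> \<in> K" using ideal_add[OF 1(1)] ideal_mult[OF 1(1)] c xc w s K(2) by blast
      finally have "(t \<otimes> s \<ominus> x \<otimes> r) \<otimes> y \<in> K" .
      moreover have "t \<otimes> s \<ominus> x \<otimes> r \<notin> Q"
      proof
        assume "t \<otimes> s \<ominus> x \<otimes> r \<in> Q"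
        moreover have "x \<otimes> r \<in> Q" using x w(2) ideal_mult_right[OF IQ] by blast
        ultimately have "t \<otimes> s \<in> Q" using ideal_diff_cancel[OF IQ] c by blast
        then show False using prime_complement_mult[OF Q t(1) s(1)] by blast
      qed
      ultimately have "y \<in> K"
        using saturatedD(2)[OF K(1), of "t \<otimes> s \<ominus> x \<otimes> r" y] c xc w(2) yc by simp
      then show False using y by blast
    qed
  qed
  then show ?thesis
    using saturation_saturated[OF Q L] saturation_superset[OF Q L] saturatedD(1) by blast
qed

text \<open>Among the annihilators of the nonzero multiples of the class of \<open>c\<close> in
  \<open>R / L\<close>, a maximal one is prime: if \<open>b\<close> lies outside the annihilator of
  \<open>d c\<close>, passing on to \<open>b d c\<close> cannot enlarge it.\<close>

lemma ex_colon_prime: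
  assumes L: "ideal L R" and c: "c \<in> carrier R" "c \<notin> L"
  obtains d where "d \<in> carrier R" "d \<otimes> c \<notin> L" "primeideal {r \<in> carrier R. r \<otimes> (d \<otimes> c) \<in> L} R"
proof -
  define C where "C = {{r \<in> carrier R. r \<otimes> (d \<otimes> c) \<in> L} | d. d \<in> carrier R \<and> d \<otimes> c \<notin> L}"
  have "\<one> \<otimes> c \<notin> L" using c by simp
  then have "{r \<in> carrier R. r \<otimes> (\<one> \<otimes> c) \<in> L} \<in> C" unfolding C_def by blast
  then obtain J where J: "J \<in> C"
    "\<And>J'. (J', J) \<in> {(J', J). ideal J' R \<and> ideal J R \<and> J \<subset> J'} \<Longrightarrow> J' \<notin> C"
    by (rule wfE_min[OF ideal_psupset_wf]) blast
  obtain d where d: "d \<in> carrier R" "d \<otimes> c \<notin> L" "J = {r \<in> carrier R. r \<otimes> (d \<otimes> c) \<in> L}"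
    using J(1) unfolding C_def by blast
  have IJ: "ideal J R" using d ideal_colon[OF L, of "d \<otimes> c"] c by simp
  have "primeideal J R"
  proof (rule prime_intro[OF IJ])
    show "\<one> \<notin> J" using d c by simp
    fix a b assume ab: "a \<in> carrier R" "b \<in> carrier R" "a \<otimes> b \<in> J"
    show "a \<in> J \<or> b \<in> J"
    proof (rule ccontr)
      assume n: "\<not> (a \<in> J \<or> b \<in> J)"
      let ?J = "{r \<in> carrier R. r \<otimes> ((b \<otimes> d) \<otimes> c) \<in> L}"
      have bd: "(b \<otimes> d) \<otimes> c \<notin> L" using n ab c d by (simp add: m_assoc)
      then have "?J \<in> C" unfolding C_def using ab d by blast
      moreover have "ideal ?J R" using ideal_colon[OF L, of "(b \<otimes> d) \<otimes> c"] ab c d by simp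
      moreover have "J \<subset> ?J"
      proof
        show "J \<subseteq> ?J"
        proof
          fix r assume r: "r \<in> J"
          then have rc: "r \<in> carrier R" using d by simp
          have "r \<otimes> ((b \<otimes> d) \<otimes> c) = b \<otimes> (r \<otimes> (d \<otimes> c))" using rc c d ab by (simp add: m_ac)
          then show "r \<in> ?J" using r rc d ab ideal_mult[OF L] by simp
        qed
        have "a \<otimes> ((b \<otimes> d) \<otimes> c) = (a \<otimes> b) \<otimes> (d \<otimes> c)" using ab c d by (simp add: m_ac)
        then have "a \<in> ?J" using ab d by simp
        then show "J \<noteq> ?J" using n by blast
      qed
      ultimately show False using J(2) IJ by blast
    qed
  qed
  then show ?thesis using that d by blast
qed

text \<open>If \<open>Q\<close> is minimal over \<open>K\<close>, then \<open>R\<^sub>Q / K R\<^sub>Q\<close> is Artinian.\<close>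

lemma descending_saturated_stabilize:
  assumes Q: "primeideal Q R"
    and min: "\<And>L. primeideal L R \<Longrightarrow> K \<subseteq> L \<Longrightarrow> L \<subseteq> Q \<Longrightarrow> L = Q"
    and L: "saturated Q L" "K \<subseteq> L"
    and J: "\<And>n. saturated Q (J n)" "\<And>n. J (Suc n) \<subseteq> J n" "\<And>n. L \<subseteq> J n"
  shows "\<exists>n0. \<forall>n\<ge>n0. J n = J n0"
proof -
  have "saturated Q L \<longrightarrow> K \<subseteq> L \<longrightarrow> (\<forall>J. (\<forall>n. saturated Q (J n) \<and> J (Suc n) \<subseteq> J n \<and> L \<subseteq> J n) \<longrightarrow>
      (\<exists>n0. \<forall>n\<ge>n0. J n = J n0))" if "ideal L R" for L
    using that
  proof (induction rule: noetherian_induct)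
    case (1 L)
    show ?case
    proof (intro impI allI)
      fix J :: "nat \<Rightarrow> 'a set"
      assume L: "saturated Q L" "K \<subseteq> L"
        and J': "\<forall>n. saturated Q (J n) \<and> J (Suc n) \<subseteq> J n \<and> L \<subseteq> J n"
      then have J: "\<And>n. saturated Q (J n)" "\<And>n. J (Suc n) \<subseteq> J n" "\<And>n. L \<subseteq> J n" by blast+
      have IJ: "\<And>n. ideal (J n) R" using J(1) saturatedD by blast
      have mono: "m \<le> n \<Longrightarrow> J n \<subseteq> J m" for m n using lift_Suc_antimono_le[of J] J(2) by blast
      show "\<exists>n0. \<forall>n\<ge>n0. J n = J n0"
      proof (cases "L = carrier R")
        case True
        then have "J n = carrier R" for n using J(3) IJ ideal_carrier by blast
        then show ?thesis by blast
      next
        case False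
        then have "\<one> \<notin> L" using ideal.one_imp_carrier[OF 1(1)] by blast
        then obtain d where "d \<in> carrier R" "d \<otimes> \<one> \<notin> L"
          "primeideal {r \<in> carrier R. r \<otimes> (d \<otimes> \<one>) \<in> L} R"
          using ex_colon_prime[OF 1(1) one_closed] by blast
        then obtain y where y: "y \<in> carrier R" "y \<notin> L" "primeideal {r \<in> carrier R. r \<otimes> y \<in> L} R"
          by simp
        \<comment> \<open>Minimality of \<open>Q\<close> over \<open>K\<close> identifies the
          annihilator of \<open>y\<close> modulo \<open>L\<close>; hence
          \<open>(L + (y)) / L\<close> becomes the residue field over the localization at
          \<open>Q\<close>, a simple module.\<close>
        have colon: "{r \<in> carrier R. r \<otimes> y \<in> L} = Q"
        proof (rule min[OF y(3)])
          show "K \<subseteq> {r \<in> carrier R. r \<otimes> y \<in> L}"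
            using L(2) ideal_mult_right[OF 1(1)] ideal_carrier[OF 1(1)] y by blast
          show "{r \<in> carrier R. r \<otimes> y \<in> L} \<subseteq> Q" using saturatedD(2)[OF L(1)] y by blast
        qed
        define K1 where "K1 = {w \<oplus> r \<otimes> y | w r. w \<in> L \<and> r \<in> carrier R}"
        have K1: "ideal K1 R" unfolding K1_def using ideal_adjoin 1(1) y by blast
        have sub: "L \<subseteq> K1"
        proof
          fix w assume w: "w \<in> L"
          then have "w = w \<oplus> \<zero> \<otimes> y" using y ideal_carrier[OF 1(1)] by simp
          then show "w \<in> K1" unfolding K1_def using w by blast
        qed
        have yK1: "y \<in> K1"
        proof -
          have "y = \<zero> \<oplus> \<one> \<otimes> y" using y by simp
          then show "y \<in> K1" unfolding K1_def using ideal_zero[OF 1(1)] by blast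
        qed
        \<comment> \<open>Simplicity in use: a saturated ideal above \<open>L\<close> that omits
          \<open>y\<close> meets \<open>L + (y)\<close> only in \<open>L\<close>.\<close>
        have small: "w \<in> L" if M: "saturated Q M" "L \<subseteq> M" "y \<notin> M" "w \<in> M" "w \<in> K1" for M w
        proof -
          obtain l r where l: "l \<in> L" "r \<in> carrier R" "w = l \<oplus> r \<otimes> y" using M(5) K1_def by blast
          have lc: "l \<in> carrier R" using l 1(1) ideal_carrier by blast
          note IM = saturatedD(1)[OF M(1)]
          have "r \<otimes> y \<in> M"
            using ideal_add_cancel[OF IM, of "r \<otimes> y" l] l lc M y by (auto simp: a_comm)
          then have "r \<in> Q" using saturatedD(2)[OF M(1)] M(3) l(2) y(1) by blast
          then have "r \<otimes> y \<in> L" using colon by blast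
          then show ?thesis using l ideal_add[OF 1(1)] by blast
        qed
        define S where "S n = saturation Q {a \<oplus> b | a b. a \<in> J n \<and> b \<in> K1}" for n
        have sum_ideal: "ideal (set_add R (J n) K1) R" for n using add_ideals[OF IJ K1] .
        define S where "S n = saturation Q (set_add R (J n) K1)" for n
        have sat_S: "saturated Q (S n)" for n
          unfolding S_def using saturation_saturated[OF Q sum_ideal] .
        have JK: "J n \<subseteq> set_add R (J n) K1" "K1 \<subseteq> set_add R (J n) K1" for n
        proof -
          have "a = a \<oplus> \<zero>" if "a \<in> J n" for a using that IJ ideal_carrier by force
          then show "J n \<subseteq> set_add R (J n) K1" using ideal_zero[OF K1] by (fastforce simp: set_add_def')
          have "a = \<zero> \<oplus> a" if "a \<in> K1" for a using that K1 ideal_carrier by force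
          then show "K1 \<subseteq> set_add R (J n) K1" using ideal_zero[OF IJ] by (fastforce simp: set_add_def')
        qed
        have S_sup: "set_add R (J n) K1 \<subseteq> S n" for n
          unfolding S_def using saturation_superset[OF Q sum_ideal] .
        let ?L' = "saturation Q K1"
        have L': "saturated Q ?L'" using saturation_saturated[OF Q K1] .
        have L'S: "?L' \<subseteq> S n" for n
          using saturation_minimal[OF sat_S] JK(2) S_sup by blast
        have S_dec: "S (Suc n) \<subseteq> S n" for n
        proof -
          have "set_add R (J (Suc n)) K1 \<subseteq> set_add R (J n) K1" using J(2)[of n] by (auto simp: set_add_def')
          then show ?thesis unfolding S_def saturation_def by blast
        qed
        have LL': "L \<subset> ?L'" using saturation_superset[OF Q K1] sub yK1 y by blast
        then have "\<exists>n0. \<forall>n\<ge>n0. S n = S n0"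
          using 1(2)[OF saturatedD(1)[OF L'] LL'] L' L(2) sat_S S_dec L'S by blast
        then obtain n1 where n1: "\<And>n. n \<ge> n1 \<Longrightarrow> S n = S n1" by blast
        have "\<exists>n2. \<forall>n\<ge>n2. y \<in> J n \<longleftrightarrow> y \<in> J n2"
        proof (cases "\<forall>n. y \<in> J n")
          case False
          then obtain m where "y \<notin> J m" by blast
          then have "\<forall>n\<ge>m. y \<notin> J n" using mono by blast
          then show ?thesis by blast
        qed blast
        then obtain n2 where n2: "\<And>n. n \<ge> n2 \<Longrightarrow> y \<in> J n \<longleftrightarrow> y \<in> J n2" by blast
        \<comment> \<open>Once the saturation of \<open>J n + L + (y)\<close> and the truth of
          \<open>y \<in> J n\<close> are both constant, so is \<open>J n\<close>: modulo
          \<open>J m\<close> an element of \<open>J n\<close> is moved into \<open>L + (y)\<close>,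
          and there these two data decide.\<close>
        have "J n \<subseteq> J m" if nm: "n \<ge> max n1 n2" "m \<ge> n" for n m
        proof
          fix w assume w: "w \<in> J n"
          then have wc: "w \<in> carrier R" using IJ ideal_carrier by blast
          have "w \<in> S m" using w JK(1) S_sup n1[of n] n1[of m] nm by fastforce
          then obtain s a b where s: "s \<in> carrier R - Q" "a \<in> J m" "b \<in> K1" "s \<otimes> w = a \<oplus> b"
            unfolding S_def saturation_def set_add_def' by blast
          have c: "a \<in> carrier R" "b \<in> carrier R"
            using s ideal_carrier[OF IJ] ideal_carrier[OF K1] by blast+
          have "a \<oplus> b \<in> J n" using w s(1,4) ideal_mult[OF IJ] by (metis DiffE)
          then have "b \<oplus> a \<in> J n" using c by (simp add: a_comm)
          then have bJ: "b \<in> J n" using ideal_add_cancel[OF IJ c(2)] s(2) mono nm by blast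
          have "b \<in> J m"
          proof (cases "y \<in> J n")
            case True
            then have "y \<in> J m" using n2[of n] n2[of m] nm by simp
            moreover obtain l r where l: "l \<in> L" "r \<in> carrier R" "b = l \<oplus> r \<otimes> y"
              using s(3) K1_def by blast
            ultimately show ?thesis using J(3) ideal_add[OF IJ] ideal_mult[OF IJ] by blast
          next
            case False
            then show ?thesis using small[OF J(1) J(3) False bJ s(3)] J(3) by blast
          qed
          then have "s \<otimes> w \<in> J m" using s ideal_add[OF IJ] by simp
          then show "w \<in> J m" using saturatedD(2)[OF J(1)] s(1) wc by blast
        qed
        then show ?thesis using mono by (intro exI[of _ "max n1 n2"]) (metis order_refl subset_antisym)
      qed
    qed
  qed
  from this[OF saturatedD(1)[OF L(1)]] show ?thesis using L J by simp
qed


text \<open>Krull's principal ideal theorem, applied to a chain \<open>P \<subset> Q \<subset> Q'\<close>: for \<open>y \<in> Q - P\<close> the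
  saturations of \<open>(y\<^sup>n) + P + (x)\<close> stabilize, and Nakayama's lemma then puts \<open>y\<^sup>n\<close> into the
  saturation of \<open>(y\<^sup>n\<^sup>+\<^sup>1) + P\<close>.\<close>

lemma principal_ideal_theorem:
  assumes P: "primeideal P R" and Q: "primeideal Q R" and Q': "primeideal Q' R"
    and sub: "P \<subset> Q" "Q \<subset> Q'" and x: "x \<in> Q'"
  obtains L where "primeideal L R" "P \<subset> L" "L \<subset> Q'" "x \<in> L"
proof (cases "x \<in> Q")
  case True
  then show ?thesis using that[OF Q sub] by blast
next
  case False
  note result = that
  note IP = prime_ideal[OF P] and IQ = prime_ideal[OF Q] and IQ' = prime_ideal[OF Q']
  have xc: "x \<in> carrier R" using x IQ' ideal_carrier by blast
  show ?thesis
  proof (rule ccontr)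
    assume no: "\<not> thesis"
    obtain y where y: "y \<in> Q" "y \<notin> P" using sub by blast
    have yc: "y \<in> carrier R" using y IQ ideal_carrier by blast
    define J0 where "J0 n = {w \<oplus> r \<otimes> (y [^] n) | w r. w \<in> P \<and> r \<in> carrier R}" for n :: nat
    have J0: "ideal (J0 n) R" for n unfolding J0_def using ideal_adjoin[OF IP] yc by simp
    define J where "J n = saturation Q (J0 n)" for n
    have satJ: "saturated Q (J n)" for n unfolding J_def using saturation_saturated[OF Q J0] .
    note IJ = saturatedD(1)[OF satJ]
    have PJ: "P \<subseteq> J n" for n
    proof
      fix w assume w: "w \<in> P"
      then have "w = w \<oplus> \<zero> \<otimes> (y [^] n)" using yc IP ideal_carrier by simp
      then have "w \<in> J0 n" unfolding J0_def using w by blast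
      then show "w \<in> J n" unfolding J_def using saturation_superset[OF Q J0] by blast
    qed
    have J0_dec: "J0 (Suc n) \<subseteq> J0 n" for n
    proof
      fix z assume "z \<in> J0 (Suc n)"
      then obtain w r where w: "w \<in> P" "r \<in> carrier R" "z = w \<oplus> r \<otimes> (y [^] Suc n)"
        unfolding J0_def by blast
      then have "z = w \<oplus> (r \<otimes> y) \<otimes> (y [^] n)" using yc by (simp add: m_ac)
      then show "z \<in> J0 n" unfolding J0_def using w yc by blast
    qed
    have J_dec: "J (Suc n) \<subseteq> J n" for n using J0_dec unfolding J_def saturation_def by blast
    define K where "K n = {w \<oplus> r \<otimes> x | w r. w \<in> J n \<and> r \<in> carrier R}" for n
    have K: "ideal (K n) R" for n unfolding K_def using ideal_adjoin[OF IJ] xc by simp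
    define S where "S n = saturation Q' (K n)" for n
    have satS: "saturated Q' (S n)" for n unfolding S_def using saturation_saturated[OF Q' K] .
    have JK: "J n \<subseteq> K n" for n
    proof
      fix w assume w: "w \<in> J n"
      then have "w \<in> carrier R" using IJ ideal_carrier by blast
      then have "w = w \<oplus> \<zero> \<otimes> x" using xc by simp
      then show "w \<in> K n" unfolding K_def using w by blast
    qed
    have KS: "K n \<subseteq> S n" for n unfolding S_def using saturation_superset[OF Q' K] .
    have S_dec: "S (Suc n) \<subseteq> S n" for n
      using J_dec[of n] unfolding S_def saturation_def K_def by blast
    define L where "L = {w \<oplus> r \<otimes> x | w r. w \<in> P \<and> r \<in> carrier R}"
    have L: "ideal L R" unfolding L_def using ideal_adjoin[OF IP] xc by simp
    have "P \<subseteq> L" "x \<in> L"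
    proof -
      have "w = w \<oplus> \<zero> \<otimes> x" if "w \<in> P" for w using xc that IP ideal_carrier by simp
      then show "P \<subseteq> L" unfolding L_def by blast
      have "x = \<zero> \<oplus> \<one> \<otimes> x" using xc by simp
      then show "x \<in> L" unfolding L_def using ideal_zero[OF IP] by blast
    qed
    have LK: "L \<subseteq> K n" for n using PJ[of n] unfolding L_def K_def by blast
    have LS: "saturation Q' L \<subseteq> S n" for n
      using saturation_minimal[OF satS] LK KS by blast
    \<comment> \<open>If the conclusion fails, no prime strictly between \<open>P\<close> and
      \<open>Q'\<close> contains \<open>x\<close>; as \<open>x \<notin> P\<close>, this makes
      \<open>Q'\<close> minimal over \<open>L = P + (x)\<close>.\<close>
    have min: "M = Q'" if M: "primeideal M R" "L \<subseteq> M" "M \<subseteq> Q'" for M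
    proof (rule ccontr)
      assume "M \<noteq> Q'"
      then have "M \<subset> Q'" using M by blast
      moreover have "x \<in> M" "P \<subseteq> M" using M(2) \<open>P \<subseteq> L\<close> \<open>x \<in> L\<close> by blast+
      moreover have "P \<noteq> M" using \<open>x \<in> M\<close> False sub by blast
      ultimately show False using result[OF M(1)] no by blast
    qed
    have "\<exists>n0. \<forall>n\<ge>n0. S n = S n0"
      by (rule descending_saturated_stabilize[of Q' L "saturation Q' L" S, OF Q' min saturation_saturated[OF Q' L]
          saturation_superset[OF Q' L] satS S_dec LS])
    then obtain n where "\<forall>m\<ge>n. S m = S n" by blast
    then have "S (Suc n) = S n" using le_SucI[OF order_refl] by blast
    then have n: "S n = S (Suc n)" by (rule sym)
    have "J n \<subseteq> saturation Q' (J (Suc n))"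
    proof (rule nakayama[OF Q' IJ IJ x])
      fix z assume z: "z \<in> J n"
      then have "z \<in> S (Suc n)" using n JK KS by blast
      then obtain s w r where s: "s \<in> carrier R - Q'" "w \<in> J (Suc n)" "r \<in> carrier R"
        "s \<otimes> z = w \<oplus> r \<otimes> x" unfolding S_def saturation_def K_def by blast
      have wc: "w \<in> carrier R" using s IJ ideal_carrier by blast
      have "r \<otimes> x \<oplus> w \<in> J n"
        using s ideal_mult[OF IJ _ z, of s] wc xc by (simp add: a_comm)
      then have "r \<otimes> x \<in> J n" using ideal_add_cancel[OF IJ] s(2,3) J_dec xc by blast
      then have "x \<otimes> r \<in> J n" using s xc by (simp add: m_comm)
      \<comment> \<open>The case assumption \<open>x \<notin> Q\<close> lets the
        \<open>Q\<close>-saturated ideal \<open>J n\<close> absorb the factor \<open>x\<close>; so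
        locally at \<open>Q'\<close> the ideal \<open>J n\<close> equals
        \<open>J (Suc n) + x J n\<close>, as Nakayama requires.\<close>
      then have "r \<in> J n" using saturatedD(2)[OF satJ xc False s(3)] by blast
      then show "\<exists>s\<in>carrier R - Q'. \<exists>l\<in>J (Suc n). \<exists>m\<in>J n. s \<otimes> z = l \<oplus> x \<otimes> m"
        using s xc by (intro bexI[of _ s] bexI[of _ w] bexI[of _ r]) (auto simp: m_comm)
    qed
    also have "\<dots> \<subseteq> J (Suc n)"
    proof (rule saturation_minimal)
      show "saturated Q' (J (Suc n))"
        using satJ sub(2) unfolding saturated_def by blast
    qed simp
    finally have sub: "J n \<subseteq> J (Suc n)" .
    have "y [^] n \<in> J0 n"
    proof -
      have "y [^] n = \<zero> \<oplus> \<one> \<otimes> y [^] n" using yc by simp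
      then show ?thesis unfolding J0_def using ideal_zero[OF IP] by blast
    qed
    then have "y [^] n \<in> J (Suc n)" using sub saturation_superset[OF Q J0] unfolding J_def by blast
    then obtain s w r where s: "s \<in> carrier R - Q" "w \<in> P" "r \<in> carrier R"
      "s \<otimes> y [^] n = w \<oplus> r \<otimes> y [^] Suc n" unfolding J_def saturation_def J0_def by blast
    define z where "z = y [^] n"
    have zc: "z \<in> carrier R" unfolding z_def using yc by simp
    have wc: "w \<in> carrier R" using s IP ideal_carrier by blast
    have sc: "s \<in> carrier R" using s by simp
    \<comment> \<open>The first factor is outside \<open>Q\<close>, since \<open>y \<in> Q\<close>
      and \<open>s \<notin> Q\<close>, and \<open>z = y [^] n\<close> is outside the prime
      \<open>P\<close>; yet their product is \<open>w \<in> P\<close>.\<close>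
    have "(s \<ominus> r \<otimes> y) \<otimes> z = s \<otimes> z \<ominus> r \<otimes> (z \<otimes> y)" using zc sc s(3) yc by algebra
    also have "\<dots> = w \<oplus> r \<otimes> (z \<otimes> y) \<ominus> r \<otimes> (z \<otimes> y)" using s(4) unfolding z_def by simp
    also have "\<dots> = w" using zc s(3) yc wc by algebra
    finally have "(s \<ominus> r \<otimes> y) \<otimes> z \<in> P" using s by simp
    moreover have "z \<notin> P" using prime_pow[OF P yc] y unfolding z_def by blast
    ultimately have "s \<ominus> r \<otimes> y \<in> Q"
      using prime_mult[OF P, of "s \<ominus> r \<otimes> y" z] zc s yc \<open>P \<subset> Q\<close> by auto
    then have "s \<in> Q" using ideal_diff_cancel[OF IQ] ideal_mult[OF IQ _ y(1)] s by blast
    then show False using s by blast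
  qed
qed

text \<open>Induction from the top of the chain: the principal ideal theorem for the three highest
  primes replaces the last but one by a prime containing \<open>x\<close>, and the induction
  hypothesis treats the shorter chain ending there.\<close>

lemma prime_chain_through:
  fixes P :: "nat \<Rightarrow> 'a set"
  assumes "\<And>i. i \<le> Suc k \<Longrightarrow> primeideal (P i) R" "\<And>i. i \<le> k \<Longrightarrow> P i \<subset> P (Suc i)" "x \<in> P (Suc k)"
  shows "\<exists>P'. (\<forall>i\<le>Suc k. primeideal (P' i) R) \<and> (\<forall>i\<le>k. P' i \<subset> P' (Suc i)) \<and>
    P' 0 = P 0 \<and> P' (Suc k) = P (Suc k) \<and> x \<in> P' 1"
  using assms
proof (induction k arbitrary: P)
  case 0
  then show ?case by (intro exI[of _ P]) auto
next
  case (Suc k)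
  obtain L where L: "primeideal L R" "P k \<subset> L" "L \<subset> P (Suc (Suc k))" "x \<in> L"
    using principal_ideal_theorem[of "P k" "P (Suc k)" "P (Suc (Suc k))" x] Suc.prems by auto
  have "\<exists>P'. (\<forall>i\<le>Suc k. primeideal (P' i) R) \<and> (\<forall>i\<le>k. P' i \<subset> P' (Suc i)) \<and>
    P' 0 = (P(Suc k := L)) 0 \<and> P' (Suc k) = (P(Suc k := L)) (Suc k) \<and> x \<in> P' 1"
    using Suc.prems L by (intro Suc.IH) auto
  then obtain P' where P': "\<forall>i\<le>Suc k. primeideal (P' i) R" "\<forall>i\<le>k. P' i \<subset> P' (Suc i)"
    "P' 0 = P 0" "P' (Suc k) = L" "x \<in> P' 1" by auto
  have "\<forall>i\<le>Suc (Suc k). primeideal ((P'(Suc (Suc k) := P (Suc (Suc k)))) i) R"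
    using P' Suc.prems(1) by (auto simp: le_Suc_eq)
  moreover have "\<forall>i\<le>Suc k. (P'(Suc (Suc k) := P (Suc (Suc k)))) i \<subset> (P'(Suc (Suc k) := P (Suc (Suc k)))) (Suc i)"
    using P' L(3) by (auto simp: le_Suc_eq)
  ultimately show ?case using P' by (intro exI[of _ "P'(Suc (Suc k) := P (Suc (Suc k)))"]) auto
qed

text \<open>The part of the chain from level \<open>m\<close> upwards is rerouted through
  \<open>b m\<close> at its first step, for \<open>m = 0, 1, 2\<close> and so on; later reroutings
  leave the lower part alone. This is the form of Krull's height theorem that the parameters
  need.\<close>

lemma prime_chain_through_sequence:
  fixes Q :: "nat \<Rightarrow> 'a set"
  assumes "\<And>i. i \<le> n \<Longrightarrow> primeideal (Q i) R" "\<And>i. i < n \<Longrightarrow> Q i \<subset> Q (Suc i)"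
    and "\<And>i. i < n \<Longrightarrow> b i \<in> Q n" and "m \<le> n"
  shows "\<exists>Q'. (\<forall>i\<le>n. primeideal (Q' i) R) \<and> (\<forall>i<n. Q' i \<subset> Q' (Suc i)) \<and> Q' n = Q n \<and>
    (\<forall>k\<le>m. \<forall>i<k. b i \<in> Q' k)"
  using \<open>m \<le> n\<close>
proof (induction m)
  case 0
  then show ?case using assms by (intro exI[of _ Q]) auto
next
  case (Suc m)
  then obtain Q1 where Q1: "\<forall>i\<le>n. primeideal (Q1 i) R" "\<forall>i<n. Q1 i \<subset> Q1 (Suc i)" "Q1 n = Q n"
    "\<forall>k\<le>m. \<forall>i<k. b i \<in> Q1 k" by auto
  obtain k where k: "n = m + Suc k" using Suc.prems less_iff_Suc_add by (metis Suc_le_lessD add_Suc_right)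
  obtain P where P: "\<forall>i\<le>Suc k. primeideal (P i) R" "\<forall>i\<le>k. P i \<subset> P (Suc i)" "P 0 = Q1 m"
    "P (Suc k) = Q1 n" "b m \<in> P 1"
    using prime_chain_through[of k "\<lambda>i. Q1 (m + i)" "b m"] Q1 assms(3)[of m] k by auto
  define Q' where "Q' i = (if i < m then Q1 i else P (i - m))" for i
  have "primeideal (Q' i) R" if "i \<le> n" for i using that Q1(1) P(1) k unfolding Q'_def by auto
  moreover have step: "Q' i \<subset> Q' (Suc i)" if "i < n" for i
  proof (cases "i < m")
    case True
    then show ?thesis using that Q1(2) P(3) unfolding Q'_def
      by (cases "Suc i = m") auto
  next
    case False
    then show ?thesis using that P(2) k unfolding Q'_def by (auto simp: Suc_diff_le)
  qed
  moreover have "Q' n = Q n" using P(4) Q1(3) k unfolding Q'_def by simp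
  moreover have "b i \<in> Q' j" if j: "j \<le> Suc m" "i < j" for i j
  proof -
    have m: "b i \<in> Q' m" if "i < m" for i using that Q1(4) P(3) unfolding Q'_def by simp
    consider "j < m" | "j = m" | "j = Suc m" using j by linarith
    then show ?thesis
    proof cases
      case 1
      then show ?thesis using Q1(4) j unfolding Q'_def by simp
    next
      case 2
      then show ?thesis using m j by simp
    next
      case 3
      have "b m \<in> Q' (Suc m)" using P(5) unfolding Q'_def by simp
      moreover have "Q' m \<subseteq> Q' (Suc m)" using step[of m] k by simp
      ultimately show ?thesis using 3 j(2) m[of i] less_Suc_eq by blast
    qed
  qed
  ultimately show ?case by (intro exI[of _ Q']) blast
qed

end

section \<open>Parameters of a regular local ring\<close>

lemma (in cring) maximalideal_intro:
  assumes "ideal M R" "M \<noteq> carrier R" "\<And>J. ideal J R \<Longrightarrow> M \<subseteq> J \<Longrightarrow> J \<noteq> M \<Longrightarrow> J = carrier R"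
  shows "maximalideal M R"
  using assms by (intro maximalidealI) auto

lemma (in noetherian_cring) ex_maximal:
  assumes "ideal J R" "J \<noteq> carrier R"
  shows "\<exists>M. maximalideal M R \<and> J \<subseteq> M"
proof -
  have "J \<noteq> carrier R \<longrightarrow> (\<exists>M. maximalideal M R \<and> J \<subseteq> M)"
    using assms(1)
  proof (induction rule: noetherian_induct)
    case (1 J)
    show ?case
    proof
      assume J: "J \<noteq> carrier R"
      show "\<exists>M. maximalideal M R \<and> J \<subseteq> M"
      proof (cases "maximalideal J R")
        case False
        then obtain J' where J': "ideal J' R" "J \<subseteq> J'" "J' \<noteq> J" "J' \<noteq> carrier R"
          using maximalideal_intro[OF 1(1) J] by blast
        then obtain M where "maximalideal M R" "J' \<subseteq> M" using 1(2)[of J'] by blast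
        then show ?thesis using J' by blast
      qed blast
    qed
  qed
  then show ?thesis using assms(2) by simp
qed

text \<open>A finite supremum of natural numbers is attained as soon as the set is nonempty; the
  prime \<open>Q\<close>, a chain of length zero, ensures the latter.\<close>

lemma krull_dim_chain:
  assumes "krull_dim R = enat n" "primeideal Q R"
  obtains P :: "nat \<Rightarrow> 'a set" where "\<And>i. i \<le> n \<Longrightarrow> primeideal (P i) R" "\<And>i. i < n \<Longrightarrow> P i \<subset> P (Suc i)"
proof -
  define K where "K = {enat k | k. \<exists>P :: nat \<Rightarrow> 'a set.
        (\<forall>i\<le>k. primeideal (P i) R) \<and> (\<forall>i<k. P i \<subset> P (Suc i))}"
  have "enat 0 \<in> K" unfolding K_def using assms(2) by auto
  moreover have S: "Sup K = enat n" using assms(1) unfolding krull_dim_def K_def .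
  ultimately have "finite K" "K \<noteq> {}" by (auto simp: Sup_enat_def split: if_splits)
  then have "enat n \<in> K" using Max_in S by (metis Sup_enat_def)
  then show ?thesis using that unfolding K_def by auto
qed

locale regular_local_cring = noetherian_cring R for R (structure) +
  fixes \<nn> :: "'a set" and B :: "'a set"
  assumes max: "maximalideal \<nn> R" and unique_max: "\<And>J. maximalideal J R \<Longrightarrow> J = \<nn>"
    and B: "B \<subseteq> carrier R" "finite B" "enat (card B) = krull_dim R" "\<nn> = Idl B"
begin

lemma max_prime: "primeideal \<nn> R" using maximalideal_prime max by blast
lemma max_ideal: "ideal \<nn> R" using prime_ideal max_prime by blast

lemma proper_ideal_max: "ideal J R \<Longrightarrow> J \<noteq> carrier R \<Longrightarrow> J \<subseteq> \<nn>"
  using ex_maximal unique_max by blast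

lemma ex_inverse:
  assumes "a \<in> carrier R" "a \<notin> \<nn>"
  obtains b where "b \<in> carrier R" "a \<otimes> b = \<one>"
proof -
  have I: "ideal (PIdl a) R" using assms cgenideal_ideal by blast
  have "a \<in> PIdl a" using assms cgenideal_self by blast
  then have "PIdl a = carrier R" using proper_ideal_max[OF I] assms by blast
  then have "\<one> \<in> PIdl a" by simp
  then obtain b where "b \<in> carrier R" "\<one> = b \<otimes> a" unfolding cgenideal_def by blast
  then show ?thesis using that[of b] assms m_comm by simp
qed

lemma saturation_max: assumes "ideal J R" shows "saturation \<nn> J = J"
proof
  show "saturation \<nn> J \<subseteq> J"
  proof
    fix y assume "y \<in> saturation \<nn> J"
    then obtain s where s: "s \<in> carrier R - \<nn>" "s \<otimes> y \<in> J" "y \<in> carrier R" unfolding saturation_def by blast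
    then obtain t where t: "t \<in> carrier R" "s \<otimes> t = \<one>" using ex_inverse by blast
    have "y = (s \<otimes> t) \<otimes> y" using t s by simp
    also have "\<dots> = t \<otimes> (s \<otimes> y)" using s(1,3) t(1) by (simp add: m_ac)
    finally show "y \<in> J" using ideal_mult[OF assms t(1) s(2)] by simp
  qed
  show "J \<subseteq> saturation \<nn> J" by (rule saturation_superset[OF max_prime assms])
qed

text \<open>The dimension supplies a chain of primes of length \<open>card B\<close>, which is bent
  so that \<open>Q k\<close> contains the first \<open>k\<close> parameters. Descending induction
  from \<open>Q ?n = \<nn>\<close> shows that they generate \<open>Q k\<close>: strictness of the
  chain gives \<open>b k \<notin> Q k\<close>, so \<open>Q k\<close> is the ideal of the first
  \<open>k\<close> parameters plus \<open>b k\<close> times \<open>Q k\<close>, and Nakayama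
  applies.\<close>

lemma parameter_sequence:
  fixes b :: "nat \<Rightarrow> 'a"
  assumes b: "b ` {..<card B} = B"
  shows "k \<le> card B \<Longrightarrow> primeideal (Idl (b ` {..<k})) R"
    and "k < card B \<Longrightarrow> b k \<notin> Idl (b ` {..<k})"
proof -
  let ?n = "card B"
  obtain P :: "nat \<Rightarrow> 'a set" where P: "\<And>i. i \<le> ?n \<Longrightarrow> primeideal (P i) R" "\<And>i. i < ?n \<Longrightarrow> P i \<subset> P (Suc i)"
    using krull_dim_chain[OF B(3)[symmetric] max_prime] by blast
  \<comment> \<open>The chain has to end in \<open>\<nn>\<close>, so that its top contains every
    parameter; enlarging the top prime keeps the inclusions strict.\<close>
  define P' where "P' = P(?n := \<nn>)"
  have Pn: "P ?n \<subseteq> \<nn>"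
    by (rule proper_ideal_max[OF prime_ideal[OF P(1)]]) (use P(1)[of ?n] prime_one in auto)
  have P': "\<And>i. i \<le> ?n \<Longrightarrow> primeideal (P' i) R" "P' ?n = \<nn>"
    using P max_prime unfolding P'_def by auto
  have P'_strict: "P' i \<subset> P' (Suc i)" if "i < ?n" for i
  proof (cases "Suc i = ?n")
    case True
    then show ?thesis using P(2)[OF that] Pn that unfolding P'_def by auto
  next
    case False
    then show ?thesis using P(2)[OF that] that unfolding P'_def by simp
  qed
  have b\<nn>: "b i \<in> \<nn>" if "i < ?n" for i using that b genideal_self[OF B(1)] B(4) by blast
  have "\<exists>Q. (\<forall>i\<le>?n. primeideal (Q i) R) \<and> (\<forall>i<?n. Q i \<subset> Q (Suc i)) \<and> Q ?n = P' ?n \<and>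
    (\<forall>k\<le>?n. \<forall>i<k. b i \<in> Q k)"
    by (rule prime_chain_through_sequence[of ?n P' b, OF P'(1) P'_strict _ order_refl]) (use b\<nn> P'(2) in auto)
  then obtain Q where Q: "\<And>i. i \<le> ?n \<Longrightarrow> primeideal (Q i) R" "\<And>i. i < ?n \<Longrightarrow> Q i \<subset> Q (Suc i)" "Q ?n = \<nn>"
    "\<And>k i. k \<le> ?n \<Longrightarrow> i < k \<Longrightarrow> b i \<in> Q k"
    unfolding P'(2) by blast
  have carr: "b ` {..<k} \<subseteq> carrier R" if "k \<le> ?n" for k using that b B(1) by auto
  have I: "ideal (Idl (b ` {..<k})) R" if "k \<le> ?n" for k using genideal_ideal[OF carr[OF that]] .
  have sup: "Idl (b ` {..<k}) \<subseteq> Q k" if "k \<le> ?n" for k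
    by (rule genideal_minimal[OF prime_ideal[OF Q(1)[OF that]]]) (use Q(4) that in auto)
  have eq: "Q k = Idl (b ` {..<k})" if "k \<le> ?n" for k
    using that
  proof (induction rule: inc_induct)
    case base
    then show ?case using Q(3) B(4) b by simp
  next
    case (step k)
    have k: "k \<le> ?n" "Suc k \<le> ?n" using step by auto
    note IQ = prime_ideal[OF Q(1)[OF k(1)]]
    have bk: "b k \<in> carrier R" using step b B(1) by auto
    have bkQ: "b k \<notin> Q k"
    proof
      assume "b k \<in> Q k"
      then have "b ` {..<Suc k} \<subseteq> Q k" using Q(4)[OF k(1)] by (auto simp: less_Suc_eq)
      then have "Q (Suc k) \<subseteq> Q k" unfolding step.IH by (rule genideal_minimal[OF IQ])
      then show False using Q(2)[of k] step by blast
    qed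
    have "Q k \<subseteq> saturation \<nn> (Idl (b ` {..<k}))"
    proof (rule nakayama[OF max_prime I[OF k(1)] IQ])
      show "b k \<in> \<nn>" using b\<nn> step by simp
      fix y assume y: "y \<in> Q k"
      then have "y \<in> Idl (insert (b k) (b ` {..<k}))"
        using Q(2)[of k] step by (auto simp: lessThan_Suc)
      then obtain w r where w: "w \<in> Idl (b ` {..<k})" "r \<in> carrier R" "y = w \<oplus> r \<otimes> b k"
        unfolding Idl_insert[OF bk carr[OF k(1)]] by blast
      have wc: "w \<in> carrier R" using w(1) I[OF k(1)] ideal_carrier by blast
      have "r \<otimes> b k \<oplus> w \<in> Q k" using y w wc bk by (simp add: a_comm)
      then have "r \<otimes> b k \<in> Q k"
        using ideal_add_cancel[OF IQ, of "r \<otimes> b k" w] w bk sup[OF k(1)] by auto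
      then have "r \<in> Q k" using prime_mult[OF Q(1)[OF k(1)] w(2) bk] bkQ by blast
      moreover have "\<one> \<otimes> y = w \<oplus> b k \<otimes> r" using w wc bk by (simp add: m_comm)
      ultimately show "\<exists>s\<in>carrier R - \<nn>. \<exists>l\<in>Idl (b ` {..<k}). \<exists>m\<in>Q k. s \<otimes> y = l \<oplus> b k \<otimes> m"
        using w prime_one[OF max_prime] by blast
    qed
    then show ?case using sup[OF k(1)] saturation_max[OF I[OF k(1)]] by blast
  qed
  show "k \<le> ?n \<Longrightarrow> primeideal (Idl (b ` {..<k})) R" using Q(1) eq by metis
  assume k: "k < ?n"
  show "b k \<notin> Idl (b ` {..<k})"
  proof
    assume "b k \<in> Idl (b ` {..<k})"
    then have "b ` {..<Suc k} \<subseteq> Idl (b ` {..<k})"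
      using genideal_self[OF carr[of k]] k by (simp add: lessThan_Suc)
    then have "Q (Suc k) \<subseteq> Q k"
      using genideal_minimal[OF I[of k]] k eq[of k] eq[of "Suc k"] by simp
    then show False using Q(2)[OF k] by blast
  qed
qed

text \<open>Listing \<open>A\<close> first and an arbitrary further parameter next transfers
  \<open>parameter_sequence\<close>, which speaks of initial segments, to all subsets of
  \<open>B\<close>.\<close>

lemma parameters_enum:
  assumes "A \<subseteq> B" "set ys = B - A" "distinct ys"
  obtains b where "b ` {..<card B} = B" "b ` {..<card A} = A" "ys \<noteq> [] \<Longrightarrow> b (card A) = hd ys"
    "ys \<noteq> [] \<Longrightarrow> card A < card B"
proof -
  obtain xs where xs: "set xs = A" "distinct xs"
    using finite_distinct_list finite_subset[OF assms(1) B(2)] by blast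
  let ?b = "\<lambda>i. (xs @ ys) ! i"
  have len: "length xs = card A" using xs distinct_card by fastforce
  have d: "distinct (xs @ ys)" using xs assms by auto
  have s: "set (xs @ ys) = B" using xs assms by auto
  have n: "length (xs @ ys) = card B" using distinct_card[OF d] s by simp
  have 1: "?b ` {..<card B} = B" using s n by (metis list.set_map map_nth set_upt atLeast0LessThan)
  have "?b ` {..<card A} = (!) xs ` {..<length xs}" using len by (intro image_cong) (auto simp: nth_append)
  then have 2: "?b ` {..<card A} = A" using xs(1) by (metis list.set_map map_nth set_upt atLeast0LessThan)
  show ?thesis
  proof (rule that[of ?b, OF 1 2])
    show "ys \<noteq> [] \<Longrightarrow> (xs @ ys) ! card A = hd ys" using len by (simp add: nth_append hd_conv_nth)
    show "ys \<noteq> [] \<Longrightarrow> card A < card B" using len n by (cases ys) auto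
  qed
qed

lemma parameters_prime: assumes "A \<subseteq> B" shows "primeideal (Idl A) R"
proof -
  obtain ys where ys: "set ys = B - A" "distinct ys" using finite_distinct_list[OF finite_Diff[OF B(2), of A]] by blast
  obtain b where "b ` {..<card B} = B" "b ` {..<card A} = A"
    by (rule parameters_enum[OF assms ys], rule that)
  then show ?thesis using parameter_sequence(1)[of b "card A"] card_mono[OF B(2) assms] by simp
qed

lemma parameter_notin: assumes "A \<subseteq> B" "x \<in> B" "x \<notin> A" shows "x \<notin> Idl A"
proof -
  obtain ys where ys: "set ys = B - insert x A" "distinct ys"
    using finite_distinct_list[OF finite_Diff[OF B(2), of "insert x A"]] by blast
  have "set (x # ys) = B - A" "distinct (x # ys)" using ys assms by auto
  from parameters_enum[OF assms(1) this] obtain b where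
    "b ` {..<card B} = B" "b ` {..<card A} = A" "b (card A) = x" "card A < card B" by auto
  then show ?thesis using parameter_sequence(2)[of b "card A"] by simp
qed

section \<open>Powers of the parameters and the socle\<close>

definition Idl_powers :: "('a \<Rightarrow> nat) \<Rightarrow> 'a set \<Rightarrow> 'a set" where
  "Idl_powers e A = Idl ((\<lambda>a. a [^] e a) ` A)"

lemma powers_carrier: "A \<subseteq> B \<Longrightarrow> (\<lambda>a. a [^] (e a :: nat)) ` A \<subseteq> carrier R"
  by (intro image_subsetI nat_pow_closed) (use B(1) in blast)

lemma Idl_powers_ideal: "A \<subseteq> B \<Longrightarrow> ideal (Idl_powers e A) R"
  unfolding Idl_powers_def by (intro genideal_ideal powers_carrier)

lemma Idl_powers_self: "A \<subseteq> B \<Longrightarrow> a \<in> A \<Longrightarrow> a [^] e a \<in> Idl_powers e A"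
  unfolding Idl_powers_def by (rule subsetD[OF genideal_self[OF powers_carrier] imageI])

lemma Idl_powers_minimal:
  "ideal J R \<Longrightarrow> (\<And>a. a \<in> A \<Longrightarrow> a [^] e a \<in> J) \<Longrightarrow> Idl_powers e A \<subseteq> J"
  unfolding Idl_powers_def by (intro genideal_minimal) auto

lemma Idl_powers_cong: "(\<And>a. a \<in> A \<Longrightarrow> e a = e' a) \<Longrightarrow> Idl_powers e A = Idl_powers e' A"
  unfolding Idl_powers_def by (metis (mono_tags, lifting) image_cong)

lemma Idl_powers_split:
  assumes "A \<subseteq> B" "a \<in> A"
  shows "Idl_powers e A = {w \<oplus> r \<otimes> a [^] e a | w r. w \<in> Idl_powers e (A - {a}) \<and> r \<in> carrier R}"
proof -
  have "(\<lambda>a. a [^] e a) ` A = insert (a [^] e a) ((\<lambda>a. a [^] e a) ` (A - {a}))" using assms(2) by auto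
  then show ?thesis unfolding Idl_powers_def using Idl_insert[OF _ powers_carrier, of "a [^] e a" "A - {a}" e] assms B(1)
    by auto
qed

lemma pow_cancel:
  assumes "\<And>w. w \<in> carrier R \<Longrightarrow> b \<otimes> w \<in> J \<Longrightarrow> w \<in> J" "b \<in> carrier R" "w \<in> carrier R" "b [^] (k::nat) \<otimes> w \<in> J"
  shows "w \<in> J"
  using assms(3,4)
proof (induction k arbitrary: w)
  case (Suc k)
  have "b [^] Suc k \<otimes> w = b [^] k \<otimes> (b \<otimes> w)" using Suc.prems(1) assms(2) by (simp add: m_assoc)
  then have "b [^] k \<otimes> (b \<otimes> w) \<in> J" using Suc.prems(2) by simp
  then have "b \<otimes> w \<in> J" by (rule Suc.IH[rotated]) (use Suc.prems(1) assms(2) in simp)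
  then show ?case using assms(1)[OF Suc.prems(1)] by simp
qed simp

text \<open>Induction on the total exponent. With all exponents 1 the ideal is prime. Otherwise some
  \<open>a\<close> has exponent \<open>m + 1\<close>, and the induction hypothesis is used three
  times: with exponent \<open>m\<close> to write \<open>w = h2 + v a^m\<close>, without
  \<open>a\<close> to cancel \<open>a^m\<close> in front of \<open>b v - g a\<close>, and with
  exponent 1 to divide \<open>v\<close> by \<open>a\<close>.\<close>

lemma parameter_nonzerodivisor:
  assumes "A \<subseteq> B" "\<And>a. a \<in> A \<Longrightarrow> e a \<ge> 1" "b \<in> B" "b \<notin> A" "w \<in> carrier R" "b \<otimes> w \<in> Idl_powers e A"
  shows "w \<in> Idl_powers e A"
  using assms
proof (induction "\<Sum>a\<in>A. e a" arbitrary: A e b w rule: less_induct)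
  case less
  have bc: "b \<in> carrier R" using less.prems B(1) by blast
  have fin: "finite A" using finite_subset[OF less.prems(1) B(2)] .
  show ?case
  proof (cases "\<forall>a\<in>A. e a = 1")
    case True
    then have "(\<lambda>a. a [^] e a) ` A = (\<lambda>a. a) ` A" using less.prems(1) B(1) by (intro image_cong) auto
    then have *: "Idl_powers e A = Idl A" unfolding Idl_powers_def by simp
    show ?thesis
      using prime_mult[OF parameters_prime[OF less.prems(1)] bc less.prems(5)]
        parameter_notin[OF less.prems(1,3,4)] less.prems(6) unfolding * by blast
  next
    case False
    then obtain a where a: "a \<in> A" "e a \<noteq> 1" by blast
    then obtain m where m: "e a = Suc m" "m \<ge> 1" using less.prems(2)[OF a(1)] by (cases "e a") auto
    have ac: "a \<in> carrier R" using a less.prems(1) B(1) by blast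
    define z where "z = a [^] m"
    have zc: "z \<in> carrier R" unfolding z_def using ac by simp
    have ea: "a [^] e a = z \<otimes> a" unfolding m z_def by simp
    let ?A = "A - {a}"
    have A': "?A \<subseteq> B" using less.prems(1) by blast
    note I' = Idl_powers_ideal[OF A']
    have sum_A: "(\<Sum>x\<in>A. f x) = f a + (\<Sum>x\<in>?A. f x)" for f :: "'a \<Rightarrow> nat"
      using fin a(1) by (simp add: sum.remove)
    have upd: "Idl_powers (e(a := k)) ?A = Idl_powers e ?A" for k by (intro Idl_powers_cong) auto
    have sum_upd: "(\<Sum>x\<in>A. (e(a := k)) x) = k + (\<Sum>x\<in>?A. e x)" for k
      unfolding sum_A by (auto intro!: sum.cong)
    have sum_lt: "(\<Sum>x\<in>A. (e(a := k)) x) < (\<Sum>x\<in>A. e x)" if "k < e a" for k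
      unfolding sum_upd unfolding sum_A[of e] using that by simp
    have ge1: "1 \<le> (e(a := k)) x" if "1 \<le> k" "x \<in> A" for k x using less.prems(2) that by simp
    have split: "Idl_powers (e(a := k)) A = {w \<oplus> r \<otimes> a [^] k | w r. w \<in> Idl_powers e ?A \<and> r \<in> carrier R}" for k
      using Idl_powers_split[OF less.prems(1) a(1), of "e(a := k)"] upd by simp
    obtain h g where h: "h \<in> Idl_powers e ?A" "g \<in> carrier R" "b \<otimes> w = h \<oplus> g \<otimes> (z \<otimes> a)"
      using less.prems(6) unfolding Idl_powers_split[OF less.prems(1) a(1)] ea by blast
    have hc: "h \<in> carrier R" using h I' ideal_carrier by blast
    have "b \<otimes> w = h \<oplus> (g \<otimes> a) \<otimes> a [^] m" using h(3) h(2) ac zc unfolding z_def by (simp add: m_ac)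
    then have "b \<otimes> w \<in> Idl_powers (e(a := m)) A" unfolding split using h ac by blast
    from less.hyps[OF sum_lt less.prems(1) ge1 less.prems(3,4,5) this]
    have "w \<in> Idl_powers (e(a := m)) A" using m by simp
    then obtain h2 v where v: "h2 \<in> Idl_powers e ?A" "v \<in> carrier R" "w = h2 \<oplus> v \<otimes> z"
      unfolding split z_def by blast
    have h2c: "h2 \<in> carrier R" using v I' ideal_carrier by blast
    have "z \<otimes> (b \<otimes> v \<ominus> g \<otimes> a) = (b \<otimes> (h2 \<oplus> v \<otimes> z) \<ominus> (h \<oplus> g \<otimes> (z \<otimes> a))) \<oplus> (h \<ominus> b \<otimes> h2)"
      using zc bc v(2) h(2) ac h2c hc by algebra
    also have "b \<otimes> (h2 \<oplus> v \<otimes> z) = h \<oplus> g \<otimes> (z \<otimes> a)" using h(3) v(3) by simp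
    also have "(h \<oplus> g \<otimes> (z \<otimes> a) \<ominus> (h \<oplus> g \<otimes> (z \<otimes> a))) \<oplus> (h \<ominus> b \<otimes> h2) = h \<ominus> b \<otimes> h2"
      using hc bc h2c zc h(2) ac by algebra
    finally have "z \<otimes> (b \<otimes> v \<ominus> g \<otimes> a) = h \<ominus> b \<otimes> h2" .
    then have 1: "a [^] m \<otimes> (b \<otimes> v \<ominus> g \<otimes> a) \<in> Idl_powers e ?A"
      using ideal_diff[OF I' h(1) ideal_mult[OF I' bc v(1)]] unfolding z_def by simp
    have 2: "b \<otimes> v \<ominus> g \<otimes> a \<in> Idl_powers e ?A"
    proof (rule pow_cancel[OF _ ac _ 1])
      fix y assume y: "y \<in> carrier R" "a \<otimes> y \<in> Idl_powers e ?A"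
      show "y \<in> Idl_powers e ?A"
        using a less.prems(1,2) m y by (intro less.hyps[OF _ A' _ _ _ y]) (auto simp: sum_A[of e])
    qed (use bc v h ac in auto)
    have "b \<otimes> v = (b \<otimes> v \<ominus> g \<otimes> a) \<oplus> g \<otimes> a [^] (1::nat)" using bc v(2) h(2) ac by (simp, algebra)
    then have "b \<otimes> v \<in> Idl_powers (e(a := 1)) A" unfolding split using 2 h(2) by blast
    from less.hyps[OF sum_lt less.prems(1) ge1 less.prems(3,4) v(2) this]
    have "v \<in> Idl_powers (e(a := 1)) A" using m by simp
    then obtain h3 r where r: "h3 \<in> Idl_powers e ?A" "r \<in> carrier R" "v = h3 \<oplus> r \<otimes> a" unfolding split using ac by auto
    have h3c: "h3 \<in> carrier R" using r I' ideal_carrier by blast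
    have "w = (h2 \<oplus> z \<otimes> h3) \<oplus> r \<otimes> (z \<otimes> a)"
      unfolding v(3) r(3) using h2c h3c r(2) ac zc by algebra
    moreover have "h2 \<oplus> z \<otimes> h3 \<in> Idl_powers e ?A" using ideal_add[OF I' v(1) ideal_mult[OF I' zc r(1)]] .
    ultimately show ?thesis unfolding Idl_powers_split[OF less.prems(1) a(1)] ea using r(2) by blast
  qed
qed


lemma parameter_pow_nonzerodivisor:
  assumes "A \<subseteq> B" "\<And>a. a \<in> A \<Longrightarrow> e a \<ge> 1" "b \<in> B" "b \<notin> A" "w \<in> carrier R" "b [^] (k::nat) \<otimes> w \<in> Idl_powers e A"
  shows "w \<in> Idl_powers e A"
proof (rule pow_cancel[OF _ _ assms(5,6)])
  show "b \<in> carrier R" using assms(3) B(1) by blast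
qed (rule parameter_nonzerodivisor[OF assms(1-4)])

text \<open>For \<open>A = B\<close>, a generator of the socle of \<open>R / (a\<^sup>q : a \<in> B)\<close>.\<close>

definition socle_power :: "nat \<Rightarrow> 'a set \<Rightarrow> 'a" where
  "socle_power q A = (\<Otimes>a\<in>A. a [^] (q - 1))"

lemma socle_power_closed: "A \<subseteq> B \<Longrightarrow> socle_power q A \<in> carrier R"
  unfolding socle_power_def using B(1) by (intro finprod_closed) auto

lemma socle_power_insert:
  assumes "insert b A \<subseteq> B" "b \<notin> A"
  shows "socle_power q (insert b A) = b [^] (q - 1) \<otimes> socle_power q A"
  unfolding socle_power_def using assms B(1) finite_subset[OF assms(1) B(2)]
  by (intro finprod_insert) auto

text \<open>Exponents of the colon ideal of the \<open>q\<close>-th powers by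
  \<open>socle_power q A\<close>, as \<open>colon_socle_power\<close> and
  \<open>mult_socle_power\<close> show together.\<close>

abbreviation mixed_exponent :: "nat \<Rightarrow> 'a set \<Rightarrow> 'a \<Rightarrow> nat" where
  "mixed_exponent q A \<equiv> (\<lambda>a. if a \<in> A then 1 else q)"

text \<open>The factors \<open>a^(q-1)\<close> are split off one at a time: in
  \<open>z a^(q-1) = h + g a^q\<close>, with \<open>h\<close> generated by powers of the other
  parameters, \<open>a^(q-1)\<close> cancels modulo those powers and leaves \<open>z\<close>
  congruent to \<open>g a\<close>.\<close>

lemma colon_socle_power:
  assumes "A \<subseteq> B" "q \<ge> 1" "z \<in> carrier R" "z \<otimes> socle_power q A \<in> Idl_powers (\<lambda>_. q) B"
  shows "z \<in> Idl_powers (mixed_exponent q A) B"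
  using finite_subset[OF assms(1) B(2)] assms(1,3,4)
proof (induction A arbitrary: z rule: finite_induct)
  case empty
  have "socle_power q {} = \<one>" unfolding socle_power_def by simp
  then show ?case using empty by simp
next
  case (insert a A)
  have ac: "a \<in> carrier R" "a \<in> B" "A \<subseteq> B" using insert.prems B(1) by auto
  define y where "y = a [^] (q - 1)"
  have yc: "y \<in> carrier R" unfolding y_def using ac by simp
  have q: "a [^] q = y \<otimes> a" unfolding y_def using assms(2) ac by (metis Suc_diff_1 le_eq_less_or_eq less_one nat_pow_Suc not_less zero_less_iff_neq_zero)
  let ?e = "mixed_exponent q A" and ?e' = "mixed_exponent q (insert a A)"
  have sc: "socle_power q A \<in> carrier R" using socle_power_closed ac by blast
  have "z \<otimes> socle_power q (insert a A) = (z \<otimes> y) \<otimes> socle_power q A"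
    unfolding socle_power_insert[OF insert.prems(1) insert.hyps(2)] y_def[symmetric]
    using sc yc insert.prems(2) by (simp add: m_assoc)
  then have "z \<otimes> y \<in> Idl_powers ?e B" using insert.prems yc ac by (intro insert.IH) auto
  moreover have "?e a = q" using insert.hyps by simp
  ultimately obtain h g where h: "h \<in> Idl_powers ?e (B - {a})" "g \<in> carrier R" "z \<otimes> y = h \<oplus> g \<otimes> (y \<otimes> a)"
    using Idl_powers_split[OF order_refl ac(2), of ?e] q by auto
  have I: "ideal (Idl_powers ?e (B - {a})) R" by (rule Idl_powers_ideal) blast
  have hc: "h \<in> carrier R" using h I ideal_carrier by blast
  have "y \<otimes> (z \<ominus> g \<otimes> a) = z \<otimes> y \<ominus> g \<otimes> (y \<otimes> a)" using yc insert.prems(2) h(2) ac(1) by algebra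
  also have "\<dots> = h" unfolding h(3) using hc h(2) yc ac(1) by algebra
  finally have "a [^] (q - 1) \<otimes> (z \<ominus> g \<otimes> a) \<in> Idl_powers ?e (B - {a})" using h(1) unfolding y_def by simp
  then have "z \<ominus> g \<otimes> a \<in> Idl_powers ?e (B - {a})"
    by (rule parameter_pow_nonzerodivisor[of "B - {a}" ?e a, rotated 5])
      (use assms(2) ac insert.prems(2) h(2) in auto)
  moreover have "Idl_powers ?e (B - {a}) = Idl_powers ?e' (B - {a})" by (intro Idl_powers_cong) auto
  moreover have "z = (z \<ominus> g \<otimes> a) \<oplus> g \<otimes> a [^] ?e' a" using insert.prems(2) h(2) ac(1) by (simp, algebra)
  ultimately show ?case unfolding Idl_powers_split[OF order_refl ac(2), of ?e'] using h(2) by blast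
qed

lemma mult_socle_power:
  assumes "A \<subseteq> B" "q \<ge> 1" "z \<in> Idl_powers (mixed_exponent q A) B"
  shows "z \<otimes> socle_power q A \<in> Idl_powers (\<lambda>_. q) B"
proof -
  note I = Idl_powers_ideal[OF order_refl, of "\<lambda>_. q"]
  have sc: "socle_power q A \<in> carrier R" using socle_power_closed assms(1) by blast
  have "Idl_powers (mixed_exponent q A) B \<subseteq> {r \<in> carrier R. r \<otimes> socle_power q A \<in> Idl_powers (\<lambda>_. q) B}"
  proof (rule Idl_powers_minimal[OF ideal_colon[OF I sc]])
    fix a assume a: "a \<in> B"
    then have ac: "a \<in> carrier R" using B(1) by blast
    have aq: "a [^] q \<in> Idl_powers (\<lambda>_. q) B" using Idl_powers_self[OF order_refl a, of "\<lambda>_. q"] .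
    have "a [^] mixed_exponent q A a \<otimes> socle_power q A \<in> Idl_powers (\<lambda>_. q) B"
    proof (cases "a \<in> A")
      case True
      have s2: "socle_power q (A - {a}) \<in> carrier R" using socle_power_closed assms(1) by blast
      have "socle_power q A = a [^] (q - 1) \<otimes> socle_power q (A - {a})"
        using socle_power_insert[of a "A - {a}" q] True assms(1) by (auto simp: insert_absorb)
      then have "a [^] mixed_exponent q A a \<otimes> socle_power q A = socle_power q (A - {a}) \<otimes> (a [^] (q - 1) \<otimes> a)"
        using True ac s2 by (simp add: m_ac)
      also have "a [^] (q - 1) \<otimes> a = a [^] q"
        using assms(2) ac by (metis Suc_diff_le diff_Suc_1 nat_pow_Suc One_nat_def)
      finally show ?thesis using ideal_mult[OF I s2 aq] by simp
    next
      case False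
      then show ?thesis using ideal_mult_right[OF I sc aq] by simp
    qed
    then show "a [^] mixed_exponent q A a \<in> {r \<in> carrier R. r \<otimes> socle_power q A \<in> Idl_powers (\<lambda>_. q) B}"
      using ac by simp
  qed
  then show ?thesis using assms(3) by blast
qed

lemma socle_power_notin:
  assumes "q \<ge> 1"
  shows "socle_power q B \<notin> Idl_powers (\<lambda>_. q) B"
proof
  assume "socle_power q B \<in> Idl_powers (\<lambda>_. q) B"
  then have "\<one> \<otimes> socle_power q B \<in> Idl_powers (\<lambda>_. q) B" using socle_power_closed by simp
  from colon_socle_power[OF order_refl assms one_closed this]
  have "\<one> \<in> Idl_powers (mixed_exponent q B) B" .
  moreover have "Idl_powers (mixed_exponent q B) B \<subseteq> \<nn>"
    by (rule Idl_powers_minimal[OF max_ideal]) (use subsetD[OF genideal_self[OF B(1)]] subsetD[OF B(1)] in \<open>simp add: B(4)\<close>)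
  ultimately show False using prime_one max_prime by blast
qed

text \<open>One parameter \<open>b\<close> is absorbed at a time. If \<open>c\<close> is congruent
  to \<open>r\<close> times \<open>socle_power q A\<close>, then \<open>b c\<close> being zero
  places \<open>b r\<close> in the colon ideal of that power; cancelling \<open>b\<close> there
  makes \<open>r\<close> congruent to \<open>g b^(q-1)\<close>, which is the factor needed for
  \<open>insert b A\<close>.\<close>

lemma socle_element:
  assumes "q \<ge> 1" "c \<in> carrier R" "\<And>b. b \<in> B \<Longrightarrow> b \<otimes> c \<in> Idl_powers (\<lambda>_. q) B"
  obtains r where "r \<in> carrier R" "c \<ominus> r \<otimes> socle_power q B \<in> Idl_powers (\<lambda>_. q) B"
proof -
  let ?J = "Idl_powers (\<lambda>_. q) B"
  note I = Idl_powers_ideal[OF order_refl, of "\<lambda>_. q"]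
  have "A \<subseteq> B \<longrightarrow> (\<exists>r\<in>carrier R. c \<ominus> r \<otimes> socle_power q A \<in> ?J)" if "finite A" for A
    using that
  proof (induction A rule: finite_induct)
    case empty
    have "c \<ominus> c \<otimes> socle_power q {} = \<zero>" using assms(2) unfolding socle_power_def by (simp add: minus_eq r_neg)
    then show ?case using assms(2) ideal_zero[OF I] by metis
  next
    case (insert b A)
    show ?case
    proof
      assume sub: "insert b A \<subseteq> B"
      then obtain r where r: "r \<in> carrier R" "c \<ominus> r \<otimes> socle_power q A \<in> ?J" using insert.IH by blast
      have bc: "b \<in> carrier R" "b \<in> B" "A \<subseteq> B" using sub B(1) by auto
      define s where "s = socle_power q A"
      define y where "y = b [^] (q - 1)"
      have c: "s \<in> carrier R" "y \<in> carrier R" unfolding s_def y_def using socle_power_closed bc by auto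
      have q: "b [^] q = y \<otimes> b" unfolding y_def using assms(1) bc by (metis Suc_diff_le diff_Suc_1 nat_pow_Suc One_nat_def)
      have "(b \<otimes> r) \<otimes> s = b \<otimes> c \<ominus> b \<otimes> (c \<ominus> r \<otimes> s)" using c r(1) bc(1) assms(2) by algebra
      also have "\<dots> \<in> ?J" using ideal_diff[OF I assms(3)[OF bc(2)] ideal_mult[OF I bc(1) r(2)]] unfolding s_def .
      finally have "b \<otimes> r \<in> Idl_powers (mixed_exponent q A) B"
        unfolding s_def by (rule colon_socle_power[rotated 3]) (use r(1) bc assms(1) in auto)
      moreover have "mixed_exponent q A b = q" using insert.hyps by simp
      ultimately obtain h g where h: "h \<in> Idl_powers (mixed_exponent q A) (B - {b})" "g \<in> carrier R"
        "b \<otimes> r = h \<oplus> g \<otimes> (y \<otimes> b)"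
        using Idl_powers_split[OF order_refl bc(2), of "mixed_exponent q A"] q by auto
      have I2: "ideal (Idl_powers (mixed_exponent q A) (B - {b})) R" by (rule Idl_powers_ideal) blast
      have hc: "h \<in> carrier R" using h I2 ideal_carrier by blast
      have "b \<otimes> (r \<ominus> g \<otimes> y) = b \<otimes> r \<ominus> g \<otimes> (y \<otimes> b)" using c r(1) h(2) bc(1) by algebra
      also have "\<dots> = h" unfolding h(3) using hc h(2) c bc(1) by algebra
      finally have "b \<otimes> (r \<ominus> g \<otimes> y) \<in> Idl_powers (mixed_exponent q A) (B - {b})" using h(1) by simp
      then have "r \<ominus> g \<otimes> y \<in> Idl_powers (mixed_exponent q A) (B - {b})"
        by (rule parameter_nonzerodivisor[of "B - {b}" "mixed_exponent q A" b, rotated 5])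
          (use assms(1) bc r(1) h(2) c in auto)
      also have "\<dots> \<subseteq> Idl_powers (mixed_exponent q A) B"
        unfolding Idl_powers_def by (intro Idl_mono powers_carrier) auto
      finally have "(r \<ominus> g \<otimes> y) \<otimes> s \<in> ?J" using mult_socle_power bc assms(1) unfolding s_def by blast
      moreover have "c \<ominus> g \<otimes> (y \<otimes> s) = (c \<ominus> r \<otimes> s) \<oplus> (r \<ominus> g \<otimes> y) \<otimes> s"
        using assms(2) c r(1) h(2) by algebra
      ultimately have "c \<ominus> g \<otimes> socle_power q (insert b A) \<in> ?J"
        using ideal_add[OF I r(2)] unfolding socle_power_insert[OF sub insert.hyps(2)] s_def y_def by simp
      then show "\<exists>r\<in>carrier R. c \<ominus> r \<otimes> socle_power q (insert b A) \<in> ?J" using h(2) by blast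
    qed
  qed
  then show ?thesis using that B(2) by blast
qed

text \<open>A multiple of \<open>c\<close> with prime annihilator is killed by every parameter,
  because the annihilator contains the \<open>q\<close>-th powers. So it is \<open>r\<close> times
  the socle generator, and \<open>r\<close> is a unit since \<open>\<nn>\<close> kills that
  generator.\<close>

lemma ex_socle_multiple:
  assumes "q \<ge> 1" "c \<in> carrier R" "c \<notin> Idl_powers (\<lambda>_. q) B"
  obtains d where "d \<in> carrier R" "d \<otimes> c \<ominus> socle_power q B \<in> Idl_powers (\<lambda>_. q) B"
proof -
  let ?J = "Idl_powers (\<lambda>_. q) B"
  note I = Idl_powers_ideal[OF order_refl, of "\<lambda>_. q"]
  obtain d where d: "d \<in> carrier R" "d \<otimes> c \<notin> ?J" "primeideal {r \<in> carrier R. r \<otimes> (d \<otimes> c) \<in> ?J} R"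
    using ex_colon_prime[OF I assms(2,3)] by blast
  have dc: "d \<otimes> c \<in> carrier R" using d assms by simp
  define s where "s = socle_power q B"
  have sc: "s \<in> carrier R" unfolding s_def using socle_power_closed by blast
  have b: "b \<otimes> (d \<otimes> c) \<in> ?J" if "b \<in> B" for b
  proof -
    have bc: "b \<in> carrier R" using that B(1) by blast
    have "b [^] q \<in> ?J" using Idl_powers_self[OF order_refl that, of "\<lambda>_. q"] .
    then have "b [^] q \<in> {r \<in> carrier R. r \<otimes> (d \<otimes> c) \<in> ?J}" using ideal_mult_right[OF I dc] bc by simp
    from prime_pow[OF d(3) bc this] show ?thesis by simp
  qed
  obtain r where r: "r \<in> carrier R" "d \<otimes> c \<ominus> r \<otimes> s \<in> ?J"
    using socle_element[OF assms(1) dc b] unfolding s_def by blast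
  have "r \<notin> \<nn>"
  proof
    assume "r \<in> \<nn>"
    moreover have "B \<subseteq> {r \<in> carrier R. r \<otimes> s \<in> ?J}"
    proof
      fix b assume bB: "b \<in> B"
      then have bc: "b \<in> carrier R" using B(1) by blast
      have 1: "b \<in> Idl_powers (mixed_exponent q B) B"
        using Idl_powers_self[OF order_refl bB, of "mixed_exponent q B"] bB bc by simp
      show "b \<in> {r \<in> carrier R. r \<otimes> s \<in> ?J}" using mult_socle_power[OF order_refl assms(1) 1] bc unfolding s_def by simp
    qed
    then have "\<nn> \<subseteq> {r \<in> carrier R. r \<otimes> s \<in> ?J}" unfolding B(4) by (rule genideal_minimal[OF ideal_colon[OF I sc]])
    ultimately have "r \<otimes> s \<in> ?J" by blast
    then show False using ideal_diff_cancel[OF I dc _ r(2)] d(2) by blast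
  qed
  then obtain t where t: "t \<in> carrier R" "r \<otimes> t = \<one>" using ex_inverse r(1) by blast
  have "(t \<otimes> d) \<otimes> c \<ominus> s = t \<otimes> (d \<otimes> c \<ominus> r \<otimes> s) \<oplus> (r \<otimes> t \<ominus> \<one>) \<otimes> s"
    using t(1) d(1) assms(2) r(1) sc by algebra
  also have "\<dots> = t \<otimes> (d \<otimes> c \<ominus> r \<otimes> s)" unfolding t(2) using t(1) r(1) d(1) assms(2) sc by algebra
  also have "\<dots> \<in> ?J" by (rule ideal_mult[OF I t(1) r(2)])
  finally show ?thesis using that[of "t \<otimes> d"] t d unfolding s_def by simp
qed

end

section \<open>The Frobenius endomorphism of a regular local ring\<close>

lemma (in cring) binomial:
  assumes x: "x \<in> carrier R" and y: "y \<in> carrier R"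
  shows "(x \<oplus> y) [^] (n::nat) = (\<Oplus>k\<in>{..n}. add_pow R (n choose k) (x [^] k \<otimes> y [^] (n - k)))"
proof (induction n)
  case 0
  then show ?case using x y by simp
next
  case (Suc n)
  let ?t = "\<lambda>k. add_pow R (n choose k) (x [^] k \<otimes> y [^] (n - k))"
  let ?f = "\<lambda>k. add_pow R (n choose k) (x [^] Suc k \<otimes> y [^] (n - k))"
  let ?g = "\<lambda>k. add_pow R (n choose k) (x [^] k \<otimes> y [^] (Suc n - k))"
  let ?h = "\<lambda>k. add_pow R (n choose Suc k) (x [^] Suc k \<otimes> y [^] (n - k))"
  have c: "?f \<in> A \<rightarrow> carrier R" "?g \<in> A \<rightarrow> carrier R" "?h \<in> A \<rightarrow> carrier R" "?t \<in> A \<rightarrow> carrier R" for A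
    using x y by auto
  have 1: "(\<Oplus>k\<in>{..n}. ?t k) \<otimes> x = (\<Oplus>k\<in>{..n}. ?f k)"
    unfolding finsum_ldistr[OF finite_atMost x c(4)]
    using x y by (intro finsum_cong') (auto simp: add_pow_ldistr add_pow_rdistr m_ac)
  have 2: "(\<Oplus>k\<in>{..n}. ?t k) \<otimes> y = (\<Oplus>k\<in>{..n}. ?g k)"
    unfolding finsum_ldistr[OF finite_atMost y c(4)]
    using x y by (intro finsum_cong') (auto simp: add_pow_ldistr add_pow_rdistr m_ac Suc_diff_le)
  have "(\<Oplus>k\<in>{..n}. ?g k) = (\<Oplus>k\<in>{..Suc n}. ?g k)"
    using c(2) x y by (subst finsum_Suc) (auto simp: binomial_eq_0)
  also have "\<dots> = (\<Oplus>k\<in>{..n}. ?h k) \<oplus> ?g 0"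
    using c(2) by (subst finsum_Suc2) auto
  finally have 3: "(\<Oplus>k\<in>{..n}. ?g k) = (\<Oplus>k\<in>{..n}. ?h k) \<oplus> ?g 0" .
  have 4: "(\<Oplus>k\<in>{..n}. ?f k) \<oplus> (\<Oplus>k\<in>{..n}. ?h k) = (\<Oplus>k\<in>{..n}. add_pow R (Suc n choose Suc k) (x [^] Suc k \<otimes> y [^] (n - k)))"
    using x y c by (subst finsum_addf[symmetric]) (auto intro!: finsum_cong' simp: add.nat_pow_mult)
  have "(x \<oplus> y) [^] Suc n = (\<Oplus>k\<in>{..n}. ?t k) \<otimes> x \<oplus> (\<Oplus>k\<in>{..n}. ?t k) \<otimes> y"
    using Suc x y c(4) by (simp add: r_distr finsum_closed)
  also have "\<dots> = ((\<Oplus>k\<in>{..n}. ?f k) \<oplus> (\<Oplus>k\<in>{..n}. ?h k)) \<oplus> ?g 0"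
    unfolding 1 2 3 using c(1,3) x y by (simp add: a_assoc finsum_closed)
  also have "\<dots> = (\<Oplus>k\<in>{..Suc n}. add_pow R (Suc n choose k) (x [^] k \<otimes> y [^] (Suc n - k)))"
    unfolding 4 using x y by (subst finsum_Suc2) auto
  finally show ?case .
qed

lemma (in cring) add_pow_dvd_zero:
  assumes "add_pow R p \<one> = \<zero>" "p dvd m" "z \<in> carrier R"
  shows "add_pow R (m::nat) z = \<zero>"
proof -
  obtain k where k: "m = p * k" using assms(2) by blast
  have "add_pow R m z = (add_pow R m \<one>) \<otimes> z" using assms(3) by (simp add: add_pow_ldistr)
  also have "add_pow R m \<one> = add_pow R k (add_pow R p \<one>)" unfolding k by (simp add: add.nat_pow_pow)
  finally show ?thesis using assms by simp
qed

lemma (in cring) freshmans_dream: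
  fixes p :: nat
  assumes p: "Factorial_Ring.prime p" "add_pow R p \<one> = \<zero>" and xy: "x \<in> carrier R" "y \<in> carrier R"
  shows "(x \<oplus> y) [^] (p ^ e) = x [^] (p ^ e) \<oplus> y [^] (p ^ e)"
proof (induction e)
  case 0
  show ?case unfolding power_0 One_nat_def nat_pow_Suc nat_pow_0 using xy by simp
next
  case (Suc e)
  have *: "(x \<oplus> y) [^] p = x [^] p \<oplus> y [^] p" if x: "x \<in> carrier R" and y: "y \<in> carrier R" for x y
  proof -
    let ?t = "\<lambda>k. add_pow R (p choose k) (x [^] k \<otimes> y [^] (p - k))"
    obtain m where "p = 2 + m" using prime_ge_2_nat[OF p(1)] le_Suc_ex by blast
    then have m: "p = Suc (Suc m)" by simp
    have t: "?t \<in> A \<rightarrow> carrier R" for A using x y by auto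
    have z: "?t k = \<zero>" if "0 < k" "k < p" for k
      by (rule add_pow_dvd_zero[OF p(2)]) (use that x y p(1) in \<open>auto intro!: dvd_choose_prime\<close>)
    have "(x \<oplus> y) [^] p = (\<Oplus>k\<in>{..Suc (Suc m)}. ?t k)" unfolding m[symmetric] by (rule binomial[OF x y])
    also have "\<dots> = ?t p \<oplus> (\<Oplus>k\<in>{..Suc m}. ?t k)" using t m by (subst finsum_Suc) auto
    also have "(\<Oplus>k\<in>{..Suc m}. ?t k) = (\<Oplus>k\<in>{..m}. ?t (Suc k)) \<oplus> ?t 0" using t by (subst finsum_Suc2) auto
    also have "(\<Oplus>k\<in>{..m}. ?t (Suc k)) = (\<Oplus>k\<in>{..m}. \<zero>)"
    proof (rule finsum_cong'[OF refl])
      show "?t (Suc k) = \<zero>" if "k \<in> {..m}" for k by (rule z) (use that m in auto)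
    qed simp
    also have "\<dots> = \<zero>" by simp
    finally show ?thesis using x y by simp
  qed
  have "(x \<oplus> y) [^] (p ^ Suc e) = ((x \<oplus> y) [^] (p ^ e)) [^] p" using xy by (simp add: nat_pow_pow mult.commute)
  also have "\<dots> = (x [^] (p ^ e)) [^] p \<oplus> (y [^] (p ^ e)) [^] p" unfolding Suc using xy by (simp add: *)
  also have "\<dots> = x [^] (p ^ Suc e) \<oplus> y [^] (p ^ Suc e)" using xy by (simp add: nat_pow_pow mult.commute)
  finally show ?case .
qed

section \<open>Linear algebra over a local ring\<close>

context cring
begin

lemma ideal_finsum: "finite A \<Longrightarrow> ideal J R \<Longrightarrow> (\<And>a. a \<in> A \<Longrightarrow> f a \<in> J) \<Longrightarrow> (\<Oplus>a\<in>A. f a) \<in> J"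
proof (induction A rule: finite_induct)
  case empty
  then show ?case by (simp add: ideal_zero)
next
  case (insert a A)
  then have "f \<in> A \<rightarrow> carrier R" "f a \<in> carrier R" using ideal_carrier by blast+
  then show ?case using insert ideal_add[OF insert.prems(1)] by (simp add: finsum_insert)
qed

lemma additive_finsum:
  assumes "\<And>x y. x \<in> carrier R \<Longrightarrow> y \<in> carrier R \<Longrightarrow> \<psi> (x \<oplus> y) = \<psi> x \<oplus> \<psi> y"
    and \<psi>: "\<And>x. x \<in> carrier R \<Longrightarrow> \<psi> x \<in> carrier R" and "finite A" "\<And>a. a \<in> A \<Longrightarrow> f a \<in> carrier R"
  shows "\<psi> (\<Oplus>a\<in>A. f a) = (\<Oplus>a\<in>A. \<psi> (f a))"
  using assms(3,4)
proof (induction A rule: finite_induct)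
  case empty
  have "\<psi> \<zero> \<oplus> \<psi> \<zero> = \<psi> \<zero> \<oplus> \<zero>" using assms(1)[of \<zero> \<zero>] \<psi> by simp
  then show ?case using \<psi> by (simp add: add.l_cancel del: r_zero l_zero)
next
  case (insert a A)
  then have "f \<in> A \<rightarrow> carrier R" "(\<lambda>a. \<psi> (f a)) \<in> A \<rightarrow> carrier R" using \<psi> by auto
  then show ?case using insert assms(1)[of "f a" "finsum R f A"] \<psi> by (simp add: finsum_insert finsum_closed)
qed

text \<open>The coefficients are taken modulo a prime ideal \<open>Q\<close>, i.e. in the domain \<open>R / Q\<close>.\<close>

lemma underdetermined_system:
  assumes Q: "primeideal Q R" and "finite C" "finite U" "card C < card U"
    and "\<And>i j. i \<in> U \<Longrightarrow> j \<in> C \<Longrightarrow> M i j \<in> carrier R"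
  shows "\<exists>c\<in>U \<rightarrow> carrier R. (\<exists>i\<in>U. c i \<notin> Q) \<and> (\<forall>j\<in>C. (\<Oplus>i\<in>U. c i \<otimes> M i j) \<in> Q)"
  using assms(2-)
proof (induction C arbitrary: U M rule: finite_induct)
  case empty
  then obtain i where "i \<in> U" by fastforce
  then show ?case using prime_one[OF Q] by (intro bexI[of _ "\<lambda>_. \<one>"]) auto
next
  case (insert j0 C)
  note IQ = prime_ideal[OF Q]
  show ?case
  proof (cases "\<forall>i\<in>U. M i j0 \<in> Q")
    case True
    obtain c where c: "c \<in> U \<rightarrow> carrier R" "\<exists>i\<in>U. c i \<notin> Q" "\<forall>j\<in>C. (\<Oplus>i\<in>U. c i \<otimes> M i j) \<in> Q"
      using insert.IH[of U M] insert.prems insert.hyps by auto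
    have "(\<Oplus>i\<in>U. c i \<otimes> M i j0) \<in> Q"
      using True c(1) insert.prems by (intro ideal_finsum[OF _ IQ] ideal_mult[OF IQ]) auto
    then show ?thesis using c by blast
  next
    case False
    then obtain i0 where i0: "i0 \<in> U" "M i0 j0 \<notin> Q" by blast
    define g where "g = M i0 j0"
    have g: "g \<in> carrier R" "g \<notin> Q" using i0 insert.prems unfolding g_def by auto
    let ?U = "U - {i0}"
    \<comment> \<open>Elimination without division: row \<open>i0\<close> has the pivot
      \<open>g\<close>, and a solution \<open>c\<close> of the reduced system is multiplied by
      \<open>g\<close>, with the coefficient \<open>-s\<close> at \<open>i0\<close> chosen to cancel
      column \<open>j0\<close>.\<close>
    define M' where "M' i j = M i j \<otimes> g \<ominus> M i j0 \<otimes> M i0 j" for i j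
    have M: "\<And>i j. i \<in> U \<Longrightarrow> j \<in> insert j0 C \<Longrightarrow> M i j \<in> carrier R" by (rule insert.prems)
    have M': "\<And>i j. i \<in> U \<Longrightarrow> j \<in> insert j0 C \<Longrightarrow> M' i j \<in> carrier R" using M i0 g unfolding M'_def by simp
    have fU: "finite ?U" "card C < card ?U" using insert.prems insert.hyps i0 by auto
    obtain c where c: "c \<in> ?U \<rightarrow> carrier R" "\<exists>i\<in>?U. c i \<notin> Q" "\<forall>j\<in>C. (\<Oplus>i\<in>?U. c i \<otimes> M' i j) \<in> Q"
      using insert.IH[OF fU, of M'] M' by auto
    define s where "s = (\<Oplus>i\<in>?U. c i \<otimes> M i j0)"
    have s: "s \<in> carrier R" unfolding s_def using c M by (intro finsum_closed) auto
    define d where "d i = (if i = i0 then \<ominus> s else g \<otimes> c i)" for i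
    have d: "d \<in> U \<rightarrow> carrier R" unfolding d_def using s g(1) c(1) by (auto simp: Pi_iff)
    have eq: "(\<Oplus>i\<in>U. d i \<otimes> M i j) = (\<Oplus>i\<in>?U. c i \<otimes> M' i j)" if j: "j \<in> insert j0 C" for j
    proof -
      have U: "U = insert i0 ?U" using i0 by blast
      have Mj: "M i0 j \<in> carrier R" using M i0 j by simp
      have dM: "(\<lambda>i. d i \<otimes> M i j) \<in> ?U \<rightarrow> carrier R" using d M j by auto
      have "(\<Oplus>i\<in>U. d i \<otimes> M i j) = d i0 \<otimes> M i0 j \<oplus> (\<Oplus>i\<in>?U. d i \<otimes> M i j)"
        by (subst U, subst finsum_insert) (use fU(1) dM Mj s in \<open>auto simp: d_def\<close>)
      also have "(\<Oplus>i\<in>?U. d i \<otimes> M i j) = (\<Oplus>i\<in>?U. c i \<otimes> M' i j \<oplus> (c i \<otimes> M i j0) \<otimes> M i0 j)"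
      proof (rule finsum_cong')
        fix i assume i: "i \<in> ?U"
        have cc: "c i \<in> carrier R" "M i j \<in> carrier R" "M i j0 \<in> carrier R" using c M i j by auto
        have "d i \<otimes> M i j = (g \<otimes> c i) \<otimes> M i j" using i unfolding d_def by auto
        also have "\<dots> = c i \<otimes> M' i j \<oplus> (c i \<otimes> M i j0) \<otimes> M i0 j"
          unfolding M'_def using cc g(1) Mj by algebra
        finally show "d i \<otimes> M i j = c i \<otimes> M' i j \<oplus> (c i \<otimes> M i j0) \<otimes> M i0 j" .
      qed (use c(1) M M' j Mj in \<open>auto simp: Pi_iff\<close>)
      also have "\<dots> = (\<Oplus>i\<in>?U. c i \<otimes> M' i j) \<oplus> (\<Oplus>i\<in>?U. (c i \<otimes> M i j0) \<otimes> M i0 j)"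
        by (rule finsum_addf) (use c(1) M M' j Mj in \<open>auto simp: Pi_iff\<close>)
      also have "(\<Oplus>i\<in>?U. (c i \<otimes> M i j0) \<otimes> M i0 j) = s \<otimes> M i0 j"
        unfolding s_def by (rule finsum_ldistr[symmetric]) (use c(1) M j Mj fU in \<open>auto simp: Pi_iff\<close>)
      finally have 1: "(\<Oplus>i\<in>U. d i \<otimes> M i j) = d i0 \<otimes> M i0 j \<oplus> ((\<Oplus>i\<in>?U. c i \<otimes> M' i j) \<oplus> s \<otimes> M i0 j)" .
      define y where "y = (\<Oplus>i\<in>?U. c i \<otimes> M' i j)"
      have y: "y \<in> carrier R" unfolding y_def using c M' j by (intro finsum_closed) auto
      have "d i0 = \<ominus> s" unfolding d_def by simp
      moreover have "\<ominus> s \<otimes> M i0 j \<oplus> (y \<oplus> s \<otimes> M i0 j) = y" using s y Mj by algebra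
      ultimately show ?thesis using 1 unfolding y_def by simp
    qed
    have "(\<Oplus>i\<in>?U. c i \<otimes> M' i j0) = (\<Oplus>i\<in>?U. \<zero>)"
    proof (rule finsum_cong')
      fix i assume i: "i \<in> ?U"
      then have "M' i j0 = \<zero>" unfolding M'_def g_def using M i0 by (simp add: minus_eq r_neg)
      then show "c i \<otimes> M' i j0 = \<zero>" using c(1) i by (simp add: Pi_iff)
    qed auto
    then have "(\<Oplus>i\<in>?U. c i \<otimes> M' i j0) \<in> Q" using ideal_zero[OF IQ] by simp
    then have 1: "\<forall>j\<in>insert j0 C. (\<Oplus>i\<in>U. d i \<otimes> M i j) \<in> Q" using c(3) eq by simp
    obtain i where i: "i \<in> ?U" "c i \<notin> Q" using c(2) by blast
    have "c i \<in> carrier R" using c(1) i(1) by blast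
    then have "g \<otimes> c i \<notin> Q" using prime_mult[OF Q g(1)] i(2) g(2) by blast
    then have "d i \<notin> Q" using i(1) unfolding d_def by simp
    then have 2: "\<exists>i\<in>U. d i \<notin> Q" using i by blast
    show ?thesis using d 1 2 by blast
  qed
qed

end

context regular_local_cring
begin

text \<open>\<open>W\<close> is a submodule of the free module on \<open>G\<close>, with functions
  compared only on \<open>G\<close>. One basis vector \<open>a\<close> is removed at a time:
  \<open>1 - m a\<close> is a unit, so modulo \<open>W\<close> this vector is a combination of the
  others with coefficients in \<open>\<nn>\<close>, and substituting it into the remaining relations
  keeps their coefficients in \<open>\<nn>\<close>.\<close>

lemma nakayama_free_module:
  fixes W :: "('i \<Rightarrow> 'a) set"
  defines "\<delta> \<equiv> (\<lambda>a h. if a = h then \<one> else \<zero>)"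
  assumes add: "\<And>s t. s \<in> W \<Longrightarrow> t \<in> W \<Longrightarrow> (\<lambda>h. s h \<oplus> t h) \<in> W"
    and smult: "\<And>r t. r \<in> carrier R \<Longrightarrow> t \<in> W \<Longrightarrow> (\<lambda>h. r \<otimes> t h) \<in> W"
    and cong: "\<And>s t. s \<in> W \<Longrightarrow> (\<And>h. h \<in> G \<Longrightarrow> s h = t h) \<Longrightarrow> t \<in> W"
    and "finite A" "A \<subseteq> G"
    and "\<And>a. a \<in> A \<Longrightarrow> \<exists>m\<in>A \<rightarrow> \<nn>. (\<lambda>h. \<delta> a h \<ominus> (if h \<in> A then m h else \<zero>)) \<in> W"
  shows "\<forall>a\<in>A. \<delta> a \<in> W"
  using assms(5-)
proof (induction A rule: finite_induct)
  case (insert a A)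
  have \<delta>: "\<delta> a h \<in> carrier R" for a h unfolding \<delta>_def by simp
  have \<nn>c: "x \<in> \<nn> \<Longrightarrow> x \<in> carrier R" for x using max_ideal ideal_carrier by blast
  obtain m where m: "m \<in> insert a A \<rightarrow> \<nn>" "(\<lambda>h. \<delta> a h \<ominus> (if h \<in> insert a A then m h else \<zero>)) \<in> W"
    using insert.prems by blast
  have mc: "h \<in> insert a A \<Longrightarrow> m h \<in> carrier R" for h using m(1) \<nn>c by blast
  have "\<one> \<ominus> m a \<notin> \<nn>"
  proof
    assume "\<one> \<ominus> m a \<in> \<nn>"
    then have "\<one> \<in> \<nn>" using ideal_diff_cancel[OF max_ideal one_closed] m(1) by blast
    then show False using prime_one max_prime by blast
  qed
  then obtain v where v: "v \<in> carrier R" "(\<one> \<ominus> m a) \<otimes> v = \<one>" using ex_inverse[of "\<one> \<ominus> m a"] mc by auto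
  define w where "w h = \<delta> a h \<ominus> (if h \<in> A then v \<otimes> m h else \<zero>)" for h
  have w: "w \<in> W"
  proof (rule cong[OF smult[OF v(1) m(2)]])
    fix h assume "h \<in> G"
    show "v \<otimes> (\<delta> a h \<ominus> (if h \<in> insert a A then m h else \<zero>)) = w h"
    proof (cases "h = a")
      case True
      then show ?thesis using v insert.hyps mc[of a] unfolding w_def \<delta>_def by (simp add: m_comm minus_eq)
    next
      case False
      then show ?thesis using v(1) mc unfolding w_def \<delta>_def by (auto simp: minus_eq r_minus)
    qed
  qed
  have IH: "\<forall>b\<in>A. \<delta> b \<in> W"
  proof (rule insert.IH)
    show "A \<subseteq> G" using insert.prems by blast
    fix b assume b: "b \<in> A"
    obtain k where k: "k \<in> insert a A \<rightarrow> \<nn>" "(\<lambda>h. \<delta> b h \<ominus> (if h \<in> insert a A then k h else \<zero>)) \<in> W"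
      using insert.prems b by blast
    have kc: "h \<in> insert a A \<Longrightarrow> k h \<in> carrier R" for h using k(1) \<nn>c by blast
    define l where "l h = k h \<oplus> k a \<otimes> (v \<otimes> m h)" for h
    have "l h \<in> \<nn>" if h: "h \<in> A" for h
    proof -
      have "k h \<in> \<nn>" "m h \<in> \<nn>" using h k(1) m(1) by auto
      then show ?thesis unfolding l_def
        using kc[of a] v(1) ideal_add[OF max_ideal] ideal_mult[OF max_ideal] by simp
    qed
    moreover have "(\<lambda>h. \<delta> b h \<ominus> (if h \<in> A then l h else \<zero>)) \<in> W"
    proof (rule cong[OF add[OF k(2) smult[OF kc[of a] w]]])
      fix h assume "h \<in> G"
      show "\<delta> b h \<ominus> (if h \<in> insert a A then k h else \<zero>) \<oplus> k a \<otimes> w h = \<delta> b h \<ominus> (if h \<in> A then l h else \<zero>)"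
      proof (cases "h = a")
        case True
        then have "h \<notin> A" "\<delta> b h = \<zero>" "w h = \<one>" using insert.hyps b unfolding w_def \<delta>_def by (auto simp: minus_eq)
        then show ?thesis using True kc[of a] by (simp add: minus_eq l_neg)
      next
        case False
        then have "w h = \<zero> \<ominus> (if h \<in> A then v \<otimes> m h else \<zero>)" unfolding w_def \<delta>_def by simp
        then show ?thesis unfolding l_def using False kc[of a] kc[of h] mc[of h] v(1) \<delta>[of b h]
          by (auto simp: minus_eq minus_add a_ac r_minus)
      qed
    qed simp
    ultimately show "\<exists>m\<in>A \<rightarrow> \<nn>. (\<lambda>h. \<delta> b h \<ominus> (if h \<in> A then m h else \<zero>)) \<in> W"
      by (intro bexI[of _ l]) auto
  qed
  \<comment> \<open>All other basis vectors now lie in \<open>W\<close>, so the terms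
    \<open>v m h\<close> of \<open>w\<close> can be added back one index at a time until only
    \<open>\<delta> a\<close> remains.\<close>
  have "\<exists>t\<in>W. \<forall>h\<in>G. t h = \<delta> a h \<ominus> (if h \<in> A - D then v \<otimes> m h else \<zero>)" if "D \<subseteq> A" for D
    using finite_subset[OF that insert.hyps(1)] that
  proof (induction D rule: finite_induct)
    case empty
    then show ?case by (intro bexI[OF _ w]) (simp add: w_def)
  next
    case (insert b D)
    then obtain t where t: "t \<in> W" "\<forall>h\<in>G. t h = \<delta> a h \<ominus> (if h \<in> A - D then v \<otimes> m h else \<zero>)" by blast
    have b: "b \<in> A" using insert by blast
    have vm: "v \<otimes> m b \<in> carrier R" using v mc b by simp
    have "\<delta> b \<in> W" using IH b by blast
    then have "(\<lambda>h. t h \<oplus> (v \<otimes> m b) \<otimes> \<delta> b h) \<in> W" by (intro add[OF t(1)] smult[OF vm])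
    moreover have "t h \<oplus> (v \<otimes> m b) \<otimes> \<delta> b h = \<delta> a h \<ominus> (if h \<in> A - insert b D then v \<otimes> m h else \<zero>)" if h: "h \<in> G" for h
    proof (cases "h = b")
      case True
      then show ?thesis using t(2) h insert b vm \<delta>[of a b] by (simp add: \<delta>_def minus_eq a_assoc l_neg)
    next
      case False
      then have "\<delta> b h = \<zero>" unfolding \<delta>_def by simp
      then show ?thesis using False t(2) h vm mc[of h] v(1) \<delta>[of a h] by (simp add: minus_eq)
    qed
    ultimately show ?case by (intro bexI[of _ "\<lambda>h. t h \<oplus> (v \<otimes> m b) \<otimes> \<delta> b h"]) auto
  qed
  from this[OF order_refl] obtain t where t: "t \<in> W" "\<forall>h\<in>G. t h = \<delta> a h \<ominus> \<zero>" by auto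
  have "\<delta> a \<in> W" by (rule cong[OF t(1)]) (use t(2) \<delta> in \<open>simp add: minus_eq\<close>)
  then show ?case using IH by simp
qed simp

lemma free_module_combination:
  fixes W :: "('i \<Rightarrow> 'a) set"
  assumes zero: "(\<lambda>_. \<zero>) \<in> W" and add: "\<And>s t. s \<in> W \<Longrightarrow> t \<in> W \<Longrightarrow> (\<lambda>h. s h \<oplus> t h) \<in> W"
    and smult: "\<And>r t. r \<in> carrier R \<Longrightarrow> t \<in> W \<Longrightarrow> (\<lambda>h. r \<otimes> t h) \<in> W"
    and cong: "\<And>s t. s \<in> W \<Longrightarrow> (\<And>h. h \<in> G \<Longrightarrow> s h = t h) \<Longrightarrow> t \<in> W"
    and G: "finite G" "\<And>a. a \<in> G \<Longrightarrow> (\<lambda>h. if a = h then \<one> else \<zero>) \<in> W" and t: "t \<in> G \<rightarrow> carrier R"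
  shows "t \<in> W"
proof -
  have "(\<lambda>h. if h \<in> D then t h else \<zero>) \<in> W" if "D \<subseteq> G" for D
    using finite_subset[OF that G(1)] that
  proof (induction D rule: finite_induct)
    case empty
    then show ?case using zero by simp
  next
    case (insert b D)
    have tb: "t b \<in> carrier R" using t insert.prems by blast
    have "(\<lambda>h. (if h \<in> D then t h else \<zero>) \<oplus> t b \<otimes> (if b = h then \<one> else \<zero>)) \<in> W"
      using insert.IH insert.prems by (intro add smult[OF tb] G(2)) auto
    then show ?case
    proof (rule cong)
      fix h assume "h \<in> G"
      then have "t h \<in> carrier R" using t by blast
      then show "(if h \<in> D then t h else \<zero>) \<oplus> t b \<otimes> (if b = h then \<one> else \<zero>) = (if h \<in> insert b D then t h else \<zero>)"
        using insert.hyps tb by auto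
    qed
  qed
  from this[OF order_refl] show ?thesis by (rule cong) simp
qed

end

text \<open>Only additivity of \<open>x [^] q\<close> is demanded, so one locale serves all powers
  of the characteristic at once, including \<open>q = 1\<close> for degree zero.\<close>

locale frobenius_cring = cring R for R (structure) +
  fixes q :: nat
  assumes q: "q \<ge> 1"
    and frob_add: "x \<in> carrier R \<Longrightarrow> y \<in> carrier R \<Longrightarrow> (x \<oplus> y) [^] q = x [^] q \<oplus> y [^] q"
begin

lemma frob_zero: "\<zero> [^] q = \<zero>"
  using q by (simp add: nat_pow_zero)

lemma frob_neg: "x \<in> carrier R \<Longrightarrow> (\<ominus> x) [^] q = \<ominus> (x [^] q)"
  using frob_add[of "\<ominus> x" x] frob_zero by (metis a_inv_closed l_neg minus_equality nat_pow_closed)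

lemma frob_mult: "x \<in> carrier R \<Longrightarrow> y \<in> carrier R \<Longrightarrow> (x \<otimes> y) [^] q = x [^] q \<otimes> y [^] q"
  by (rule nat_pow_distrib)

text \<open>Maps \<open>\<psi> : F\<^sub>* R \<rightarrow> R\<close>.\<close>

definition cartier :: "('a \<Rightarrow> 'a) \<Rightarrow> bool" where
  "cartier \<psi> \<longleftrightarrow> (\<forall>x\<in>carrier R. \<psi> x \<in> carrier R) \<and>
     (\<forall>x\<in>carrier R. \<forall>y\<in>carrier R. \<psi> (x \<oplus> y) = \<psi> x \<oplus> \<psi> y) \<and>
     (\<forall>r\<in>carrier R. \<forall>x\<in>carrier R. \<psi> (r [^] q \<otimes> x) = r \<otimes> \<psi> x)"

lemma cartierD:
  assumes "cartier \<psi>"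
  shows "x \<in> carrier R \<Longrightarrow> \<psi> x \<in> carrier R"
    and "x \<in> carrier R \<Longrightarrow> y \<in> carrier R \<Longrightarrow> \<psi> (x \<oplus> y) = \<psi> x \<oplus> \<psi> y"
    and "r \<in> carrier R \<Longrightarrow> x \<in> carrier R \<Longrightarrow> \<psi> (r [^] q \<otimes> x) = r \<otimes> \<psi> x"
  using assms unfolding cartier_def by blast+

definition frob_comb :: "('a \<Rightarrow> 'a) \<Rightarrow> 'a set \<Rightarrow> 'a" where
  "frob_comb c G = (\<Oplus>g\<in>G. c g [^] q \<otimes> g)"

lemma frob_comb_closed: "G \<subseteq> carrier R \<Longrightarrow> c \<in> G \<rightarrow> carrier R \<Longrightarrow> frob_comb c G \<in> carrier R"
  unfolding frob_comb_def by (intro finsum_closed) auto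

lemma frob_comb_cong: "G \<subseteq> carrier R \<Longrightarrow> d \<in> G \<rightarrow> carrier R \<Longrightarrow> (\<And>g. g \<in> G \<Longrightarrow> c g = d g) \<Longrightarrow> frob_comb c G = frob_comb d G"
  unfolding frob_comb_def by (intro finsum_cong') auto

lemma frob_comb_add:
  assumes "G \<subseteq> carrier R" "c \<in> G \<rightarrow> carrier R" "d \<in> G \<rightarrow> carrier R"
  shows "frob_comb c G \<oplus> frob_comb d G = frob_comb (\<lambda>g. c g \<oplus> d g) G"
proof -
  have "frob_comb c G \<oplus> frob_comb d G = (\<Oplus>g\<in>G. c g [^] q \<otimes> g \<oplus> d g [^] q \<otimes> g)"
    unfolding frob_comb_def using assms by (intro finsum_addf[symmetric]) (auto simp: Pi_iff subset_iff)
  also have "\<dots> = frob_comb (\<lambda>g. c g \<oplus> d g) G"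
    unfolding frob_comb_def
  proof (rule finsum_cong'[OF refl])
    fix g assume "g \<in> G"
    then have "c g \<in> carrier R" "d g \<in> carrier R" "g \<in> carrier R" using assms by auto
    then show "c g [^] q \<otimes> g \<oplus> d g [^] q \<otimes> g = (c g \<oplus> d g) [^] q \<otimes> g" by (simp add: frob_add l_distr)
  qed (use assms in \<open>auto simp: Pi_iff subset_iff\<close>)
  finally show ?thesis .
qed

lemma frob_comb_smult:
  assumes "finite G" "G \<subseteq> carrier R" "c \<in> G \<rightarrow> carrier R" "r \<in> carrier R"
  shows "r [^] q \<otimes> frob_comb c G = frob_comb (\<lambda>g. r \<otimes> c g) G"
proof -
  have "r [^] q \<otimes> frob_comb c G = (\<Oplus>g\<in>G. r [^] q \<otimes> (c g [^] q \<otimes> g))"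
    unfolding frob_comb_def using assms by (intro finsum_rdistr) auto
  also have "\<dots> = frob_comb (\<lambda>g. r \<otimes> c g) G"
    unfolding frob_comb_def
  proof (rule finsum_cong'[OF refl])
    fix g assume "g \<in> G"
    then have "c g \<in> carrier R" "g \<in> carrier R" using assms by auto
    then show "r [^] q \<otimes> (c g [^] q \<otimes> g) = (r \<otimes> c g) [^] q \<otimes> g" using assms(4) by (simp add: frob_mult m_assoc)
  qed (use assms in \<open>auto simp: Pi_iff subset_iff\<close>)
  finally show ?thesis .
qed

lemma frob_comb_diff:
  assumes "finite G" "G \<subseteq> carrier R" "c \<in> G \<rightarrow> carrier R" "d \<in> G \<rightarrow> carrier R"
  shows "frob_comb c G \<ominus> frob_comb d G = frob_comb (\<lambda>g. c g \<ominus> d g) G"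
proof -
  have d': "(\<lambda>g. c g \<ominus> d g) \<in> G \<rightarrow> carrier R" using assms by auto
  have "frob_comb (\<lambda>g. c g \<ominus> d g) G \<oplus> frob_comb d G = frob_comb c G"
    unfolding frob_comb_add[OF assms(2) d' assms(4)]
  proof (rule frob_comb_cong[OF assms(2,3)])
    fix g assume "g \<in> G"
    then have "c g \<in> carrier R" "d g \<in> carrier R" using assms by auto
    then show "c g \<ominus> d g \<oplus> d g = c g" by algebra
  qed
  moreover have "frob_comb (\<lambda>g. c g \<ominus> d g) G \<in> carrier R" "frob_comb d G \<in> carrier R"
    using frob_comb_closed assms(2,4) d' by auto
  moreover have "a \<oplus> b \<ominus> b = a" if "a \<in> carrier R" "b \<in> carrier R" for a b using that by algebra
  ultimately show ?thesis by metis
qed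

lemma frob_comb_remove:
  assumes "finite G" "G \<subseteq> carrier R" "c \<in> G \<rightarrow> carrier R" "g \<in> G"
  shows "frob_comb c G = c g [^] q \<otimes> g \<oplus> frob_comb c (G - {g})"
proof -
  have "G = insert g (G - {g})" using assms(4) by blast
  then have "frob_comb c G = frob_comb c (insert g (G - {g}))" by simp
  also have "\<dots> = c g [^] q \<otimes> g \<oplus> frob_comb c (G - {g})"
    unfolding frob_comb_def using assms by (intro finsum_insert) auto
  finally show ?thesis .
qed

lemma cartier_frob_comb:
  assumes "cartier \<psi>" "finite G" "G \<subseteq> carrier R" "c \<in> G \<rightarrow> carrier R"
  shows "\<psi> (frob_comb c G) = (\<Oplus>g\<in>G. c g \<otimes> \<psi> g)"
proof -
  note \<psi> = cartierD[OF assms(1)]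
  have "\<psi> (frob_comb c G) = (\<Oplus>g\<in>G. \<psi> (c g [^] q \<otimes> g))"
    unfolding frob_comb_def using assms by (intro additive_finsum \<psi>) auto
  also have "\<dots> = (\<Oplus>g\<in>G. c g \<otimes> \<psi> g)"
  proof (rule finsum_cong'[OF refl])
    fix g assume "g \<in> G"
    then show "\<psi> (c g [^] q \<otimes> g) = c g \<otimes> \<psi> g" using assms(3,4) by (intro \<psi>(3)) auto
  qed (use assms \<psi>(1) in auto)
  finally show ?thesis .
qed

lemma cartier_mult_right: "cartier \<psi> \<Longrightarrow> u \<in> carrier R \<Longrightarrow> cartier (\<lambda>x. \<psi> (u \<otimes> x))"
  unfolding cartier_def using m_lcomm[of u "_ [^] q"] by (auto simp: r_distr)

definition frob_generates :: "'a set \<Rightarrow> bool" where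
  "frob_generates G \<longleftrightarrow> finite G \<and> G \<subseteq> carrier R \<and> (\<forall>x\<in>carrier R. \<exists>c\<in>G \<rightarrow> carrier R. x = frob_comb c G)"

text \<open>The ideal \<open>?K\<close> below is the Frobenius power \<open>J\<^sup>[\<^sup>q\<^sup>]\<close>.\<close>

lemma frobenius_power_ideal:
  assumes G: "frob_generates G" and J: "ideal J R"
  shows "ideal {frob_comb m G | m. m \<in> G \<rightarrow> J} R" (is "ideal ?K R")
    and "a \<in> J \<Longrightarrow> x \<in> carrier R \<Longrightarrow> a [^] q \<otimes> x \<in> {frob_comb m G | m. m \<in> G \<rightarrow> J}"
proof -
  have fG: "finite G" "G \<subseteq> carrier R" using G unfolding frob_generates_def by auto
  have JG: "m \<in> G \<rightarrow> carrier R" if "m \<in> G \<rightarrow> J" for m using that ideal_carrier[OF J] by blast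
  have pow: "a [^] q \<otimes> x \<in> ?K" if a: "a \<in> J" and x: "x \<in> carrier R" for a x
  proof -
    obtain c where c: "c \<in> G \<rightarrow> carrier R" "x = frob_comb c G" using G x unfolding frob_generates_def by blast
    have "a [^] q \<otimes> x = frob_comb (\<lambda>g. a \<otimes> c g) G"
      unfolding c(2) using frob_comb_smult fG c(1) ideal_carrier[OF J a] by blast
    moreover have "(\<lambda>g. a \<otimes> c g) \<in> G \<rightarrow> J" using c(1) a ideal_mult_right[OF J] by auto
    ultimately show ?thesis by blast
  qed
  show "a \<in> J \<Longrightarrow> x \<in> carrier R \<Longrightarrow> a [^] q \<otimes> x \<in> {frob_comb m G | m. m \<in> G \<rightarrow> J}" by (rule pow)
  have add: "x \<oplus> y \<in> ?K" if xy: "x \<in> ?K" "y \<in> ?K" for x y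
  proof -
    obtain m k where m: "m \<in> G \<rightarrow> J" "x = frob_comb m G" "k \<in> G \<rightarrow> J" "y = frob_comb k G" using xy by blast
    then have "x \<oplus> y = frob_comb (\<lambda>g. m g \<oplus> k g) G" using frob_comb_add[OF fG(2) JG JG] by simp
    moreover have "(\<lambda>g. m g \<oplus> k g) \<in> G \<rightarrow> J" using m ideal_add[OF J] by auto
    ultimately show ?thesis by blast
  qed
  have zero: "\<zero> \<in> ?K" using pow[OF ideal_zero[OF J] one_closed] frob_zero by simp
  show "ideal ?K R"
  proof (rule ideal_intro)
    show "?K \<subseteq> carrier R" using frob_comb_closed[OF fG(2)] JG by blast
    show "\<zero> \<in> ?K" by (rule zero)
    show "\<And>x y. x \<in> ?K \<Longrightarrow> y \<in> ?K \<Longrightarrow> x \<oplus> y \<in> ?K" by (rule add)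
    fix r x assume r: "r \<in> carrier R" "x \<in> ?K"
    then obtain m where m: "m \<in> G \<rightarrow> J" "x = frob_comb m G" by blast
    have mc: "m g \<in> carrier R" "g \<in> carrier R" if "g \<in> G" for g using JG[OF m(1)] fG that by auto
    have "r \<otimes> x = (\<Oplus>g\<in>G. r \<otimes> (m g [^] q \<otimes> g))"
      unfolding m(2) frob_comb_def using fG r mc by (intro finsum_rdistr) auto
    also have "\<dots> \<in> ?K"
    proof -
      have "(\<Oplus>g\<in>D. r \<otimes> (m g [^] q \<otimes> g)) \<in> ?K" if "D \<subseteq> G" for D
        using finite_subset[OF that fG(1)] that
      proof (induction D rule: finite_induct)
        case empty
        then show ?case using zero by simp
      next
        case (insert g D)
        have "r \<otimes> (m g [^] q \<otimes> g) = m g [^] q \<otimes> (r \<otimes> g)" using r(1) mc[of g] insert.prems by (simp add: m_lcomm)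
        also have "\<dots> \<in> ?K" using m(1) r(1) mc[of g] insert.prems by (intro pow) auto
        finally have 1: "r \<otimes> (m g [^] q \<otimes> g) \<in> ?K" .
        have "(\<Oplus>g\<in>insert g D. r \<otimes> (m g [^] q \<otimes> g)) = r \<otimes> (m g [^] q \<otimes> g) \<oplus> (\<Oplus>g\<in>D. r \<otimes> (m g [^] q \<otimes> g))"
          using insert.hyps insert.prems r(1) mc by (intro finsum_insert) auto
        then show ?case using add[OF 1 insert.IH] insert.prems by simp
      qed
      then show ?thesis by blast
    qed
    finally show "r \<otimes> x \<in> ?K" .
  qed
qed

end

section \<open>Kunz's theorem and the generator of the Cartier maps\<close>

locale frobenius_regular_cring = regular_local_cring R \<nn> B + frobenius_cring R q
  for R (structure) and \<nn> B q +
  assumes F_finite: "\<exists>G. frob_generates G"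
begin

lemma frob_powers_ideal:
  assumes "A \<subseteq> B" "t \<in> Idl A"
  shows "t [^] q \<in> Idl_powers (\<lambda>_. q) A"
proof -
  have Ac: "A \<subseteq> carrier R" using assms B(1) by blast
  note I = Idl_powers_ideal[OF assms(1), of "\<lambda>_. q"]
  have "Idl A \<subseteq> {t \<in> carrier R. t [^] q \<in> Idl_powers (\<lambda>_. q) A}"
  proof (rule genideal_minimal)
    show "ideal {t \<in> carrier R. t [^] q \<in> Idl_powers (\<lambda>_. q) A} R"
      by (rule ideal_intro) (auto simp: frob_zero frob_add frob_mult ideal_zero[OF I] ideal_add[OF I] ideal_mult[OF I])
    show "A \<subseteq> {t \<in> carrier R. t [^] q \<in> Idl_powers (\<lambda>_. q) A}"
      using Ac Idl_powers_self[OF assms(1), of _ "\<lambda>_. q"] by blast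
  qed
  then show ?thesis using assms(2) by blast
qed

lemma Idl_powers_frob_comb:
  assumes G: "frob_generates G" and A: "A \<subseteq> B" and z: "z \<in> Idl_powers (\<lambda>_. q) A"
  obtains m where "m \<in> G \<rightarrow> Idl A" "z = frob_comb m G"
proof -
  have Ac: "A \<subseteq> carrier R" using A B(1) by blast
  note I = genideal_ideal[OF Ac]
  have "Idl_powers (\<lambda>_. q) A \<subseteq> {frob_comb m G | m. m \<in> G \<rightarrow> Idl A}"
  proof (rule Idl_powers_minimal[OF frobenius_power_ideal(1)[OF G I]])
    fix a assume a: "a \<in> A"
    have "a [^] q \<otimes> \<one> \<in> {frob_comb m G | m. m \<in> G \<rightarrow> Idl A}"
      by (rule frobenius_power_ideal(2)[OF G I]) (use a genideal_self[OF Ac] in auto)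
    then show "a [^] q \<in> {frob_comb m G | m. m \<in> G \<rightarrow> Idl A}" using a Ac by (simp add: subset_iff)
  qed
  then show ?thesis using z that by blast
qed

lemma frob_comb_in_powers:
  assumes "G \<subseteq> carrier R" "finite G" "A \<subseteq> B" "m \<in> G \<rightarrow> Idl A"
  shows "frob_comb m G \<in> Idl_powers (\<lambda>_. q) A"
proof -
  note I = Idl_powers_ideal[OF assms(3), of "\<lambda>_. q"]
  show ?thesis unfolding frob_comb_def
  proof (rule ideal_finsum[OF assms(2) I])
    fix g assume "g \<in> G"
    then show "m g [^] q \<otimes> g \<in> Idl_powers (\<lambda>_. q) A"
      using assms by (intro ideal_mult_right[OF I] frob_powers_ideal) auto
  qed
qed

text \<open>A combination lying in the Frobenius power of \<open>\<nn>\<close> can also be written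
  with coefficients in \<open>\<nn>\<close>, and the difference of the two is an exact relation. A
  coefficient outside \<open>\<nn>\<close> would be a unit in it, and \<open>g\<close> could be
  dropped from the minimal set \<open>G\<close>.\<close>

lemma minimal_generators_independent_mod_max:
  assumes G: "frob_generates G" and minimal: "\<And>G'. frob_generates G' \<Longrightarrow> card G \<le> card G'"
    and c: "c \<in> G \<rightarrow> carrier R" "frob_comb c G \<in> Idl_powers (\<lambda>_. q) B" and g: "g \<in> G"
  shows "c g \<in> \<nn>"
proof (rule ccontr)
  assume n: "c g \<notin> \<nn>"
  have fG: "finite G" "G \<subseteq> carrier R" using G unfolding frob_generates_def by auto
  obtain m where m: "m \<in> G \<rightarrow> \<nn>" "frob_comb c G = frob_comb m G"
    using Idl_powers_frob_comb[OF G order_refl c(2)] unfolding B(4)[symmetric] by blast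
  have mc: "m \<in> G \<rightarrow> carrier R" using m(1) ideal_carrier[OF max_ideal] by blast
  let ?d = "\<lambda>g. c g \<ominus> m g"
  have d: "?d \<in> G \<rightarrow> carrier R" using c(1) mc by auto
  have "frob_comb ?d G = frob_comb c G \<ominus> frob_comb m G" using frob_comb_diff[OF fG c(1) mc] by simp
  also have "\<dots> = \<zero>" using m(2) frob_comb_closed[OF fG(2) mc] by (simp add: minus_eq r_neg)
  finally have dz: "frob_comb ?d G = \<zero>" .
  have "?d g \<notin> \<nn>" using n ideal_diff_cancel[OF max_ideal, of "c g" "m g"] c(1) m(1) g by blast
  then obtain t where t: "t \<in> carrier R" "?d g \<otimes> t = \<one>" using ex_inverse[of "?d g"] d g by blast
  let ?e = "\<lambda>g. t \<otimes> ?d g"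
  have e: "?e \<in> G \<rightarrow> carrier R" using d t(1) by auto
  have "?d g \<in> carrier R" using d g by blast
  then have "?e g = \<one>" using t(2) m_comm[OF t(1)] by simp
  moreover have "frob_comb ?e G = \<zero>" using frob_comb_smult[OF fG d t(1)] dz t(1) by simp
  moreover have "g \<in> carrier R" using g fG by blast
  ultimately have 1: "g \<oplus> frob_comb ?e (G - {g}) = \<zero>" using frob_comb_remove[OF fG e g] by simp
  let ?G = "G - {g}"
  have fG': "finite ?G" "?G \<subseteq> carrier R" using fG by auto
  have "frob_generates ?G" unfolding frob_generates_def
  proof (intro conjI ballI fG')
    fix x assume "x \<in> carrier R"
    then obtain k where k: "k \<in> G \<rightarrow> carrier R" "x = frob_comb k G" using G unfolding frob_generates_def by blast
    have kg: "k g \<in> carrier R" using k g by blast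
    \<comment> \<open>The coefficients of \<open>x\<close> after substituting
      \<open>g = - frob_comb ?e (G - {g})\<close>.\<close>
    let ?l = "\<lambda>h. k h \<ominus> k g \<otimes> ?e h"
    have kc: "k \<in> ?G \<rightarrow> carrier R" and ec: "?e \<in> ?G \<rightarrow> carrier R" using k e by blast+
    have kec: "(\<lambda>h. k g \<otimes> ?e h) \<in> ?G \<rightarrow> carrier R" using ec kg by (auto simp: Pi_iff)
    have fe: "frob_comb ?e ?G \<in> carrier R" by (rule frob_comb_closed[OF fG'(2) ec])
    have fk: "frob_comb k ?G \<in> carrier R" by (rule frob_comb_closed[OF fG'(2) kc])
    have kq: "k g [^] q \<in> carrier R" using kg by simp
    have "frob_comb ?l ?G = frob_comb k ?G \<ominus> k g [^] q \<otimes> frob_comb ?e ?G"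
      using frob_comb_diff[OF fG' kc kec] frob_comb_smult[OF fG' ec kg] by simp
    also have "\<dots> = (k g [^] q \<otimes> g \<oplus> frob_comb k ?G) \<ominus> k g [^] q \<otimes> (g \<oplus> frob_comb ?e ?G)"
    proof -
      have "y \<ominus> z \<otimes> w = (z \<otimes> h \<oplus> y) \<ominus> z \<otimes> (h \<oplus> w)"
        if "y \<in> carrier R" "z \<in> carrier R" "w \<in> carrier R" "h \<in> carrier R" for y z w h
        using that by algebra
      then show ?thesis using fe fk kq \<open>g \<in> carrier R\<close> by blast
    qed
    also have "\<dots> = x" unfolding 1 k(2) frob_comb_remove[OF fG k(1) g, symmetric]
      using frob_comb_closed[OF fG(2) k(1)] kq by (simp add: minus_eq)
    finally have "x = frob_comb ?l ?G" by simp
    moreover have "?l \<in> ?G \<rightarrow> carrier R" using kc kec by (auto simp: Pi_iff)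
    ultimately show "\<exists>c\<in>?G \<rightarrow> carrier R. x = frob_comb c ?G" by blast
  qed
  from minimal[OF this] show False using g fG(1) by (metis card_Diff1_less not_le)
qed

text \<open>Kunz's theorem: for \<open>A = {}\<close> this says that \<open>G\<close> is a basis of \<open>F\<^sub>* R\<close>. The induction removes one
  parameter at a time from \<open>A = B\<close>, where the claim is the minimality of \<open>G\<close>.\<close>

lemma minimal_generators_independent_mod_parameters:
  assumes G: "frob_generates G" and minimal: "\<And>G'. frob_generates G' \<Longrightarrow> card G \<le> card G'"
    and "A \<subseteq> B" "c \<in> G \<rightarrow> carrier R" "frob_comb c G \<in> Idl_powers (\<lambda>_. q) A" "g \<in> G"
  shows "c g \<in> Idl A"
  using assms(3-)
proof (induction "card (B - A)" arbitrary: A c g)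
  case 0
  then have "A = B" using B(2) by simp
  then show ?case using minimal_generators_independent_mod_max[OF G minimal] 0 B(4) by simp
next
  case (Suc k)
  have fG: "finite G" "G \<subseteq> carrier R" using G unfolding frob_generates_def by auto
  have "B - A \<noteq> {}" using Suc(2) by (metis card.empty nat.distinct(1))
  then obtain a where a: "a \<in> B" "a \<notin> A" by blast
  have ac: "a \<in> carrier R" and Ac: "A \<subseteq> carrier R" and aA: "insert a A \<subseteq> B" using a Suc.prems B(1) by auto
  have "B - A = insert a (B - insert a A)" using a by blast
  then have card: "k = card (B - insert a A)" using Suc(2) B(2) by (metis Diff_iff card_insert_disjoint finite_Diff insertI1 old.nat.inject)
  note IA = genideal_ideal[OF Ac] and Iq = Idl_powers_ideal[OF Suc.prems(1), of "\<lambda>_. q"]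
  \<comment> \<open>The ideal of all \<open>g\<close>-th coefficients of relations modulo the
    \<open>q\<close>-th powers of \<open>A\<close>; Nakayama is to show that it lies in
    \<open>Idl A\<close>.\<close>
  define K where "K = {r. \<exists>c. c \<in> G \<rightarrow> carrier R \<and> frob_comb c G \<in> Idl_powers (\<lambda>_. q) A \<and> r = c g}"
  have K: "ideal K R"
  proof (rule ideal_intro)
    show "K \<subseteq> carrier R" unfolding K_def using Suc.prems(4) by blast
    have "frob_comb (\<lambda>_. \<zero>) G \<in> Idl_powers (\<lambda>_. q) A"
      by (rule frob_comb_in_powers[OF fG(2,1) Suc.prems(1)]) (use ideal_zero[OF IA] in auto)
    then show "\<zero> \<in> K" unfolding K_def by (intro CollectI exI[of _ "\<lambda>_. \<zero>"]) auto
  next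
    fix x y assume "x \<in> K" "y \<in> K"
    then obtain c d where c: "c \<in> G \<rightarrow> carrier R" "frob_comb c G \<in> Idl_powers (\<lambda>_. q) A" "x = c g"
      and d: "d \<in> G \<rightarrow> carrier R" "frob_comb d G \<in> Idl_powers (\<lambda>_. q) A" "y = d g" unfolding K_def by blast
    have "frob_comb (\<lambda>g. c g \<oplus> d g) G \<in> Idl_powers (\<lambda>_. q) A"
      using frob_comb_add[OF fG(2) c(1) d(1)] ideal_add[OF Iq c(2) d(2)] by simp
    then show "x \<oplus> y \<in> K" unfolding K_def using c d by (intro CollectI exI[of _ "\<lambda>g. c g \<oplus> d g"]) (auto simp: Pi_iff)
  next
    fix r x assume r: "r \<in> carrier R" "x \<in> K"
    then obtain c where c: "c \<in> G \<rightarrow> carrier R" "frob_comb c G \<in> Idl_powers (\<lambda>_. q) A" "x = c g" unfolding K_def by blast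
    have "frob_comb (\<lambda>g. r \<otimes> c g) G \<in> Idl_powers (\<lambda>_. q) A"
      using frob_comb_smult[OF fG c(1) r(1)] ideal_mult[OF Iq _ c(2), of "r [^] q"] r(1) by simp
    then show "r \<otimes> x \<in> K" unfolding K_def using c r(1) by (intro CollectI exI[of _ "\<lambda>g. r \<otimes> c g"]) (auto simp: Pi_iff)
  qed
  have "K \<subseteq> saturation \<nn> (Idl A)"
  proof (rule nakayama[OF max_prime IA K])
    show "a \<in> \<nn>" using a genideal_self[OF B(1)] B(4) by blast
    fix y assume "y \<in> K"
    then obtain d where d: "d \<in> G \<rightarrow> carrier R" "frob_comb d G \<in> Idl_powers (\<lambda>_. q) A" "y = d g" unfolding K_def by blast
    have "Idl_powers (\<lambda>_. q) A \<subseteq> Idl_powers (\<lambda>_. q) (insert a A)"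
      unfolding Idl_powers_def by (intro Idl_mono powers_carrier[OF aA]) auto
    then have "d h \<in> Idl (insert a A)" if "h \<in> G" for h
      using Suc.hyps(1)[OF card aA d(1) _ that] d(2) by blast
    then have "\<forall>h\<in>G. \<exists>w r. w \<in> Idl A \<and> r \<in> carrier R \<and> d h = w \<oplus> r \<otimes> a"
      unfolding Idl_insert[OF ac Ac] by blast
    then obtain w r where wr: "\<And>h. h \<in> G \<Longrightarrow> w h \<in> Idl A" "\<And>h. h \<in> G \<Longrightarrow> r h \<in> carrier R"
      "\<And>h. h \<in> G \<Longrightarrow> d h = w h \<oplus> r h \<otimes> a" by metis
    have w: "w \<in> G \<rightarrow> carrier R" and r: "r \<in> G \<rightarrow> carrier R" using wr ideal_carrier[OF IA] by auto
    have ar: "(\<lambda>h. a \<otimes> r h) \<in> G \<rightarrow> carrier R" using r ac by (auto simp: Pi_iff)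
    have fw: "frob_comb w G \<in> Idl_powers (\<lambda>_. q) A"
      by (rule frob_comb_in_powers[OF fG(2,1) Suc.prems(1)]) (use wr in auto)
    have c: "frob_comb w G \<in> carrier R" "frob_comb r G \<in> carrier R" using frob_comb_closed[OF fG(2)] w r by auto
    have "frob_comb d G = frob_comb (\<lambda>h. w h \<oplus> a \<otimes> r h) G"
      by (rule frob_comb_cong[OF fG(2)]) (use wr w r ac in \<open>auto simp: Pi_iff m_comm\<close>)
    also have "\<dots> = frob_comb w G \<oplus> a [^] q \<otimes> frob_comb r G"
      using frob_comb_add[OF fG(2) w ar] frob_comb_smult[OF fG r ac] by simp
    finally have "a [^] q \<otimes> frob_comb r G \<oplus> frob_comb w G \<in> Idl_powers (\<lambda>_. q) A" using d(2) c ac by (simp add: a_comm)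
    then have "a [^] q \<otimes> frob_comb r G \<in> Idl_powers (\<lambda>_. q) A"
      using ideal_add_cancel[OF Iq _ fw] c ac by simp
    \<comment> \<open>Here the regular sequence is used: \<open>a [^] q\<close> cancels modulo the
      \<open>q\<close>-th powers of \<open>A\<close>, so \<open>r\<close> is again a relation, and
      \<open>d g\<close> lies in \<open>Idl A + a K\<close>.\<close>
    then have "frob_comb r G \<in> Idl_powers (\<lambda>_. q) A"
      by (rule parameter_pow_nonzerodivisor[rotated 5]) (use Suc.prems(1) q a c in auto)
    then have "r g \<in> K" unfolding K_def using r by blast
    moreover have "\<one> \<otimes> y = w g \<oplus> a \<otimes> r g" using d wr Suc.prems(4) ac w by (auto simp: Pi_iff m_comm)
    ultimately show "\<exists>s\<in>carrier R - \<nn>. \<exists>l\<in>Idl A. \<exists>m\<in>K. s \<otimes> y = l \<oplus> a \<otimes> m"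
      using wr(1)[OF Suc.prems(4)] prime_one[OF max_prime] by blast
  qed
  then show ?case using saturation_max[OF IA] Suc.prems unfolding K_def by blast
qed

text \<open>The case \<open>A = {}\<close> of the preceding lemma makes coefficients unique, whence
  the coefficient functions are additive and semilinear: a dual basis of \<open>F\<^sub>* R\<close>.
  The last clause, independence modulo \<open>\<nn>\<close>, is kept for
  \<open>ex_trace\<close>.\<close>

lemma ex_frobenius_basis:
  obtains G \<psi> where "frob_generates G" "\<forall>g\<in>G. cartier (\<psi> g)"
    "\<forall>x\<in>carrier R. x = frob_comb (\<lambda>g. \<psi> g x) G"
    "\<forall>c\<in>G \<rightarrow> carrier R. frob_comb c G \<in> Idl_powers (\<lambda>_. q) B \<longrightarrow> (\<forall>g\<in>G. c g \<in> \<nn>)"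
proof -
  obtain G where G: "frob_generates G" "\<And>G'. frob_generates G' \<Longrightarrow> card G \<le> card G'"
    using F_finite ex_has_least_nat[of frob_generates _ card] by blast
  have fG: "finite G" "G \<subseteq> carrier R" using G unfolding frob_generates_def by auto
  have uniq: "c g = d g" if c: "c \<in> G \<rightarrow> carrier R" and d: "d \<in> G \<rightarrow> carrier R"
    and eq: "frob_comb c G = frob_comb d G" and g: "g \<in> G" for c d g
  proof -
    have "frob_comb (\<lambda>h. c h \<ominus> d h) G = \<zero>"
      using frob_comb_diff[OF fG c d] eq frob_comb_closed[OF fG(2) d] by (simp add: minus_eq r_neg)
    moreover have "ideal (Idl_powers (\<lambda>_. q) {}) R" by (rule Idl_powers_ideal) simp
    ultimately have "frob_comb (\<lambda>h. c h \<ominus> d h) G \<in> Idl_powers (\<lambda>_. q) {}" using ideal_zero by simp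
    from minimal_generators_independent_mod_parameters[OF G empty_subsetI _ this g]
    have "c g \<ominus> d g \<in> Idl {}" using c d by (auto simp: Pi_iff)
    then have "c g \<ominus> d g = \<zero>" unfolding Idl_empty by simp
    moreover have "c g \<in> carrier R" "d g \<in> carrier R" using c d g by auto
    ultimately show "c g = d g" by simp
  qed
  have "\<forall>x\<in>carrier R. \<exists>c. c \<in> G \<rightarrow> carrier R \<and> x = frob_comb c G" using G unfolding frob_generates_def by blast
  then obtain C where C: "\<And>x. x \<in> carrier R \<Longrightarrow> C x \<in> G \<rightarrow> carrier R" "\<And>x. x \<in> carrier R \<Longrightarrow> x = frob_comb (C x) G"
    by metis
  show ?thesis
  proof (rule that[OF G(1)])
    show "\<forall>x\<in>carrier R. x = frob_comb (\<lambda>g. C x g) G" using C(2) by blast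
    show "\<forall>c\<in>G \<rightarrow> carrier R. frob_comb c G \<in> Idl_powers (\<lambda>_. q) B \<longrightarrow> (\<forall>g\<in>G. c g \<in> \<nn>)"
      using minimal_generators_independent_mod_max[OF G] by blast
    show "\<forall>g\<in>G. cartier (\<lambda>x. C x g)" unfolding cartier_def
    proof (intro ballI conjI)
      fix g x assume g: "g \<in> G" and x: "x \<in> carrier R"
      show "C x g \<in> carrier R" using C(1)[OF x] g by blast
      fix z assume z: "z \<in> carrier R"
      show "C (x \<oplus> z) g = C x g \<oplus> C z g"
      proof (rule uniq[OF _ _ _ g])
        show "frob_comb (C (x \<oplus> z)) G = frob_comb (\<lambda>g. C x g \<oplus> C z g) G"
          using frob_comb_add[OF fG(2) C(1)[OF x] C(1)[OF z]] C(2) x z by (metis a_closed)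
      qed (use C(1)[OF x] C(1)[OF z] C(1)[of "x \<oplus> z"] x z in \<open>auto simp: Pi_iff\<close>)
    next
      fix g r x assume g: "g \<in> G" and r: "r \<in> carrier R" and x: "x \<in> carrier R"
      have rx: "r [^] q \<otimes> x \<in> carrier R" using r x by simp
      show "C (r [^] q \<otimes> x) g = r \<otimes> C x g"
      proof (rule uniq[OF C(1)[OF rx] _ _ g])
        show "frob_comb (C (r [^] q \<otimes> x)) G = frob_comb (\<lambda>g. r \<otimes> C x g) G"
          using frob_comb_smult[OF fG C(1)[OF x] r] C(2) x rx by metis
      qed (use C(1)[OF x] r in \<open>auto simp: Pi_iff\<close>)
    qed
  qed
qed

text \<open>\<open>Hom(F\<^sub>* R, R)\<close> is a free \<open>F\<^sub>* R\<close>-module of rank one, since \<open>R / \<nn>\<^sup>[\<^sup>q\<^sup>]\<close> is Gorenstein: a map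
  that does not vanish on its socle induces a perfect pairing.\<close>

lemma ex_trace:
  obtains \<tau> where "cartier \<tau>" "\<And>\<psi>. cartier \<psi> \<Longrightarrow> \<exists>u\<in>carrier R. \<forall>x\<in>carrier R. \<psi> x = \<tau> (u \<otimes> x)"
proof -
  obtain G P where G: "frob_generates G" and P: "\<forall>g\<in>G. cartier (P g)"
    and Pcomb: "\<forall>x\<in>carrier R. x = frob_comb (\<lambda>g. P g x) G"
    and Gmax: "\<forall>c\<in>G \<rightarrow> carrier R. frob_comb c G \<in> Idl_powers (\<lambda>_. q) B \<longrightarrow> (\<forall>g\<in>G. c g \<in> \<nn>)"
    using ex_frobenius_basis by metis
  have fG: "finite G" "G \<subseteq> carrier R" using G unfolding frob_generates_def by auto
  let ?J = "Idl_powers (\<lambda>_. q) B"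
  define C where "C x g = P g x" for x g
  have C: "\<And>x. x \<in> carrier R \<Longrightarrow> C x \<in> G \<rightarrow> carrier R" "\<And>x. x \<in> carrier R \<Longrightarrow> x = frob_comb (C x) G"
    using P Pcomb cartierD(1) unfolding C_def by auto
  define y where "y = socle_power q B"
  have y: "y \<in> carrier R" "y \<notin> ?J" unfolding y_def using socle_power_closed socle_power_notin q by auto
  have "\<not> (\<forall>g\<in>G. C y g \<in> \<nn>)"
    using frob_comb_in_powers[OF fG(2,1) order_refl, of "C y"] B(4) C(2)[OF y(1)] y(2) by auto
  \<comment> \<open>As the socle generator \<open>y\<close> is not in the Frobenius power of
    \<open>\<nn>\<close>, one of its coordinates is a unit; that coordinate function becomes
    \<open>\<tau>\<close>.\<close>
  then obtain g0 where g0: "g0 \<in> G" "C y g0 \<notin> \<nn>" by blast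
  define \<tau> where "\<tau> x = C x g0" for x
  have \<tau>: "cartier \<tau>" using P g0(1) unfolding \<tau>_def C_def by simp
  note \<tau>D = cartierD[OF \<tau>]
  have \<tau>J: "\<tau> z \<in> \<nn>" if "z \<in> ?J" for z
  proof -
    obtain m where m: "m \<in> G \<rightarrow> \<nn>" "z = frob_comb m G"
      using Idl_powers_frob_comb[OF G order_refl \<open>z \<in> ?J\<close>] unfolding B(4)[symmetric] by blast
    have "m \<in> G \<rightarrow> carrier R" using m(1) ideal_carrier[OF max_ideal] by blast
    then have "\<tau> z = (\<Oplus>g\<in>G. m g \<otimes> \<tau> g)" unfolding m(2) by (rule cartier_frob_comb[OF \<tau> fG])
    also have "\<dots> \<in> \<nn>"
      using m(1) fG \<tau>D(1) by (intro ideal_finsum[OF _ max_ideal] ideal_mult_right[OF max_ideal]) auto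
    finally show ?thesis .
  qed
  \<comment> \<open>If \<open>c\<close> were nonzero modulo \<open>?J\<close>, some multiple of it
    would agree there with the socle generator \<open>y\<close>, whose value under
    \<open>\<tau>\<close> is a unit.\<close>
  have nondeg: "c \<in> ?J" if c: "c \<in> carrier R" "\<And>x. x \<in> carrier R \<Longrightarrow> \<tau> (c \<otimes> x) \<in> \<nn>" for c
  proof (rule ccontr)
    assume "c \<notin> ?J"
    then obtain d where d: "d \<in> carrier R" "d \<otimes> c \<ominus> y \<in> ?J"
      using ex_socle_multiple[OF q c(1)] unfolding y_def by blast
    have dc: "d \<otimes> c \<in> carrier R" using d c by simp
    have yd: "y \<oplus> (d \<otimes> c \<ominus> y) = c \<otimes> d" using y(1) d(1) c(1) by algebra
    have "\<tau> y \<oplus> \<tau> (d \<otimes> c \<ominus> y) = \<tau> (c \<otimes> d)"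
      unfolding yd[symmetric] using y(1) dc by (intro \<tau>D(2)[symmetric]) auto
    also have "\<dots> \<in> \<nn>" by (rule c(2)[OF d(1)])
    finally have "\<tau> y \<oplus> \<tau> (d \<otimes> c \<ominus> y) \<in> \<nn>" .
    then have "\<tau> y \<in> \<nn>" using ideal_add_cancel[OF max_ideal \<tau>D(1)[OF y(1)] \<tau>J[OF d(2)]] by blast
    then show False using g0(2) unfolding \<tau>_def by blast
  qed
  have approx: "\<exists>u\<in>carrier R. \<forall>h\<in>G. \<tau> (u \<otimes> h) \<ominus> t h \<in> \<nn>" if t: "t \<in> G \<rightarrow> carrier R" for t
  proof -
    \<comment> \<open>Counting dimensions over the residue field: \<open>t\<close> and the
      functionals \<open>\<tau> (g \<cdot>)\<close>, evaluated on \<open>G\<close>, are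
      \<open>card G + 1\<close> vectors of length \<open>card G\<close>. They satisfy a nontrivial
      relation, and nondegeneracy forces \<open>t\<close> to occur in it with a unit
      coefficient.\<close>
    define M where "M i h = (case i of None \<Rightarrow> t h | Some g \<Rightarrow> \<tau> (g \<otimes> h))" for i h
    define U where "U = insert None (Some ` G)"
    have U: "finite U" "card G < card U" unfolding U_def using fG(1) by (auto simp: card_image)
    have Mc: "M i j \<in> carrier R" if "i \<in> U" "j \<in> G" for i j
      using that t fG(2) \<tau>D(1) unfolding U_def M_def by (auto simp: Pi_iff subset_iff)
    obtain c where c: "c \<in> U \<rightarrow> carrier R" "\<exists>i\<in>U. c i \<notin> \<nn>" "\<forall>h\<in>G. (\<Oplus>i\<in>U. c i \<otimes> M i h) \<in> \<nn>"
      using underdetermined_system[where M = M, OF max_prime fG(1) U Mc] by blast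
    define c' where "c' g = c (Some g)" for g
    have c': "c' \<in> G \<rightarrow> carrier R" and cN: "c None \<in> carrier R" using c(1) unfolding c'_def U_def by (auto simp: Pi_iff)
    define v where "v = frob_comb c' G"
    have v: "v \<in> carrier R" unfolding v_def by (rule frob_comb_closed[OF fG(2) c'])
    have eq: "c None \<otimes> t h \<oplus> \<tau> (v \<otimes> h) \<in> \<nn>" if h: "h \<in> G" for h
    proof -
      have hc: "h \<in> carrier R" using h fG by blast
      have th: "t h \<in> carrier R" using h t by blast
      have "\<tau> (v \<otimes> h) = \<tau> (h \<otimes> frob_comb c' G)" unfolding v_def[symmetric] using v hc by (simp add: m_comm)
      also have "\<dots> = (\<Oplus>g\<in>G. c' g \<otimes> \<tau> (h \<otimes> g))" by (rule cartier_frob_comb[OF cartier_mult_right[OF \<tau> hc] fG c'])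
      also have "\<dots> = (\<Oplus>g\<in>G. c (Some g) \<otimes> M (Some g) h)"
        unfolding M_def c'_def[symmetric] using c' \<tau>D(1) fG(2) hc
        by (intro finsum_cong') (auto simp: Pi_iff subset_iff m_comm)
      also have "\<dots> = (\<Oplus>i\<in>Some ` G. c i \<otimes> M i h)"
        by (rule finsum_reindex[symmetric]) (use c(1) Mc h in \<open>auto simp: Pi_iff U_def\<close>)
      finally have *: "\<tau> (v \<otimes> h) = (\<Oplus>i\<in>Some ` G. c i \<otimes> M i h)" .
      have "(\<Oplus>i\<in>U. c i \<otimes> M i h) = c None \<otimes> M None h \<oplus> (\<Oplus>i\<in>Some ` G. c i \<otimes> M i h)"
        unfolding U_def using c(1) Mc h fG(1) by (intro finsum_insert) (auto simp: Pi_iff U_def)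
      then have "c None \<otimes> M None h \<oplus> \<tau> (v \<otimes> h) \<in> \<nn>" using c(3) h unfolding * by metis
      then show ?thesis by (simp add: M_def)
    qed
    have "c None \<notin> \<nn>"
    proof
      assume N: "c None \<in> \<nn>"
      have "\<tau> (v \<otimes> h) \<in> \<nn>" if h: "h \<in> G" for h
      proof -
        have hc: "h \<in> carrier R" using h fG by blast
        have "c None \<otimes> t h \<in> \<nn>" using ideal_mult_right[OF max_ideal _ N] t h by blast
        moreover have "\<tau> (v \<otimes> h) \<oplus> c None \<otimes> t h \<in> \<nn>"
          using eq[OF h] \<tau>D(1)[of "v \<otimes> h"] v hc cN t h by (simp add: a_comm Pi_iff)
        ultimately show ?thesis using ideal_add_cancel[OF max_ideal] \<tau>D(1)[of "v \<otimes> h"] v hc by blast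
      qed
      then have "\<tau> (v \<otimes> frob_comb k G) \<in> \<nn>" if "k \<in> G \<rightarrow> carrier R" for k
        unfolding cartier_frob_comb[OF cartier_mult_right[OF \<tau> v] fG that]
        using that by (intro ideal_finsum[OF fG(1) max_ideal] ideal_mult[OF max_ideal]) auto
      then have "v \<in> ?J" using C by (intro nondeg[OF v]) metis
      then have "c' g \<in> \<nn>" if "g \<in> G" for g using Gmax c' that unfolding v_def by blast
      then show False using c(2) N unfolding U_def c'_def by blast
    qed
    then obtain w where w: "w \<in> carrier R" "c None \<otimes> w = \<one>" using ex_inverse cN by blast
    \<comment> \<open>The relation is solved for \<open>t\<close>; the scalar \<open>-w\<close> has
      to enter as a \<open>q\<close>-th power because \<open>\<tau>\<close> is semilinear.\<close>
    define u where "u = (\<ominus> w) [^] q \<otimes> v"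
    have u: "u \<in> carrier R" unfolding u_def using w v by simp
    have "\<tau> (u \<otimes> h) \<ominus> t h \<in> \<nn>" if h: "h \<in> G" for h
    proof -
      have hc: "h \<in> carrier R" using h fG by blast
      have th: "t h \<in> carrier R" using h t by blast
      define z where "z = \<tau> (v \<otimes> h)"
      have z: "z \<in> carrier R" unfolding z_def using \<tau>D(1) v hc by simp
      have "u \<otimes> h = (\<ominus> w) [^] q \<otimes> (v \<otimes> h)" unfolding u_def using w v hc by (simp add: m_assoc)
      then have 1: "\<tau> (u \<otimes> h) = \<ominus> w \<otimes> z" unfolding z_def using \<tau>D(3)[of "\<ominus> w" "v \<otimes> h"] w v hc by simp
      have "\<ominus> w \<otimes> (c None \<otimes> t h \<oplus> z) = \<ominus> w \<otimes> z \<ominus> (c None \<otimes> w) \<otimes> t h" using w(1) cN th z by algebra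
      also have "\<dots> = \<tau> (u \<otimes> h) \<ominus> t h" unfolding w(2) 1 using th by simp
      finally show ?thesis using ideal_mult[OF max_ideal _ eq[OF h], of "\<ominus> w"] w(1) unfolding z_def by simp
    qed
    then show ?thesis using u by blast
  qed
  \<comment> \<open>The functionals \<open>\<tau> (u \<cdot>)\<close>, restricted to
    \<open>G\<close>. By \<open>approx\<close> they fill the free module on \<open>G\<close> modulo
    \<open>\<nn>\<close>, and Nakayama removes the error.\<close>
  define W where "W = {t. \<exists>u\<in>carrier R. \<forall>h\<in>G. t h = \<tau> (u \<otimes> h)}"
  have Gc: "h \<in> G \<Longrightarrow> h \<in> carrier R" for h using fG by blast
  have W_add: "(\<lambda>h. s h \<oplus> t h) \<in> W" if st: "s \<in> W" "t \<in> W" for s t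
  proof -
    obtain u v where u: "u \<in> carrier R" "\<forall>h\<in>G. s h = \<tau> (u \<otimes> h)" "v \<in> carrier R" "\<forall>h\<in>G. t h = \<tau> (v \<otimes> h)"
      using st unfolding W_def by blast
    have "\<forall>h\<in>G. s h \<oplus> t h = \<tau> ((u \<oplus> v) \<otimes> h)" using u Gc by (simp add: l_distr \<tau>D(2))
    then show ?thesis unfolding W_def using u(1,3) by blast
  qed
  have W_smult: "(\<lambda>h. r \<otimes> t h) \<in> W" if r: "r \<in> carrier R" and t: "t \<in> W" for r t
  proof -
    obtain u where u: "u \<in> carrier R" "\<forall>h\<in>G. t h = \<tau> (u \<otimes> h)" using t unfolding W_def by blast
    have "\<forall>h\<in>G. r \<otimes> t h = \<tau> ((r [^] q \<otimes> u) \<otimes> h)" using u Gc r by (simp add: m_assoc \<tau>D(3))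
    then show ?thesis unfolding W_def using u(1) r by blast
  qed
  have W_cong: "t \<in> W" if "s \<in> W" "\<And>h. h \<in> G \<Longrightarrow> s h = t h" for s t using that unfolding W_def by simp
  have W_basis: "(\<lambda>h. if a = h then \<one> else \<zero>) \<in> W" if "a \<in> G" for a
  proof -
    have "\<forall>a\<in>G. (\<lambda>h. if a = h then \<one> else \<zero>) \<in> W"
    proof (rule nakayama_free_module[where W = W and G = G and A = G, OF W_add W_smult W_cong fG(1) order_refl])
      fix a assume "a \<in> G"
      let ?\<delta> = "\<lambda>h. if a = h then \<one> else \<zero>"
      obtain u where u: "u \<in> carrier R" "\<forall>h\<in>G. \<tau> (u \<otimes> h) \<ominus> ?\<delta> h \<in> \<nn>" using approx[of ?\<delta>] by auto
      define m where "m h = \<ominus> (\<tau> (u \<otimes> h) \<ominus> ?\<delta> h)" for h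
      have "m \<in> G \<rightarrow> \<nn>" unfolding m_def using u(2) ideal_neg[OF max_ideal] by auto
      moreover have "(\<lambda>h. ?\<delta> h \<ominus> (if h \<in> G then m h else \<zero>)) \<in> W"
        unfolding W_def
      proof (intro CollectI bexI[OF _ u(1)] ballI)
        fix h assume h: "h \<in> G"
        have "?\<delta> h \<ominus> \<ominus> (z \<ominus> ?\<delta> h) = z" if "z \<in> carrier R" for z
        proof -
          have "d \<ominus> \<ominus> (z \<ominus> d) = z" if "d \<in> carrier R" for d using that \<open>z \<in> carrier R\<close> by algebra
          then show ?thesis by simp
        qed
        then show "?\<delta> h \<ominus> (if h \<in> G then m h else \<zero>) = \<tau> (u \<otimes> h)"
          using h \<tau>D(1)[of "u \<otimes> h"] u(1) Gc unfolding m_def by simp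
      qed
      ultimately show "\<exists>m\<in>G \<rightarrow> \<nn>. (\<lambda>h. ?\<delta> h \<ominus> (if h \<in> G then m h else \<zero>)) \<in> W" by blast
    qed (auto, erule W_cong, blast)
    then show ?thesis using that by blast
  qed
  have W_zero: "(\<lambda>_. \<zero>) \<in> W" if "a \<in> G" for a
    using W_smult[OF zero_closed W_basis[OF that]] by (rule W_cong) auto
  show ?thesis
  proof (rule that[OF \<tau>])
    fix \<psi> assume \<psi>: "cartier \<psi>"
    have \<psi>G: "\<psi> \<in> G \<rightarrow> carrier R" using cartierD(1)[OF \<psi>] Gc by blast
    have "\<psi> \<in> W"
      by (rule free_module_combination[OF W_zero[OF g0(1)] W_add W_smult W_cong fG(1) W_basis \<psi>G]) (auto, erule W_cong, blast)
    then obtain u where u: "u \<in> carrier R" "\<forall>h\<in>G. \<psi> h = \<tau> (u \<otimes> h)" unfolding W_def by blast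
    have "\<psi> x = \<tau> (u \<otimes> x)" if x: "x \<in> carrier R" for x
    proof -
      have "\<psi> x = (\<Oplus>g\<in>G. C x g \<otimes> \<psi> g)"
        using cartier_frob_comb[OF \<psi> fG C(1)[OF x]] C(2)[OF x] by simp
      also have "\<dots> = (\<Oplus>g\<in>G. C x g \<otimes> \<tau> (u \<otimes> g))"
        using u C(1)[OF x] \<tau>D(1) Gc by (intro finsum_cong') (auto simp: Pi_iff)
      also have "\<dots> = \<tau> (u \<otimes> x)"
        using cartier_frob_comb[OF cartier_mult_right[OF \<tau> u(1)] fG C(1)[OF x]] C(2)[OF x] by simp
      finally show ?thesis .
    qed
    then show "\<exists>u\<in>carrier R. \<forall>x\<in>carrier R. \<psi> x = \<tau> (u \<otimes> x)" using u(1) by blast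
  qed
qed

end

section \<open>Injective modules and maps between resolutions\<close>

lemma mod_homD:
  assumes "h \<in> mod_hom R M N"
  shows "x \<in> carrier M \<Longrightarrow> h x \<in> carrier N"
    and "x \<in> carrier M \<Longrightarrow> y \<in> carrier M \<Longrightarrow> h (x \<oplus>\<^bsub>M\<^esub> y) = h x \<oplus>\<^bsub>N\<^esub> h y"
    and "r \<in> carrier R \<Longrightarrow> x \<in> carrier M \<Longrightarrow> h (r \<odot>\<^bsub>M\<^esub> x) = r \<odot>\<^bsub>N\<^esub> h x"
  using assms unfolding mod_hom_def hom_def by auto

lemma mod_homI:
  assumes "\<And>x. x \<in> carrier M \<Longrightarrow> h x \<in> carrier N"
    and "\<And>x y. x \<in> carrier M \<Longrightarrow> y \<in> carrier M \<Longrightarrow> h (x \<oplus>\<^bsub>M\<^esub> y) = h x \<oplus>\<^bsub>N\<^esub> h y"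
    and "\<And>r x. r \<in> carrier R \<Longrightarrow> x \<in> carrier M \<Longrightarrow> h (r \<odot>\<^bsub>M\<^esub> x) = r \<odot>\<^bsub>N\<^esub> h x"
  shows "h \<in> mod_hom R M N"
  using assms unfolding mod_hom_def hom_def by auto

lemma mod_hom_zero:
  assumes "module R M" "module R N" "h \<in> mod_hom R M N"
  shows "h \<zero>\<^bsub>M\<^esub> = \<zero>\<^bsub>N\<^esub>"
proof -
  interpret M: module R M by fact
  interpret N: module R N by fact
  have "h (\<zero>\<^bsub>R\<^esub> \<odot>\<^bsub>M\<^esub> \<zero>\<^bsub>M\<^esub>) = \<zero>\<^bsub>R\<^esub> \<odot>\<^bsub>N\<^esub> h \<zero>\<^bsub>M\<^esub>" by (rule mod_homD(3)[OF assms(3)]) auto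
  then show ?thesis using mod_homD(1)[OF assms(3)] by simp
qed

lemma mod_hom_neg:
  assumes "module R M" "module R N" "h \<in> mod_hom R M N" "x \<in> carrier M"
  shows "h (\<ominus>\<^bsub>M\<^esub> x) = \<ominus>\<^bsub>N\<^esub> h x"
proof -
  interpret M: module R M by fact
  interpret N: module R N by fact
  have "h ((\<ominus>\<^bsub>R\<^esub> \<one>\<^bsub>R\<^esub>) \<odot>\<^bsub>M\<^esub> x) = (\<ominus>\<^bsub>R\<^esub> \<one>\<^bsub>R\<^esub>) \<odot>\<^bsub>N\<^esub> h x" by (rule mod_homD(3)[OF assms(3)]) (use assms(4) in auto)
  then show ?thesis using mod_homD(1)[OF assms(3,4)] assms(4) by (simp add: M.smult_l_minus N.smult_l_minus)
qed

lemma mod_hom_diff: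
  assumes "module R M" "module R N" "h \<in> mod_hom R M N" "x \<in> carrier M" "y \<in> carrier M"
  shows "h (x \<ominus>\<^bsub>M\<^esub> y) = h x \<ominus>\<^bsub>N\<^esub> h y"
proof -
  interpret M: module R M by fact
  interpret N: module R N by fact
  show ?thesis using mod_homD(2)[OF assms(3,4), of "\<ominus>\<^bsub>M\<^esub> y"] mod_hom_neg[OF assms(1-3,5)] assms(5)
    by (simp add: M.minus_eq N.minus_eq)
qed

section \<open>Baer's criterion\<close>

lemma (in abelian_group) diff_eq_zero_iff:
  assumes "x \<in> carrier G" "y \<in> carrier G"
  shows "x \<ominus> y = \<zero> \<longleftrightarrow> x = y"
proof
  assume "x \<ominus> y = \<zero>"
  then have "\<ominus> (\<ominus> y) = x" using assms by (intro minus_equality) (auto simp: minus_eq)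
  then show "x = y" using assms by simp
qed (use assms in \<open>simp add: minus_eq r_neg\<close>)

text \<open>Injectivity expressed through ideals only. This form can be checked for twisted modules,
  and by \<open>baer_extend\<close> it yields extensions for modules on any type, whereas
  \<open>injective_module\<close> tests modules on the type of the ring.\<close>

definition baer :: "('a, 'm) ring_scheme \<Rightarrow> ('a, 'b, 'k) module_scheme \<Rightarrow> bool" where
  "baer R D \<longleftrightarrow> (\<forall>J g. ideal J R \<longrightarrow> (\<forall>a\<in>J. g a \<in> carrier D) \<longrightarrow>
     (\<forall>a\<in>J. \<forall>b\<in>J. g (a \<oplus>\<^bsub>R\<^esub> b) = g a \<oplus>\<^bsub>D\<^esub> g b) \<longrightarrow>
     (\<forall>r\<in>carrier R. \<forall>a\<in>J. g (r \<otimes>\<^bsub>R\<^esub> a) = r \<odot>\<^bsub>D\<^esub> g a) \<longrightarrow>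
     (\<exists>e\<in>carrier D. \<forall>a\<in>J. g a = a \<odot>\<^bsub>D\<^esub> e))"

lemma baerD:
  assumes "baer R D" "ideal J R" "\<And>a. a \<in> J \<Longrightarrow> g a \<in> carrier D"
    "\<And>a b. a \<in> J \<Longrightarrow> b \<in> J \<Longrightarrow> g (a \<oplus>\<^bsub>R\<^esub> b) = g a \<oplus>\<^bsub>D\<^esub> g b"
    "\<And>r a. r \<in> carrier R \<Longrightarrow> a \<in> J \<Longrightarrow> g (r \<otimes>\<^bsub>R\<^esub> a) = r \<odot>\<^bsub>D\<^esub> g a"
  obtains e where "e \<in> carrier D" "\<And>a. a \<in> J \<Longrightarrow> g a = a \<odot>\<^bsub>D\<^esub> e"
proof -
  have "\<exists>e\<in>carrier D. \<forall>a\<in>J. g a = a \<odot>\<^bsub>D\<^esub> e"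
    using assms(1)[unfolded baer_def, THEN spec, THEN spec, of J g] assms(2-) by blast
  then show ?thesis using that by blast
qed

lemma (in cring) ideal_module:
  assumes "ideal J R"
  shows "module R ((regular_module R)\<lparr>carrier := J\<rparr>)"
proof (rule moduleI[OF cring_axioms])
  note [simp] = ideal_carrier[OF assms] ideal_add[OF assms] ideal_zero[OF assms] ideal_mult[OF assms] ideal_neg[OF assms]
  show "abelian_group ((regular_module R)\<lparr>carrier := J\<rparr>)"
  proof (rule abelian_groupI)
    fix x assume "x \<in> carrier ((regular_module R)\<lparr>carrier := J\<rparr>)"
    then show "\<exists>y\<in>carrier ((regular_module R)\<lparr>carrier := J\<rparr>). y \<oplus>\<^bsub>(regular_module R)\<lparr>carrier := J\<rparr>\<^esub> x = \<zero>\<^bsub>(regular_module R)\<lparr>carrier := J\<rparr>\<^esub>"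
      by (intro bexI[of _ "\<ominus> x"]) (auto simp: regular_module_def l_neg)
  qed (auto simp: regular_module_def a_ac)
qed (auto simp: regular_module_def ideal_mult[OF assms] ideal_carrier[OF assms] l_distr r_distr m_assoc)

lemma (in cring) injective_module_baer:
  fixes E :: "('a, 'c, 'k) module_scheme"
  assumes "injective_module R E"
  shows "baer R E"
  unfolding baer_def
proof (intro allI impI)
  fix J and g :: "'a \<Rightarrow> 'c"
  assume J: "ideal J R" and g: "\<forall>a\<in>J. g a \<in> carrier E" "\<forall>a\<in>J. \<forall>b\<in>J. g (a \<oplus> b) = g a \<oplus>\<^bsub>E\<^esub> g b"
    "\<forall>r\<in>carrier R. \<forall>a\<in>J. g (r \<otimes> a) = r \<odot>\<^bsub>E\<^esub> g a"
  let ?M = "(regular_module R)\<lparr>carrier := J\<rparr> :: ('a, 'a) module"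
  let ?N = "(regular_module R)\<lparr>carrier := carrier R\<rparr> :: ('a, 'a) module"
  have "(\<lambda>x. x) \<in> mod_hom R ?M ?N"
    by (rule mod_homI) (auto simp: regular_module_def ideal_carrier[OF J])
  moreover have "g \<in> mod_hom R ?M E"
    by (rule mod_homI) (use g in \<open>auto simp: regular_module_def\<close>)
  ultimately obtain h where h: "h \<in> mod_hom R ?N E" "\<forall>x\<in>carrier ?M. h x = g x"
    using assms[unfolded injective_module_def, THEN conjunct2, THEN spec, THEN spec, THEN spec, THEN spec, of ?M ?N "\<lambda>x. x" g]
      ideal_module[OF J] ideal_module[OF oneideal] by (auto simp: inj_on_def)
  have "g a = a \<odot>\<^bsub>E\<^esub> h \<one>" if a: "a \<in> J" for a
  proof -
    have ac: "a \<in> carrier R" using a J ideal_carrier by blast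
    have "h (a \<odot>\<^bsub>?N\<^esub> \<one>) = a \<odot>\<^bsub>E\<^esub> h \<one>" by (rule mod_homD(3)[OF h(1) ac]) simp
    moreover have "a \<odot>\<^bsub>?N\<^esub> \<one> = a" using ac by (simp add: regular_module_def)
    ultimately show ?thesis using h(2) a by simp
  qed
  moreover have "h \<one> \<in> carrier E" by (rule mod_homD(1)[OF h(1)]) simp
  ultimately show "\<exists>e\<in>carrier E. \<forall>a\<in>J. g a = a \<odot>\<^bsub>E\<^esub> e" by blast
qed

text \<open>Partial maps are carried as graphs, so that domains such as images and kernels need not
  become module records.\<close>

definition linear_relation ::
  "('a, 'm) ring_scheme \<Rightarrow> ('a, 'b, 'k) module_scheme \<Rightarrow> ('a, 'c, 'l) module_scheme \<Rightarrow> ('b \<times> 'c) set \<Rightarrow> bool" where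
  "linear_relation R C D G \<longleftrightarrow> G \<subseteq> carrier C \<times> carrier D \<and> (\<zero>\<^bsub>C\<^esub>, \<zero>\<^bsub>D\<^esub>) \<in> G \<and>
     (\<forall>x y x' y'. (x, y) \<in> G \<longrightarrow> (x', y') \<in> G \<longrightarrow> (x \<oplus>\<^bsub>C\<^esub> x', y \<oplus>\<^bsub>D\<^esub> y') \<in> G) \<and>
     (\<forall>r x y. r \<in> carrier R \<longrightarrow> (x, y) \<in> G \<longrightarrow> (r \<odot>\<^bsub>C\<^esub> x, r \<odot>\<^bsub>D\<^esub> y) \<in> G)"

text \<open>For a linear relation this already makes it the graph of a partial map, by
  \<open>linear_relation_unique\<close>.\<close>

definition functional_at_zero ::
  "('a, 'b, 'k) module_scheme \<Rightarrow> ('a, 'c, 'l) module_scheme \<Rightarrow> ('b \<times> 'c) set \<Rightarrow> bool" where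
  "functional_at_zero C D G \<longleftrightarrow> (\<forall>y. (\<zero>\<^bsub>C\<^esub>, y) \<in> G \<longrightarrow> y = \<zero>\<^bsub>D\<^esub>)"

lemma linear_relationD:
  assumes "linear_relation R C D G"
  shows "(x, y) \<in> G \<Longrightarrow> x \<in> carrier C" "(x, y) \<in> G \<Longrightarrow> y \<in> carrier D" "(\<zero>\<^bsub>C\<^esub>, \<zero>\<^bsub>D\<^esub>) \<in> G"
    "(x, y) \<in> G \<Longrightarrow> (x', y') \<in> G \<Longrightarrow> (x \<oplus>\<^bsub>C\<^esub> x', y \<oplus>\<^bsub>D\<^esub> y') \<in> G"
    "r \<in> carrier R \<Longrightarrow> (x, y) \<in> G \<Longrightarrow> (r \<odot>\<^bsub>C\<^esub> x, r \<odot>\<^bsub>D\<^esub> y) \<in> G"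
  using assms unfolding linear_relation_def by auto

lemma linear_relation_unique:
  assumes C: "module R C" and D: "module R D" and G: "linear_relation R C D G" "functional_at_zero C D G"
    and xy: "(x, y) \<in> G" "(x, z) \<in> G"
  shows "y = z"
proof -
  interpret C: module R C by fact
  interpret D: module R D by fact
  note GD = linear_relationD[OF G(1)]
  have c: "x \<in> carrier C" "y \<in> carrier D" "z \<in> carrier D" using GD xy by blast+
  have "((\<ominus>\<^bsub>R\<^esub> \<one>\<^bsub>R\<^esub>) \<odot>\<^bsub>C\<^esub> x, (\<ominus>\<^bsub>R\<^esub> \<one>\<^bsub>R\<^esub>) \<odot>\<^bsub>D\<^esub> z) \<in> G" by (rule GD(5)) (use xy in auto)
  from GD(4)[OF xy(1) this] have "(\<zero>\<^bsub>C\<^esub>, y \<oplus>\<^bsub>D\<^esub> \<ominus>\<^bsub>D\<^esub> z) \<in> G"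
    using c by (simp add: C.smult_l_minus D.smult_l_minus C.M.r_neg)
  then have "y \<ominus>\<^bsub>D\<^esub> z = \<zero>\<^bsub>D\<^esub>" using G(2) unfolding functional_at_zero_def D.minus_eq by blast
  then show ?thesis using c D.diff_eq_zero_iff by blast
qed

text \<open>Baer's criterion, for extensions of partial maps given by their graphs.\<close>

lemma baer_extend:
  assumes C: "module R C" and D: "module R D" "baer R D"
    and G: "linear_relation R C D G" "functional_at_zero C D G"
  shows "\<exists>f\<in>mod_hom R C D. \<forall>x y. (x, y) \<in> G \<longrightarrow> f x = y"
proof -
  interpret C: module R C by fact
  interpret D: module R D by fact
  define A where "A = {G'. linear_relation R C D G' \<and> functional_at_zero C D G' \<and> G \<subseteq> G'}"
  have "\<exists>M\<in>A. \<forall>N\<in>A. M \<subseteq> N \<longrightarrow> N = M"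
  proof (rule subset_Zorn_nonempty)
    show "A \<noteq> {}" unfolding A_def using G by blast
    fix K assume K: "K \<noteq> {}" "subset.chain A K"
    have KA: "H \<in> A" if "H \<in> K" for H using K(2) that unfolding subset_chain_def by blast
    have LK: "linear_relation R C D H" if "H \<in> K" for H using KA[OF that] unfolding A_def by blast
    have "linear_relation R C D (\<Union>K)" unfolding linear_relation_def
    proof (intro conjI allI impI)
      show "\<Union>K \<subseteq> carrier C \<times> carrier D" using LK unfolding linear_relation_def by blast
      show "(\<zero>\<^bsub>C\<^esub>, \<zero>\<^bsub>D\<^esub>) \<in> \<Union>K" using K(1) linear_relationD(3)[OF LK] by blast
      show "(r \<odot>\<^bsub>C\<^esub> x, r \<odot>\<^bsub>D\<^esub> y) \<in> \<Union>K" if "r \<in> carrier R" "(x, y) \<in> \<Union>K" for r x y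
        using linear_relationD(5)[OF LK] that by blast
      fix x y x' y' assume "(x, y) \<in> \<Union>K" "(x', y') \<in> \<Union>K"
      then obtain H H' where H: "H \<in> K" "(x, y) \<in> H" "H' \<in> K" "(x', y') \<in> H'" by blast
      then have "H \<subseteq> H' \<or> H' \<subseteq> H" using K(2) unfolding subset_chain_def by blast
      then obtain L where "L \<in> K" "(x, y) \<in> L" "(x', y') \<in> L" using H by blast
      then show "(x \<oplus>\<^bsub>C\<^esub> x', y \<oplus>\<^bsub>D\<^esub> y') \<in> \<Union>K" using linear_relationD(4)[OF LK] by blast
    qed
    moreover have "functional_at_zero C D (\<Union>K)"
      using KA unfolding A_def functional_at_zero_def by blast
    moreover have "G \<subseteq> \<Union>K" using K(1) KA unfolding A_def by blast
    ultimately show "\<Union>K \<in> A" unfolding A_def by blast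
  qed
  then obtain M where M: "M \<in> A" "\<And>N. N \<in> A \<Longrightarrow> M \<subseteq> N \<Longrightarrow> N = M" by blast
  have LM: "linear_relation R C D M" and FM: "functional_at_zero C D M" and GM: "G \<subseteq> M"
    using M(1) unfolding A_def by auto
  note MD = linear_relationD[OF LM]
  note Mu = linear_relation_unique[OF C D(1) LM FM]
  have total: "\<exists>y. (c, y) \<in> M" if c: "c \<in> carrier C" for c
  proof -
    \<comment> \<open>Extension of the maximal graph by one element \<open>c\<close>: the scalars
      taking \<open>c\<close> into the present domain form the ideal \<open>J\<close>, and Baer's
      condition on \<open>J\<close> supplies the value \<open>e\<close> at \<open>c\<close>.\<close>
    define J where "J = {r \<in> carrier R. \<exists>y. (r \<odot>\<^bsub>C\<^esub> c, y) \<in> M}"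
    define g where "g r = (THE y. (r \<odot>\<^bsub>C\<^esub> c, y) \<in> M)" for r
    have gI: "g r = y" if "(r \<odot>\<^bsub>C\<^esub> c, y) \<in> M" for r y
      unfolding g_def using that Mu by (intro the_equality) auto
    have g: "(r \<odot>\<^bsub>C\<^esub> c, g r) \<in> M" if "r \<in> J" for r using that gI unfolding J_def by auto
    have Jc: "r \<in> carrier R" if "r \<in> J" for r using that unfolding J_def by blast
    have gadd: "((r \<oplus>\<^bsub>R\<^esub> s) \<odot>\<^bsub>C\<^esub> c, g r \<oplus>\<^bsub>D\<^esub> g s) \<in> M" if "r \<in> J" "s \<in> J" for r s
      using MD(4)[OF g[OF that(1)] g[OF that(2)]] Jc that c by (simp add: C.smult_l_distr)
    have gmult: "((r \<otimes>\<^bsub>R\<^esub> s) \<odot>\<^bsub>C\<^esub> c, r \<odot>\<^bsub>D\<^esub> g s) \<in> M" if "r \<in> carrier R" "s \<in> J" for r s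
      using MD(5)[OF that(1) g[OF that(2)]] Jc that c by (simp add: C.smult_assoc1)
    have IJ: "ideal J R"
    proof (rule C.R.ideal_intro)
      show "J \<subseteq> carrier R" using Jc by blast
      show "\<zero>\<^bsub>R\<^esub> \<in> J" unfolding J_def using MD(3) c by auto
      show "\<And>x y. x \<in> J \<Longrightarrow> y \<in> J \<Longrightarrow> x \<oplus>\<^bsub>R\<^esub> y \<in> J" using gadd Jc unfolding J_def by blast
      show "\<And>r x. r \<in> carrier R \<Longrightarrow> x \<in> J \<Longrightarrow> r \<otimes>\<^bsub>R\<^esub> x \<in> J" using gmult Jc unfolding J_def by blast
    qed
    obtain e where e: "e \<in> carrier D" "\<And>a. a \<in> J \<Longrightarrow> g a = a \<odot>\<^bsub>D\<^esub> e"
      by (rule baerD[OF D(2) IJ, of g]) (use MD(2)[OF g] gI[OF gadd] gI[OF gmult] in auto)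
    define N where "N = {(x \<oplus>\<^bsub>C\<^esub> r \<odot>\<^bsub>C\<^esub> c, y \<oplus>\<^bsub>D\<^esub> r \<odot>\<^bsub>D\<^esub> e) | x y r. (x, y) \<in> M \<and> r \<in> carrier R}"
    have NI: "(x \<oplus>\<^bsub>C\<^esub> r \<odot>\<^bsub>C\<^esub> c, y \<oplus>\<^bsub>D\<^esub> r \<odot>\<^bsub>D\<^esub> e) \<in> N" if "(x, y) \<in> M" "r \<in> carrier R" for x y r
      unfolding N_def using that by blast
    have MN: "M \<subseteq> N"
    proof
      fix z assume "z \<in> M"
      then obtain x y where z: "z = (x, y)" "(x, y) \<in> M" by (metis surj_pair)
      then show "z \<in> N" using NI[OF z(2) C.R.zero_closed] MD(1,2)[OF z(2)] c e(1) by simp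
    qed
    have ce: "(c, e) \<in> N" using NI[OF MD(3) C.R.one_closed] c e(1) by simp
    have "linear_relation R C D N" unfolding linear_relation_def
    proof (intro conjI allI impI)
      show "N \<subseteq> carrier C \<times> carrier D" unfolding N_def using MD(1,2) c e(1) by auto
      show "(\<zero>\<^bsub>C\<^esub>, \<zero>\<^bsub>D\<^esub>) \<in> N" using MN MD(3) by blast
    next
      fix x y x' y' assume "(x, y) \<in> N" "(x', y') \<in> N"
      then obtain u v r u' v' r' where *: "(u, v) \<in> M" "r \<in> carrier R" "x = u \<oplus>\<^bsub>C\<^esub> r \<odot>\<^bsub>C\<^esub> c" "y = v \<oplus>\<^bsub>D\<^esub> r \<odot>\<^bsub>D\<^esub> e"
        "(u', v') \<in> M" "r' \<in> carrier R" "x' = u' \<oplus>\<^bsub>C\<^esub> r' \<odot>\<^bsub>C\<^esub> c" "y' = v' \<oplus>\<^bsub>D\<^esub> r' \<odot>\<^bsub>D\<^esub> e"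
        unfolding N_def by blast
      have cs: "u \<in> carrier C" "u' \<in> carrier C" "v \<in> carrier D" "v' \<in> carrier D" using MD * by blast+
      have "x \<oplus>\<^bsub>C\<^esub> x' = (u \<oplus>\<^bsub>C\<^esub> u') \<oplus>\<^bsub>C\<^esub> (r \<oplus>\<^bsub>R\<^esub> r') \<odot>\<^bsub>C\<^esub> c"
        using * cs c by (simp add: C.smult_l_distr C.M.a_ac)
      moreover have "y \<oplus>\<^bsub>D\<^esub> y' = (v \<oplus>\<^bsub>D\<^esub> v') \<oplus>\<^bsub>D\<^esub> (r \<oplus>\<^bsub>R\<^esub> r') \<odot>\<^bsub>D\<^esub> e"
        using * cs e(1) by (simp add: D.smult_l_distr D.M.a_ac)
      ultimately show "(x \<oplus>\<^bsub>C\<^esub> x', y \<oplus>\<^bsub>D\<^esub> y') \<in> N" using NI[OF MD(4)[OF *(1,5)], of "r \<oplus>\<^bsub>R\<^esub> r'"] *(2,6) by simp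
    next
      fix s x y assume s: "s \<in> carrier R" and "(x, y) \<in> N"
      then obtain u v r where *: "(u, v) \<in> M" "r \<in> carrier R" "x = u \<oplus>\<^bsub>C\<^esub> r \<odot>\<^bsub>C\<^esub> c" "y = v \<oplus>\<^bsub>D\<^esub> r \<odot>\<^bsub>D\<^esub> e"
        unfolding N_def by blast
      have cs: "u \<in> carrier C" "v \<in> carrier D" using MD * by blast+
      have "s \<odot>\<^bsub>C\<^esub> x = s \<odot>\<^bsub>C\<^esub> u \<oplus>\<^bsub>C\<^esub> (s \<otimes>\<^bsub>R\<^esub> r) \<odot>\<^bsub>C\<^esub> c" using * cs c s by (simp add: C.smult_r_distr C.smult_assoc1)
      moreover have "s \<odot>\<^bsub>D\<^esub> y = s \<odot>\<^bsub>D\<^esub> v \<oplus>\<^bsub>D\<^esub> (s \<otimes>\<^bsub>R\<^esub> r) \<odot>\<^bsub>D\<^esub> e" using * cs e(1) s by (simp add: D.smult_r_distr D.smult_assoc1)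
      ultimately show "(s \<odot>\<^bsub>C\<^esub> x, s \<odot>\<^bsub>D\<^esub> y) \<in> N" using NI[OF MD(5)[OF s *(1)], of "s \<otimes>\<^bsub>R\<^esub> r"] s *(2) by simp
    qed
    moreover have "functional_at_zero C D N" unfolding functional_at_zero_def
    proof (intro allI impI)
      fix y assume "(\<zero>\<^bsub>C\<^esub>, y) \<in> N"
      then obtain u v r where *: "(u, v) \<in> M" "r \<in> carrier R" "\<zero>\<^bsub>C\<^esub> = u \<oplus>\<^bsub>C\<^esub> r \<odot>\<^bsub>C\<^esub> c" "y = v \<oplus>\<^bsub>D\<^esub> r \<odot>\<^bsub>D\<^esub> e"
        unfolding N_def by blast
      have cs: "u \<in> carrier C" "v \<in> carrier D" using MD * by blast+
      have "u = \<ominus>\<^bsub>C\<^esub> (r \<odot>\<^bsub>C\<^esub> c)" using *(2,3) cs c by (metis C.M.minus_equality C.smult_closed)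
      then have u: "u = (\<ominus>\<^bsub>R\<^esub> r) \<odot>\<^bsub>C\<^esub> c" using *(2) c by (simp add: C.smult_l_minus)
      then have "\<ominus>\<^bsub>R\<^esub> r \<in> J" unfolding J_def using *(1,2) by auto
      then have "v = (\<ominus>\<^bsub>R\<^esub> r) \<odot>\<^bsub>D\<^esub> e" using e(2) gI *(1) u by metis
      then show "y = \<zero>\<^bsub>D\<^esub>" using *(2,4) e(1) by (simp add: D.smult_l_minus D.M.l_neg)
    qed
    moreover have "G \<subseteq> N" using GM MN by blast
    ultimately have "N \<in> A" unfolding A_def by blast
    then have "N = M" using M(2) MN by blast
    then show ?thesis using ce by blast
  qed
  define f where "f x = (THE y. (x, y) \<in> M)" for x
  have fI: "f x = y" if "(x, y) \<in> M" for x y unfolding f_def using that Mu by (intro the_equality) auto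
  have f: "(x, f x) \<in> M" if "x \<in> carrier C" for x using total[OF that] fI by auto
  have "f \<in> mod_hom R C D"
    by (rule mod_homI) (use MD(2)[OF f] fI[OF MD(4)[OF f f]] fI[OF MD(5)[OF _ f]] in auto)
  then show ?thesis using fI GM by blast
qed


section \<open>Comparison of resolutions\<close>

lemma linear_relation_image:
  assumes K: "module R K" and C: "module R C" and D: "module R D"
    and f: "f \<in> mod_hom R K C" and g: "g \<in> mod_hom R K D"
    and ker: "\<And>x. x \<in> carrier K \<Longrightarrow> f x = \<zero>\<^bsub>C\<^esub> \<Longrightarrow> g x = \<zero>\<^bsub>D\<^esub>"
  shows "linear_relation R C D ((\<lambda>x. (f x, g x)) ` carrier K)"
    and "functional_at_zero C D ((\<lambda>x. (f x, g x)) ` carrier K)"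
proof -
  interpret K: module R K by fact
  let ?G = "(\<lambda>x. (f x, g x)) ` carrier K"
  note fD = mod_homD[OF f] and gD = mod_homD[OF g]
  show "linear_relation R C D ?G" unfolding linear_relation_def
  proof (intro conjI allI impI)
    show "?G \<subseteq> carrier C \<times> carrier D" using fD(1) gD(1) by blast
    show "(\<zero>\<^bsub>C\<^esub>, \<zero>\<^bsub>D\<^esub>) \<in> ?G"
      using mod_hom_zero[OF K C f] mod_hom_zero[OF K D g] K.M.zero_closed by force
    fix x y x' y' assume "(x, y) \<in> ?G" "(x', y') \<in> ?G"
    then obtain u v where u: "u \<in> carrier K" "x = f u" "y = g u" "v \<in> carrier K" "x' = f v" "y' = g v" by blast
    then show "(x \<oplus>\<^bsub>C\<^esub> x', y \<oplus>\<^bsub>D\<^esub> y') \<in> ?G"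
      using fD(2) gD(2) by (intro image_eqI[of _ _ "u \<oplus>\<^bsub>K\<^esub> v"]) auto
  next
    fix r x y assume "r \<in> carrier R" "(x, y) \<in> ?G"
    then obtain u where u: "u \<in> carrier K" "x = f u" "y = g u" by blast
    then show "(r \<odot>\<^bsub>C\<^esub> x, r \<odot>\<^bsub>D\<^esub> y) \<in> ?G"
      using fD(3) gD(3) \<open>r \<in> carrier R\<close> by (intro image_eqI[of _ _ "r \<odot>\<^bsub>K\<^esub> u"]) auto
  qed
  show "functional_at_zero C D ?G" unfolding functional_at_zero_def using ker by auto
qed

lemma factor_through:
  assumes K: "module R K" and C: "module R C" and D: "module R D" "baer R D"
    and f: "f \<in> mod_hom R K C" and g: "g \<in> mod_hom R K D"
    and ker: "\<And>x. x \<in> carrier K \<Longrightarrow> f x = \<zero>\<^bsub>C\<^esub> \<Longrightarrow> g x = \<zero>\<^bsub>D\<^esub>"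
  obtains h where "h \<in> mod_hom R C D" "\<And>x. x \<in> carrier K \<Longrightarrow> h (f x) = g x"
  using baer_extend[OF C D linear_relation_image[OF K C D(1) f g ker]] by blast

text \<open>The comparison theorem: exactness of \<open>C\<close> and injectivity of the
  \<open>D n\<close> extend a map degree by degree. The map to be lifted is given by the graph
  \<open>G\<close> on the cocycles in degree \<open>Suc 0\<close>, which stand for the resolved
  module, and degree \<open>0\<close> of \<open>C\<close> is zero. The invariant \<open>P\<close>
  asks that cocycles go to cocycles, since this is what factors the next map through
  \<open>d n\<close>.\<close>

lemma lift_chain_map:
  fixes C D :: "nat \<Rightarrow> ('a, 'b) module"
  assumes C: "\<And>n. module R (C n)" and dC: "\<And>n. d n \<in> mod_hom R (C n) (C (Suc n))"
    and D: "\<And>n. module R (D n)" "\<And>n. baer R (D n)" and dD: "\<And>n. d' n \<in> mod_hom R (D n) (D (Suc n))"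
    and C0: "carrier (C 0) = {\<zero>\<^bsub>C 0\<^esub>}"
    and exact: "\<And>n x. x \<in> carrier (C (Suc (Suc n))) \<Longrightarrow> d (Suc (Suc n)) x = \<zero>\<^bsub>C (Suc (Suc (Suc n)))\<^esub> \<Longrightarrow>
      x \<in> d (Suc n) ` carrier (C (Suc n))"
    and dd: "\<And>n x. x \<in> carrier (D n) \<Longrightarrow> d' (Suc n) (d' n x) = \<zero>\<^bsub>D (Suc (Suc n))\<^esub>"
    and G: "linear_relation R (C (Suc 0)) (D (Suc 0)) G" "functional_at_zero (C (Suc 0)) (D (Suc 0)) G"
    and G_dom: "\<And>x. x \<in> carrier (C (Suc 0)) \<Longrightarrow> d (Suc 0) x = \<zero>\<^bsub>C (Suc (Suc 0))\<^esub> \<Longrightarrow> \<exists>y. (x, y) \<in> G"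
    and G_cocycle: "\<And>x y. (x, y) \<in> G \<Longrightarrow> d' (Suc 0) y = \<zero>\<^bsub>D (Suc (Suc 0))\<^esub>"
  obtains f where "\<And>n. f n \<in> mod_hom R (C n) (D n)"
    "\<And>n x. x \<in> carrier (C n) \<Longrightarrow> f (Suc n) (d n x) = d' n (f n x)"
    "\<And>x y. (x, y) \<in> G \<Longrightarrow> f (Suc 0) x = y"
proof -
  define P where "P n f \<longleftrightarrow> f \<in> mod_hom R (C n) (D n) \<and> (n = Suc 0 \<longrightarrow> (\<forall>x y. (x, y) \<in> G \<longrightarrow> f x = y)) \<and>
    (\<forall>x\<in>carrier (C n). d n x = \<zero>\<^bsub>C (Suc n)\<^esub> \<longrightarrow> d' n (f x) = \<zero>\<^bsub>D (Suc n)\<^esub>)" for n f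
  define Q where "Q n f f' \<longleftrightarrow> (\<forall>x\<in>carrier (C n). f' (d n x) = d' n (f x))" for n f f'
  have zC: "d n \<zero>\<^bsub>C n\<^esub> = \<zero>\<^bsub>C (Suc n)\<^esub>" for n using mod_hom_zero[OF C C dC] .
  have zD: "d' n \<zero>\<^bsub>D n\<^esub> = \<zero>\<^bsub>D (Suc n)\<^esub>" for n using mod_hom_zero[OF D(1) D(1) dD] .
  have "\<exists>f. P 0 f"
  proof -
    interpret D0: module R "D 0" by (rule D(1))
    have "(\<lambda>_. \<zero>\<^bsub>D 0\<^esub>) \<in> mod_hom R (C 0) (D 0)" by (rule mod_homI) auto
    then show ?thesis unfolding P_def using zD by (intro exI[of _ "\<lambda>_. \<zero>\<^bsub>D 0\<^esub>"]) auto
  qed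
  moreover have "\<exists>f'. P (Suc n) f' \<and> Q n f f'" if Pf: "P n f" for n f
  proof (cases n)
    case 0
    obtain f' where f': "f' \<in> mod_hom R (C (Suc 0)) (D (Suc 0))" "\<And>x y. (x, y) \<in> G \<Longrightarrow> f' x = y"
      using baer_extend[OF C D G] by blast
    have "P (Suc n) f'" unfolding P_def
    proof (intro conjI ballI impI allI)
      show "f' \<in> mod_hom R (C (Suc n)) (D (Suc n))" using f'(1) 0 by simp
      show "f' x = y" if "(x, y) \<in> G" for x y using f'(2) that by blast
      fix x assume "x \<in> carrier (C (Suc n))" "d (Suc n) x = \<zero>\<^bsub>C (Suc (Suc n))\<^esub>"
      then have "x \<in> carrier (C (Suc 0))" "d (Suc 0) x = \<zero>\<^bsub>C (Suc (Suc 0))\<^esub>" using 0 by (auto simp: numeral_2_eq_2)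
      then obtain y where y: "(x, y) \<in> G" using G_dom by blast
      show "d' (Suc n) (f' x) = \<zero>\<^bsub>D (Suc (Suc n))\<^esub>" using G_cocycle[OF y] f'(2)[OF y] 0 by (simp add: numeral_2_eq_2)
    qed
    moreover have "Q n f f'" unfolding Q_def
    proof
      fix x assume "x \<in> carrier (C n)"
      then have x: "x = \<zero>\<^bsub>C n\<^esub>" using C0 0 by simp
      have f: "f \<in> mod_hom R (C n) (D n)" using Pf unfolding P_def by blast
      have "f' (d n x) = \<zero>\<^bsub>D (Suc n)\<^esub>" unfolding x zC using mod_hom_zero[OF C D(1) f'(1)] 0 by simp
      moreover have "d' n (f x) = \<zero>\<^bsub>D (Suc n)\<^esub>" unfolding x using mod_hom_zero[OF C D(1) f] zD by simp
      ultimately show "f' (d n x) = d' n (f x)" by simp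
    qed
    ultimately show ?thesis by blast
  next
    case (Suc m)
    have f: "f \<in> mod_hom R (C n) (D n)" using Pf unfolding P_def by blast
    have comp: "(\<lambda>x. d' n (f x)) \<in> mod_hom R (C n) (D (Suc n))"
      by (rule mod_homI) (use mod_homD[OF f] mod_homD[OF dD] in auto)
    obtain f' where f': "f' \<in> mod_hom R (C (Suc n)) (D (Suc n))" "\<And>x. x \<in> carrier (C n) \<Longrightarrow> f' (d n x) = d' n (f x)"
      by (rule factor_through[OF C C D dC comp]) (use Pf in \<open>auto simp: P_def\<close>)
    have "P (Suc n) f'" unfolding P_def
    proof (intro conjI ballI impI)
      show "f' \<in> mod_hom R (C (Suc n)) (D (Suc n))" by (rule f')
      show "\<forall>x y. (x, y) \<in> G \<longrightarrow> f' x = y" if "Suc n = Suc 0" using that Suc by simp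
      fix x assume x: "x \<in> carrier (C (Suc n))" "d (Suc n) x = \<zero>\<^bsub>C (Suc (Suc n))\<^esub>"
      obtain y where y: "y \<in> carrier (C n)" "x = d n y" using exact[of x m] x Suc by auto
      show "d' (Suc n) (f' x) = \<zero>\<^bsub>D (Suc (Suc n))\<^esub>"
        unfolding y(2) f'(2)[OF y(1)] by (rule dd[OF mod_homD(1)[OF f y(1)]])
    qed
    moreover have "Q n f f'" unfolding Q_def using f'(2) by blast
    ultimately show ?thesis by blast
  qed
  ultimately have "\<exists>F. \<forall>n. P n (F n) \<and> Q n (F n) (F (Suc n))" by (rule dependent_nat_choice)
  then obtain F where F: "\<And>n. P n (F n)" "\<And>n. Q n (F n) (F (Suc n))" by blast
  show ?thesis
  proof (rule that[of F])
    show "F n \<in> mod_hom R (C n) (D n)" for n using F(1) unfolding P_def by blast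
    show "x \<in> carrier (C n) \<Longrightarrow> F (Suc n) (d n x) = d' n (F n x)" for n x using F(2) unfolding Q_def by blast
    show "(x, y) \<in> G \<Longrightarrow> F (Suc 0) x = y" for x y using F(1)[of "Suc 0"] unfolding P_def by blast
  qed
qed

text \<open>Uniqueness in the comparison theorem, stated on cocycles only, which is all that
  cohomology sees. If \<open>t = d' h\<close> on cocycles, then \<open>t - d' h\<close> vanishes on
  the kernel of \<open>d\<close> and extends from the image of \<open>d\<close> to the next
  \<open>h'\<close>; applying \<open>d'\<close> then removes the term \<open>d' h\<close>.\<close>

lemma null_homotopic:
  fixes C D :: "nat \<Rightarrow> ('a, 'b) module"
  assumes C: "\<And>n. module R (C n)" and dC: "\<And>n. d n \<in> mod_hom R (C n) (C (Suc n))"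
    and D: "\<And>n. module R (D n)" "\<And>n. baer R (D n)" and dD: "\<And>n. d' n \<in> mod_hom R (D n) (D (Suc n))"
    and exact: "\<And>n x. x \<in> carrier (C (Suc (Suc n))) \<Longrightarrow> d (Suc (Suc n)) x = \<zero>\<^bsub>C (Suc (Suc (Suc n)))\<^esub> \<Longrightarrow>
      x \<in> d (Suc n) ` carrier (C (Suc n))"
    and dd: "\<And>n x. x \<in> carrier (D n) \<Longrightarrow> d' (Suc n) (d' n x) = \<zero>\<^bsub>D (Suc (Suc n))\<^esub>"
    and t: "\<And>n. t n \<in> mod_hom R (C n) (D n)"
    and td: "\<And>n x. x \<in> carrier (C n) \<Longrightarrow> t (Suc n) (d n x) = d' n (t n x)"
    and t1: "\<And>x. x \<in> carrier (C (Suc 0)) \<Longrightarrow> d (Suc 0) x = \<zero>\<^bsub>C (Suc (Suc 0))\<^esub> \<Longrightarrow> t (Suc 0) x = \<zero>\<^bsub>D (Suc 0)\<^esub>"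
  shows "\<exists>h\<in>mod_hom R (C (Suc n)) (D n). \<forall>x\<in>carrier (C (Suc n)).
    d (Suc n) x = \<zero>\<^bsub>C (Suc (Suc n))\<^esub> \<longrightarrow> t (Suc n) x = d' n (h x)"
proof (induction n)
  case 0
  interpret D0: module R "D 0" by (rule D(1))
  have "(\<lambda>_. \<zero>\<^bsub>D 0\<^esub>) \<in> mod_hom R (C (Suc 0)) (D 0)" by (rule mod_homI) auto
  moreover have "d' 0 \<zero>\<^bsub>D 0\<^esub> = \<zero>\<^bsub>D (Suc 0)\<^esub>" by (rule mod_hom_zero[OF D(1) D(1) dD])
  ultimately show ?case using t1 by (intro bexI[of _ "\<lambda>_. \<zero>\<^bsub>D 0\<^esub>"]) (auto simp: numeral_2_eq_2)
next
  case (Suc n)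
  then obtain h where h: "h \<in> mod_hom R (C (Suc n)) (D n)"
    "\<And>x. x \<in> carrier (C (Suc n)) \<Longrightarrow> d (Suc n) x = \<zero>\<^bsub>C (Suc (Suc n))\<^esub> \<Longrightarrow> t (Suc n) x = d' n (h x)" by blast
  interpret DS: module R "D (Suc n)" by (rule D(1))
  interpret DS2: module R "D (Suc (Suc n))" by (rule D(1))
  define g where "g x = t (Suc n) x \<ominus>\<^bsub>D (Suc n)\<^esub> d' n (h x)" for x
  note hD = mod_homD[OF h(1)] and tD = mod_homD[OF t] and dDD = mod_homD[OF dD]
  have g: "g \<in> mod_hom R (C (Suc n)) (D (Suc n))"
  proof (rule mod_homI)
    fix x assume x: "x \<in> carrier (C (Suc n))"
    then show "g x \<in> carrier (D (Suc n))" unfolding g_def using tD(1) dDD(1) hD(1) by simp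
    show "g (r \<odot>\<^bsub>C (Suc n)\<^esub> x) = r \<odot>\<^bsub>D (Suc n)\<^esub> g x" if r: "r \<in> carrier R" for r
      unfolding g_def using tD dDD hD x r by (simp add: DS.minus_eq DS.smult_r_distr DS.smult_r_minus)
    fix y assume y: "y \<in> carrier (C (Suc n))"
    show "g (x \<oplus>\<^bsub>C (Suc n)\<^esub> y) = g x \<oplus>\<^bsub>D (Suc n)\<^esub> g y"
      unfolding g_def using tD dDD hD x y by (simp add: DS.minus_eq DS.M.minus_add DS.M.a_ac)
  qed
  have ker: "g x = \<zero>\<^bsub>D (Suc n)\<^esub>" if "x \<in> carrier (C (Suc n))" "d (Suc n) x = \<zero>\<^bsub>C (Suc (Suc n))\<^esub>" for x
    unfolding g_def h(2)[OF that] using dDD(1) hD(1) that by (simp add: DS.minus_eq DS.M.r_neg)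
  obtain h' where h': "h' \<in> mod_hom R (C (Suc (Suc n))) (D (Suc n))"
    "\<And>x. x \<in> carrier (C (Suc n)) \<Longrightarrow> h' (d (Suc n) x) = g x"
    using factor_through[OF C C D dC g ker] by blast
  have "t (Suc (Suc n)) x = d' (Suc n) (h' x)"
    if x: "x \<in> carrier (C (Suc (Suc n)))" "d (Suc (Suc n)) x = \<zero>\<^bsub>C (Suc (Suc (Suc n)))\<^esub>" for x
  proof -
    obtain y where y: "y \<in> carrier (C (Suc n))" "x = d (Suc n) y" using exact[OF x] by blast
    have hy: "h y \<in> carrier (D n)" using hD(1) y by blast
    have "d' (Suc n) (h' x) = d' (Suc n) (t (Suc n) y) \<ominus>\<^bsub>D (Suc (Suc n))\<^esub> d' (Suc n) (d' n (h y))"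
      unfolding y(2) h'(2)[OF y(1)] g_def
      by (rule mod_hom_diff[OF D(1) D(1) dD]) (use tD(1) dDD(1) hy y in auto)
    also have "\<dots> = d' (Suc n) (t (Suc n) y)" unfolding dd[OF hy] using dDD(1) tD(1) y by (simp add: DS2.minus_eq)
    also have "\<dots> = t (Suc (Suc n)) x" unfolding y(2) td[OF y(1)] ..
    finally show ?thesis by simp
  qed
  then show ?case using h'(1) by blast
qed

text \<open>This is \<open>F\<^sub>* M\<close>. A semilinear map is a homomorphism into or out of a
  twist, so all results on \<open>mod_hom\<close> apply to it.\<close>

definition twist :: "('a, 'm) ring_scheme \<Rightarrow> nat \<Rightarrow> ('a, 'b) module \<Rightarrow> ('a, 'b) module" where
  "twist R q M = M\<lparr>smult := (\<lambda>r x. (r [^]\<^bsub>R\<^esub> q) \<odot>\<^bsub>M\<^esub> x)\<rparr>"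

lemma twist_simps [simp]:
  "carrier (twist R q M) = carrier M" "\<zero>\<^bsub>twist R q M\<^esub> = \<zero>\<^bsub>M\<^esub>" "add (twist R q M) = add M"
  "r \<odot>\<^bsub>twist R q M\<^esub> x = (r [^]\<^bsub>R\<^esub> q) \<odot>\<^bsub>M\<^esub> x"
  by (auto simp: twist_def)

lemma (in frobenius_cring) twist_module:
  assumes "module R M"
  shows "module R (twist R q M)"
proof -
  interpret M: module R M by fact
  show ?thesis
  proof (rule moduleI[OF cring_axioms])
    show "abelian_group (twist R q M)"
      by (rule abelian_groupI) (auto simp: M.M.a_ac intro!: bexI[of _ "\<ominus>\<^bsub>M\<^esub> _"] M.M.l_neg)
  qed (auto simp: frob_add frob_mult M.smult_l_distr M.smult_r_distr M.smult_assoc1)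
qed

lemma twist_hom_twist:
  assumes "cring R" "f \<in> mod_hom R M N" shows "f \<in> mod_hom R (twist R q M) (twist R q N)"
proof -
  interpret cring R by fact
  show ?thesis by (rule mod_homI) (use mod_homD[OF assms(2)] in auto)
qed

lemma finsum_additive_on:
  assumes "abelian_group A" "abelian_group D"
    and T: "T \<subseteq> carrier A" "\<zero>\<^bsub>A\<^esub> \<in> T" "\<And>x y. x \<in> T \<Longrightarrow> y \<in> T \<Longrightarrow> x \<oplus>\<^bsub>A\<^esub> y \<in> T"
    and h: "\<And>x. x \<in> T \<Longrightarrow> h x \<in> carrier D" "\<And>x y. x \<in> T \<Longrightarrow> y \<in> T \<Longrightarrow> h (x \<oplus>\<^bsub>A\<^esub> y) = h x \<oplus>\<^bsub>D\<^esub> h y"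
    and "finite S" "\<And>s. s \<in> S \<Longrightarrow> f s \<in> T"
  shows "finsum A f S \<in> T \<and> h (finsum A f S) = finsum D (\<lambda>s. h (f s)) S"
proof -
  interpret A: abelian_group A by fact
  interpret D: abelian_group D by fact
  have "h \<zero>\<^bsub>A\<^esub> \<oplus>\<^bsub>D\<^esub> h \<zero>\<^bsub>A\<^esub> = h \<zero>\<^bsub>A\<^esub> \<oplus>\<^bsub>D\<^esub> \<zero>\<^bsub>D\<^esub>" using h(2)[OF T(2,2)] h(1)[OF T(2)] T(1,2) by (simp add: subset_iff)
  then have h0: "h \<zero>\<^bsub>A\<^esub> = \<zero>\<^bsub>D\<^esub>" using h(1)[OF T(2)] by (simp add: D.add.l_cancel del: D.r_zero D.l_zero)
  show ?thesis using assms(8,9)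
  proof (induction S rule: finite_induct)
    case empty
    then show ?case using T(2) h0 by simp
  next
    case (insert s S)
    then have IH: "finsum A f S \<in> T" "h (finsum A f S) = finsum D (\<lambda>s. h (f s)) S" and s: "f s \<in> T" by auto
    have c: "f \<in> S \<rightarrow> carrier A" "f s \<in> carrier A" using insert.prems T(1) by blast+
    have d: "(\<lambda>s. h (f s)) \<in> S \<rightarrow> carrier D" "h (f s) \<in> carrier D" using insert.prems h(1) by auto
    show ?case using A.finsum_insert[OF insert.hyps c] D.finsum_insert[OF insert.hyps d] T(3)[OF s IH(1)] h(2)[OF s IH(1)] IH(2)
      by simp
  qed
qed

lemma (in module) finsum_smult_rdistr:
  assumes "finite A" "f \<in> A \<rightarrow> carrier R" "x \<in> carrier M"
  shows "(\<Oplus>\<^bsub>R\<^esub>a\<in>A. f a) \<odot>\<^bsub>M\<^esub> x = (\<Oplus>\<^bsub>M\<^esub>a\<in>A. f a \<odot>\<^bsub>M\<^esub> x)"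
  using finsum_additive_on[OF R.is_abelian_group M.abelian_group_axioms, of "carrier R" "\<lambda>r. r \<odot>\<^bsub>M\<^esub> x" A f] assms
  by (auto simp: smult_l_distr)

text \<open>\<open>F\<^sub>*\<close> preserves injectivity because \<open>F\<^sub>* R\<close> is projective; the dual basis \<open>\<psi>\<close> is used to write
  down the extension of a map from \<open>J\<close> to one from \<open>J\<^sup>[\<^sup>q\<^sup>]\<close>.\<close>

lemma (in frobenius_regular_cring) twist_baer:
  assumes "module R M" "baer R M"
  shows "baer R (twist R q M)"
  unfolding baer_def twist_simps
proof (intro allI impI)
  interpret M: module R M by fact
  fix J and g :: "'a \<Rightarrow> 'c"
  assume J: "ideal J R" and g0: "\<forall>a\<in>J. g a \<in> carrier M" "\<forall>a\<in>J. \<forall>b\<in>J. g (a \<oplus> b) = g a \<oplus>\<^bsub>M\<^esub> g b"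
    "\<forall>r\<in>carrier R. \<forall>a\<in>J. g (r \<otimes> a) = (r [^] q) \<odot>\<^bsub>M\<^esub> g a"
  note g = g0[THEN bspec] and JD = ideal_carrier[OF J] ideal_mult[OF J] ideal_mult_right[OF J]
  obtain G \<psi> where G: "frob_generates G" and \<psi>: "\<forall>b\<in>G. cartier (\<psi> b)"
    and \<psi>comb: "\<forall>x\<in>carrier R. x = frob_comb (\<lambda>b. \<psi> b x) G" using ex_frobenius_basis by metis
  have fG: "finite G" "G \<subseteq> carrier R" using G unfolding frob_generates_def by auto
  have Gc: "b \<in> G \<Longrightarrow> b \<in> carrier R" for b using fG by blast
  define K where "K = {frob_comb m G | m. m \<in> G \<rightarrow> J}"
  have K: "ideal K R" unfolding K_def by (rule frobenius_power_ideal(1)[OF G J])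
  have pow: "a [^] q \<otimes> x \<in> K" if "a \<in> J" "x \<in> carrier R" for a x
    unfolding K_def by (rule frobenius_power_ideal(2)[OF G J that])
  have \<psi>K: "\<psi> b y \<in> J" if b: "b \<in> G" and y: "y \<in> K" for b y
  proof -
    obtain m where m: "m \<in> G \<rightarrow> J" "y = frob_comb m G" using y unfolding K_def by blast
    have mc: "m \<in> G \<rightarrow> carrier R" using m(1) JD(1) by blast
    have "\<psi> b y = (\<Oplus>h\<in>G. m h \<otimes> \<psi> b h)"
      unfolding m(2) by (rule cartier_frob_comb[OF _ fG mc]) (use \<psi> b in blast)
    also have "\<dots> \<in> J"
      using m(1) cartierD(1)[of "\<psi> b"] \<psi> b Gc by (intro ideal_finsum[OF fG(1) J] JD(3)) auto
    finally show ?thesis .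
  qed
  \<comment> \<open>The \<open>R\<close>-linear map on the Frobenius power \<open>K\<close> of
    \<open>J\<close> that corresponds to \<open>g\<close>. Linearity forces it to send
    \<open>a^q s\<close> to \<open>s\<close> times \<open>g a\<close>, as \<open>g'_pow\<close>
    records; the dual basis provides a formula that does not depend on a presentation of
    \<open>y\<close>.\<close>
  define g' where "g' y = (\<Oplus>\<^bsub>M\<^esub>b\<in>G. b \<odot>\<^bsub>M\<^esub> g (\<psi> b y))" for y
  have term_closed: "b \<odot>\<^bsub>M\<^esub> g (\<psi> b y) \<in> carrier M" if "b \<in> G" "y \<in> K" for b y
    using Gc[OF that(1)] g(1)[OF \<psi>K[OF that]] by simp
  have g'_closed: "g' y \<in> carrier M" if "y \<in> K" for y
    unfolding g'_def using term_closed that by (intro M.M.finsum_closed) auto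
  have g'_add: "g' (y \<oplus> z) = g' y \<oplus>\<^bsub>M\<^esub> g' z" if y: "y \<in> K" and z: "z \<in> K" for y z
  proof -
    have yz: "y \<in> carrier R" "z \<in> carrier R" using y z K ideal_carrier by blast+
    have "g' (y \<oplus> z) = (\<Oplus>\<^bsub>M\<^esub>b\<in>G. b \<odot>\<^bsub>M\<^esub> g (\<psi> b y) \<oplus>\<^bsub>M\<^esub> b \<odot>\<^bsub>M\<^esub> g (\<psi> b z))"
      unfolding g'_def
    proof (rule M.M.finsum_cong'[OF refl])
      fix b assume b: "b \<in> G"
      have "\<psi> b (y \<oplus> z) = \<psi> b y \<oplus> \<psi> b z" using \<psi> b yz cartierD(2) by blast
      moreover have "g (\<psi> b y \<oplus> \<psi> b z) = g (\<psi> b y) \<oplus>\<^bsub>M\<^esub> g (\<psi> b z)" using g(2) \<psi>K b y z by blast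
      ultimately show "b \<odot>\<^bsub>M\<^esub> g (\<psi> b (y \<oplus> z)) = b \<odot>\<^bsub>M\<^esub> g (\<psi> b y) \<oplus>\<^bsub>M\<^esub> b \<odot>\<^bsub>M\<^esub> g (\<psi> b z)"
        using Gc[OF b] g(1)[OF \<psi>K[OF b y]] g(1)[OF \<psi>K[OF b z]] by (simp add: M.smult_r_distr)
    qed (use term_closed y z in auto)
    also have "\<dots> = g' y \<oplus>\<^bsub>M\<^esub> g' z" unfolding g'_def using term_closed y z by (intro M.M.finsum_addf) auto
    finally show ?thesis .
  qed
  have g'_pow: "g' (a [^] q \<otimes> s) = s \<odot>\<^bsub>M\<^esub> g a" if a: "a \<in> J" and s: "s \<in> carrier R" for a s
  proof -
    have ac: "a \<in> carrier R" and ga: "g a \<in> carrier M" using a JD(1) g(1) by blast+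
    have \<psi>s: "\<psi> b s \<in> carrier R" if "b \<in> G" for b using \<psi> that s cartierD(1) by blast
    have "g' (a [^] q \<otimes> s) = (\<Oplus>\<^bsub>M\<^esub>b\<in>G. (\<psi> b s [^] q \<otimes> b) \<odot>\<^bsub>M\<^esub> g a)"
      unfolding g'_def
    proof (rule M.M.finsum_cong'[OF refl])
      fix b assume b: "b \<in> G"
      have "\<psi> b (a [^] q \<otimes> s) = \<psi> b s \<otimes> a" using \<psi> b ac s cartierD(3)[of "\<psi> b" a s] \<psi>s[OF b] by (simp add: m_comm)
      then have "g (\<psi> b (a [^] q \<otimes> s)) = (\<psi> b s [^] q) \<odot>\<^bsub>M\<^esub> g a" using g(3)[OF \<psi>s[OF b]] a by simp
      then show "b \<odot>\<^bsub>M\<^esub> g (\<psi> b (a [^] q \<otimes> s)) = (\<psi> b s [^] q \<otimes> b) \<odot>\<^bsub>M\<^esub> g a"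
        using Gc[OF b] \<psi>s[OF b] ga by (simp add: M.smult_assoc1[symmetric] m_comm)
    qed (use Gc \<psi>s ga in auto)
    also have "\<dots> = (\<Oplus>b\<in>G. \<psi> b s [^] q \<otimes> b) \<odot>\<^bsub>M\<^esub> g a"
      using fG \<psi>s Gc ga by (intro M.finsum_smult_rdistr[symmetric]) auto
    also have "(\<Oplus>b\<in>G. \<psi> b s [^] q \<otimes> b) = s" using \<psi>comb s unfolding frob_comb_def by metis
    finally show ?thesis .
  qed
  have g'_smult: "g' (r \<otimes> y) = r \<odot>\<^bsub>M\<^esub> g' y" if r: "r \<in> carrier R" and y: "y \<in> K" for r y
  proof -
    obtain m where m: "m \<in> G \<rightarrow> J" "y = frob_comb m G" using y unfolding K_def by blast
    have mJ: "m b \<in> J" "m b \<in> carrier R" "g (m b) \<in> carrier M" if "b \<in> G" for b using that m(1) JD(1) g(1) by blast+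
    have KT: "K \<subseteq> carrier R" "\<zero> \<in> K" "\<And>x y. x \<in> K \<Longrightarrow> y \<in> K \<Longrightarrow> x \<oplus> y \<in> K"
      using ideal_carrier[OF K] ideal_zero[OF K] ideal_add[OF K] by blast+
    note sum = finsum_additive_on[OF is_abelian_group M.M.abelian_group_axioms KT g'_closed g'_add fG(1)]
    have terms: "m b [^] q \<otimes> b \<in> K" "r \<otimes> (m b [^] q \<otimes> b) \<in> K" if "b \<in> G" for b
      using pow[OF mJ(1)[OF that] Gc[OF that]] ideal_mult[OF K r] by blast+
    have "g' y = (\<Oplus>\<^bsub>M\<^esub>b\<in>G. g' (m b [^] q \<otimes> b))" unfolding m(2) frob_comb_def using sum[of "\<lambda>b. m b [^] q \<otimes> b"] terms(1) by simp
    also have "\<dots> = (\<Oplus>\<^bsub>M\<^esub>b\<in>G. b \<odot>\<^bsub>M\<^esub> g (m b))" using mJ Gc by (intro M.M.finsum_cong'[OF refl]) (auto simp: g'_pow)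
    finally have "r \<odot>\<^bsub>M\<^esub> g' y = (\<Oplus>\<^bsub>M\<^esub>b\<in>G. r \<odot>\<^bsub>M\<^esub> (b \<odot>\<^bsub>M\<^esub> g (m b)))"
      using M.finsum_smult_ldistr[OF fG(1) r, of "\<lambda>b. b \<odot>\<^bsub>M\<^esub> g (m b)"] mJ Gc by auto
    also have "\<dots> = (\<Oplus>\<^bsub>M\<^esub>b\<in>G. g' (r \<otimes> (m b [^] q \<otimes> b)))"
    proof (rule M.M.finsum_cong'[OF refl])
      fix b assume b: "b \<in> G"
      have "r \<otimes> (m b [^] q \<otimes> b) = m b [^] q \<otimes> (r \<otimes> b)" using r mJ(2)[OF b] Gc[OF b] by (simp add: m_lcomm)
      then show "r \<odot>\<^bsub>M\<^esub> (b \<odot>\<^bsub>M\<^esub> g (m b)) = g' (r \<otimes> (m b [^] q \<otimes> b))"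
        using g'_pow[OF mJ(1)[OF b], of "r \<otimes> b"] r Gc[OF b] mJ(3)[OF b] by (simp add: M.smult_assoc1)
    qed (use terms g'_closed in blast)
    also have "\<dots> = g' (\<Oplus>b\<in>G. r \<otimes> (m b [^] q \<otimes> b))" using sum terms(2) by simp
    also have "(\<Oplus>b\<in>G. r \<otimes> (m b [^] q \<otimes> b)) = r \<otimes> y"
      unfolding m(2) frob_comb_def using fG r mJ Gc by (intro finsum_rdistr[symmetric]) auto
    finally show ?thesis by simp
  qed
  obtain e where e: "e \<in> carrier M" "\<And>y. y \<in> K \<Longrightarrow> g' y = y \<odot>\<^bsub>M\<^esub> e"
    using baerD[OF assms(2) K g'_closed g'_add g'_smult] by blast
  have "g a = (a [^] q) \<odot>\<^bsub>M\<^esub> e" if a: "a \<in> J" for a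
  proof -
    have ac: "a \<in> carrier R" using a JD(1) by blast
    have "g a = g' (a [^] q \<otimes> \<one>)" using g'_pow[OF a one_closed] g(1)[OF a] by simp
    also have "\<dots> = (a [^] q \<otimes> \<one>) \<odot>\<^bsub>M\<^esub> e" by (rule e(2)[OF pow[OF a one_closed]])
    finally show ?thesis using ac by simp
  qed
  then show "\<exists>e\<in>carrier M. \<forall>a\<in>J. g a = (a [^] q) \<odot>\<^bsub>M\<^esub> e" using e(1) by blast
qed

section \<open>Local cohomology and Ext\<close>

text \<open>The zero module \<open>C 0\<close> precedes the resolution, whose degree
  \<open>k\<close> sits at \<open>C (Suc k)\<close>: every degree then has a predecessor, and
  coboundaries in degree zero are no separate case.\<close>

locale injective_resolution_of_ring = noetherian_cring R for R (structure) +
  fixes C :: "nat \<Rightarrow> ('a, 'c) module" and \<delta> :: "nat \<Rightarrow> 'c \<Rightarrow> 'c" and \<epsilon> :: "'a \<Rightarrow> 'c"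
  assumes C_module: "\<And>n. module R (C n)" and C_baer: "\<And>n. baer R (C n)"
    and \<delta>: "\<And>n. \<delta> n \<in> mod_hom R (C n) (C (Suc n))"
    and C_0: "carrier (C 0) = {\<zero>\<^bsub>C 0\<^esub>}"
    and exact: "\<And>n x. x \<in> carrier (C (Suc (Suc n))) \<Longrightarrow> \<delta> (Suc (Suc n)) x = \<zero>\<^bsub>C (Suc (Suc (Suc n)))\<^esub> \<longleftrightarrow>
      x \<in> \<delta> (Suc n) ` carrier (C (Suc n))"
    and \<epsilon>: "\<epsilon> \<in> mod_hom R (regular_module R) (C (Suc 0))" and \<epsilon>_inj: "inj_on \<epsilon> (carrier R)"
    and \<epsilon>_exact: "\<And>x. x \<in> carrier (C (Suc 0)) \<Longrightarrow> \<delta> (Suc 0) x = \<zero>\<^bsub>C (Suc (Suc 0))\<^esub> \<longleftrightarrow> x \<in> \<epsilon> ` carrier R"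
begin

sublocale C: module R "C n" for n by (rule C_module)

lemmas \<delta>D = mod_homD[OF \<delta>]

lemma \<delta>_zero: "\<delta> n \<zero>\<^bsub>C n\<^esub> = \<zero>\<^bsub>C (Suc n)\<^esub>"
  by (rule mod_hom_zero[OF C_module C_module \<delta>])

lemma \<delta>_\<delta>: "x \<in> carrier (C n) \<Longrightarrow> \<delta> (Suc n) (\<delta> n x) = \<zero>\<^bsub>C (Suc (Suc n))\<^esub>"
proof (cases n)
  case 0
  assume "x \<in> carrier (C n)"
  then have "x = \<zero>\<^bsub>C n\<^esub>" using C_0 0 by simp
  then show ?thesis using \<delta>_zero by simp
next
  case (Suc m)
  assume "x \<in> carrier (C n)"
  then show ?thesis using exact[of "\<delta> n x" m] \<delta>D(1) Suc by blast
qed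

lemma \<epsilon>D:
  "s \<in> carrier R \<Longrightarrow> \<epsilon> s \<in> carrier (C (Suc 0))"
  "s \<in> carrier R \<Longrightarrow> t \<in> carrier R \<Longrightarrow> \<epsilon> (s \<oplus> t) = \<epsilon> s \<oplus>\<^bsub>C (Suc 0)\<^esub> \<epsilon> t"
  "s \<in> carrier R \<Longrightarrow> t \<in> carrier R \<Longrightarrow> \<epsilon> (s \<otimes> t) = s \<odot>\<^bsub>C (Suc 0)\<^esub> \<epsilon> t"
  using mod_homD[OF \<epsilon>] by (auto simp: regular_module_def)

lemma \<epsilon>_zero: "\<epsilon> \<zero> = \<zero>\<^bsub>C (Suc 0)\<^esub>"
  using \<epsilon>D(3)[of \<zero> \<zero>] \<epsilon>D(1)[of \<zero>] by simp

lemma regular_module: "module R (regular_module R)"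
  using ideal_module[OF oneideal] by (simp add: regular_module_def)

text \<open>The exponent may depend on \<open>a\<close>, unlike in \<open>torsion_functor\<close>;
  over a Noetherian ring the two agree by \<open>torsion_functor_carrier\<close>, and this form
  passes directly through semilinear maps.\<close>

definition torsion :: "'a set \<Rightarrow> nat \<Rightarrow> 'c set" where
  "torsion I n = {x \<in> carrier (C n). \<forall>a\<in>I. \<exists>t::nat. a [^] t \<odot>\<^bsub>C n\<^esub> x = \<zero>\<^bsub>C n\<^esub>}"

text \<open>The cocycles in \<open>C (Suc n)\<close> of the torsion subcomplex whose class in local
  cohomology is zero.\<close>

definition boundaries :: "'a set \<Rightarrow> nat \<Rightarrow> 'c set" where
  "boundaries I n = \<delta> n ` torsion I n"

end

locale frobenius_resolution = frobenius_regular_cring R \<nn> B q + injective_resolution_of_ring R C \<delta> \<epsilon>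
  for R (structure) and \<nn> B q C \<delta> \<epsilon>
begin

abbreviation "FC n \<equiv> twist R q (C n)"

lemma FC_module: "module R (FC n)" by (rule twist_module[OF C_module])
lemma FC_baer: "baer R (FC n)" by (rule twist_baer[OF C_module C_baer])
lemma F\<delta>: "\<delta> n \<in> mod_hom R (FC n) (FC (Suc n))" by (rule twist_hom_twist[OF cring_axioms \<delta>])

text \<open>The target is the twisted complex, whose terms are injective by
  \<open>twist_baer\<close>; exactness is taken from the untwisted source.\<close>

lemma frobenius_lift:
  obtains F where "\<And>n. F n \<in> mod_hom R (C n) (FC n)" "\<And>n x. x \<in> carrier (C n) \<Longrightarrow> F (Suc n) (\<delta> n x) = \<delta> n (F n x)"
    "\<And>s. s \<in> carrier R \<Longrightarrow> F (Suc 0) (\<epsilon> s) = \<epsilon> (s [^] q)"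
proof -
  let ?g = "\<lambda>s. \<epsilon> (s [^] q)"
  have g: "?g \<in> mod_hom R (regular_module R) (FC (Suc 0))"
    by (rule mod_homI) (auto simp: regular_module_def \<epsilon>D frob_add frob_mult)
  have ker: "?g s = \<zero>\<^bsub>FC (Suc 0)\<^esub>" if "s \<in> carrier (regular_module R)" "\<epsilon> s = \<zero>\<^bsub>C (Suc 0)\<^esub>" for s
  proof -
    have "s = \<zero>" using that \<epsilon>_zero \<epsilon>_inj by (auto simp: regular_module_def inj_on_def)
    then show ?thesis using frob_zero \<epsilon>_zero by simp
  qed
  note G = linear_relation_image[OF regular_module C_module FC_module \<epsilon> g ker]
  obtain F where F: "\<And>n. F n \<in> mod_hom R (C n) (FC n)" "\<And>n x. x \<in> carrier (C n) \<Longrightarrow> F (Suc n) (\<delta> n x) = \<delta> n (F n x)"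
    "\<And>x y. (x, y) \<in> (\<lambda>s. (\<epsilon> s, ?g s)) ` carrier (regular_module R) \<Longrightarrow> F (Suc 0) x = y"
  proof (rule lift_chain_map[OF C_module \<delta> FC_module FC_baer F\<delta> C_0 _ _ G])
    show "\<exists>y. (x, y) \<in> (\<lambda>s. (\<epsilon> s, ?g s)) ` carrier (regular_module R)"
      if "x \<in> carrier (C (Suc 0))" "\<delta> (Suc 0) x = \<zero>\<^bsub>C (Suc (Suc 0))\<^esub>" for x
      using \<epsilon>_exact[OF that(1)] that(2) by (auto simp: regular_module_def)
    show "\<delta> (Suc 0) y = \<zero>\<^bsub>FC (Suc (Suc 0))\<^esub>" if "(x, y) \<in> (\<lambda>s. (\<epsilon> s, ?g s)) ` carrier (regular_module R)" for x y
      using that \<epsilon>_exact \<epsilon>D(1) by (auto simp: regular_module_def)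
  qed (use exact \<delta>_\<delta> that in auto)
  show ?thesis by (rule that[OF F(1,2)]) (auto intro!: F(3) simp: regular_module_def)
qed

text \<open>Here the twisted complex is the source: twisting changes only the scalars, so it remains
  exact and resolves \<open>F\<^sub>* R\<close>.\<close>

lemma cartier_lift:
  assumes \<psi>: "cartier \<psi>"
  obtains \<Psi> where "\<And>n. \<Psi> n \<in> mod_hom R (FC n) (C n)" "\<And>n x. x \<in> carrier (C n) \<Longrightarrow> \<Psi> (Suc n) (\<delta> n x) = \<delta> n (\<Psi> n x)"
    "\<And>s. s \<in> carrier R \<Longrightarrow> \<Psi> (Suc 0) (\<epsilon> s) = \<epsilon> (\<psi> s)"
proof -
  let ?K = "twist R q (regular_module R)"
  let ?g = "\<lambda>s. \<epsilon> (\<psi> s)"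
  have K: "module R ?K" by (rule twist_module[OF regular_module])
  have f: "\<epsilon> \<in> mod_hom R ?K (FC (Suc 0))" by (rule twist_hom_twist[OF cring_axioms \<epsilon>])
  have g: "?g \<in> mod_hom R ?K (C (Suc 0))"
    by (rule mod_homI) (use cartierD[OF \<psi>] in \<open>auto simp: regular_module_def \<epsilon>D\<close>)
  have ker: "?g s = \<zero>\<^bsub>C (Suc 0)\<^esub>" if "s \<in> carrier ?K" "\<epsilon> s = \<zero>\<^bsub>FC (Suc 0)\<^esub>" for s
  proof -
    have s: "s = \<zero>" using that \<epsilon>_zero \<epsilon>_inj by (auto simp: regular_module_def inj_on_def)
    have "\<psi> \<zero> = \<zero>" using cartierD(3)[OF \<psi>, of \<zero> \<zero>] cartierD(1)[OF \<psi>, of \<zero>] by simp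
    then show ?thesis using s \<epsilon>_zero by simp
  qed
  note G = linear_relation_image[OF K FC_module C_module f g ker]
  obtain \<Psi> where \<Psi>: "\<And>n. \<Psi> n \<in> mod_hom R (FC n) (C n)" "\<And>n x. x \<in> carrier (FC n) \<Longrightarrow> \<Psi> (Suc n) (\<delta> n x) = \<delta> n (\<Psi> n x)"
    "\<And>x y. (x, y) \<in> (\<lambda>s. (\<epsilon> s, ?g s)) ` carrier ?K \<Longrightarrow> \<Psi> (Suc 0) x = y"
  proof (rule lift_chain_map[OF FC_module F\<delta> C_module C_baer \<delta> _ _ _ G])
    show "\<exists>y. (x, y) \<in> (\<lambda>s. (\<epsilon> s, ?g s)) ` carrier ?K"
      if "x \<in> carrier (FC (Suc 0))" "\<delta> (Suc 0) x = \<zero>\<^bsub>FC (Suc (Suc 0))\<^esub>" for x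
      using \<epsilon>_exact[of x] that by (auto simp: regular_module_def)
    show "\<delta> (Suc 0) y = \<zero>\<^bsub>C (Suc (Suc 0))\<^esub>" if "(x, y) \<in> (\<lambda>s. (\<epsilon> s, ?g s)) ` carrier ?K" for x y
      using that \<epsilon>_exact \<epsilon>D(1) cartierD(1)[OF \<psi>] by (auto simp: regular_module_def)
  qed (use exact \<delta>_\<delta> C_0 that in auto)
  show ?thesis by (rule that[OF \<Psi>(1)]) (auto intro!: \<Psi>(2,3) simp: regular_module_def)
qed

end

section \<open>Noetherianity of Ext\<close>

context injective_resolution_of_ring
begin

definition submod :: "nat \<Rightarrow> 'c set \<Rightarrow> bool" where
  "submod n N \<longleftrightarrow> N \<subseteq> carrier (C n) \<and> \<zero>\<^bsub>C n\<^esub> \<in> N \<and> (\<forall>x\<in>N. \<forall>y\<in>N. x \<oplus>\<^bsub>C n\<^esub> y \<in> N) \<and>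
     (\<forall>r\<in>carrier R. \<forall>x\<in>N. r \<odot>\<^bsub>C n\<^esub> x \<in> N)"

lemma submodD:
  assumes "submod n N"
  shows "x \<in> N \<Longrightarrow> x \<in> carrier (C n)" "\<zero>\<^bsub>C n\<^esub> \<in> N" "x \<in> N \<Longrightarrow> y \<in> N \<Longrightarrow> x \<oplus>\<^bsub>C n\<^esub> y \<in> N"
    "r \<in> carrier R \<Longrightarrow> x \<in> N \<Longrightarrow> r \<odot>\<^bsub>C n\<^esub> x \<in> N"
    "x \<in> N \<Longrightarrow> y \<in> N \<Longrightarrow> x \<ominus>\<^bsub>C n\<^esub> y \<in> N"
proof -
  show 1: "x \<in> N \<Longrightarrow> x \<in> carrier (C n)" "\<zero>\<^bsub>C n\<^esub> \<in> N" "x \<in> N \<Longrightarrow> y \<in> N \<Longrightarrow> x \<oplus>\<^bsub>C n\<^esub> y \<in> N"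
    "r \<in> carrier R \<Longrightarrow> x \<in> N \<Longrightarrow> r \<odot>\<^bsub>C n\<^esub> x \<in> N" for x y r using assms unfolding submod_def by auto
  have "\<ominus>\<^bsub>C n\<^esub> y = (\<ominus> \<one>) \<odot>\<^bsub>C n\<^esub> y" if "y \<in> carrier (C n)" using that by (simp add: C.smult_l_minus)
  then show "x \<in> N \<Longrightarrow> y \<in> N \<Longrightarrow> x \<ominus>\<^bsub>C n\<^esub> y \<in> N" using 1(1,3) 1(4)[of "\<ominus> \<one>" y] by (simp add: C.minus_eq)
qed

lemma submod_add_cancel:
  assumes "submod n N" "x \<in> carrier (C n)" "y \<in> N" "x \<oplus>\<^bsub>C n\<^esub> y \<in> N"
  shows "x \<in> N"
proof -
  have y: "y \<in> carrier (C n)" using submodD(1)[OF assms(1,3)] .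
  have "x = (x \<oplus>\<^bsub>C n\<^esub> y) \<ominus>\<^bsub>C n\<^esub> y" using assms(2) y by (simp add: C.minus_eq C.M.a_assoc C.M.r_neg)
  then show ?thesis using submodD(5)[OF assms(1,4,3)] by simp
qed

lemma submod_diff_cancel:
  assumes "submod n N" "x \<in> carrier (C n)" "y \<in> carrier (C n)" "x \<ominus>\<^bsub>C n\<^esub> y \<in> N"
  shows "x \<in> N \<longleftrightarrow> y \<in> N"
proof -
  have "(x \<ominus>\<^bsub>C n\<^esub> y) \<oplus>\<^bsub>C n\<^esub> y = x" using assms(2,3) by (simp add: C.minus_eq C.M.a_assoc C.M.l_neg)
  moreover have "y \<oplus>\<^bsub>C n\<^esub> (x \<ominus>\<^bsub>C n\<^esub> y) = x" using assms(2,3) by (simp add: C.minus_eq C.M.a_lcomm C.M.r_neg)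
  ultimately show ?thesis
    using submodD(3)[OF assms(1,4), of y] submod_add_cancel[OF assms(1,3,4)] by auto
qed

lemma submod_finsum:
  "submod n N \<Longrightarrow> finite A \<Longrightarrow> (\<And>a. a \<in> A \<Longrightarrow> f a \<in> N) \<Longrightarrow> (\<Oplus>\<^bsub>C n\<^esub>a\<in>A. f a) \<in> N"
  using finsum_additive_on[OF C.M.abelian_group_axioms C.M.abelian_group_axioms, of N n "\<lambda>x. x" n A f]
    submodD[of n N] by (metis subsetI)

lemma torsion_submod: "I \<subseteq> carrier R \<Longrightarrow> submod n (torsion I n)"
  unfolding submod_def
proof (intro conjI ballI)
  assume I: "I \<subseteq> carrier R"
  show "torsion I n \<subseteq> carrier (C n)" unfolding torsion_def by blast
  show "\<zero>\<^bsub>C n\<^esub> \<in> torsion I n" unfolding torsion_def using I by auto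
  fix x assume x: "x \<in> torsion I n"
  then have xc: "x \<in> carrier (C n)" unfolding torsion_def by blast
  show "r \<odot>\<^bsub>C n\<^esub> x \<in> torsion I n" if r: "r \<in> carrier R" for r
    unfolding torsion_def
  proof (intro CollectI conjI ballI)
    fix a assume a: "a \<in> I"
    then obtain t where t: "a [^] (t::nat) \<odot>\<^bsub>C n\<^esub> x = \<zero>\<^bsub>C n\<^esub>" using x unfolding torsion_def by blast
    have ac: "a [^] t \<in> carrier R" using a I by auto
    have "a [^] t \<odot>\<^bsub>C n\<^esub> (r \<odot>\<^bsub>C n\<^esub> x) = r \<odot>\<^bsub>C n\<^esub> (a [^] t \<odot>\<^bsub>C n\<^esub> x)"
      using ac r xc by (simp add: C.smult_assoc1[symmetric] m_comm)
    then show "\<exists>t::nat. a [^] t \<odot>\<^bsub>C n\<^esub> (r \<odot>\<^bsub>C n\<^esub> x) = \<zero>\<^bsub>C n\<^esub>" using t r by auto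
  qed (use r xc in simp)
  fix y assume y: "y \<in> torsion I n"
  then have yc: "y \<in> carrier (C n)" unfolding torsion_def by blast
  show "x \<oplus>\<^bsub>C n\<^esub> y \<in> torsion I n"
    unfolding torsion_def
  proof (intro CollectI conjI ballI)
    fix a assume a: "a \<in> I"
    then obtain t s where t: "a [^] (t::nat) \<odot>\<^bsub>C n\<^esub> x = \<zero>\<^bsub>C n\<^esub>" "a [^] (s::nat) \<odot>\<^bsub>C n\<^esub> y = \<zero>\<^bsub>C n\<^esub>"
      using x y unfolding torsion_def by blast
    have ac: "a \<in> carrier R" using a I by auto
    have "a [^] (s + t) \<odot>\<^bsub>C n\<^esub> x = a [^] s \<odot>\<^bsub>C n\<^esub> (a [^] t \<odot>\<^bsub>C n\<^esub> x)"
      using ac xc by (simp add: C.smult_assoc1[symmetric] nat_pow_mult)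
    moreover have "a [^] (s + t) \<odot>\<^bsub>C n\<^esub> y = a [^] t \<odot>\<^bsub>C n\<^esub> (a [^] s \<odot>\<^bsub>C n\<^esub> y)"
      using ac yc by (simp add: C.smult_assoc1[symmetric] nat_pow_mult add.commute)
    ultimately have "a [^] (s + t) \<odot>\<^bsub>C n\<^esub> (x \<oplus>\<^bsub>C n\<^esub> y) = \<zero>\<^bsub>C n\<^esub>"
      using t ac xc yc by (simp add: C.smult_r_distr)
    then show "\<exists>t::nat. a [^] t \<odot>\<^bsub>C n\<^esub> (x \<oplus>\<^bsub>C n\<^esub> y) = \<zero>\<^bsub>C n\<^esub>" by blast
  qed (use xc yc in simp)
qed

lemma image_submod:
  assumes "submod n N" shows "submod (Suc n) (\<delta> n ` N)"
  unfolding submod_def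
proof (intro conjI ballI)
  note ND = submodD[OF assms]
  show "\<delta> n ` N \<subseteq> carrier (C (Suc n))" using ND(1) \<delta>D(1) by blast
  show "\<zero>\<^bsub>C (Suc n)\<^esub> \<in> \<delta> n ` N" using ND(2) \<delta>_zero by (metis imageI)
  fix x assume "x \<in> \<delta> n ` N"
  then obtain u where u: "u \<in> N" "x = \<delta> n u" by blast
  show "r \<odot>\<^bsub>C (Suc n)\<^esub> x \<in> \<delta> n ` N" if "r \<in> carrier R" for r
    using \<delta>D(3)[OF that ND(1)[OF u(1)]] ND(4)[OF that u(1)] u(2) by (metis imageI)
  fix y assume "y \<in> \<delta> n ` N"
  then obtain v where v: "v \<in> N" "y = \<delta> n v" by blast
  show "x \<oplus>\<^bsub>C (Suc n)\<^esub> y \<in> \<delta> n ` N"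
    using \<delta>D(2)[OF ND(1)[OF u(1)] ND(1)[OF v(1)]] ND(3)[OF u(1) v(1)] u(2) v(2) by (metis imageI)
qed

lemma boundaries_submod: "I \<subseteq> carrier R \<Longrightarrow> submod (Suc n) (boundaries I n)"
  unfolding boundaries_def by (intro image_submod torsion_submod)

text \<open>\<open>Hom(R / J, C n)\<close>, a homomorphism being recorded by its value at 1.\<close>

definition annihilated :: "'a set \<Rightarrow> nat \<Rightarrow> 'c set" where
  "annihilated J n = {y \<in> carrier (C n). \<forall>a\<in>J. a \<odot>\<^bsub>C n\<^esub> y = \<zero>\<^bsub>C n\<^esub>}"

text \<open>These cocycles represent \<open>Ext\<^sup>n(R / J, R)\<close>; cohomological degree \<open>n\<close> is \<open>C (Suc n)\<close>.\<close>

definition cocycles :: "'a set \<Rightarrow> nat \<Rightarrow> 'c set" where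
  "cocycles J n = {x \<in> annihilated J (Suc n). \<delta> (Suc n) x = \<zero>\<^bsub>C (Suc (Suc n))\<^esub>}"

lemma annihilated_torsion: "J \<subseteq> carrier R \<Longrightarrow> annihilated J n \<subseteq> torsion J n"
  unfolding annihilated_def torsion_def by (auto intro!: exI[of _ "Suc 0"])

lemma annihilator_ideal:
  assumes "y \<in> carrier (C n)"
  shows "ideal {r \<in> carrier R. r \<odot>\<^bsub>C n\<^esub> y = \<zero>\<^bsub>C n\<^esub>} R"
  using assms by (intro ideal_intro) (auto simp: C.smult_l_distr C.smult_assoc1)

lemma annihilated_Idl:
  assumes "A \<subseteq> carrier R" "y \<in> carrier (C n)" "\<And>a. a \<in> A \<Longrightarrow> a \<odot>\<^bsub>C n\<^esub> y = \<zero>\<^bsub>C n\<^esub>" "r \<in> Idl A"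
  shows "r \<odot>\<^bsub>C n\<^esub> y = \<zero>\<^bsub>C n\<^esub>"
  using genideal_minimal[OF annihilator_ideal[OF assms(2)], of A] assms by blast

lemma annihilated_submod: "J \<subseteq> carrier R \<Longrightarrow> submod n (annihilated J n)"
  unfolding submod_def annihilated_def
proof (intro conjI ballI)
  assume J: "J \<subseteq> carrier R"
  fix r x assume r: "r \<in> carrier R" and x: "x \<in> {y \<in> carrier (C n). \<forall>a\<in>J. a \<odot>\<^bsub>C n\<^esub> y = \<zero>\<^bsub>C n\<^esub>}"
  have "a \<odot>\<^bsub>C n\<^esub> (r \<odot>\<^bsub>C n\<^esub> x) = r \<odot>\<^bsub>C n\<^esub> (a \<odot>\<^bsub>C n\<^esub> x)" if "a \<in> J" for a
  proof -
    have a: "a \<in> carrier R" and xc: "x \<in> carrier (C n)" using that J x by auto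
    show ?thesis using C.smult_assoc1[OF a r xc] C.smult_assoc1[OF r a xc] m_comm[OF a r] by simp
  qed
  then show "r \<odot>\<^bsub>C n\<^esub> x \<in> {y \<in> carrier (C n). \<forall>a\<in>J. a \<odot>\<^bsub>C n\<^esub> y = \<zero>\<^bsub>C n\<^esub>}" using r x by auto
qed (auto simp: C.smult_r_distr subset_iff)

text \<open>Sending \<open>x + r a\<close>, with \<open>x\<close> in \<open>Idl A\<close>, to
  \<open>r v\<close> is well defined because \<open>v\<close> is killed by the colon ideal;
  injectivity of \<open>C n\<close> extends this map to \<open>R\<close>, and its value at
  \<open>\<one>\<close> is the required \<open>w\<close>.\<close>

lemma ex_prescribed_multiple:
  assumes A: "A \<subseteq> carrier R" and a: "a \<in> carrier R" and v: "v \<in> annihilated {r \<in> carrier R. r \<otimes> a \<in> Idl A} n"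
  obtains w where "w \<in> carrier (C n)" "a \<odot>\<^bsub>C n\<^esub> w = v" "\<And>b. b \<in> A \<Longrightarrow> b \<odot>\<^bsub>C n\<^esub> w = \<zero>\<^bsub>C n\<^esub>"
proof -
  note I = genideal_ideal[OF A]
  have vc: "v \<in> carrier (C n)" and vz: "\<And>r. r \<in> carrier R \<Longrightarrow> r \<otimes> a \<in> Idl A \<Longrightarrow> r \<odot>\<^bsub>C n\<^esub> v = \<zero>\<^bsub>C n\<^esub>"
    using v unfolding annihilated_def by auto
  let ?S = "regular_module R"
  define G where "G = {(w \<oplus> r \<otimes> a, r \<odot>\<^bsub>C n\<^esub> v) | w r. w \<in> Idl A \<and> r \<in> carrier R}"
  have GI: "(w \<oplus> r \<otimes> a, r \<odot>\<^bsub>C n\<^esub> v) \<in> G" if "w \<in> Idl A" "r \<in> carrier R" for w r unfolding G_def using that by blast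
  note wc = ideal_carrier[OF I]
  have L: "linear_relation R ?S (C n) G" unfolding linear_relation_def
  proof (intro conjI allI impI)
    show "G \<subseteq> carrier ?S \<times> carrier (C n)" unfolding G_def using wc a vc by (auto simp: regular_module_def)
    show "(\<zero>\<^bsub>?S\<^esub>, \<zero>\<^bsub>C n\<^esub>) \<in> G" using GI[OF ideal_zero[OF I] zero_closed] a vc by (simp add: regular_module_def)
  next
    fix x y x' y' assume "(x, y) \<in> G" "(x', y') \<in> G"
    then obtain w r w' r' where *: "w \<in> Idl A" "r \<in> carrier R" "x = w \<oplus> r \<otimes> a" "y = r \<odot>\<^bsub>C n\<^esub> v"
      "w' \<in> Idl A" "r' \<in> carrier R" "x' = w' \<oplus> r' \<otimes> a" "y' = r' \<odot>\<^bsub>C n\<^esub> v" unfolding G_def by blast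
    have "x \<oplus> x' = (w \<oplus> w') \<oplus> (r \<oplus> r') \<otimes> a" using * wc a by (simp add: l_distr a_ac)
    moreover have "y \<oplus>\<^bsub>C n\<^esub> y' = (r \<oplus> r') \<odot>\<^bsub>C n\<^esub> v" using * vc by (simp add: C.smult_l_distr)
    ultimately show "(x \<oplus>\<^bsub>?S\<^esub> x', y \<oplus>\<^bsub>C n\<^esub> y') \<in> G"
      using GI[OF ideal_add[OF I *(1,5)], of "r \<oplus> r'"] * by (simp add: regular_module_def)
  next
    fix s x y assume s: "s \<in> carrier R" and "(x, y) \<in> G"
    then obtain w r where *: "w \<in> Idl A" "r \<in> carrier R" "x = w \<oplus> r \<otimes> a" "y = r \<odot>\<^bsub>C n\<^esub> v" unfolding G_def by blast
    have "s \<otimes> x = s \<otimes> w \<oplus> (s \<otimes> r) \<otimes> a" using * wc a s by (simp add: r_distr m_assoc)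
    moreover have "s \<odot>\<^bsub>C n\<^esub> y = (s \<otimes> r) \<odot>\<^bsub>C n\<^esub> v" using * s vc by (simp add: C.smult_assoc1)
    ultimately show "(s \<odot>\<^bsub>?S\<^esub> x, s \<odot>\<^bsub>C n\<^esub> y) \<in> G"
      using GI[OF ideal_mult[OF I s *(1)], of "s \<otimes> r"] * s by (simp add: regular_module_def)
  qed
  have Fz: "functional_at_zero ?S (C n) G" unfolding functional_at_zero_def
  proof (intro allI impI)
    fix y assume "(\<zero>\<^bsub>?S\<^esub>, y) \<in> G"
    then obtain w r where *: "w \<in> Idl A" "r \<in> carrier R" "\<zero> = w \<oplus> r \<otimes> a" "y = r \<odot>\<^bsub>C n\<^esub> v"
      unfolding G_def by (auto simp: regular_module_def)
    have "r \<otimes> a \<oplus> w \<in> Idl A" using * wc a ideal_zero[OF I] by (simp add: a_comm)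
    then have "r \<otimes> a \<in> Idl A" using ideal_add_cancel[OF I _ *(1)] *(2) a by simp
    then show "y = \<zero>\<^bsub>C n\<^esub>" using vz *(2,4) by simp
  qed
  obtain f where f: "f \<in> mod_hom R ?S (C n)" "\<And>x y. (x, y) \<in> G \<Longrightarrow> f x = y"
    using baer_extend[OF regular_module C_module C_baer L Fz] by blast
  have fr: "f r = r \<odot>\<^bsub>C n\<^esub> f \<one>" if "r \<in> carrier R" for r
    using mod_homD(3)[OF f(1), of r \<one>] that by (simp add: regular_module_def)
  show ?thesis
  proof (rule that[of "f \<one>"])
    show "f \<one> \<in> carrier (C n)" using mod_homD(1)[OF f(1), of \<one>] by (simp add: regular_module_def)
    have "f a = v" using f(2)[OF GI[OF ideal_zero[OF I] one_closed]] a vc by simp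
    then show "a \<odot>\<^bsub>C n\<^esub> f \<one> = v" using fr[OF a] by simp
    fix b assume b: "b \<in> A"
    then have "b \<in> Idl A" "b \<in> carrier R" using genideal_self[OF A] A by auto
    then show "b \<odot>\<^bsub>C n\<^esub> f \<one> = \<zero>\<^bsub>C n\<^esub>" using f(2)[OF GI[OF _ zero_closed, of b]] fr[of b] a vc by simp
  qed
qed

text \<open>\<open>Ext\<^sup>n(R / J, R)\<close> is Noetherian, by induction on \<open>n\<close>: if \<open>J = (a\<^sub>0, \<dots>, a\<^sub>m\<^sub>-\<^sub>1)\<close>, then
  \<open>Ext\<^sup>n\<^sup>+\<^sup>1(R / J, R)\<close> is a quotient of \<open>Ext\<^sup>n(J, R)\<close>, and \<open>J\<close> has a filtration with the cyclic quotients
  \<open>R / ((a\<^sub>l : l < i) : a\<^sub>i)\<close>.\<close>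

lemma ascending_cocycles_stabilize:
  assumes "ideal J R" "\<And>k. submod (Suc n) (N k)" "\<And>k. \<delta> n ` annihilated J n \<subseteq> N k" "\<And>k. N k \<subseteq> cocycles J n"
    "\<And>k. N k \<subseteq> N (Suc k)"
  shows "\<exists>k0. \<forall>k\<ge>k0. N k = N k0"
  using assms
proof (induction n arbitrary: J N)
  case 0
  \<comment> \<open>In degree zero the cocycles lie in the image of \<open>\<epsilon>\<close>, so
    the chain is one of ideals of \<open>R\<close>.\<close>
  define K where "K k = {s \<in> carrier R. \<epsilon> s \<in> N k}" for k
  have Ki: "ideal (K k) R" for k
    unfolding K_def using submodD[OF 0(2)[of k]]
    by (intro ideal_intro) (auto simp: \<epsilon>D[simplified] \<epsilon>_zero[simplified])
  have Kinc: "K k \<subseteq> K (Suc k)" for k unfolding K_def using 0(5)[of k] by blast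
  obtain k0 where k0: "\<And>k. k \<ge> k0 \<Longrightarrow> K k = K k0" using ascending_ideals_stabilize[of K, OF Ki Kinc] by metis
  have "N k = \<epsilon> ` K k" for k
  proof
    show "\<epsilon> ` K k \<subseteq> N k" unfolding K_def by blast
    show "N k \<subseteq> \<epsilon> ` K k"
    proof
      fix x assume x: "x \<in> N k"
      then have "x \<in> carrier (C (Suc 0))" "\<delta> (Suc 0) x = \<zero>\<^bsub>C (Suc (Suc 0))\<^esub>"
        using 0(4)[of k] unfolding cocycles_def annihilated_def by auto
      then have "x \<in> \<epsilon> ` carrier R" using \<epsilon>_exact by blast
      then show "x \<in> \<epsilon> ` K k" using x unfolding K_def by blast
    qed
  qed
  then show ?case using k0 by metis
next
  case (Suc n)
  note J = Suc.prems(1) and Nsub = Suc.prems(2) and ND = submodD[OF Suc.prems(2)] and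
    Nbd = Suc.prems(3) and Nco = Suc.prems(4)
  have Nmono: "k \<le> l \<Longrightarrow> N k \<subseteq> N l" for k l using lift_Suc_mono_le[of N] Suc.prems(5) by blast
  obtain A where A: "A \<subseteq> carrier R" "finite A" "J = Idl A" using finetely_gen[OF J] by blast
  obtain as where as: "set as = A" using finite_list[OF A(2)] by blast
  define m where "m = length as"
  define a where "a i = as ! i" for i
  have am: "a ` {..<m} = A" unfolding a_def m_def as[symmetric] by (auto simp: in_set_conv_nth)
  have ac: "a i \<in> carrier R" if "i < m" for i using am A(1) that by blast
  have aJ: "a i \<in> J" if "i < m" for i using am A(1,3) genideal_self that by blast
  have sub: "a ` {..<i} \<subseteq> carrier R" if "i \<le> m" for i using ac that by auto
  \<comment> \<open>\<open>Q i\<close> is the annihilator of \<open>a i\<close> modulo the earlier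
    generators. \<open>V i k\<close> holds the cochains killed by those generators whose coboundary
    is in \<open>N k\<close>; viewed as functionals they are evaluated by \<open>M i k\<close> on
    the next generator, which gives a chain in degree \<open>n\<close> for
    \<open>Q i\<close>.\<close>
  define Q where "Q i = {r \<in> carrier R. r \<otimes> a i \<in> Idl (a ` {..<i})}" for i
  define V where "V i k = {y \<in> carrier (C (Suc n)). \<delta> (Suc n) y \<in> N k \<and> (\<forall>l<i. a l \<odot>\<^bsub>C (Suc n)\<^esub> y = \<zero>\<^bsub>C (Suc n)\<^esub>)}" for i k
  define M where "M i k = (\<lambda>y. a i \<odot>\<^bsub>C (Suc n)\<^esub> y) ` V i k" for i k
  have Vsub: "submod (Suc n) (V i k)" if i: "i \<le> m" for i k
    unfolding submod_def
  proof (intro conjI ballI)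
    show "V i k \<subseteq> carrier (C (Suc n))" unfolding V_def by blast
    have "\<zero>\<^bsub>C (Suc n)\<^esub> \<in> V i k" unfolding V_def using ND(2)[of k] ac i by (auto simp: \<delta>_zero)
    then show "\<zero>\<^bsub>C (Suc n)\<^esub> \<in> V i k" .
    fix x assume x: "x \<in> V i k"
    show "x \<oplus>\<^bsub>C (Suc n)\<^esub> y \<in> V i k" if "y \<in> V i k" for y
      using x that ND(3)[of _ k] ac i unfolding V_def by (auto simp: \<delta>D C.smult_r_distr)
    fix r assume r: "r \<in> carrier R"
    have "a l \<odot>\<^bsub>C (Suc n)\<^esub> (r \<odot>\<^bsub>C (Suc n)\<^esub> x) = \<zero>\<^bsub>C (Suc n)\<^esub>" if "l < i" for l
    proof -
      have "a l \<in> carrier R" "x \<in> carrier (C (Suc n))" "a l \<odot>\<^bsub>C (Suc n)\<^esub> x = \<zero>\<^bsub>C (Suc n)\<^esub>"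
        using x that ac i unfolding V_def by auto
      then show ?thesis using r by (metis C.smult_assoc1 C.smult_r_null m_comm)
    qed
    then show "r \<odot>\<^bsub>C (Suc n)\<^esub> x \<in> V i k"
      using x r ND(4)[of r _ k] unfolding V_def by (auto simp: \<delta>D)
  qed
  have stab: "\<exists>k0. \<forall>k\<ge>k0. M i k = M i k0" if i: "i < m" for i
  proof (rule Suc.IH[of "Q i" "M i"])
    show "ideal (Q i) R" unfolding Q_def using i ac genideal_ideal[OF sub] by (intro ideal_colon) auto
    fix k
    note VD = submodD[OF Vsub[of i k]]
    show "submod (Suc n) (M i k)" unfolding submod_def
    proof (intro conjI ballI)
      show "M i k \<subseteq> carrier (C (Suc n))" unfolding M_def using VD(1) ac i by auto
      have "a i \<odot>\<^bsub>C (Suc n)\<^esub> \<zero>\<^bsub>C (Suc n)\<^esub> \<in> M i k"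
        unfolding M_def by (rule imageI[OF VD(2)]) (use i in simp)
      then show "\<zero>\<^bsub>C (Suc n)\<^esub> \<in> M i k" using ac i by simp
      fix x assume "x \<in> M i k"
      then obtain u where u: "u \<in> V i k" "x = a i \<odot>\<^bsub>C (Suc n)\<^esub> u" unfolding M_def by blast
      have uc: "u \<in> carrier (C (Suc n))" using VD(1) u i by simp
      show "r \<odot>\<^bsub>C (Suc n)\<^esub> x \<in> M i k" if r: "r \<in> carrier R" for r
      proof -
        have "r \<odot>\<^bsub>C (Suc n)\<^esub> x = a i \<odot>\<^bsub>C (Suc n)\<^esub> (r \<odot>\<^bsub>C (Suc n)\<^esub> u)"
          using u(2) uc r ac[OF i] by (simp add: C.smult_assoc1[symmetric] m_comm)
        then show ?thesis unfolding M_def using VD(4)[OF _ r u(1)] i by auto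
      qed
      fix y assume "y \<in> M i k"
      then obtain v where v: "v \<in> V i k" "y = a i \<odot>\<^bsub>C (Suc n)\<^esub> v" unfolding M_def by blast
      have vc: "v \<in> carrier (C (Suc n))" using VD(1) v i by simp
      have "x \<oplus>\<^bsub>C (Suc n)\<^esub> y = a i \<odot>\<^bsub>C (Suc n)\<^esub> (u \<oplus>\<^bsub>C (Suc n)\<^esub> v)"
        using u(2) v(2) uc vc ac[OF i] by (simp add: C.smult_r_distr)
      then show "x \<oplus>\<^bsub>C (Suc n)\<^esub> y \<in> M i k" unfolding M_def using VD(3)[OF _ u(1) v(1)] i by auto
    qed
    show "\<delta> n ` annihilated (Q i) n \<subseteq> M i k"
    proof
      fix x assume "x \<in> \<delta> n ` annihilated (Q i) n"
      then obtain v where v: "v \<in> annihilated (Q i) n" "x = \<delta> n v" by blast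
      \<comment> \<open>By injectivity of \<open>C n\<close> the cochain \<open>v\<close> is a
        multiple \<open>a i w\<close> with \<open>w\<close> killed by the earlier generators, so its
        coboundary is \<open>a i\<close> times a member of \<open>V i k\<close>.\<close>
      obtain w where w: "w \<in> carrier (C n)" "a i \<odot>\<^bsub>C n\<^esub> w = v" "\<And>b. b \<in> a ` {..<i} \<Longrightarrow> b \<odot>\<^bsub>C n\<^esub> w = \<zero>\<^bsub>C n\<^esub>"
        using ex_prescribed_multiple[OF sub ac[OF i] v(1)[unfolded Q_def]] i by (metis less_imp_le)
      have "a l \<odot>\<^bsub>C (Suc n)\<^esub> \<delta> n w = \<zero>\<^bsub>C (Suc n)\<^esub>" if "l < i" for l
        using \<delta>D(3)[of "a l" w n] ac[of l] w(1) w(3)[of "a l"] that i \<delta>_zero by auto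
      then have "\<delta> n w \<in> V i k" unfolding V_def using \<delta>D(1) \<delta>_\<delta> w(1) ND(2) by simp
      moreover have "x = a i \<odot>\<^bsub>C (Suc n)\<^esub> \<delta> n w" using v(2) w(2) \<delta>D(3)[OF ac[OF i] w(1)] by simp
      ultimately show "x \<in> M i k" unfolding M_def by blast
    qed
    show "M i k \<subseteq> cocycles (Q i) n"
    proof
      fix x assume "x \<in> M i k"
      then obtain y where y: "y \<in> V i k" "x = a i \<odot>\<^bsub>C (Suc n)\<^esub> y" unfolding M_def by blast
      have yc: "y \<in> carrier (C (Suc n))" and yN: "\<delta> (Suc n) y \<in> N k"
        and yz: "\<And>l. l < i \<Longrightarrow> a l \<odot>\<^bsub>C (Suc n)\<^esub> y = \<zero>\<^bsub>C (Suc n)\<^esub>" using y(1) unfolding V_def by auto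
      have "\<delta> (Suc n) y \<in> cocycles J (Suc n)" using yN Nco by blast
      then have "a i \<odot>\<^bsub>C (Suc (Suc n))\<^esub> \<delta> (Suc n) y = \<zero>\<^bsub>C (Suc (Suc n))\<^esub>"
        using aJ[OF i] unfolding cocycles_def annihilated_def by blast
      then have 1: "\<delta> (Suc n) x = \<zero>\<^bsub>C (Suc (Suc n))\<^esub>" unfolding y(2) using \<delta>D(3)[OF ac[OF i] yc] by simp
      have "r \<odot>\<^bsub>C (Suc n)\<^esub> x = \<zero>\<^bsub>C (Suc n)\<^esub>" if r: "r \<in> Q i" for r
      proof -
        have rc: "r \<in> carrier R" "r \<otimes> a i \<in> Idl (a ` {..<i})" using r unfolding Q_def by auto
        have "(r \<otimes> a i) \<odot>\<^bsub>C (Suc n)\<^esub> y = \<zero>\<^bsub>C (Suc n)\<^esub>"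
          using annihilated_Idl[OF sub yc _ rc(2)] yz i by auto
        then show ?thesis unfolding y(2) using rc(1) ac[OF i] yc by (simp add: C.smult_assoc1)
      qed
      moreover have "x \<in> carrier (C (Suc n))" unfolding y(2) using ac[OF i] yc by simp
      ultimately show "x \<in> cocycles (Q i) n" unfolding cocycles_def annihilated_def using 1 by blast
    qed
    show "M i k \<subseteq> M i (Suc k)" unfolding M_def V_def using Suc.prems(5)[of k] by blast
  qed
  have "\<exists>k0. \<forall>i<m. \<forall>k\<ge>k0. M i k = M i k0"
  proof -
    obtain f where f: "\<And>i. i < m \<Longrightarrow> \<forall>k\<ge>f i. M i k = M i (f i)" using stab by metis
    have "f i \<le> (\<Sum>j<m. f j)" if "i < m" for i using that by (intro member_le_sum) auto
    then have "M i k = M i (\<Sum>j<m. f j)" if "i < m" "k \<ge> (\<Sum>j<m. f j)" for i k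
      using f[OF that(1)] that by (metis order_trans)
    then show ?thesis by blast
  qed
  then obtain k0 where k0: "\<And>i k. i < m \<Longrightarrow> k \<ge> k0 \<Longrightarrow> M i k = M i k0" by blast
  have "N k \<subseteq> N k0" if k: "k \<ge> k0" for k
  proof
    fix x assume x: "x \<in> N k"
    have xc: "x \<in> carrier (C (Suc (Suc n)))" using ND(1) x by blast
    have "\<delta> (Suc (Suc n)) x = \<zero>\<^bsub>C (Suc (Suc (Suc n)))\<^esub>" using x Nco unfolding cocycles_def by blast
    then obtain y0 where y0: "y0 \<in> carrier (C (Suc n))" "x = \<delta> (Suc n) y0" using exact[OF xc] by blast
    \<comment> \<open>The preimage \<open>y0\<close> of \<open>x\<close> is corrected generator by
      generator. At stage \<open>i\<close> the equality of \<open>M i k\<close> and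
      \<open>M i k0\<close> provides \<open>z\<close> over \<open>N k0\<close> with
      \<open>a i z = a i y\<close>; then \<open>y - z\<close> is killed by \<open>a i\<close>, and
      the coboundary has changed only by an element of \<open>N k0\<close>. At the end
      \<open>y\<close> is killed by all of \<open>J\<close>.\<close>
    have "\<exists>y\<in>V i k. x \<ominus>\<^bsub>C (Suc (Suc n))\<^esub> \<delta> (Suc n) y \<in> N k0" if "i \<le> m" for i
      using that
    proof (induction i)
      case 0
      have "y0 \<in> V 0 k" unfolding V_def using y0 x by simp
      moreover have "x \<ominus>\<^bsub>C (Suc (Suc n))\<^esub> \<delta> (Suc n) y0 \<in> N k0"
        using y0(2) xc ND(2) by (simp add: C.minus_eq C.M.r_neg)
      ultimately show ?case by blast
    next
      case (Suc i)
      then obtain y where y: "y \<in> V i k" "x \<ominus>\<^bsub>C (Suc (Suc n))\<^esub> \<delta> (Suc n) y \<in> N k0" by auto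
      have i: "i < m" "i \<le> m" using Suc.prems by auto
      have "a i \<odot>\<^bsub>C (Suc n)\<^esub> y \<in> M i k0" using y(1) k0[OF i(1) k] unfolding M_def by blast
      then obtain z where z: "z \<in> V i k0" "a i \<odot>\<^bsub>C (Suc n)\<^esub> y = a i \<odot>\<^bsub>C (Suc n)\<^esub> z" unfolding M_def by blast
      have zk: "z \<in> V i k" using z(1) Nmono[OF k] unfolding V_def by blast
      note VD = submodD[OF Vsub[OF i(2), of k]]
      have c: "y \<in> carrier (C (Suc n))" "z \<in> carrier (C (Suc n))" using VD(1) y(1) zk by blast+
      let ?w = "y \<ominus>\<^bsub>C (Suc n)\<^esub> z"
      have w: "?w \<in> V i k" using VD(5)[OF y(1) zk] .
      have "a i \<odot>\<^bsub>C (Suc n)\<^esub> ?w = \<zero>\<^bsub>C (Suc n)\<^esub>"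
        using z(2) c ac[OF i(1)] by (simp add: C.minus_eq C.smult_r_distr C.smult_r_minus C.M.r_neg)
      then have 1: "?w \<in> V (Suc i) k" using w unfolding V_def by (auto simp: less_Suc_eq)
      have dz: "\<delta> (Suc n) z \<in> N k0" using z(1) unfolding V_def by blast
      have dc: "\<delta> (Suc n) y \<in> carrier (C (Suc (Suc n)))" "\<delta> (Suc n) z \<in> carrier (C (Suc (Suc n)))" using \<delta>D(1) c by auto
      have "x \<ominus>\<^bsub>C (Suc (Suc n))\<^esub> \<delta> (Suc n) ?w = (x \<ominus>\<^bsub>C (Suc (Suc n))\<^esub> \<delta> (Suc n) y) \<oplus>\<^bsub>C (Suc (Suc n))\<^esub> \<delta> (Suc n) z"
        unfolding mod_hom_diff[OF C_module C_module \<delta> c] using xc dc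
        by (simp add: C.minus_eq C.M.minus_add C.M.a_assoc)
      also have "\<dots> \<in> N k0" by (rule ND(3)[OF y(2) dz])
      finally show ?case using 1 by blast
    qed
    then obtain y where y: "y \<in> V m k" "x \<ominus>\<^bsub>C (Suc (Suc n))\<^esub> \<delta> (Suc n) y \<in> N k0" by blast
    have yc: "y \<in> carrier (C (Suc n))" and yz: "\<And>l. l < m \<Longrightarrow> a l \<odot>\<^bsub>C (Suc n)\<^esub> y = \<zero>\<^bsub>C (Suc n)\<^esub>" using y(1) unfolding V_def by auto
    have "y \<in> annihilated J (Suc n)" unfolding annihilated_def
    proof (intro CollectI conjI ballI yc)
      fix r assume "r \<in> J"
      then show "r \<odot>\<^bsub>C (Suc n)\<^esub> y = \<zero>\<^bsub>C (Suc n)\<^esub>" unfolding A(3)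
        by (rule annihilated_Idl[OF A(1) yc, rotated]) (use yz am in auto)
    qed
    then have "\<delta> (Suc n) y \<in> N k0" using Nbd by blast
    then show "x \<in> N k0" using submod_diff_cancel[OF Nsub xc _ y(2)] \<delta>D(1)[OF yc] by blast
  qed
  then have "\<forall>k\<ge>k0. N k = N k0" using Nmono by blast
  then show ?case by blast
qed

text \<open>The cocycles whose class in local cohomology is killed by \<open>a^k\<close> form an
  increasing sequence of submodules containing the coboundaries of Ext, so
  \<open>ascending_cocycles_stabilize\<close> gives one exponent for all of them.\<close>

lemma power_torsion_bound:
  assumes I: "ideal I R" and a: "a \<in> carrier R"
  obtains T where "\<And>x s. x \<in> cocycles I n \<Longrightarrow> a [^] (s::nat) \<odot>\<^bsub>C (Suc n)\<^esub> x \<in> boundaries I n \<Longrightarrow>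
    a [^] (T::nat) \<odot>\<^bsub>C (Suc n)\<^esub> x \<in> boundaries I n"
proof -
  have Ic: "I \<subseteq> carrier R" using ideal_carrier[OF I] by blast
  note bdD = submodD[OF boundaries_submod[OF Ic, of n]]
  note anD = submodD[OF annihilated_submod[OF Ic]]
  define N where "N k = {x \<in> cocycles I n. a [^] (k::nat) \<odot>\<^bsub>C (Suc n)\<^esub> x \<in> boundaries I n}" for k
  have coc: "x \<in> carrier (C (Suc n))" if "x \<in> cocycles I n" for x using that unfolding cocycles_def annihilated_def by blast
  have pc: "a [^] k \<in> carrier R" for k :: nat using a by simp
  have step: "a [^] Suc k \<odot>\<^bsub>C (Suc n)\<^esub> x = a \<odot>\<^bsub>C (Suc n)\<^esub> (a [^] k \<odot>\<^bsub>C (Suc n)\<^esub> x)" if "x \<in> cocycles I n" for k x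
  proof -
    have "a [^] Suc k = a \<otimes> a [^] k" using a pc by (simp add: m_comm)
    then show ?thesis using C.smult_assoc1[OF a pc coc[OF that], of k] by simp
  qed
  have inc: "N k \<subseteq> N (Suc k)" for k
  proof
    fix x assume x: "x \<in> N k"
    then have "x \<in> cocycles I n" "a [^] k \<odot>\<^bsub>C (Suc n)\<^esub> x \<in> boundaries I n" unfolding N_def by auto
    then show "x \<in> N (Suc k)" unfolding N_def using step bdD(4)[OF a] by simp
  qed
  have "\<exists>k0. \<forall>k\<ge>k0. N k = N k0"
  proof (rule ascending_cocycles_stabilize[where N = N and n = n and J = I, OF I _ _ _ inc])
    fix k
    show "N k \<subseteq> cocycles I n" unfolding N_def by blast
    show "submod (Suc n) (N k)" unfolding submod_def
    proof (intro conjI ballI)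
      show "N k \<subseteq> carrier (C (Suc n))" unfolding N_def using coc by blast
      show "\<zero>\<^bsub>C (Suc n)\<^esub> \<in> N k" unfolding N_def cocycles_def using anD(2) bdD(2) pc by (simp add: \<delta>_zero)
      fix x assume x: "x \<in> N k"
      then have x': "x \<in> annihilated I (Suc n)" "\<delta> (Suc n) x = \<zero>\<^bsub>C (Suc (Suc n))\<^esub>" "x \<in> carrier (C (Suc n))"
        "a [^] k \<odot>\<^bsub>C (Suc n)\<^esub> x \<in> boundaries I n" using coc unfolding N_def cocycles_def by auto
      show "r \<odot>\<^bsub>C (Suc n)\<^esub> x \<in> N k" if r: "r \<in> carrier R" for r
      proof -
        have "a [^] k \<odot>\<^bsub>C (Suc n)\<^esub> (r \<odot>\<^bsub>C (Suc n)\<^esub> x) = r \<odot>\<^bsub>C (Suc n)\<^esub> (a [^] k \<odot>\<^bsub>C (Suc n)\<^esub> x)"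
          using C.smult_assoc1[OF pc r x'(3), of k] C.smult_assoc1[OF r pc x'(3), of k] m_comm[OF pc r] by simp
        also have "\<dots> \<in> boundaries I n" using bdD(4)[OF r x'(4)] .
        finally show ?thesis unfolding N_def cocycles_def using anD(4)[OF r x'(1)] \<delta>D(3)[OF r x'(3)] x'(2) r by simp
      qed
      fix y assume y: "y \<in> N k"
      then have y': "y \<in> annihilated I (Suc n)" "\<delta> (Suc n) y = \<zero>\<^bsub>C (Suc (Suc n))\<^esub>" "y \<in> carrier (C (Suc n))"
        "a [^] k \<odot>\<^bsub>C (Suc n)\<^esub> y \<in> boundaries I n" using coc unfolding N_def cocycles_def by auto
      have "a [^] k \<odot>\<^bsub>C (Suc n)\<^esub> (x \<oplus>\<^bsub>C (Suc n)\<^esub> y) \<in> boundaries I n"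
        using C.smult_r_distr[OF pc x'(3) y'(3), of k] bdD(3)[OF x'(4) y'(4)] by simp
      then show "x \<oplus>\<^bsub>C (Suc n)\<^esub> y \<in> N k"
        unfolding N_def cocycles_def using anD(3)[OF x'(1) y'(1)] \<delta>D(2)[OF x'(3) y'(3)] x'(2) y'(2) by simp
    qed
    show "\<delta> n ` annihilated I n \<subseteq> N k"
    proof
      fix x assume "x \<in> \<delta> n ` annihilated I n"
      then obtain y where y: "y \<in> annihilated I n" "x = \<delta> n y" by blast
      have yc: "y \<in> carrier (C n)" and yz: "\<And>b. b \<in> I \<Longrightarrow> b \<odot>\<^bsub>C n\<^esub> y = \<zero>\<^bsub>C n\<^esub>" using y unfolding annihilated_def by auto
      have "b \<odot>\<^bsub>C (Suc n)\<^esub> x = \<zero>\<^bsub>C (Suc n)\<^esub>" if "b \<in> I" for b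
        unfolding y(2) using \<delta>D(3)[of b y n] yz[OF that] that Ic yc \<delta>_zero by auto
      then have "x \<in> cocycles I n" unfolding cocycles_def annihilated_def y(2) using \<delta>D(1) \<delta>_\<delta> yc by simp
      moreover have "x \<in> boundaries I n" unfolding boundaries_def y(2) using annihilated_torsion[OF Ic] y(1) by blast
      ultimately show "x \<in> N k" unfolding N_def using bdD(4)[OF pc] by simp
    qed
  qed
  then obtain T where T: "\<And>k. k \<ge> T \<Longrightarrow> N k = N T" by blast
  have Nle: "N s \<subseteq> N T" for s
  proof (cases "s \<ge> T")
    case True
    then show ?thesis using T[OF True] by blast
  next
    case False
    then show ?thesis using lift_Suc_mono_le[of N s T] inc by simp
  qed
  show ?thesis
    by (rule that[of T]) (use Nle in \<open>unfold N_def, blast\<close>)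
qed

end

section \<open>Frobenius and Cartier maps on local cohomology\<close>

context frobenius_resolution
begin

lemma hom_torsion:
  assumes "h \<in> mod_hom R (C m) (C n)" "I \<subseteq> carrier R" "x \<in> torsion I m"
  shows "h x \<in> torsion I n"
  unfolding torsion_def
proof (intro CollectI conjI ballI)
  have xc: "x \<in> carrier (C m)" using assms(3) unfolding torsion_def by blast
  show "h x \<in> carrier (C n)" by (rule mod_homD(1)[OF assms(1) xc])
  fix a assume a: "a \<in> I"
  then obtain t where t: "a [^] (t::nat) \<odot>\<^bsub>C m\<^esub> x = \<zero>\<^bsub>C m\<^esub>" using assms(3) unfolding torsion_def by blast
  have "a [^] t \<odot>\<^bsub>C n\<^esub> h x = h (a [^] t \<odot>\<^bsub>C m\<^esub> x)" using mod_homD(3)[OF assms(1) _ xc] a assms(2) by auto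
  then show "\<exists>t::nat. a [^] t \<odot>\<^bsub>C n\<^esub> h x = \<zero>\<^bsub>C n\<^esub>" using t mod_hom_zero[OF C_module C_module assms(1)] by auto
qed

lemma frobenius_hom_torsion:
  assumes h: "h \<in> mod_hom R (C m) (FC n)" and I: "I \<subseteq> carrier R" and x: "x \<in> torsion I m"
  shows "h x \<in> torsion I n"
  unfolding torsion_def
proof (intro CollectI conjI ballI)
  have xc: "x \<in> carrier (C m)" using x unfolding torsion_def by blast
  show "h x \<in> carrier (C n)" using mod_homD(1)[OF h xc] by simp
  fix a assume a: "a \<in> I"
  then obtain t where t: "a [^] (t::nat) \<odot>\<^bsub>C m\<^esub> x = \<zero>\<^bsub>C m\<^esub>" using x unfolding torsion_def by blast
  have ac: "a \<in> carrier R" using a I by blast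
  have "a [^] (t * q) \<odot>\<^bsub>C n\<^esub> h x = h (a [^] t \<odot>\<^bsub>C m\<^esub> x)"
    using mod_homD(3)[OF h _ xc, of "a [^] t"] ac by (simp add: nat_pow_pow)
  also have "\<dots> = \<zero>\<^bsub>C n\<^esub>" unfolding t using mod_hom_zero[OF C_module FC_module h] by simp
  finally show "\<exists>t::nat. a [^] t \<odot>\<^bsub>C n\<^esub> h x = \<zero>\<^bsub>C n\<^esub>" by blast
qed

text \<open>The twisted action of \<open>a^t\<close> multiplies by \<open>a^(t q)\<close>, a
  multiple of \<open>a^t\<close> since \<open>q \<ge> 1\<close>.\<close>

lemma twisted_pow_annihilates:
  assumes "a \<in> carrier R" "x \<in> carrier (C m)" "a [^] (t::nat) \<odot>\<^bsub>C m\<^esub> x = \<zero>\<^bsub>C m\<^esub>"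
  shows "(a [^] t) \<odot>\<^bsub>FC m\<^esub> x = \<zero>\<^bsub>C m\<^esub>"
proof -
  have "(a [^] t) \<odot>\<^bsub>FC m\<^esub> x = a [^] (t * (q - 1)) \<odot>\<^bsub>C m\<^esub> (a [^] t \<odot>\<^bsub>C m\<^esub> x)"
  proof -
    have "t * q = t * (q - 1) + t" using q by (cases q) auto
    then have "(a [^] t) [^] q = a [^] (t * (q - 1)) \<otimes> a [^] t" using assms(1) by (simp add: nat_pow_pow nat_pow_mult)
    then show ?thesis using assms(1,2) by (simp add: C.smult_assoc1)
  qed
  then show ?thesis unfolding assms(3) using assms(1) by simp
qed

lemma cartier_hom_torsion:
  assumes h: "h \<in> mod_hom R (FC m) (C n)" and I: "I \<subseteq> carrier R" and x: "x \<in> torsion I m"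
  shows "h x \<in> torsion I n"
  unfolding torsion_def
proof (intro CollectI conjI ballI)
  have xc: "x \<in> carrier (C m)" using x unfolding torsion_def by blast
  show "h x \<in> carrier (C n)" using mod_homD(1)[OF h] xc by simp
  fix a assume a: "a \<in> I"
  then obtain t where t: "a [^] (t::nat) \<odot>\<^bsub>C m\<^esub> x = \<zero>\<^bsub>C m\<^esub>" using x unfolding torsion_def by blast
  have ac: "a \<in> carrier R" using a I by blast
  have "a [^] t \<odot>\<^bsub>C n\<^esub> h x = h ((a [^] t) \<odot>\<^bsub>FC m\<^esub> x)"
    using mod_homD(3)[OF h, of "a [^] t" x] ac xc by simp
  also have "\<dots> = \<zero>\<^bsub>C n\<^esub>" unfolding twisted_pow_annihilates[OF ac xc t] using mod_hom_zero[OF FC_module C_module h] by simp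
  finally show "\<exists>t::nat. a [^] t \<odot>\<^bsub>C n\<^esub> h x = \<zero>\<^bsub>C n\<^esub>" by blast
qed

lemma twisted_hom_torsion:
  assumes h: "h \<in> mod_hom R (FC m) (FC n)" and I: "I \<subseteq> carrier R" and x: "x \<in> torsion I m"
  shows "h x \<in> torsion I n"
  unfolding torsion_def
proof (intro CollectI conjI ballI)
  have xc: "x \<in> carrier (C m)" using x unfolding torsion_def by blast
  show "h x \<in> carrier (C n)" using mod_homD(1)[OF h] xc by simp
  fix a assume a: "a \<in> I"
  then obtain t where t: "a [^] (t::nat) \<odot>\<^bsub>C m\<^esub> x = \<zero>\<^bsub>C m\<^esub>" using x unfolding torsion_def by blast
  have ac: "a \<in> carrier R" using a I by blast
  have "a [^] (t * q) \<odot>\<^bsub>C n\<^esub> h x = h ((a [^] t) \<odot>\<^bsub>FC m\<^esub> x)"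
    using mod_homD(3)[OF h, of "a [^] t" x] ac xc by (simp add: nat_pow_pow)
  also have "\<dots> = \<zero>\<^bsub>C n\<^esub>" unfolding twisted_pow_annihilates[OF ac xc t] using mod_hom_zero[OF FC_module FC_module h] by simp
  finally show "\<exists>t::nat. a [^] t \<odot>\<^bsub>C n\<^esub> h x = \<zero>\<^bsub>C n\<^esub>" by blast
qed

text \<open>\<open>\<psi> \<circ> (c \<cdot>) \<circ> F\<close> induces multiplication by \<open>\<psi> c\<close> on local cohomology.\<close>

lemma cartier_frobenius_homotopy:
  assumes \<psi>: "cartier \<psi>"
    and F: "\<And>n. F n \<in> mod_hom R (C n) (FC n)" "\<And>n x. x \<in> carrier (C n) \<Longrightarrow> F (Suc n) (\<delta> n x) = \<delta> n (F n x)"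
      "\<And>s. s \<in> carrier R \<Longrightarrow> F 1 (\<epsilon> s) = \<epsilon> (s [^] q)"
    and \<Psi>: "\<And>n. \<Psi> n \<in> mod_hom R (FC n) (C n)" "\<And>n x. x \<in> carrier (C n) \<Longrightarrow> \<Psi> (Suc n) (\<delta> n x) = \<delta> n (\<Psi> n x)"
      "\<And>s. s \<in> carrier R \<Longrightarrow> \<Psi> 1 (\<epsilon> s) = \<epsilon> (\<psi> s)"
    and c: "c \<in> carrier R" and I: "I \<subseteq> carrier R"
    and x: "x \<in> torsion I (Suc n)" "\<delta> (Suc n) x = \<zero>\<^bsub>C (Suc (Suc n))\<^esub>"
  shows "\<Psi> (Suc n) (c \<odot>\<^bsub>C (Suc n)\<^esub> F (Suc n) x) \<in> boundaries I n \<longleftrightarrow> \<psi> c \<odot>\<^bsub>C (Suc n)\<^esub> x \<in> boundaries I n"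
proof -
  note FD = mod_homD[OF F(1), simplified] and \<Psi>D = mod_homD[OF \<Psi>(1), simplified] and \<psi>D = cartierD[OF \<psi>]
  \<comment> \<open>The difference of the two maps is linear: the \<open>q\<close>-th powers of
    scalars produced by \<open>F\<close> are undone by \<open>\<Psi>\<close>. On
    \<open>\<epsilon> s\<close> it vanishes since \<open>\<psi> (s^q c) = s \<psi> c\<close>, so on
    cocycles it is null homotopic.\<close>
  define t where "t n x = \<Psi> n (c \<odot>\<^bsub>C n\<^esub> F n x) \<ominus>\<^bsub>C n\<^esub> \<psi> c \<odot>\<^bsub>C n\<^esub> x" for n x
  have \<psi>c: "\<psi> c \<in> carrier R" by (rule \<psi>D(1)[OF c])
  have t: "t n \<in> mod_hom R (C n) (C n)" for n
  proof (rule mod_homI)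
    fix x assume x: "x \<in> carrier (C n)"
    show "t n x \<in> carrier (C n)" unfolding t_def using x FD(1) \<Psi>D(1) c \<psi>c by simp
    show "t n (x \<oplus>\<^bsub>C n\<^esub> y) = t n x \<oplus>\<^bsub>C n\<^esub> t n y" if y: "y \<in> carrier (C n)" for y
      unfolding t_def using x y FD(1,2) \<Psi>D(1,2) c \<psi>c
      by (simp add: C.smult_r_distr C.minus_eq C.M.minus_add C.M.a_ac)
    fix r assume r: "r \<in> carrier R"
    have "c \<odot>\<^bsub>C n\<^esub> F n (r \<odot>\<^bsub>C n\<^esub> x) = (r [^] q) \<odot>\<^bsub>C n\<^esub> (c \<odot>\<^bsub>C n\<^esub> F n x)"
      using FD(3)[OF r x] C.smult_assoc1[of c "r [^] q" "F n x" n] C.smult_assoc1[of "r [^] q" c "F n x" n]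
        c r FD(1)[OF x] m_comm[of c "r [^] q"] by simp
    then have "\<Psi> n (c \<odot>\<^bsub>C n\<^esub> F n (r \<odot>\<^bsub>C n\<^esub> x)) = r \<odot>\<^bsub>C n\<^esub> \<Psi> n (c \<odot>\<^bsub>C n\<^esub> F n x)"
      using \<Psi>D(3)[OF r, of "c \<odot>\<^bsub>C n\<^esub> F n x" n] c FD(1)[OF x] by simp
    moreover have "\<psi> c \<odot>\<^bsub>C n\<^esub> (r \<odot>\<^bsub>C n\<^esub> x) = r \<odot>\<^bsub>C n\<^esub> (\<psi> c \<odot>\<^bsub>C n\<^esub> x)"
      using C.smult_assoc1[OF \<psi>c r x] C.smult_assoc1[OF r \<psi>c x] m_comm[OF \<psi>c r] by simp
    ultimately show "t n (r \<odot>\<^bsub>C n\<^esub> x) = r \<odot>\<^bsub>C n\<^esub> t n x"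
      unfolding t_def using r x c \<psi>c FD(1)[OF x] \<Psi>D(1)
      by (simp add: C.minus_eq C.smult_r_distr C.smult_r_minus)
  qed
  have td: "t (Suc n) (\<delta> n x) = \<delta> n (t n x)" if x: "x \<in> carrier (C n)" for n x
  proof -
    have a: "c \<odot>\<^bsub>C n\<^esub> F n x \<in> carrier (C n)" using c FD(1)[OF x] by simp
    have "\<Psi> (Suc n) (c \<odot>\<^bsub>C (Suc n)\<^esub> F (Suc n) (\<delta> n x)) = \<delta> n (\<Psi> n (c \<odot>\<^bsub>C n\<^esub> F n x))"
      unfolding F(2)[OF x] using \<delta>D(3)[OF c FD(1)[OF x]] \<Psi>(2)[OF a] by simp
    moreover have "\<psi> c \<odot>\<^bsub>C (Suc n)\<^esub> \<delta> n x = \<delta> n (\<psi> c \<odot>\<^bsub>C n\<^esub> x)" using \<delta>D(3)[OF \<psi>c x] by simp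
    ultimately show ?thesis unfolding t_def
      using mod_hom_diff[OF C_module C_module \<delta>, of "\<Psi> n (c \<odot>\<^bsub>C n\<^esub> F n x)" n "\<psi> c \<odot>\<^bsub>C n\<^esub> x"] \<Psi>D(1)[OF a] \<psi>c x by simp
  qed
  have t1: "t 1 x = \<zero>\<^bsub>C 1\<^esub>" if x: "x \<in> carrier (C 1)" "\<delta> 1 x = \<zero>\<^bsub>C 2\<^esub>" for x
  proof -
    obtain s where s: "s \<in> carrier R" "x = \<epsilon> s" using \<epsilon>_exact[of x] x by (auto simp: numeral_2_eq_2)
    have "\<Psi> 1 (c \<odot>\<^bsub>C 1\<^esub> F 1 x) = \<Psi> 1 (\<epsilon> (s [^] q \<otimes> c))"
      unfolding s(2) F(3)[OF s(1)] using \<epsilon>D(3)[of c "s [^] q"] c s(1) by (simp add: m_comm)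
    also have "\<dots> = \<epsilon> (s \<otimes> \<psi> c)" using \<Psi>(3)[of "s [^] q \<otimes> c"] \<psi>D(3)[OF s(1) c] s(1) c by simp
    also have "\<dots> = \<psi> c \<odot>\<^bsub>C 1\<^esub> x" unfolding s(2) using \<epsilon>D(3)[OF \<psi>c s(1)] m_comm[OF \<psi>c s(1)] by simp
    finally show ?thesis unfolding t_def using \<psi>c x(1) by (simp add: C.minus_eq C.M.r_neg)
  qed
  have xc: "x \<in> carrier (C (Suc n))" using x unfolding torsion_def by blast
  have "\<exists>h\<in>mod_hom R (C (Suc n)) (C n). \<forall>x\<in>carrier (C (Suc n)).
    \<delta> (Suc n) x = \<zero>\<^bsub>C (Suc (Suc n))\<^esub> \<longrightarrow> t (Suc n) x = \<delta> n (h x)"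
    by (rule null_homotopic[where C = C and D = C and d = \<delta> and d' = \<delta> and t = t, OF C_module \<delta> C_module C_baer \<delta> _ \<delta>_\<delta> t td])
      (use exact t1 in \<open>auto simp: numeral_2_eq_2\<close>)
  then obtain h where h: "h \<in> mod_hom R (C (Suc n)) (C n)" "t (Suc n) x = \<delta> n (h x)" using xc x(2) by blast
  \<comment> \<open>The homotopy is linear and hence preserves torsion, so the coboundary is taken
    inside the torsion subcomplex.\<close>
  have "t (Suc n) x \<in> boundaries I n" unfolding h(2) boundaries_def using hom_torsion[OF h(1) I x(1)] by blast
  then show ?thesis unfolding t_def
    by (intro submod_diff_cancel[OF boundaries_submod[OF I]]) (use \<Psi>D(1) FD(1) xc c \<psi>c in auto)
qed

lemma boundaries_map:
  assumes "\<And>n x. x \<in> carrier (C n) \<Longrightarrow> f (Suc n) (\<delta> n x) = \<delta> n (f n x)"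
    and "\<And>n x. x \<in> torsion I n \<Longrightarrow> f n x \<in> torsion I n" "x \<in> boundaries I n"
  shows "f (Suc n) x \<in> boundaries I n"
proof -
  obtain y where y: "y \<in> torsion I n" "x = \<delta> n y" using assms(3) unfolding boundaries_def by blast
  then have "f (Suc n) x = \<delta> n (f n y)" using assms(1) unfolding torsion_def by blast
  then show ?thesis unfolding boundaries_def using assms(2)[OF y(1)] by blast
qed

text \<open>An associated prime of local cohomology is already associated to the image of \<open>Ext(R / I, R)\<close>:
  a class killed by the \<open>q\<close>-th powers of elements of \<open>I\<close> is a combination of Frobenius images of
  classes \<open>\<psi>\<^sub>b x\<close> killed by \<open>I\<close>.\<close>

lemma associated_prime_cocycle:
  assumes I: "ideal I R" and P: "primeideal P R"
    and x: "x \<in> torsion I (Suc n)" "\<delta> (Suc n) x = \<zero>\<^bsub>C (Suc (Suc n))\<^esub>"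
    and killed: "\<And>a. a \<in> I \<Longrightarrow> (a [^] q) \<odot>\<^bsub>C (Suc n)\<^esub> x = \<zero>\<^bsub>C (Suc n)\<^esub>"
    and ann: "P = {r \<in> carrier R. r \<odot>\<^bsub>C (Suc n)\<^esub> x \<in> boundaries I n}"
  obtains z where "z \<in> cocycles I n" "P = {r \<in> carrier R. r \<odot>\<^bsub>C (Suc n)\<^esub> z \<in> boundaries I n}"
proof -
  have Ic: "I \<subseteq> carrier R" using ideal_carrier[OF I] by blast
  note bd = boundaries_submod[OF Ic, of n] and bdD = submodD[OF boundaries_submod[OF Ic, of n]]
  have xc: "x \<in> carrier (C (Suc n))" using x unfolding torsion_def by blast
  obtain G \<psi> where G: "frob_generates G" and \<psi>: "\<forall>b\<in>G. cartier (\<psi> b)"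
    and \<psi>comb: "\<forall>x\<in>carrier R. x = frob_comb (\<lambda>b. \<psi> b x) G" using ex_frobenius_basis by metis
  have fG: "finite G" "G \<subseteq> carrier R" using G unfolding frob_generates_def by auto
  have Gc: "b \<in> G \<Longrightarrow> b \<in> carrier R" for b using fG by blast
  obtain F where F: "\<And>n. F n \<in> mod_hom R (C n) (FC n)" "\<And>n x. x \<in> carrier (C n) \<Longrightarrow> F (Suc n) (\<delta> n x) = \<delta> n (F n x)"
    "\<And>s. s \<in> carrier R \<Longrightarrow> F 1 (\<epsilon> s) = \<epsilon> (s [^] q)" using frobenius_lift by (metis One_nat_def)
  have "\<forall>b\<in>G. \<exists>\<Psi>. (\<forall>n. \<Psi> n \<in> mod_hom R (FC n) (C n)) \<and> (\<forall>n. \<forall>x\<in>carrier (C n). \<Psi> (Suc n) (\<delta> n x) = \<delta> n (\<Psi> n x)) \<and>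
    (\<forall>s\<in>carrier R. \<Psi> 1 (\<epsilon> s) = \<epsilon> (\<psi> b s))"
  proof
    fix b assume "b \<in> G"
    then have "cartier (\<psi> b)" using \<psi> by blast
    from cartier_lift[OF this] show "\<exists>\<Psi>. (\<forall>n. \<Psi> n \<in> mod_hom R (FC n) (C n)) \<and> (\<forall>n. \<forall>x\<in>carrier (C n). \<Psi> (Suc n) (\<delta> n x) = \<delta> n (\<Psi> n x)) \<and>
      (\<forall>s\<in>carrier R. \<Psi> 1 (\<epsilon> s) = \<epsilon> (\<psi> b s))" by (metis One_nat_def)
  qed
  then obtain \<Psi> where \<Psi>: "\<And>b n. b \<in> G \<Longrightarrow> \<Psi> b n \<in> mod_hom R (FC n) (C n)"
    "\<And>b n x. b \<in> G \<Longrightarrow> x \<in> carrier (C n) \<Longrightarrow> \<Psi> b (Suc n) (\<delta> n x) = \<delta> n (\<Psi> b n x)"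
    "\<And>b s. b \<in> G \<Longrightarrow> s \<in> carrier R \<Longrightarrow> \<Psi> b 1 (\<epsilon> s) = \<epsilon> (\<psi> b s)" by metis
  note FD = mod_homD[OF F(1), simplified]
  have \<Psi>D: "b \<in> G \<Longrightarrow> x \<in> carrier (C n) \<Longrightarrow> \<Psi> b n x \<in> carrier (C n)"
    "b \<in> G \<Longrightarrow> x \<in> carrier (C n) \<Longrightarrow> y \<in> carrier (C n) \<Longrightarrow> \<Psi> b n (x \<oplus>\<^bsub>C n\<^esub> y) = \<Psi> b n x \<oplus>\<^bsub>C n\<^esub> \<Psi> b n y"
    "b \<in> G \<Longrightarrow> r \<in> carrier R \<Longrightarrow> x \<in> carrier (C n) \<Longrightarrow> \<Psi> b n (r [^] q \<odot>\<^bsub>C n\<^esub> x) = r \<odot>\<^bsub>C n\<^esub> \<Psi> b n x"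
    for b x y r n using mod_homD[OF \<Psi>(1)[of b n]] by auto
  have \<Psi>0: "\<Psi> b n \<zero>\<^bsub>C n\<^esub> = \<zero>\<^bsub>C n\<^esub>" if "b \<in> G" for b n
    using mod_hom_zero[OF FC_module C_module \<Psi>(1)[OF that]] by simp
  \<comment> \<open>The lift to the resolution of the dual basis expansion, with \<open>F\<close> in
    the role of the \<open>q\<close>-th power; it will agree with the identity up to homotopy. It
    commutes only with \<open>q\<close>-th powers of scalars, so the homotopy lives on the twisted
    complex.\<close>
  define S where "S n x = (\<Oplus>\<^bsub>C n\<^esub>b\<in>G. b \<odot>\<^bsub>C n\<^esub> F n (\<Psi> b n x))" for n x
  have terms: "b \<odot>\<^bsub>C n\<^esub> F n (\<Psi> b n x) \<in> carrier (C n)" if "b \<in> G" "x \<in> carrier (C n)" for b n x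
    using FD(1)[OF \<Psi>D(1)[OF that]] Gc[OF that(1)] by simp
  have Sc: "S n x \<in> carrier (C n)" if "x \<in> carrier (C n)" for n x
    unfolding S_def using terms that by (intro C.M.finsum_closed) auto
  define t where "t n x = x \<ominus>\<^bsub>C n\<^esub> S n x" for n x
  have t: "t n \<in> mod_hom R (FC n) (FC n)" for n
  proof (rule mod_homI; unfold twist_simps)
    fix x assume x: "x \<in> carrier (C n)"
    show "t n x \<in> carrier (C n)" unfolding t_def using x Sc by simp
    show "t n (x \<oplus>\<^bsub>C n\<^esub> y) = t n x \<oplus>\<^bsub>C n\<^esub> t n y" if y: "y \<in> carrier (C n)" for y
    proof -
      have "S n (x \<oplus>\<^bsub>C n\<^esub> y) = (\<Oplus>\<^bsub>C n\<^esub>b\<in>G. b \<odot>\<^bsub>C n\<^esub> F n (\<Psi> b n x) \<oplus>\<^bsub>C n\<^esub> b \<odot>\<^bsub>C n\<^esub> F n (\<Psi> b n y))"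
        unfolding S_def by (rule C.M.finsum_cong'[OF refl])
          (use x y FD(1,2) \<Psi>D(1,2) Gc in \<open>auto simp: C.smult_r_distr\<close>)
      also have "\<dots> = S n x \<oplus>\<^bsub>C n\<^esub> S n y" unfolding S_def using terms x y by (intro C.M.finsum_addf) auto
      finally show ?thesis unfolding t_def using x y Sc by (simp add: C.minus_eq C.M.minus_add C.M.a_ac)
    qed
    fix r assume r: "r \<in> carrier R"
    have rq: "r [^] q \<in> carrier R" using r by simp
    have "S n (r [^] q \<odot>\<^bsub>C n\<^esub> x) = (\<Oplus>\<^bsub>C n\<^esub>b\<in>G. r [^] q \<odot>\<^bsub>C n\<^esub> (b \<odot>\<^bsub>C n\<^esub> F n (\<Psi> b n x)))"
      unfolding S_def
    proof (rule C.M.finsum_cong'[OF refl])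
      fix b assume b: "b \<in> G"
      note c = Gc[OF b] FD(1)[OF \<Psi>D(1)[OF b x]]
      have "F n (\<Psi> b n (r [^] q \<odot>\<^bsub>C n\<^esub> x)) = r [^] q \<odot>\<^bsub>C n\<^esub> F n (\<Psi> b n x)"
        using \<Psi>D(3)[OF b r x] FD(3)[OF r \<Psi>D(1)[OF b x]] by simp
      then show "b \<odot>\<^bsub>C n\<^esub> F n (\<Psi> b n (r [^] q \<odot>\<^bsub>C n\<^esub> x)) = r [^] q \<odot>\<^bsub>C n\<^esub> (b \<odot>\<^bsub>C n\<^esub> F n (\<Psi> b n x))"
        using C.smult_assoc1[OF c(1) rq c(2)] C.smult_assoc1[OF rq c] m_comm[OF c(1) rq] by simp
    qed (use terms x rq in auto)
    also have "\<dots> = r [^] q \<odot>\<^bsub>C n\<^esub> S n x"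
      unfolding S_def by (rule C.finsum_smult_ldistr[OF fG(1) rq, symmetric]) (use terms x in auto)
    finally show "t n (r [^] q \<odot>\<^bsub>C n\<^esub> x) = r [^] q \<odot>\<^bsub>C n\<^esub> t n x"
      unfolding t_def using rq x Sc by (simp add: C.minus_eq C.smult_r_distr C.smult_r_minus)
  qed
  have td: "t (Suc n) (\<delta> n x) = \<delta> n (t n x)" if x: "x \<in> carrier (C n)" for n x
  proof -
    have "\<delta> n (S n x) = (\<Oplus>\<^bsub>C (Suc n)\<^esub>b\<in>G. \<delta> n (b \<odot>\<^bsub>C n\<^esub> F n (\<Psi> b n x)))"
      unfolding S_def using finsum_additive_on[OF C.M.abelian_group_axioms C.M.abelian_group_axioms, of "carrier (C n)" n "\<delta> n" "Suc n" G "\<lambda>b. b \<odot>\<^bsub>C n\<^esub> F n (\<Psi> b n x)"]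
        \<delta>D(1,2) terms[OF _ x] fG(1) by simp
    also have "\<dots> = S (Suc n) (\<delta> n x)"
      unfolding S_def
    proof (rule C.M.finsum_cong'[OF refl])
      fix b assume b: "b \<in> G"
      have "\<delta> n (b \<odot>\<^bsub>C n\<^esub> F n (\<Psi> b n x)) = b \<odot>\<^bsub>C (Suc n)\<^esub> \<delta> n (F n (\<Psi> b n x))"
        by (rule \<delta>D(3)[OF Gc[OF b] FD(1)[OF \<Psi>D(1)[OF b x]]])
      also have "\<delta> n (F n (\<Psi> b n x)) = F (Suc n) (\<Psi> b (Suc n) (\<delta> n x))"
        using F(2)[OF \<Psi>D(1)[OF b x]] \<Psi>(2)[OF b x] by simp
      finally show "\<delta> n (b \<odot>\<^bsub>C n\<^esub> F n (\<Psi> b n x)) = b \<odot>\<^bsub>C (Suc n)\<^esub> F (Suc n) (\<Psi> b (Suc n) (\<delta> n x))" .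
    qed (use terms \<delta>D(1)[OF x] in auto)
    finally show ?thesis unfolding t_def using mod_hom_diff[OF C_module C_module \<delta> x Sc[OF x]] by simp
  qed
  have t1: "t 1 x = \<zero>\<^bsub>C 1\<^esub>" if x: "x \<in> carrier (C 1)" "\<delta> 1 x = \<zero>\<^bsub>C 2\<^esub>" for x
  proof -
    obtain s where s: "s \<in> carrier R" "x = \<epsilon> s" using \<epsilon>_exact[of x] x by (auto simp: numeral_2_eq_2)
    have \<psi>s: "\<psi> b s \<in> carrier R" if "b \<in> G" for b using \<psi> that s cartierD(1) by blast
    have "\<epsilon> (\<Oplus>b\<in>G. \<psi> b s [^] q \<otimes> b) = (\<Oplus>\<^bsub>C 1\<^esub>b\<in>G. \<epsilon> (\<psi> b s [^] q \<otimes> b))"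
      using finsum_additive_on[OF is_abelian_group C.M.abelian_group_axioms, of "carrier R" \<epsilon> 1 G "\<lambda>b. \<psi> b s [^] q \<otimes> b"]
        \<epsilon>D(1,2) \<psi>s Gc fG(1) by simp
    also have "\<dots> = S 1 x" unfolding S_def
    proof (rule C.M.finsum_cong'[OF refl])
      fix b assume b: "b \<in> G"
      have "F 1 (\<Psi> b 1 x) = \<epsilon> (\<psi> b s [^] q)" unfolding s(2) using \<Psi>(3)[OF b s(1)] F(3)[OF \<psi>s[OF b]] by simp
      then show "\<epsilon> (\<psi> b s [^] q \<otimes> b) = b \<odot>\<^bsub>C 1\<^esub> F 1 (\<Psi> b 1 x)"
        using \<epsilon>D(3)[of b "\<psi> b s [^] q"] Gc[OF b] \<psi>s[OF b] by (simp add: m_comm)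
    qed (use terms x in auto)
    also have "(\<Oplus>b\<in>G. \<psi> b s [^] q \<otimes> b) = s" using \<psi>comb s(1) unfolding frob_comb_def by metis
    finally show ?thesis unfolding t_def using x(1) s(2) by (simp add: C.minus_eq C.M.r_neg)
  qed
  have "\<exists>h\<in>mod_hom R (FC (Suc n)) (FC n). \<forall>x\<in>carrier (FC (Suc n)).
    \<delta> (Suc n) x = \<zero>\<^bsub>FC (Suc (Suc n))\<^esub> \<longrightarrow> t (Suc n) x = \<delta> n (h x)"
    by (rule null_homotopic[where C = "\<lambda>n. FC n" and D = "\<lambda>n. FC n" and d = \<delta> and d' = \<delta> and t = t, OF FC_module F\<delta> FC_module FC_baer F\<delta> _ _ t])
      (use exact t1 td \<delta>_\<delta> in \<open>auto simp: numeral_2_eq_2\<close>)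
  then obtain h where h: "h \<in> mod_hom R (FC (Suc n)) (FC n)" "t (Suc n) x = \<delta> n (h x)" using xc x(2) by auto
  have "t (Suc n) x \<in> boundaries I n" unfolding h(2) boundaries_def using twisted_hom_torsion[OF h(1) Ic x(1)] by blast
  then have tbd: "x \<ominus>\<^bsub>C (Suc n)\<^esub> S (Suc n) x \<in> boundaries I n" unfolding t_def .
  \<comment> \<open>\<open>I\<close> kills \<open>z b\<close> because multiplying by
    \<open>a\<close> outside \<open>\<Psi>\<close> is multiplying by \<open>a [^] q\<close> inside,
    where \<open>killed\<close> applies. This is where a class of local cohomology becomes one of
    Ext.\<close>
  define z where "z b = \<Psi> b (Suc n) x" for b
  have zco: "z b \<in> cocycles I n" if b: "b \<in> G" for b
  proof -
    have "a \<odot>\<^bsub>C (Suc n)\<^esub> z b = \<zero>\<^bsub>C (Suc n)\<^esub>" if a: "a \<in> I" for a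
      unfolding z_def using \<Psi>D(3)[OF b _ xc, of a] killed[OF a] \<Psi>0[OF b] a Ic by auto
    moreover have "\<delta> (Suc n) (z b) = \<zero>\<^bsub>C (Suc (Suc n))\<^esub>"
      unfolding z_def using \<Psi>(2)[OF b xc] x(2) \<Psi>0[OF b] by simp
    ultimately show ?thesis unfolding cocycles_def annihilated_def z_def using \<Psi>D(1)[OF b xc] by simp
  qed
  have zc: "z b \<in> carrier (C (Suc n))" if "b \<in> G" for b unfolding z_def by (rule \<Psi>D(1)[OF that xc])
  have Psub: "P \<subseteq> {r \<in> carrier R. r \<odot>\<^bsub>C (Suc n)\<^esub> z b \<in> boundaries I n}" if b: "b \<in> G" for b
  proof
    fix r assume r: "r \<in> P"
    then have rc: "r \<in> carrier R" "r \<odot>\<^bsub>C (Suc n)\<^esub> x \<in> boundaries I n" using ann by auto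
    have "r [^] q = r [^] (q - 1) \<otimes> r" using q rc(1) by (metis Suc_diff_le diff_Suc_1 nat_pow_Suc One_nat_def)
    then have "r [^] q \<odot>\<^bsub>C (Suc n)\<^esub> x = r [^] (q - 1) \<odot>\<^bsub>C (Suc n)\<^esub> (r \<odot>\<^bsub>C (Suc n)\<^esub> x)"
      using rc xc by (simp add: C.smult_assoc1)
    then have 1: "r [^] q \<odot>\<^bsub>C (Suc n)\<^esub> x \<in> boundaries I n" using bdD(4)[OF _ rc(2)] rc(1) by simp
    have "\<Psi> b (Suc n) (r [^] q \<odot>\<^bsub>C (Suc n)\<^esub> x) \<in> boundaries I n"
      by (rule boundaries_map[OF \<Psi>(2)[OF b] cartier_hom_torsion[OF \<Psi>(1)[OF b] Ic] 1])
    then show "r \<in> {r \<in> carrier R. r \<odot>\<^bsub>C (Suc n)\<^esub> z b \<in> boundaries I n}"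
      unfolding z_def using \<Psi>D(3)[OF b rc(1) xc] rc(1) by simp
  qed
  \<comment> \<open>Otherwise a product \<open>r\<close> of elements outside \<open>P\<close>, one
    for each \<open>b\<close>, kills the classes of all \<open>z b\<close>; then
    \<open>r [^] q\<close> kills that of \<open>S (Suc n) x\<close>, hence that of \<open>x\<close>,
    which puts \<open>r\<close> into the prime \<open>P\<close>.\<close>
  have "\<exists>b\<in>G. P = {r \<in> carrier R. r \<odot>\<^bsub>C (Suc n)\<^esub> z b \<in> boundaries I n}"
  proof (rule ccontr)
    assume no: "\<not> ?thesis"
    have ex: "\<exists>r\<in>carrier R. r \<notin> P \<and> r \<odot>\<^bsub>C (Suc n)\<^esub> z b \<in> boundaries I n" if "b \<in> G" for b
      using no Psub[OF that] that by blast
    have "\<exists>r\<in>carrier R. r \<notin> P \<and> (\<forall>b\<in>D. r \<odot>\<^bsub>C (Suc n)\<^esub> z b \<in> boundaries I n)" if "D \<subseteq> G" for D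
      using finite_subset[OF that fG(1)] that
    proof (induction D rule: finite_induct)
      case empty
      then show ?case using prime_one[OF P] by blast
    next
      case (insert b D)
      then obtain r s where r: "r \<in> carrier R" "r \<notin> P" "\<forall>b\<in>D. r \<odot>\<^bsub>C (Suc n)\<^esub> z b \<in> boundaries I n"
        and s: "s \<in> carrier R" "s \<notin> P" "s \<odot>\<^bsub>C (Suc n)\<^esub> z b \<in> boundaries I n" using ex[of b] by auto
      have "(r \<otimes> s) \<odot>\<^bsub>C (Suc n)\<^esub> z b \<in> boundaries I n"
        using C.smult_assoc1[OF r(1) s(1) zc] bdD(4)[OF r(1) s(3)] insert.prems by simp
      moreover have "(r \<otimes> s) \<odot>\<^bsub>C (Suc n)\<^esub> z d \<in> boundaries I n" if d: "d \<in> D" for d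
        using C.smult_assoc1[OF s(1) r(1) zc, of d] bdD(4)[OF s(1), of "r \<odot>\<^bsub>C (Suc n)\<^esub> z d"] r(3) d insert.prems
          m_comm[OF r(1) s(1)] by auto
      ultimately show ?case using prime_mult[OF P r(1) s(1)] r s by (intro bexI[of _ "r \<otimes> s"]) auto
    qed
    from this[OF order_refl] obtain r where r: "r \<in> carrier R" "r \<notin> P" "\<forall>b\<in>G. r \<odot>\<^bsub>C (Suc n)\<^esub> z b \<in> boundaries I n" by blast
    have rq: "r [^] q \<in> carrier R" using r by simp
    have "r [^] q \<odot>\<^bsub>C (Suc n)\<^esub> S (Suc n) x = (\<Oplus>\<^bsub>C (Suc n)\<^esub>b\<in>G. r [^] q \<odot>\<^bsub>C (Suc n)\<^esub> (b \<odot>\<^bsub>C (Suc n)\<^esub> F (Suc n) (z b)))"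
      unfolding S_def z_def by (rule C.finsum_smult_ldistr[OF fG(1) rq]) (use terms xc in auto)
    also have "\<dots> \<in> boundaries I n"
    proof (rule submod_finsum[OF bd fG(1)])
      fix b assume b: "b \<in> G"
      note c = Gc[OF b] FD(1)[OF zc[OF b]]
      have "F (Suc n) (r \<odot>\<^bsub>C (Suc n)\<^esub> z b) \<in> boundaries I n"
        by (rule boundaries_map[OF F(2) frobenius_hom_torsion[OF F(1) Ic]]) (use r(3) b in auto)
      then have "b \<odot>\<^bsub>C (Suc n)\<^esub> (r [^] q \<odot>\<^bsub>C (Suc n)\<^esub> F (Suc n) (z b)) \<in> boundaries I n"
        using FD(3)[OF r(1) zc[OF b]] bdD(4)[OF c(1)] by simp
      then show "r [^] q \<odot>\<^bsub>C (Suc n)\<^esub> (b \<odot>\<^bsub>C (Suc n)\<^esub> F (Suc n) (z b)) \<in> boundaries I n"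
        using C.smult_assoc1[OF c(1) rq c(2)] C.smult_assoc1[OF rq c] m_comm[OF c(1) rq] by simp
    qed
    finally have 1: "r [^] q \<odot>\<^bsub>C (Suc n)\<^esub> S (Suc n) x \<in> boundaries I n" .
    have sx: "S (Suc n) x \<in> carrier (C (Suc n))" by (rule Sc[OF xc])
    have "r [^] q \<odot>\<^bsub>C (Suc n)\<^esub> (x \<ominus>\<^bsub>C (Suc n)\<^esub> S (Suc n) x) =
      r [^] q \<odot>\<^bsub>C (Suc n)\<^esub> x \<ominus>\<^bsub>C (Suc n)\<^esub> r [^] q \<odot>\<^bsub>C (Suc n)\<^esub> S (Suc n) x"
      using rq xc sx by (simp add: C.minus_eq C.smult_r_distr C.smult_r_minus)
    then have 2: "r [^] q \<odot>\<^bsub>C (Suc n)\<^esub> x \<ominus>\<^bsub>C (Suc n)\<^esub> r [^] q \<odot>\<^bsub>C (Suc n)\<^esub> S (Suc n) x \<in> boundaries I n"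
      using bdD(4)[OF rq tbd] by simp
    have "r [^] q \<odot>\<^bsub>C (Suc n)\<^esub> x \<in> boundaries I n"
      using submod_diff_cancel[OF bd C.smult_closed[OF rq xc] C.smult_closed[OF rq sx] 2] 1 by blast
    then have "r [^] q \<in> P" using ann rq by simp
    then show False using prime_pow[OF P r(1)] r(2) by blast
  qed
  then show ?thesis using that zco by blast
qed

text \<open>With \<open>b = \<psi> a\<close> and \<open>D x = \<psi> (a x)\<close>, semilinearity
  gives \<open>D (b^q w^q) = b^2 w\<close>. So \<open>b^2 w\<close> has the preimage
  \<open>b^2 (b^(q-2) w^q)\<close>, which is of the same shape, and one can pull back from
  \<open>b^2 \<notin> P\<close> any number of times; \<open>q \<ge> 2\<close> makes room for the
  factor \<open>b^2\<close>.\<close>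

lemma cartier_iterate_notin:
  assumes \<psi>: "cartier \<psi>" and P: "primeideal P R" and a: "a \<in> carrier R" "\<psi> a \<notin> P" and q2: "q \<ge> 2"
  shows "\<exists>w\<in>carrier R. ((\<lambda>x. \<psi> (a \<otimes> x)) ^^ k) (\<psi> a \<otimes> (\<psi> a \<otimes> w)) \<notin> P"
proof (induction k)
  case 0
  have b: "\<psi> a \<in> carrier R" by (rule cartierD(1)[OF \<psi> a(1)])
  have "\<psi> a \<otimes> \<psi> a \<notin> P" using prime_mult[OF P b b] a(2) by blast
  then show ?case using b by (intro bexI[of _ \<one>]) auto
next
  case (Suc k)
  let ?D = "\<lambda>x. \<psi> (a \<otimes> x)"
  define b where "b = \<psi> a"
  have b: "b \<in> carrier R" unfolding b_def by (rule cartierD(1)[OF \<psi> a(1)])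
  obtain w where w: "w \<in> carrier R" "(?D ^^ k) (b \<otimes> (b \<otimes> w)) \<notin> P" using Suc.IH unfolding b_def by blast
  obtain m where m: "q = Suc (Suc m)" using q2 by (metis Suc_1 Suc_le_D Suc_le_mono numeral_2_eq_2)
  let ?w = "b [^] m \<otimes> w [^] q"
  have "b \<otimes> (b \<otimes> ?w) = (b [^] m \<otimes> b \<otimes> b) \<otimes> w [^] q" using b w(1) by (simp add: m_ac)
  also have "\<dots> = (b \<otimes> w) [^] q" using frob_mult[OF b w(1)] m by simp
  finally have "a \<otimes> (b \<otimes> (b \<otimes> ?w)) = (b \<otimes> w) [^] q \<otimes> a" using a(1) b w(1) by (simp add: m_comm)
  then have "?D (b \<otimes> (b \<otimes> ?w)) = b \<otimes> (b \<otimes> w)"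
    using cartierD(3)[OF \<psi>, of "b \<otimes> w" a] a(1) b w(1) by (simp add: b_def[symmetric] m_ac)
  moreover have "(?D ^^ Suc k) v = (?D ^^ k) (?D v)" for v by (simp only: funpow_Suc_right comp_apply)
  ultimately have "(?D ^^ Suc k) (b \<otimes> (b \<otimes> ?w)) \<notin> P" using w(2) by metis
  then show ?case using b w(1) unfolding b_def by (intro bexI[of _ "\<psi> a [^] m \<otimes> w [^] q"]) (auto simp: b_def)
qed

lemma cartier_preserves_associated_prime:
  assumes I: "ideal I R" and P: "primeideal P R" and z: "z \<in> cocycles I n"
    and ann: "P = {r \<in> carrier R. r \<odot>\<^bsub>C (Suc n)\<^esub> z \<in> boundaries I n}"
    and \<psi>: "cartier \<psi>" and \<psi>I: "\<And>a. a \<in> I \<Longrightarrow> \<psi> a \<in> I" and a: "a \<in> P"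
  shows "\<psi> a \<in> P"
proof (rule ccontr)
  assume no: "\<psi> a \<notin> P"
  note \<psi>D = cartierD[OF \<psi>]
  have IP: "ideal P R" using P prime_ideal by blast
  have ac: "a \<in> carrier R" using a IP ideal_carrier by blast
  \<comment> \<open>For \<open>q = 1\<close> the map \<open>\<psi>\<close> is multiplication by
    \<open>\<psi> \<one>\<close> and preserves every ideal.\<close>
  have q2: "q \<ge> 2"
  proof (rule ccontr)
    assume "\<not> 2 \<le> q"
    then have "q = Suc 0" using q by simp
    then have "\<psi> a = a \<otimes> \<psi> \<one>" using \<psi>D(3)[OF ac one_closed] ac by simp
    then show False using no ideal_mult_right[OF IP \<psi>D(1)[OF one_closed] a] by simp
  qed
  have Ic: "I \<subseteq> carrier R" using ideal_carrier[OF I] by blast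
  note bdD = submodD[OF boundaries_submod[OF Ic, of n]]
  obtain \<tau> where \<tau>: "cartier \<tau>" and gen: "\<And>\<psi>. cartier \<psi> \<Longrightarrow> \<exists>u\<in>carrier R. \<forall>x\<in>carrier R. \<psi> x = \<tau> (u \<otimes> x)"
    using ex_trace by blast
  obtain u where u: "u \<in> carrier R" "\<And>x. x \<in> carrier R \<Longrightarrow> \<psi> x = \<tau> (u \<otimes> x)" using gen[OF \<psi>] by blast
  obtain F where F: "\<And>n. F n \<in> mod_hom R (C n) (FC n)" "\<And>n x. x \<in> carrier (C n) \<Longrightarrow> F (Suc n) (\<delta> n x) = \<delta> n (F n x)"
    "\<And>s. s \<in> carrier R \<Longrightarrow> F 1 (\<epsilon> s) = \<epsilon> (s [^] q)" using frobenius_lift by (metis One_nat_def)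
  obtain T\<tau> where T\<tau>: "\<And>n. T\<tau> n \<in> mod_hom R (FC n) (C n)" "\<And>n x. x \<in> carrier (C n) \<Longrightarrow> T\<tau> (Suc n) (\<delta> n x) = \<delta> n (T\<tau> n x)"
    "\<And>s. s \<in> carrier R \<Longrightarrow> T\<tau> 1 (\<epsilon> s) = \<epsilon> (\<tau> s)" using cartier_lift[OF \<tau>] by (metis One_nat_def)
  note FD = mod_homD[OF F(1), simplified]
  have F0: "F n \<zero>\<^bsub>C n\<^esub> = \<zero>\<^bsub>C n\<^esub>" for n using mod_hom_zero[OF C_module FC_module F(1)] by simp
  obtain G \<phi> where G: "frob_generates G" and \<phi>: "\<forall>b\<in>G. cartier (\<phi> b)"
    and \<phi>comb: "\<forall>x\<in>carrier R. x = frob_comb (\<lambda>b. \<phi> b x) G" using ex_frobenius_basis by metis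
  have fG: "finite G" "G \<subseteq> carrier R" using G unfolding frob_generates_def by auto
  \<comment> \<open>In other words \<open>u I\<close> lies in the Frobenius power of
    \<open>I\<close>: each coordinate function is \<open>\<tau> (v \<cdot>)\<close>, and exchanging
    \<open>u\<close> and \<open>v\<close> turns it into a value of \<open>\<psi>\<close> on
    \<open>I\<close>. Because of this, \<open>A\<close> below preserves annihilation by
    \<open>I\<close>.\<close>
  have uI: "\<phi> b (u \<otimes> x) \<in> I" if b: "b \<in> G" and x: "x \<in> I" for b x
  proof -
    have xc: "x \<in> carrier R" using x Ic by blast
    have "cartier (\<phi> b)" using \<phi> b by blast
    from gen[OF this] obtain v where v: "v \<in> carrier R" "\<And>x. x \<in> carrier R \<Longrightarrow> \<phi> b x = \<tau> (v \<otimes> x)" by blast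
    have "\<phi> b (u \<otimes> x) = \<tau> (u \<otimes> (v \<otimes> x))" using v u(1) xc by (simp add: m_lcomm)
    also have "\<dots> = \<psi> (v \<otimes> x)" using u(2)[of "v \<otimes> x"] v(1) xc by simp
    finally show ?thesis using \<psi>I[OF ideal_mult[OF I v(1) x]] by simp
  qed
  define A where "A y = u \<odot>\<^bsub>C (Suc n)\<^esub> F (Suc n) y" for y
  have coc: "y \<in> carrier (C (Suc n))" if "y \<in> cocycles I n" for y using that unfolding cocycles_def annihilated_def by blast
  have A: "A y \<in> cocycles I n" if y: "y \<in> cocycles I n" for y
  proof -
    have yc: "y \<in> carrier (C (Suc n))" by (rule coc[OF y])
    have Fy: "F (Suc n) y \<in> carrier (C (Suc n))" by (rule FD(1)[OF yc])
    have yI: "x \<odot>\<^bsub>C (Suc n)\<^esub> y = \<zero>\<^bsub>C (Suc n)\<^esub>" if "x \<in> I" for x using y that unfolding cocycles_def annihilated_def by blast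
    have "x \<odot>\<^bsub>C (Suc n)\<^esub> A y = \<zero>\<^bsub>C (Suc n)\<^esub>" if x: "x \<in> I" for x
    proof -
      have xc: "x \<in> carrier R" using x Ic by blast
      have \<phi>c: "\<phi> b (u \<otimes> x) \<in> carrier R" if "b \<in> G" for b using uI[OF that x] Ic by blast
      have "x \<odot>\<^bsub>C (Suc n)\<^esub> A y = (u \<otimes> x) \<odot>\<^bsub>C (Suc n)\<^esub> F (Suc n) y"
        unfolding A_def using C.smult_assoc1[OF xc u(1) Fy] m_comm[OF xc u(1)] by simp
      also have "u \<otimes> x = (\<Oplus>b\<in>G. \<phi> b (u \<otimes> x) [^] q \<otimes> b)"
        using \<phi>comb[THEN bspec, OF m_closed[OF u(1) xc]] unfolding frob_comb_def .
      also have "\<dots> \<odot>\<^bsub>C (Suc n)\<^esub> F (Suc n) y = (\<Oplus>\<^bsub>C (Suc n)\<^esub>b\<in>G. (\<phi> b (u \<otimes> x) [^] q \<otimes> b) \<odot>\<^bsub>C (Suc n)\<^esub> F (Suc n) y)"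
        by (rule C.finsum_smult_rdistr[OF fG(1) _ Fy]) (use \<phi>c fG in auto)
      also have "\<dots> = (\<Oplus>\<^bsub>C (Suc n)\<^esub>b\<in>G. \<zero>\<^bsub>C (Suc n)\<^esub>)"
      proof (rule C.M.finsum_cong'[OF refl])
        fix b assume b: "b \<in> G"
        have bc: "b \<in> carrier R" using b fG by blast
        have "\<phi> b (u \<otimes> x) [^] q \<odot>\<^bsub>C (Suc n)\<^esub> F (Suc n) y = \<zero>\<^bsub>C (Suc n)\<^esub>"
          using FD(3)[OF \<phi>c[OF b] yc] yI[OF uI[OF b x]] F0 by simp
        then show "(\<phi> b (u \<otimes> x) [^] q \<otimes> b) \<odot>\<^bsub>C (Suc n)\<^esub> F (Suc n) y = \<zero>\<^bsub>C (Suc n)\<^esub>"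
          using C.smult_assoc1[OF bc _ Fy, of "\<phi> b (u \<otimes> x) [^] q"] m_comm[OF bc, of "\<phi> b (u \<otimes> x) [^] q"] \<phi>c[OF b] bc by simp
      qed auto
      finally show ?thesis by simp
    qed
    moreover have "\<delta> (Suc n) (A y) = \<zero>\<^bsub>C (Suc (Suc n))\<^esub>"
    proof -
      have "\<delta> (Suc n) y = \<zero>\<^bsub>C (Suc (Suc n))\<^esub>" using y unfolding cocycles_def by blast
      then have "\<delta> (Suc n) (F (Suc n) y) = \<zero>\<^bsub>C (Suc (Suc n))\<^esub>" using F(2)[OF yc] F0 by metis
      then show ?thesis unfolding A_def using \<delta>D(3)[OF u(1) Fy] u(1) by simp
    qed
    ultimately show ?thesis unfolding cocycles_def annihilated_def using u(1) Fy by (simp add: A_def)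
  qed
  define y where "y k = (A ^^ k) z" for k
  have yS: "y (Suc k) = A (y k)" for k unfolding y_def by simp
  have yco: "y k \<in> cocycles I n" for k by (induction k) (auto simp: y_def z A)
  note yc = coc[OF yco]
  have ytor: "y k \<in> torsion I (Suc n)" "\<delta> (Suc n) (y k) = \<zero>\<^bsub>C (Suc (Suc n))\<^esub>" for k
    using yco[of k] annihilated_torsion[OF Ic] unfolding cocycles_def by auto
  \<comment> \<open>Annihilators in local cohomology of the iterates \<open>y k\<close> of
    \<open>z\<close>. Two facts connect them: \<open>\<psi>\<close> maps \<open>K (Suc k)\<close>
    into \<open>K k\<close>, and \<open>a^(q^k)\<close> lies in \<open>K k\<close>.\<close>
  define K where "K k = {c \<in> carrier R. c \<odot>\<^bsub>C (Suc n)\<^esub> y k \<in> boundaries I n}" for k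
  have KI: "ideal (K k) R" for k
    unfolding K_def using yc[of k] bdD(2,3,4)
    by (intro ideal_intro) (auto simp: C.smult_l_distr C.smult_assoc1)
  have K0: "K 0 = P" unfolding K_def ann y_def by simp
  have K\<psi>: "\<psi> c \<in> K k" if c: "c \<in> K (Suc k)" for c k
  proof -
    have cc: "c \<in> carrier R" and cb: "c \<odot>\<^bsub>C (Suc n)\<^esub> A (y k) \<in> boundaries I n" using c unfolding K_def yS by auto
    have cu: "c \<otimes> u \<in> carrier R" using cc u(1) by simp
    have "(c \<otimes> u) \<odot>\<^bsub>C (Suc n)\<^esub> F (Suc n) (y k) \<in> boundaries I n"
      using cb C.smult_assoc1[OF cc u(1) FD(1)[OF yc[of k]]] unfolding A_def by simp
    then have "T\<tau> (Suc n) ((c \<otimes> u) \<odot>\<^bsub>C (Suc n)\<^esub> F (Suc n) (y k)) \<in> boundaries I n"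
      using boundaries_map[of T\<tau> I _ n, OF T\<tau>(2) cartier_hom_torsion[OF T\<tau>(1) Ic]] by blast
    then have "\<tau> (c \<otimes> u) \<odot>\<^bsub>C (Suc n)\<^esub> y k \<in> boundaries I n"
      using cartier_frobenius_homotopy[OF \<tau> F T\<tau> cu Ic ytor] by blast
    moreover have "\<tau> (c \<otimes> u) = \<psi> c" using u cc by (simp add: m_comm)
    ultimately show ?thesis unfolding K_def using \<psi>D(1)[OF cc] by simp
  qed
  have pow: "a [^] (q ^ k) \<in> K k" for k
  proof (induction k)
    case 0
    then show ?case using K0 a ac by (simp add: nat_pow_eone)
  next
    case (Suc k)
    have ak: "a [^] (q ^ k) \<in> carrier R" using ac by simp
    have "F (Suc n) (a [^] (q ^ k) \<odot>\<^bsub>C (Suc n)\<^esub> y k) \<in> boundaries I n"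
      by (rule boundaries_map[OF F(2) frobenius_hom_torsion[OF F(1) Ic]]) (use Suc in \<open>auto simp: K_def\<close>)
    then have "(a [^] (q ^ k)) [^] q \<odot>\<^bsub>C (Suc n)\<^esub> F (Suc n) (y k) \<in> boundaries I n" using FD(3)[OF ak yc[of k]] by simp
    moreover have "(a [^] (q ^ k)) [^] q = a [^] (q ^ Suc k)" using ac by (simp add: nat_pow_pow mult.commute)
    ultimately have "u \<odot>\<^bsub>C (Suc n)\<^esub> (a [^] (q ^ Suc k) \<odot>\<^bsub>C (Suc n)\<^esub> F (Suc n) (y k)) \<in> boundaries I n" using bdD(4)[OF u(1)] by simp
    moreover have aq: "a [^] (q ^ Suc k) \<in> carrier R" using ac by (rule nat_pow_closed)
    ultimately have "a [^] (q ^ Suc k) \<odot>\<^bsub>C (Suc n)\<^esub> A (y k) \<in> boundaries I n"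
      unfolding A_def using C.smult_assoc1[OF u(1) aq FD(1)[OF yc[of k]]] C.smult_assoc1[OF aq u(1) FD(1)[OF yc[of k]]]
        m_comm[OF u(1) aq] by simp
    then show ?case unfolding K_def yS using aq by blast
  qed
  obtain T where T: "\<And>x s. x \<in> cocycles I n \<Longrightarrow> a [^] (s::nat) \<odot>\<^bsub>C (Suc n)\<^esub> x \<in> boundaries I n \<Longrightarrow>
    a [^] (T::nat) \<odot>\<^bsub>C (Suc n)\<^esub> x \<in> boundaries I n" using power_torsion_bound[OF I ac, of n] by metis
  \<comment> \<open>\<open>T\<close> is both the exponent and the number of iterations; this choice
    is possible because the bound does not depend on the cocycle.\<close>
  have aT: "a [^] T \<in> K T" using T[OF yco, of "q ^ T" T] pow[of T] ac unfolding K_def by simp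
  let ?D = "\<lambda>x. \<psi> (a \<otimes> x)"
  have Dc: "(?D ^^ i) v \<in> carrier R" if "v \<in> carrier R" for i v by (induction i) (use that \<psi>D(1) ac in auto)
  \<comment> \<open>Each step down from \<open>K (Suc m)\<close> to \<open>K m\<close> trades one
    factor \<open>a\<close> for one application of \<open>?D\<close>: after multiplication by
    \<open>a^(m (q-1))\<close> the power \<open>a^(m+1)\<close> becomes \<open>(a^m)^q a\<close>,
    and \<open>\<psi>\<close> extracts \<open>a^m\<close>. After \<open>T\<close> steps no factor
    \<open>a\<close> is left.\<close>
  have "a [^] (T - i) \<otimes> (?D ^^ i) v \<in> K (T - i)" if "v \<in> carrier R" "i \<le> T" for i v
    using that(2)
  proof (induction i)
    case 0
    then show ?case using ideal_mult_right[OF KI that(1) aT] by simp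
  next
    case (Suc i)
    obtain m where m: "T - i = Suc m" "T - Suc i = m" using Suc.prems by (metis Suc_diff_Suc Suc_le_lessD)
    define w where "w = (?D ^^ i) v"
    have w: "w \<in> carrier R" unfolding w_def by (rule Dc[OF that(1)])
    have "a [^] Suc m \<otimes> w \<in> K (Suc m)" using Suc.IH Suc.prems m(1) unfolding w_def by simp
    then have "a [^] (m * (q - 1)) \<otimes> (a [^] Suc m \<otimes> w) \<in> K (Suc m)" using ideal_mult[OF KI, of "a [^] (m * (q - 1))"] ac by simp
    then have 1: "\<psi> (a [^] (m * (q - 1)) \<otimes> (a [^] Suc m \<otimes> w)) \<in> K m" by (rule K\<psi>)
    have "m * (q - 1) + m = m * q" using q by (cases q) auto
    then have "(a [^] m) [^] q = a [^] (m * (q - 1)) \<otimes> a [^] m" using ac by (simp add: nat_pow_pow nat_pow_mult)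
    then have "a [^] (m * (q - 1)) \<otimes> (a [^] Suc m \<otimes> w) = (a [^] m) [^] q \<otimes> (a \<otimes> w)" using ac w by (simp add: m_assoc)
    then have "\<psi> (a [^] (m * (q - 1)) \<otimes> (a [^] Suc m \<otimes> w)) = a [^] m \<otimes> ?D w"
      using \<psi>D(3)[of "a [^] m" "a \<otimes> w"] ac w by simp
    then show ?case using 1 m(2) unfolding w_def by simp
  qed
  from this[OF _ order_refl] have DP: "(?D ^^ T) v \<in> P" if "v \<in> carrier R" for v using that K0 Dc by simp
  obtain w where w: "w \<in> carrier R" "(?D ^^ T) (\<psi> a \<otimes> (\<psi> a \<otimes> w)) \<notin> P"
    using cartier_iterate_notin[OF \<psi> P ac no q2] by blast
  then show False using DP[of "\<psi> a \<otimes> (\<psi> a \<otimes> w)"] \<psi>D(1)[OF ac] by simp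
qed

end

section \<open>Quotients and iterates of Frobenius\<close>

context frobenius_cring
begin

lemma frob_comb_single:
  assumes "finite G" "G \<subseteq> carrier R" "g \<in> G" "r \<in> carrier R"
  shows "frob_comb (\<lambda>h. if h = g then r else \<zero>) G = r [^] q \<otimes> g"
proof -
  have gc: "g \<in> carrier R" using assms by blast
  have "frob_comb (\<lambda>h. if h = g then r else \<zero>) (G - {g}) = (\<Oplus>h\<in>G - {g}. \<zero>)"
    unfolding frob_comb_def by (intro finsum_cong'[OF refl]) (use assms(2) frob_zero in auto)
  then have "frob_comb (\<lambda>h. if h = g then r else \<zero>) (G - {g}) = \<zero>" by simp
  then show ?thesis using frob_comb_remove[OF assms(1,2) _ assms(3), of "\<lambda>h. if h = g then r else \<zero>"] assms gc by auto
qed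

lemma frob_comb_finsum:
  assumes "finite G" "G \<subseteq> carrier R" "finite D" "\<And>d. d \<in> D \<Longrightarrow> f d \<in> {frob_comb c G | c. c \<in> G \<rightarrow> carrier R}"
  shows "(\<Oplus>d\<in>D. f d) \<in> {frob_comb c G | c. c \<in> G \<rightarrow> carrier R}" (is "_ \<in> ?T")
proof -
  have T1: "?T \<subseteq> carrier R" using frob_comb_closed[OF assms(2)] by blast
  have "frob_comb (\<lambda>_. \<zero>) G = (\<Oplus>h\<in>G. \<zero>)"
    unfolding frob_comb_def by (intro finsum_cong'[OF refl]) (use assms(2) frob_zero in auto)
  then have "\<zero> = frob_comb (\<lambda>_. \<zero>) G" by simp
  then have T2: "\<zero> \<in> ?T" by blast
  have T3: "x \<oplus> y \<in> ?T" if xy: "x \<in> ?T" "y \<in> ?T" for x y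
  proof -
    obtain c d where c: "c \<in> G \<rightarrow> carrier R" "x = frob_comb c G" "d \<in> G \<rightarrow> carrier R" "y = frob_comb d G" using xy by blast
    have "x \<oplus> y = frob_comb (\<lambda>g. c g \<oplus> d g) G" unfolding c(2,4) by (rule frob_comb_add[OF assms(2) c(1,3)])
    moreover have "(\<lambda>g. c g \<oplus> d g) \<in> G \<rightarrow> carrier R" using c by auto
    ultimately show ?thesis by blast
  qed
  have h: "\<And>x. x \<in> ?T \<Longrightarrow> x \<in> carrier R" using T1 by blast
  show ?thesis
    using finsum_additive_on[OF is_abelian_group is_abelian_group T1 T2 T3, of "\<lambda>x. x" D f] h assms(3,4) by blast
qed

end

text \<open>Substituting an expansion of the coefficient \<open>c g\<close> in the elements
  \<open>h\<close>, with coefficients \<open>d h\<close>, turns \<open>(c g)^q g\<close> into a sum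
  of terms \<open>(d h)^(q q') (h^q g)\<close>; so the products \<open>h^q g\<close>
  generate.\<close>

lemma (in cring) frob_generates_compose:
  assumes q: "frobenius_cring R q" and q': "frobenius_cring R q'" and qq: "frobenius_cring R (q * q')"
    and G: "frobenius_cring.frob_generates R q G" and H: "frobenius_cring.frob_generates R q' H"
  shows "\<exists>K. frobenius_cring.frob_generates R (q * q') K"
proof -
  interpret A: frobenius_cring R q by fact
  interpret A': frobenius_cring R q' by fact
  interpret AA: frobenius_cring R "q * q'" by fact
  have G: "finite G" "G \<subseteq> carrier R" "\<forall>x\<in>carrier R. \<exists>c\<in>G \<rightarrow> carrier R. x = A.frob_comb c G"
    using G unfolding A.frob_generates_def by auto
  have H: "finite H" "H \<subseteq> carrier R" "\<forall>x\<in>carrier R. \<exists>c\<in>H \<rightarrow> carrier R. x = A'.frob_comb c H"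
    using H unfolding A'.frob_generates_def by auto
  define K where "K = (\<lambda>(g, h). h [^] q \<otimes> g) ` (G \<times> H)"
  have K: "finite K" "K \<subseteq> carrier R" unfolding K_def using G(1,2) H(1,2) by (auto simp: subset_iff)
  let ?T = "{AA.frob_comb c K | c. c \<in> K \<rightarrow> carrier R}"
  have single: "d [^] (q * q') \<otimes> k \<in> ?T" if "d \<in> carrier R" "k \<in> K" for d k
  proof -
    have "(\<lambda>h. if h = k then d else \<zero>) \<in> K \<rightarrow> carrier R" using that(1) by auto
    moreover have "d [^] (q * q') \<otimes> k = AA.frob_comb (\<lambda>h. if h = k then d else \<zero>) K"
      by (rule AA.frob_comb_single[OF K that(2,1), symmetric])
    ultimately show ?thesis by blast
  qed
  have "x \<in> ?T" if x: "x \<in> carrier R" for x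
  proof -
    obtain c where c: "c \<in> G \<rightarrow> carrier R" "x = A.frob_comb c G" using G(3) x by blast
    have "c g [^] q \<otimes> g \<in> ?T" if g: "g \<in> G" for g
    proof -
      have gc: "g \<in> carrier R" "c g \<in> carrier R" using g G(2) c(1) by blast+
      obtain d where d: "d \<in> H \<rightarrow> carrier R" "c g = A'.frob_comb d H" using H(3) gc(2) by blast
      have hc: "h \<in> carrier R" "d h \<in> carrier R" if "h \<in> H" for h using that H(2) d(1) by blast+
      have "c g [^] q \<otimes> g = (\<Oplus>h\<in>H. (d h [^] q' \<otimes> h) [^] q \<otimes> g)"
        unfolding d(2) A'.frob_comb_def
        using finsum_additive_on[OF is_abelian_group is_abelian_group, of "carrier R" "\<lambda>y. y [^] q \<otimes> g" H "\<lambda>h. d h [^] q' \<otimes> h"]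
          H(1) hc gc by (auto simp: A.frob_add l_distr)
      also have "\<dots> \<in> ?T"
      proof (rule AA.frob_comb_finsum[OF K H(1)])
        fix h assume h: "h \<in> H"
        have "(d h [^] q' \<otimes> h) [^] q \<otimes> g = d h [^] (q * q') \<otimes> (h [^] q \<otimes> g)"
          using hc[OF h] gc by (simp add: A.frob_mult nat_pow_pow m_assoc mult.commute)
        moreover have "h [^] q \<otimes> g \<in> K" unfolding K_def using g h by force
        ultimately show "(d h [^] q' \<otimes> h) [^] q \<otimes> g \<in> ?T" using single[OF hc(2)[OF h]] by simp
      qed
      finally show ?thesis .
    qed
    then show ?thesis unfolding c(2) A.frob_comb_def by (rule AA.frob_comb_finsum[OF K G(1)])
  qed
  then have "\<forall>x\<in>carrier R. \<exists>c\<in>K \<rightarrow> carrier R. x = AA.frob_comb c K" by blast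
  then show ?thesis unfolding AA.frob_generates_def using K by blast
qed

lemma (in cring) char_p_frobenius:
  fixes p :: nat
  assumes "Factorial_Ring.prime p" "ring_char R = p"
  shows "frobenius_cring R (p ^ e)"
proof unfold_locales
  show "1 \<le> p ^ e" using prime_gt_0_nat[OF assms(1)] by simp
  have ex: "\<exists>m>0. add_pow R (m::nat) \<one> = \<zero>"
  proof (rule ccontr)
    assume "\<not> ?thesis"
    then have "ring_char R = 0" unfolding ring_char_def by (rule if_not_P)
    then show False using assms prime_gt_0_nat by auto
  qed
  then have "p = (LEAST m. m > 0 \<and> add_pow R m \<one> = \<zero>)" using assms(2) unfolding ring_char_def by simp
  then have "add_pow R p \<one> = \<zero>" using LeastI_ex[of "\<lambda>m. m > 0 \<and> add_pow R m \<one> = \<zero>"] ex by auto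
  then show "(x \<oplus> y) [^] p ^ e = x [^] p ^ e \<oplus> y [^] p ^ e" if "x \<in> carrier R" "y \<in> carrier R" for x y
    by (rule freshmans_dream[OF assms(1) _ that])
qed

lemma (in cring) F_finite_generates:
  fixes p :: nat
  assumes p: "Factorial_Ring.prime p" "ring_char R = p" and fin: "F_finite R p"
  shows "\<exists>G. frobenius_cring.frob_generates R (p ^ e) G"
proof (induction e)
  case 0
  interpret A: frobenius_cring R "p ^ 0" by (rule char_p_frobenius[OF p])
  have "x = A.frob_comb (\<lambda>_. x) {\<one>}" if "x \<in> carrier R" for x
    unfolding A.frob_comb_def using that by (subst finsum_insert) (auto simp: nat_pow_eone)
  then have "A.frob_generates {\<one>}" unfolding A.frob_generates_def by auto
  then show ?case by blast
next
  case (Suc e)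
  interpret A: frobenius_cring R p using char_p_frobenius[OF p, of 1] by simp
  let ?M = "frobenius_module R p"
  obtain H where H: "H \<subseteq> carrier ?M" "finite H"
    "\<forall>x\<in>carrier ?M. \<exists>c\<in>H \<rightarrow> carrier R. x = (\<Oplus>\<^bsub>?M\<^esub>b\<in>H. c b \<odot>\<^bsub>?M\<^esub> b)"
    using fin unfolding F_finite_def fin_gen_module_def by blast
  interpret M: module R ?M using fin unfolding F_finite_def fin_gen_module_def by blast
  have M: "carrier ?M = carrier R" "\<zero>\<^bsub>?M\<^esub> = \<zero>" "add ?M = add R" "r \<odot>\<^bsub>?M\<^esub> x = r [^] p \<otimes> x" for r x
    by (simp_all add: frobenius_module_def regular_module_def)
  have sum: "finsum ?M f H = finsum R f H" if "\<And>h. h \<in> H \<Longrightarrow> f h \<in> carrier R" for f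
    using finsum_additive_on[OF M.M.abelian_group_axioms is_abelian_group, of "carrier R" "\<lambda>x. x" H f] M H(2) that by simp
  have "\<exists>c\<in>H \<rightarrow> carrier R. x = A.frob_comb c H" if "x \<in> carrier R" for x
  proof -
    obtain c where c: "c \<in> H \<rightarrow> carrier R" "x = (\<Oplus>\<^bsub>?M\<^esub>b\<in>H. c b \<odot>\<^bsub>?M\<^esub> b)" using H(3) \<open>x \<in> carrier R\<close> M(1) by blast
    have "c b [^] p \<otimes> b \<in> carrier R" if "b \<in> H" for b using c(1) H(1) M(1) that by (auto simp: Pi_iff subset_iff)
    then have "x = A.frob_comb c H" unfolding A.frob_comb_def c(2) M(4) by (rule sum)
    then show ?thesis using c(1) by blast
  qed
  then have "A.frob_generates H" using H(1,2) M(1) unfolding A.frob_generates_def by blast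
  moreover obtain G where "frobenius_cring.frob_generates R (p ^ e) G" using Suc by blast
  ultimately have "\<exists>K. frobenius_cring.frob_generates R (p ^ e * p) K"
    using char_p_frobenius[OF p, of e] A.frobenius_cring_axioms char_p_frobenius[OF p, of "Suc e"]
    by (intro frob_generates_compose) (auto simp: mult.commute)
  then show ?case by (simp add: mult.commute)
qed

text \<open>Maps in \<open>\<C>\<^sub>e(R / I)\<close> lift to \<open>R\<close> because \<open>F\<^sub>* R\<close> is projective.\<close>

lemma (in frobenius_regular_cring) lift_cartier_quotient:
  assumes I: "ideal I R" and add: "\<phi> \<in> hom (add_monoid (R Quot I)) (add_monoid (R Quot I))"
    and semilinear: "\<And>r s. r \<in> carrier (R Quot I) \<Longrightarrow> s \<in> carrier (R Quot I) \<Longrightarrow>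
      r \<otimes>\<^bsub>R Quot I\<^esub> \<phi> s = \<phi> ((r [^]\<^bsub>R Quot I\<^esub> q) \<otimes>\<^bsub>R Quot I\<^esub> s)"
  obtains \<psi> where "cartier \<psi>" "\<And>x. x \<in> carrier R \<Longrightarrow> \<phi> (I +> x) = I +> \<psi> x"
proof -
  let ?Q = "R Quot I"
  interpret I: ideal I R by fact
  interpret Q: ring_hom_cring R ?Q "(+>) I" by (rule I.rcos_ring_hom_cring[OF cring_axioms])
  have Qc: "carrier ?Q = (+>) I ` carrier R"
    unfolding FactRing_def A_RCOSETS_def' partial_object.simps by (rule UNION_singleton_eq_range)
  have hom_pow: "I +> (x [^] k) = (I +> x) [^]\<^bsub>?Q\<^esub> k" if "x \<in> carrier R" for x and k :: nat
    using that by (induction k) auto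
  have \<phi>c: "\<phi> x \<in> carrier ?Q" if "x \<in> carrier ?Q" for x using add that unfolding hom_def by auto
  have \<phi>add: "\<phi> (x \<oplus>\<^bsub>?Q\<^esub> y) = \<phi> x \<oplus>\<^bsub>?Q\<^esub> \<phi> y" if "x \<in> carrier ?Q" "y \<in> carrier ?Q" for x y
    using add that unfolding hom_def by auto
  obtain G P where G: "frob_generates G" and P: "\<forall>b\<in>G. cartier (P b)"
    and comb: "\<forall>x\<in>carrier R. x = frob_comb (\<lambda>b. P b x) G" using ex_frobenius_basis by metis
  have fG: "finite G" "G \<subseteq> carrier R" using G unfolding frob_generates_def by auto
  have Gc: "b \<in> G \<Longrightarrow> b \<in> carrier R" for b using fG by blast
  have PD: "b \<in> G \<Longrightarrow> x \<in> carrier R \<Longrightarrow> P b x \<in> carrier R"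
    "b \<in> G \<Longrightarrow> x \<in> carrier R \<Longrightarrow> y \<in> carrier R \<Longrightarrow> P b (x \<oplus> y) = P b x \<oplus> P b y"
    "b \<in> G \<Longrightarrow> r \<in> carrier R \<Longrightarrow> x \<in> carrier R \<Longrightarrow> P b (r [^] q \<otimes> x) = r \<otimes> P b x" for b x y r
    using P cartierD by blast+
  have "\<exists>t\<in>carrier R. \<phi> (I +> b) = I +> t" if "b \<in> G" for b
    using \<phi>c[of "I +> b"] Gc[OF that] unfolding Qc by blast
  \<comment> \<open>Arbitrary representatives \<open>t b\<close> may be chosen because the values of
    a Cartier map on a basis are free; the coordinates \<open>P b\<close> extend them to all of
    \<open>R\<close>.\<close>
  then obtain t where t: "\<And>b. b \<in> G \<Longrightarrow> t b \<in> carrier R" "\<And>b. b \<in> G \<Longrightarrow> \<phi> (I +> b) = I +> t b" by metis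
  define \<psi> where "\<psi> x = (\<Oplus>b\<in>G. P b x \<otimes> t b)" for x
  have terms: "P b x \<otimes> t b \<in> carrier R" if "b \<in> G" "x \<in> carrier R" for b x using PD(1) t(1) that by simp
  have "cartier \<psi>" unfolding cartier_def
  proof (intro conjI ballI)
    fix x assume x: "x \<in> carrier R"
    show "\<psi> x \<in> carrier R" unfolding \<psi>_def using terms x by (intro finsum_closed) auto
    show "\<psi> (x \<oplus> y) = \<psi> x \<oplus> \<psi> y" if y: "y \<in> carrier R" for y
    proof -
      have "\<psi> (x \<oplus> y) = (\<Oplus>b\<in>G. P b x \<otimes> t b \<oplus> P b y \<otimes> t b)" unfolding \<psi>_def
        by (rule finsum_cong'[OF refl]) (use PD t x y in \<open>auto simp: l_distr\<close>)
      also have "\<dots> = \<psi> x \<oplus> \<psi> y" unfolding \<psi>_def using terms x y by (intro finsum_addf) auto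
      finally show ?thesis .
    qed
  next
    fix r x assume r: "r \<in> carrier R" and x: "x \<in> carrier R"
    have "\<psi> (r [^] q \<otimes> x) = (\<Oplus>b\<in>G. r \<otimes> (P b x \<otimes> t b))" unfolding \<psi>_def
      by (rule finsum_cong'[OF refl]) (use PD t r x in \<open>auto simp: m_assoc\<close>)
    also have "\<dots> = r \<otimes> \<psi> x" unfolding \<psi>_def using terms fG r x by (intro finsum_rdistr[symmetric]) auto
    finally show "\<psi> (r [^] q \<otimes> x) = r \<otimes> \<psi> x" .
  qed
  moreover have "\<phi> (I +> x) = I +> \<psi> x" if x: "x \<in> carrier R" for x
  proof -
    let ?h = "\<lambda>x. \<phi> (I +> x)"
    have sum1: "?h (\<Oplus>b\<in>G. P b x [^] q \<otimes> b) = (\<Oplus>\<^bsub>?Q\<^esub>b\<in>G. ?h (P b x [^] q \<otimes> b))"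
      using finsum_additive_on[OF is_abelian_group Q.S.is_abelian_group, of "carrier R" ?h G "\<lambda>b. P b x [^] q \<otimes> b"]
        \<phi>c \<phi>add fG PD(1) x Gc by simp
    have sum2: "I +> (\<Oplus>b\<in>G. P b x \<otimes> t b) = (\<Oplus>\<^bsub>?Q\<^esub>b\<in>G. I +> (P b x \<otimes> t b))"
      using finsum_additive_on[OF is_abelian_group Q.S.is_abelian_group, of "carrier R" "(+>) I" G "\<lambda>b. P b x \<otimes> t b"]
        fG terms x by simp
    have "(\<Oplus>\<^bsub>?Q\<^esub>b\<in>G. ?h (P b x [^] q \<otimes> b)) = (\<Oplus>\<^bsub>?Q\<^esub>b\<in>G. I +> (P b x \<otimes> t b))"
    proof (rule Q.S.finsum_cong'[OF refl])
      fix b assume b: "b \<in> G"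
      have c: "P b x \<in> carrier R" "b \<in> carrier R" "t b \<in> carrier R" using PD(1) b x Gc t by auto
      have "?h (P b x [^] q \<otimes> b) = \<phi> (((I +> P b x) [^]\<^bsub>?Q\<^esub> q) \<otimes>\<^bsub>?Q\<^esub> (I +> b))"
        using c hom_pow[OF c(1), of q] by simp
      also have "\<dots> = (I +> P b x) \<otimes>\<^bsub>?Q\<^esub> (I +> t b)" using semilinear[of "I +> P b x" "I +> b"] c t(2)[OF b] by simp
      also have "\<dots> = I +> (P b x \<otimes> t b)" using c by simp
      finally show "?h (P b x [^] q \<otimes> b) = I +> (P b x \<otimes> t b)" .
    qed (use terms x in auto)
    moreover have "x = (\<Oplus>b\<in>G. P b x [^] q \<otimes> b)" using comb x unfolding frob_comb_def by blast
    ultimately show ?thesis using sum1 sum2 unfolding \<psi>_def by simp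
  qed
  ultimately show ?thesis using that by blast
qed

section \<open>Torsion and the cohomology of the given resolution\<close>

lemma (in noetherian_cring) power_subset_of_radical:
  assumes "ideal L R" "ideal I R" "\<And>a. a \<in> I \<Longrightarrow> \<exists>t::nat. a [^] t \<in> L"
  shows "\<exists>T::nat. I [^]\<^bsub>ideals_set R\<^esub> T \<subseteq> L"
  using assms(1,3)
proof (induction rule: noetherian_induct)
  case (1 L)
  interpret S: comm_monoid "ideals_set R" by (rule ideals_set_is_comm_monoid)
  have Ic: "I \<in> carrier (ideals_set R)" using assms(2) by (simp add: ideals_set_def)
  show ?case
  proof (cases "I \<subseteq> L")
    case True
    have "I [^]\<^bsub>ideals_set R\<^esub> Suc 0 = I" using Ic by simp
    then show ?thesis using True by (intro exI[of _ "Suc 0"]) simp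
  next
    case False
    then obtain a where a: "a \<in> I" "a \<notin> L" by blast
    have ac: "a \<in> carrier R" using a assms(2) ideal_carrier by blast
    have one: "\<one> \<notin> L" using ideal.one_imp_carrier[OF 1(1)] a ac by blast
    obtain s where s: "a [^] s \<notin> L" "a [^] Suc s \<in> L"
      using 1(3)[OF a(1)] one ex_least_nat_less[of "\<lambda>t. a [^] t \<in> L"] by (metis le_refl nat_pow_0)
    \<comment> \<open>Noetherian induction without generators of \<open>I\<close>: since
      \<open>c\<close> is outside \<open>L\<close> while \<open>a c\<close> is in \<open>L\<close>,
      both \<open>L + (c)\<close> and the colon ideal of \<open>L\<close> by \<open>c\<close> are
      strictly larger than \<open>L\<close>, and their product lies in \<open>L\<close>.\<close>
    define c where "c = a [^] s"
    have cc: "c \<in> carrier R" unfolding c_def using ac by simp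
    define L1 where "L1 = {w \<oplus> r \<otimes> c | w r. w \<in> L \<and> r \<in> carrier R}"
    define L2 where "L2 = {r \<in> carrier R. r \<otimes> c \<in> L}"
    have IL: "ideal L1 R" "ideal L2 R" unfolding L1_def L2_def using ideal_adjoin ideal_colon 1(1) cc by blast+
    have "L \<subseteq> L1"
    proof
      fix w assume w: "w \<in> L"
      then have "w = w \<oplus> \<zero> \<otimes> c" using cc ideal_carrier[OF 1(1)] by simp
      then show "w \<in> L1" unfolding L1_def using w by blast
    qed
    moreover have "c \<in> L1"
    proof -
      have "c = \<zero> \<oplus> \<one> \<otimes> c" using cc by simp
      then show ?thesis unfolding L1_def using ideal_zero[OF 1(1)] by blast
    qed
    ultimately have L1: "L \<subset> L1" using s(1) unfolding c_def by blast
    have "L \<subseteq> L2" unfolding L2_def using ideal_carrier[OF 1(1)] ideal_mult_right[OF 1(1) cc] by blast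
    moreover have "a \<in> L2" unfolding L2_def c_def using s(2) ac by (simp add: m_comm)
    ultimately have L2: "L \<subset> L2" using a(2) by blast
    obtain t1 :: nat where t1: "I [^]\<^bsub>ideals_set R\<^esub> t1 \<subseteq> L1" using 1(2)[OF IL(1) L1] 1(3) L1 by blast
    obtain t2 :: nat where t2: "I [^]\<^bsub>ideals_set R\<^esub> t2 \<subseteq> L2" using 1(2)[OF IL(2) L2] 1(3) L2 by blast
    have "I [^]\<^bsub>ideals_set R\<^esub> (t2 + t1) = ideal_prod R (I [^]\<^bsub>ideals_set R\<^esub> t2) (I [^]\<^bsub>ideals_set R\<^esub> t1)"
      using S.nat_pow_mult[OF Ic, of t2 t1] by (simp add: ideals_set_def)
    also have "\<dots> \<subseteq> L"
    proof
      fix x assume "x \<in> ideal_prod R (I [^]\<^bsub>ideals_set R\<^esub> t2) (I [^]\<^bsub>ideals_set R\<^esub> t1)"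
      then show "x \<in> L"
      proof (induction rule: ideal_prod.induct)
        case (prod i j)
        have ic: "i \<in> carrier R" "i \<otimes> c \<in> L" using prod(1) t2 unfolding L2_def by auto
        obtain w r where w: "w \<in> L" "r \<in> carrier R" "j = w \<oplus> r \<otimes> c" using prod(2) t1 unfolding L1_def by blast
        have "i \<otimes> j = i \<otimes> w \<oplus> r \<otimes> (i \<otimes> c)" using w ic(1) cc ideal_carrier[OF 1(1)] by (simp add: r_distr m_lcomm)
        then show ?case using ideal_add[OF 1(1)] ideal_mult[OF 1(1)] w ic by simp
      next
        case (sum s1 s2)
        then show ?case using ideal_add[OF 1(1)] by blast
      qed
    qed
    finally show ?thesis by blast
  qed
qed

lemma (in cring) power_mem_ideal_power:
  assumes "ideal I R" "a \<in> I"
  shows "a [^] t \<in> I [^]\<^bsub>ideals_set R\<^esub> (t::nat)"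
proof (induction t)
  interpret S: comm_monoid "ideals_set R" by (rule ideals_set_is_comm_monoid)
  case 0
  then show ?case by (simp add: ideals_set_def)
next
  interpret S: comm_monoid "ideals_set R" by (rule ideals_set_is_comm_monoid)
  case (Suc t)
  have "a [^] t \<otimes> a \<in> ideal_prod R (I [^]\<^bsub>ideals_set R\<^esub> t) I" by (rule ideal_prod.prod[OF Suc assms(2)])
  then show ?case by (simp add: ideals_set_def)
qed

text \<open>The annihilator of \<open>x\<close> is an ideal containing a power of each
  \<open>a \<in> I\<close>, so \<open>power_subset_of_radical\<close> supplies the common
  exponent.\<close>

lemma (in noetherian_cring) torsion_functor_carrier:
  assumes M: "module R M" and I: "ideal I R"
  shows "carrier (torsion_functor R I M) = {x \<in> carrier M. \<forall>a\<in>I. \<exists>t::nat. a [^] t \<odot>\<^bsub>M\<^esub> x = \<zero>\<^bsub>M\<^esub>}"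
proof -
  interpret M: module R M by fact
  have "(\<exists>t::nat. \<forall>a\<in>I [^]\<^bsub>ideals_set R\<^esub> t. a \<odot>\<^bsub>M\<^esub> x = \<zero>\<^bsub>M\<^esub>) \<longleftrightarrow> (\<forall>a\<in>I. \<exists>t::nat. a [^] t \<odot>\<^bsub>M\<^esub> x = \<zero>\<^bsub>M\<^esub>)"
    (is "?l \<longleftrightarrow> ?r") if x: "x \<in> carrier M" for x
  proof
    assume ?l
    then show ?r using power_mem_ideal_power[OF I] by blast
  next
    assume r: ?r
    let ?L = "{r \<in> carrier R. r \<odot>\<^bsub>M\<^esub> x = \<zero>\<^bsub>M\<^esub>}"
    have "ideal ?L R" using x by (intro ideal_intro) (auto simp: M.smult_l_distr M.smult_assoc1)
    moreover have "\<exists>t::nat. a [^] t \<in> ?L" if "a \<in> I" for a using r that ideal_carrier[OF I that] by auto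
    ultimately show ?l using power_subset_of_radical[OF _ I, of ?L] by blast
  qed
  then show ?thesis unfolding torsion_functor_def by auto
qed

text \<open>The ambient complex is shifted by one, so that degree \<open>-1\<close> becomes \<open>C 0 = 0\<close>.\<close>

lemma (in noetherian_cring) shifted_resolution:
  assumes "injective_resolution R (regular_module R) E d \<epsilon>"
  shows "injective_resolution_of_ring R (\<lambda>n. E (int n - 1)) (\<lambda>n. d (int n - 1)) \<epsilon>"
proof -
  note H = assms[unfolded injective_resolution_def]
  have inj: "injective_module R (E k)" for k using H by blast
  have mod: "module R (E k)" for k using inj unfolding injective_module_def by blast
  have d: "d k \<in> mod_hom R (E k) (E (k + 1))" for k using H by blast
  have ker: "x \<in> carrier (E (k + 1)) \<Longrightarrow> d (k + 1) x = \<zero>\<^bsub>E (k + 2)\<^esub> \<longleftrightarrow> x \<in> d k ` carrier (E k)" if "k \<ge> 0" for k x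
  proof -
    have "a_kernel (E (k + 1)) (E (k + 2)) (d (k + 1)) = d k ` carrier (E k)" using H that by blast
    then show "x \<in> carrier (E (k + 1)) \<Longrightarrow> d (k + 1) x = \<zero>\<^bsub>E (k + 2)\<^esub> \<longleftrightarrow> x \<in> d k ` carrier (E k)"
      unfolding a_kernel_def' by blast
  qed
  show ?thesis
  proof (intro injective_resolution_of_ring.intro noetherian_cring_axioms injective_resolution_of_ring_axioms.intro)
    show "module R (E (int n - 1))" for n by (rule mod)
    show "baer R (E (int n - 1))" for n by (rule injective_module_baer[OF inj])
    show "d (int n - 1) \<in> mod_hom R (E (int n - 1)) (E (int (Suc n) - 1))" for n
      using d[of "int n - 1"] by simp
    show "carrier (E (int 0 - 1)) = {\<zero>\<^bsub>E (int 0 - 1)\<^esub>}" using H by simp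
    show "d (int (Suc (Suc n)) - 1) x = \<zero>\<^bsub>E (int (Suc (Suc (Suc n))) - 1)\<^esub> \<longleftrightarrow>
        x \<in> d (int (Suc n) - 1) ` carrier (E (int (Suc n) - 1))"
      if "x \<in> carrier (E (int (Suc (Suc n)) - 1))" for n x
    proof -
      have eq: "int (Suc (Suc n)) - 1 = int n + 1" "int (Suc (Suc (Suc n))) - 1 = int n + 2" "int (Suc n) - 1 = int n" by auto
      show ?thesis using that unfolding eq by (intro ker) auto
    qed
    show "\<epsilon> \<in> mod_hom R (regular_module R) (E (int (Suc 0) - 1))" using H by simp
    show "inj_on \<epsilon> (carrier R)" using H by (simp add: regular_module_def)
    show "d (int (Suc 0) - 1) x = \<zero>\<^bsub>E (int (Suc (Suc 0)) - 1)\<^esub> \<longleftrightarrow> x \<in> \<epsilon> ` carrier R"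
      if "x \<in> carrier (E (int (Suc 0) - 1))" for x
    proof -
      have "a_kernel (E 0) (E 1) (d 0) = \<epsilon> ` carrier R" using H by (simp add: regular_module_def)
      then show ?thesis using that unfolding a_kernel_def' by auto
    qed
  qed
qed

text \<open>Used with cocycles \<open>Z\<close> and coboundaries \<open>N\<close> to replace an
  element of cohomology by a representing cocycle. The multiple of a coset, defined as a union of
  cosets, is computed as a set of sums; it equals \<open>N\<close> exactly when \<open>r y\<close>
  lies in \<open>N\<close>.\<close>

lemma quotient_module_annihilator:
  assumes M: "module R M" and N: "N \<subseteq> carrier M" "\<zero>\<^bsub>M\<^esub> \<in> N" "\<And>x y. x \<in> N \<Longrightarrow> y \<in> N \<Longrightarrow> x \<oplus>\<^bsub>M\<^esub> y \<in> N"
      "\<And>r x. r \<in> carrier R \<Longrightarrow> x \<in> N \<Longrightarrow> r \<odot>\<^bsub>M\<^esub> x \<in> N"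
    and Z: "Z \<subseteq> carrier M" and c: "c \<in> carrier (quotient_module (M\<lparr>carrier := Z\<rparr>) N)"
  obtains y where "y \<in> Z" "\<And>r. r \<in> carrier R \<Longrightarrow>
    r \<odot>\<^bsub>quotient_module (M\<lparr>carrier := Z\<rparr>) N\<^esub> c = \<zero>\<^bsub>quotient_module (M\<lparr>carrier := Z\<rparr>) N\<^esub> \<longleftrightarrow> r \<odot>\<^bsub>M\<^esub> y \<in> N"
proof -
  interpret M: module R M by fact
  let ?Q = "quotient_module (M\<lparr>carrier := Z\<rparr>) N"
  obtain y where y: "y \<in> Z" "c = N +>\<^bsub>M\<lparr>carrier := Z\<rparr>\<^esub> y"
    using c unfolding quotient_module_def A_RCOSETS_def' by auto
  have yc: "y \<in> carrier M" using y Z by blast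
  have c_eq: "c = {h \<oplus>\<^bsub>M\<^esub> y | h. h \<in> N}" unfolding y(2) a_r_coset_def' by auto
  have "r \<odot>\<^bsub>?Q\<^esub> c = \<zero>\<^bsub>?Q\<^esub> \<longleftrightarrow> r \<odot>\<^bsub>M\<^esub> y \<in> N" if r: "r \<in> carrier R" for r
  proof -
    have smult: "r \<odot>\<^bsub>?Q\<^esub> c = {h' \<oplus>\<^bsub>M\<^esub> (r \<odot>\<^bsub>M\<^esub> (h \<oplus>\<^bsub>M\<^esub> y)) | h h'. h \<in> N \<and> h' \<in> N}"
      unfolding quotient_module_def c_eq a_r_coset_def' by auto
    have zero: "\<zero>\<^bsub>?Q\<^esub> = N" unfolding quotient_module_def by simp
    have ry: "r \<odot>\<^bsub>M\<^esub> y \<in> carrier M" using r yc by simp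
    show ?thesis unfolding smult zero
    proof
      assume eq: "{h' \<oplus>\<^bsub>M\<^esub> (r \<odot>\<^bsub>M\<^esub> (h \<oplus>\<^bsub>M\<^esub> y)) | h h'. h \<in> N \<and> h' \<in> N} = N"
      have "\<zero>\<^bsub>M\<^esub> \<oplus>\<^bsub>M\<^esub> (r \<odot>\<^bsub>M\<^esub> (\<zero>\<^bsub>M\<^esub> \<oplus>\<^bsub>M\<^esub> y)) \<in> N" using eq N(2) by blast
      then show "r \<odot>\<^bsub>M\<^esub> y \<in> N" using ry yc by simp
    next
      assume N_ry: "r \<odot>\<^bsub>M\<^esub> y \<in> N"
      show "{h' \<oplus>\<^bsub>M\<^esub> (r \<odot>\<^bsub>M\<^esub> (h \<oplus>\<^bsub>M\<^esub> y)) | h h'. h \<in> N \<and> h' \<in> N} = N"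
      proof (intro subset_antisym subsetI)
        fix x assume "x \<in> {h' \<oplus>\<^bsub>M\<^esub> (r \<odot>\<^bsub>M\<^esub> (h \<oplus>\<^bsub>M\<^esub> y)) | h h'. h \<in> N \<and> h' \<in> N}"
        then obtain h h' where h: "h \<in> N" "h' \<in> N" "x = h' \<oplus>\<^bsub>M\<^esub> (r \<odot>\<^bsub>M\<^esub> (h \<oplus>\<^bsub>M\<^esub> y))" by blast
        have "r \<odot>\<^bsub>M\<^esub> (h \<oplus>\<^bsub>M\<^esub> y) = r \<odot>\<^bsub>M\<^esub> h \<oplus>\<^bsub>M\<^esub> r \<odot>\<^bsub>M\<^esub> y" using h(1) N(1) yc r by (intro M.smult_r_distr) auto
        then show "x \<in> N" using N(3)[OF h(2) N(3)[OF N(4)[OF r h(1)] N_ry]] h(3) by simp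
      next
        fix x assume x: "x \<in> N"
        have xc: "x \<in> carrier M" using x N(1) by blast
        have "(\<ominus>\<^bsub>R\<^esub> \<one>\<^bsub>R\<^esub>) \<odot>\<^bsub>M\<^esub> (r \<odot>\<^bsub>M\<^esub> y) \<in> N" by (rule N(4)[OF _ N_ry]) simp
        then have "x \<oplus>\<^bsub>M\<^esub> \<ominus>\<^bsub>M\<^esub> (r \<odot>\<^bsub>M\<^esub> y) \<in> N" using N(3)[OF x] ry by (simp add: M.smult_l_minus)
        moreover have "x = (x \<oplus>\<^bsub>M\<^esub> \<ominus>\<^bsub>M\<^esub> (r \<odot>\<^bsub>M\<^esub> y)) \<oplus>\<^bsub>M\<^esub> (r \<odot>\<^bsub>M\<^esub> (\<zero>\<^bsub>M\<^esub> \<oplus>\<^bsub>M\<^esub> y))"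
          using xc ry yc by (simp add: M.M.a_assoc M.M.l_neg)
        ultimately show "x \<in> {h' \<oplus>\<^bsub>M\<^esub> (r \<odot>\<^bsub>M\<^esub> (h \<oplus>\<^bsub>M\<^esub> y)) | h h'. h \<in> N \<and> h' \<in> N}" using N(2) by blast
      qed
    qed
  qed
  then show ?thesis using that y(1) by blast
qed

theorem theorem1:
  fixes S :: "'a ring"
    and \<nn> I \<pp> :: "'a set"
    and p n e :: nat
    and i :: int
    and E :: "int \<Rightarrow> ('a, 'b) module"
    and d :: "int \<Rightarrow> 'b \<Rightarrow> 'b"
    and \<epsilon> :: "'a \<Rightarrow> 'b"
    and \<phi> :: "'a set \<Rightarrow> 'a set"
  assumes "Factorial_Ring.prime p"
    and "ring_char S = p"
    and "regular_local_ring S \<nn>"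
    and "F_finite S p"
    and "krull_dim S = enat n"
    and "ideal I S"
    and "I \<noteq> carrier S"
    and "F_pure (S Quot I) p"
    and "injective_resolution S (regular_module S) E d \<epsilon>"
    and "\<pp> \<in> associated_primes S (local_cohomology S I E d (int n - i))"
    and "\<phi> \<in> cartier_maps (S Quot I) p e"
  shows "\<phi> ` ideal_extension S I \<pp> \<subseteq> ideal_extension S I \<pp>"
proof -
  have "noetherian_ring S" "cring S" and max: "maximalideal \<nn> S" and uniq: "\<And>J. maximalideal J S \<Longrightarrow> J = \<nn>"
    using assms(3) unfolding regular_local_ring_def local_ring_def by auto
  interpret S: noetherian_cring S by (intro noetherian_cring.intro) fact+
  obtain B where B: "B \<subseteq> carrier S" "finite B" "enat (card B) = krull_dim S" "\<nn> = Idl\<^bsub>S\<^esub> B"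
    using assms(3) unfolding regular_local_ring_def by blast
  interpret L: regular_local_cring S \<nn> B
    by (intro regular_local_cring.intro regular_local_cring_axioms.intro S.noetherian_cring_axioms max uniq B)
  \<comment> \<open>All exponents are provided, since \<open>p ^ t\<close> is used for the class
    attached to \<open>\<pp>\<close> and \<open>p ^ e\<close> for the Cartier map.\<close>
  have frob: "frobenius_regular_cring S \<nn> B (p ^ k)" for k
  proof -
    interpret F: frobenius_cring S "p ^ k" by (rule S.char_p_frobenius[OF assms(1,2)])
    show ?thesis using S.F_finite_generates[OF assms(1,2,4), of k]
      by unfold_locales
  qed
  define C where "C n = E (int n - 1)" for n :: nat
  define \<delta> where "\<delta> n = d (int n - 1)" for n :: nat
  interpret res: injective_resolution_of_ring S C \<delta> \<epsilon>
    unfolding C_def \<delta>_def by (rule S.shifted_resolution[OF assms(9)])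
  have frob_res: "frobenius_resolution S \<nn> B (p ^ k) C \<delta> \<epsilon>" for k
    by (intro frobenius_resolution.intro frob res.injective_resolution_of_ring_axioms)
  define j where "j = int n - i"
  have Ic: "I \<subseteq> carrier S" using S.ideal_carrier[OF assms(6)] by blast
  obtain c where P: "primeideal \<pp> S" and c: "c \<in> carrier (local_cohomology S I E d j)"
    and \<pp>: "\<pp> = {r \<in> carrier S. r \<odot>\<^bsub>local_cohomology S I E d j\<^esub> c = \<zero>\<^bsub>local_cohomology S I E d j\<^esub>}"
    using assms(10) unfolding associated_primes_def j_def by blast
  have Emod: "module S (E k)" for k
    using assms(9) unfolding injective_resolution_def injective_module_def by blast
  have Ehom: "d k \<in> mod_hom S (E k) (E (k + 1))" for k
    using assms(9) unfolding injective_resolution_def by blast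
  let ?\<Gamma> = "torsion_functor S I"
  define Z where "Z = a_kernel (?\<Gamma> (E j)) (?\<Gamma> (E (j + 1))) (d j)"
  define N where "N = d (j - 1) ` carrier (?\<Gamma> (E (j - 1)))"
  have tf: "carrier (?\<Gamma> (E k)) = {x \<in> carrier (E k). \<forall>a\<in>I. \<exists>t::nat. a [^]\<^bsub>S\<^esub> t \<odot>\<^bsub>E k\<^esub> x = \<zero>\<^bsub>E k\<^esub>}" for k
    by (rule S.torsion_functor_carrier[OF Emod assms(6)])
  have lc: "local_cohomology S I E d j = quotient_module ((E j)\<lparr>carrier := Z\<rparr>) N"
    unfolding local_cohomology_def cohomology_def Z_def N_def by (simp add: torsion_functor_def)
  have Z: "Z = {x \<in> carrier (?\<Gamma> (E j)). d j x = \<zero>\<^bsub>E (j + 1)\<^esub>}"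
    unfolding Z_def a_kernel_def' by (simp add: torsion_functor_def)
  show ?thesis
  \<comment> \<open>In negative degrees the resolution is zero, so local cohomology vanishes and
    \<open>\<one>\<close> would lie in \<open>\<pp>\<close>.\<close>
  proof (cases "j < 0")
    case True
    then have "carrier (E j) = {\<zero>\<^bsub>E j\<^esub>}" "carrier (E (j - 1)) = {\<zero>\<^bsub>E (j - 1)\<^esub>}"
      using assms(9) unfolding injective_resolution_def by auto
    interpret Ej: module S "E j" by (rule Emod)
    have N0: "N = {\<zero>\<^bsub>E j\<^esub>}"
    proof -
      interpret Ej1: module S "E (j - 1)" by (rule Emod)
      have "d (j - 1) \<zero>\<^bsub>E (j - 1)\<^esub> = \<zero>\<^bsub>E j\<^esub>" using mod_hom_zero[OF Emod Emod Ehom, of "j - 1"] by simp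
      moreover have "carrier (?\<Gamma> (E (j - 1))) = {\<zero>\<^bsub>E (j - 1)\<^esub>}"
        unfolding tf using \<open>carrier (E (j - 1)) = _\<close> Ic by auto
      ultimately show ?thesis unfolding N_def by simp
    qed
    have "Z \<subseteq> carrier (E j)" unfolding Z tf by blast
    then obtain y where y: "y \<in> Z" "\<And>r. r \<in> carrier S \<Longrightarrow>
        r \<odot>\<^bsub>local_cohomology S I E d j\<^esub> c = \<zero>\<^bsub>local_cohomology S I E d j\<^esub> \<longleftrightarrow> r \<odot>\<^bsub>E j\<^esub> y \<in> N"
      using quotient_module_annihilator[OF Emod[of j], of N Z c] c unfolding lc N0 by auto
    have "y = \<zero>\<^bsub>E j\<^esub>" using y(1) \<open>carrier (E j) = _\<close> unfolding Z tf by auto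
    then have "\<one>\<^bsub>S\<^esub> \<in> \<pp>" using y(2)[OF S.one_closed] unfolding \<pp> N0 by simp
    then show ?thesis using S.prime_one[OF P] by blast
  next
    case False
    then obtain m where m: "j = int m" using nonneg_int_cases by (metis not_less)
    have E: "E j = C (Suc m)" "E (j + 1) = C (Suc (Suc m))" "E (j - 1) = C m" "d j = \<delta> (Suc m)" "d (j - 1) = \<delta> m"
      unfolding C_def \<delta>_def m by (simp_all add: add.commute)
    have Zres: "Z = {x \<in> res.torsion I (Suc m). \<delta> (Suc m) x = \<zero>\<^bsub>C (Suc (Suc m))\<^esub>}"
      unfolding Z tf unfolding E res.torsion_def by simp
    have Nres: "N = res.boundaries I m"
      unfolding N_def tf unfolding E res.boundaries_def res.torsion_def by simp
    have ZE: "Z \<subseteq> carrier (C (Suc m))" unfolding Z tf unfolding E by blast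
    note bd = res.submodD[OF res.boundaries_submod[OF Ic, of m]]
    obtain x where x: "x \<in> Z" "\<And>r. r \<in> carrier S \<Longrightarrow>
        r \<odot>\<^bsub>local_cohomology S I E d j\<^esub> c = \<zero>\<^bsub>local_cohomology S I E d j\<^esub> \<longleftrightarrow> r \<odot>\<^bsub>C (Suc m)\<^esub> x \<in> N"
      using quotient_module_annihilator[OF res.C_module[of "Suc m"] _ _ _ _ ZE, of N c] bd c unfolding lc E(1) Nres by auto
    have ann: "\<pp> = {r \<in> carrier S. r \<odot>\<^bsub>C (Suc m)\<^esub> x \<in> res.boundaries I m}"
      using \<pp> x(2) unfolding Nres by auto
    have x': "x \<in> res.torsion I (Suc m)" "\<delta> (Suc m) x = \<zero>\<^bsub>C (Suc (Suc m))\<^esub>" using x(1) unfolding Zres by auto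
    have xc: "x \<in> carrier (C (Suc m))" using x(1) ZE by blast
    \<comment> \<open>Here the uniform power of \<open>I\<close> from the definition of torsion is
      wanted: as \<open>t \<le> p ^ t\<close>, Frobenius with exponent \<open>t\<close> meets the
      assumption \<open>killed\<close> of \<open>associated_prime_cocycle\<close>.\<close>
    have "x \<in> carrier (?\<Gamma> (C (Suc m)))" using x(1) unfolding Z E by blast
    then obtain t :: nat where t: "\<And>a. a \<in> I [^]\<^bsub>ideals_set S\<^esub> t \<Longrightarrow> a \<odot>\<^bsub>C (Suc m)\<^esub> x = \<zero>\<^bsub>C (Suc m)\<^esub>"
      unfolding torsion_functor_def by auto
    interpret T: frobenius_resolution S \<nn> B "p ^ t" C \<delta> \<epsilon> by (rule frob_res)
    have killed: "a [^]\<^bsub>S\<^esub> (p ^ t) \<odot>\<^bsub>C (Suc m)\<^esub> x = \<zero>\<^bsub>C (Suc m)\<^esub>" if a: "a \<in> I" for a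
    proof -
      have ac: "a \<in> carrier S" using a Ic by blast
      have "t \<le> p ^ t" using prime_gt_1_nat[OF assms(1)] by (simp add: less_imp_le less_exp power_gt_expt)
      then obtain l where l: "p ^ t = l + t" by (metis add.commute le_Suc_ex)
      have "a [^]\<^bsub>S\<^esub> t \<odot>\<^bsub>C (Suc m)\<^esub> x = \<zero>\<^bsub>C (Suc m)\<^esub>" by (rule t[OF S.power_mem_ideal_power[OF assms(6) a]])
      moreover have "a [^]\<^bsub>S\<^esub> (p ^ t) = a [^]\<^bsub>S\<^esub> l \<otimes>\<^bsub>S\<^esub> a [^]\<^bsub>S\<^esub> t" using ac unfolding l by (simp add: S.nat_pow_mult)
      ultimately show ?thesis using ac xc by (simp add: res.C.smult_assoc1)
    qed
    obtain z where z: "z \<in> res.cocycles I m" "\<pp> = {r \<in> carrier S. r \<odot>\<^bsub>C (Suc m)\<^esub> z \<in> res.boundaries I m}"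
      using T.associated_prime_cocycle[OF assms(6) P x' killed ann] by blast
    interpret F: frobenius_resolution S \<nn> B "p ^ e" C \<delta> \<epsilon> by (rule frob_res)
    interpret I: ideal I S by fact
    obtain \<psi> where \<psi>: "F.cartier \<psi>" "\<And>x. x \<in> carrier S \<Longrightarrow> \<phi> (I +>\<^bsub>S\<^esub> x) = I +>\<^bsub>S\<^esub> \<psi> x"
      by (rule F.lift_cartier_quotient[OF assms(6), of \<phi>]) (use assms(11) in \<open>auto simp: cartier_maps_def\<close>)
    have \<psi>I: "\<psi> a \<in> I" if a: "a \<in> I" for a
    proof -
      have ac: "a \<in> carrier S" using a Ic by blast
      interpret Q: ring_hom_cring S "S Quot I" "(+>\<^bsub>S\<^esub>) I" by (rule I.rcos_ring_hom_cring[OF S.cring_axioms])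
      have "I +>\<^bsub>S\<^esub> a = I +>\<^bsub>S\<^esub> \<zero>\<^bsub>S\<^esub>" using S.a_rcos_zero[OF assms(6) a] S.a_rcos_zero[OF assms(6) S.ideal_zero[OF assms(6)]] by simp
      then have "I +>\<^bsub>S\<^esub> \<psi> a = I +>\<^bsub>S\<^esub> \<psi> \<zero>\<^bsub>S\<^esub>" using \<psi>(2)[OF ac] \<psi>(2)[OF S.zero_closed] by simp
      moreover have "\<psi> \<zero>\<^bsub>S\<^esub> = \<zero>\<^bsub>S\<^esub>"
        using F.cartierD(3)[OF \<psi>(1), of "\<zero>\<^bsub>S\<^esub>" "\<zero>\<^bsub>S\<^esub>"] F.cartierD(1)[OF \<psi>(1), of "\<zero>\<^bsub>S\<^esub>"] by simp
      ultimately have "I +>\<^bsub>S\<^esub> \<psi> a = I" using S.a_rcos_zero[OF assms(6) S.ideal_zero[OF assms(6)]] by simp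
      then show ?thesis using I.rcos_const_imp_mem F.cartierD(1)[OF \<psi>(1) ac] by blast
    qed
    have \<psi>P: "\<psi> a \<in> \<pp>" if "a \<in> \<pp>" for a
      by (rule F.cartier_preserves_associated_prime[OF assms(6) P z \<psi>(1) \<psi>I that])
    have Pc: "\<pp> \<subseteq> carrier S" using S.ideal_carrier[OF S.prime_ideal[OF P]] by blast
    have "ideal ((+>\<^bsub>S\<^esub>) I ` \<pp>) (S Quot I)"
      by (rule S.ring_ideal_imp_quot_ideal[OF assms(6) S.prime_ideal[OF P]])
    moreover have "ring (S Quot I)" by (rule I.quotient_is_ring)
    ultimately have ext: "ideal_extension S I \<pp> = (+>\<^bsub>S\<^esub>) I ` \<pp>"
      unfolding ideal_extension_def using ring.genideal_minimal ring.genideal_self ideal.Icarr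
      by (metis (no_types, lifting) order_refl subset_antisym subsetI)
    show ?thesis unfolding ext
    proof
      fix w assume "w \<in> \<phi> ` (+>\<^bsub>S\<^esub>) I ` \<pp>"
      then obtain s where s: "s \<in> \<pp>" "w = \<phi> (I +>\<^bsub>S\<^esub> s)" by blast
      then have "w = I +>\<^bsub>S\<^esub> \<psi> s" using \<psi>(2) Pc by blast
      then show "w \<in> (+>\<^bsub>S\<^esub>) I ` \<pp>" using \<psi>P[OF s(1)] by blast
    qed
  qed
qed

end
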